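(* Let $A=\mathbb{K}Q/J^2$ be a radical square zero algebra which is not selfinjective, and let $\mathcal{S}_D$ be the set of (isomorphism classes of) simple $A$-modules that are neither projective nor injective. Then $\phi\dim(A)=\phi\big(\bigoplus_{S\in\mathcal{S}_D}S\big)+1$.
   Context: $\mathbb{K}$ is a field, $Q$ is a finite connected quiver, $J$ is the ideal of $\mathbb{K}Q$ generated by the arrows. Modules are finitely generated right modules. $K_0(A)$ is the abelian group generated by symbols $[M]$, one for each isomorphism class of finitely generated $A$-modules, modulo the relations $[M]-[M']-[M'']$ whenever $M\cong M'\oplus M''$ and $[P]$ for each projective $P$. The syzygy $\Omega$ induces a group endomorphism $\overline{\Omega}:K_0(A)\to K_0(A)$. For a module $M$, $\langle \mathrm{add}\, M\rangle$ is the subgroup of $K_0(A)$ generated by the classes of the indecomposable direct summands of $M$, and $\phi(M)=\min\{l\in\mathbb{N}: \overline{\Omega}|_{\overline{\Omega}^{l+s}\langle \mathrm{add}\, M\rangle}\text{ is injective for all } s\in\mathbb{N}\}$ ($0\in\mathbb{N}$; in particular $\phi(0)=0$). $\phi\dim(A)=\sup\{\phi(M): M\in \mathrm{mod}\,A\}$. *)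

theory Defs
  imports
    "HOL-Algebra.Algebra"
    "HOL-Library.Extended_Nat"
    "Graph_Theory.Graph_Theory"
begin

section \<open>Path algebras\<close>

text \<open>A quiver is a \<^type>\<open>pre_digraph\<close> satisfying \<^locale>\<open>wf_digraph\<close>: loops and parallel arcs are
  allowed. A path is a start vertex together with a walk, so that every vertex
  has its own trivial path \<open>(v, [])\<close>.\<close>

definition qpaths :: "('v, 'e) pre_digraph \<Rightarrow> ('v \<times> 'e list) set" where
  "qpaths Q = {(u, p). \<exists>v. pre_digraph.awalk Q u p v}"

definition path_end :: "('v, 'e) pre_digraph \<Rightarrow> 'v \<times> 'e list \<Rightarrow> 'v" where
  "path_end Q p = pre_digraph.awlast Q (fst p) (snd p)"

text \<open>Paths are composed from left to right: \<open>p q\<close> means first \<open>p\<close>, then \<open>q\<close>. With this convention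
  right modules are the representations of the quiver itself.\<close>

definition path_algebra :: "('v, 'e) pre_digraph \<Rightarrow> (('v \<times> 'e list) \<Rightarrow>\<^sub>0 'k::field) ring" where
  "path_algebra Q =
     \<lparr>carrier = {f. Poly_Mapping.keys f \<subseteq> qpaths Q},
      monoid.mult = (\<lambda>f g. \<Sum>p\<in>Poly_Mapping.keys f. \<Sum>q\<in>Poly_Mapping.keys g.
        if path_end Q p = fst q
        then Poly_Mapping.single (fst p, snd p @ snd q)
               (Poly_Mapping.lookup f p * Poly_Mapping.lookup g q)
        else 0),
      one = (\<Sum>v\<in>verts Q. Poly_Mapping.single (v, []) 1),
      ring.zero = 0,
      ring.add = (+)\<rparr>"

definition arrow_ideal :: "('v, 'e) pre_digraph \<Rightarrow> (('v \<times> 'e list) \<Rightarrow>\<^sub>0 'k::field) set" where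
  "arrow_ideal Q =
     Idl\<^bsub>path_algebra Q\<^esub> ((\<lambda>a. Poly_Mapping.single (tail Q a, [a]) 1) ` arcs Q)"

definition rad_sq_zero_algebra ::
  "('v, 'e) pre_digraph \<Rightarrow> (('v \<times> 'e list) \<Rightarrow>\<^sub>0 'k::field) set ring" where
  "rad_sq_zero_algebra Q =
     path_algebra Q Quot (ideal_prod (path_algebra Q) (arrow_ideal Q) (arrow_ideal Q))"


section \<open>Right modules over a not necessarily commutative ring\<close>

text \<open>As for \<^locale>\<open>module\<close>, the underlying abelian group is the additive part of a \<^type>\<open>ring\<close> record
  whose fields \<^const>\<open>monoid.mult\<close> and \<^const>\<open>one\<close> play no role. Over a unital algebra
  the vector space structure of a module is determined by the action of the ring, and the
  homomorphisms below are automatically linear over the field.\<close>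

record ('a, 'm) rmodule = "'m ring" +
  ract :: "'m \<Rightarrow> 'a \<Rightarrow> 'm" (infixl \<open>\<star>\<index>\<close> 70)

locale right_module = R?: ring A + M?: abelian_group M
  for A :: "('a, 'x) ring_scheme" (structure) and M :: "('a, 'm, 'y) rmodule_scheme" (structure) +
  assumes ract_closed:
      "\<lbrakk>x \<in> carrier M; a \<in> carrier A\<rbrakk> \<Longrightarrow> x \<star>\<^bsub>M\<^esub> a \<in> carrier M"
    and ract_add_left:
      "\<lbrakk>x \<in> carrier M; y \<in> carrier M; a \<in> carrier A\<rbrakk> \<Longrightarrow>
       (x \<oplus>\<^bsub>M\<^esub> y) \<star>\<^bsub>M\<^esub> a = x \<star>\<^bsub>M\<^esub> a \<oplus>\<^bsub>M\<^esub> y \<star>\<^bsub>M\<^esub> a"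
    and ract_add_right:
      "\<lbrakk>x \<in> carrier M; a \<in> carrier A; b \<in> carrier A\<rbrakk> \<Longrightarrow>
       x \<star>\<^bsub>M\<^esub> (a \<oplus>\<^bsub>A\<^esub> b) = x \<star>\<^bsub>M\<^esub> a \<oplus>\<^bsub>M\<^esub> x \<star>\<^bsub>M\<^esub> b"
    and ract_assoc:
      "\<lbrakk>x \<in> carrier M; a \<in> carrier A; b \<in> carrier A\<rbrakk> \<Longrightarrow>
       x \<star>\<^bsub>M\<^esub> (a \<otimes>\<^bsub>A\<^esub> b) = (x \<star>\<^bsub>M\<^esub> a) \<star>\<^bsub>M\<^esub> b"
    and ract_one:
      "x \<in> carrier M \<Longrightarrow> x \<star>\<^bsub>M\<^esub> \<one>\<^bsub>A\<^esub> = x"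

definition submod ::
  "('a, 'x) ring_scheme \<Rightarrow> 'm set \<Rightarrow> ('a, 'm, 'y) rmodule_scheme \<Rightarrow> bool" where
  "submod A U M \<longleftrightarrow>
     additive_subgroup U M \<and> (\<forall>x\<in>U. \<forall>a\<in>carrier A. x \<star>\<^bsub>M\<^esub> a \<in> U)"

definition fin_gen :: "('a, 'x) ring_scheme \<Rightarrow> ('a, 'm, 'y) rmodule_scheme \<Rightarrow> bool" where
  "fin_gen A M \<longleftrightarrow>
     (\<exists>S. finite S \<and> S \<subseteq> carrier M \<and> (\<forall>U. submod A U M \<and> S \<subseteq> U \<longrightarrow> U = carrier M))"

definition rmod_hom ::
  "('a, 'x) ring_scheme \<Rightarrow> ('a, 'm, 'y) rmodule_scheme \<Rightarrow> ('a, 'n, 'z) rmodule_scheme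
     \<Rightarrow> ('m \<Rightarrow> 'n) set" where
  "rmod_hom A M N =
     {f. f \<in> carrier M \<rightarrow> carrier N \<and>
         (\<forall>x\<in>carrier M. \<forall>y\<in>carrier M. f (x \<oplus>\<^bsub>M\<^esub> y) = f x \<oplus>\<^bsub>N\<^esub> f y) \<and>
         (\<forall>x\<in>carrier M. \<forall>a\<in>carrier A. f (x \<star>\<^bsub>M\<^esub> a) = f x \<star>\<^bsub>N\<^esub> a)}"

definition rmod_iso ::
  "('a, 'x) ring_scheme \<Rightarrow> ('a, 'm, 'y) rmodule_scheme \<Rightarrow> ('a, 'n, 'z) rmodule_scheme
     \<Rightarrow> bool" where
  "rmod_iso A M N \<longleftrightarrow> (\<exists>f\<in>rmod_hom A M N. bij_betw f (carrier M) (carrier N))"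

definition regular_rmod :: "('a, 'x) ring_scheme \<Rightarrow> ('a, 'a) rmodule" where
  "regular_rmod A =
     \<lparr>carrier = carrier A, monoid.mult = undefined, one = undefined,
      ring.zero = \<zero>\<^bsub>A\<^esub>, add = (\<oplus>\<^bsub>A\<^esub>), ract = (\<otimes>\<^bsub>A\<^esub>)\<rparr>"

definition dsum2 ::
  "('a, 'm, 'y) rmodule_scheme \<Rightarrow> ('a, 'n, 'z) rmodule_scheme \<Rightarrow> ('a, 'm \<times> 'n) rmodule" where
  "dsum2 M N =
     \<lparr>carrier = carrier M \<times> carrier N, monoid.mult = undefined, one = undefined,
      ring.zero = (\<zero>\<^bsub>M\<^esub>, \<zero>\<^bsub>N\<^esub>),
      ring.add = (\<lambda>(x, y) (x', y'). (x \<oplus>\<^bsub>M\<^esub> x', y \<oplus>\<^bsub>N\<^esub> y')),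
      ract = (\<lambda>(x, y) a. (x \<star>\<^bsub>M\<^esub> a, y \<star>\<^bsub>N\<^esub> a))\<rparr>"

definition dsum ::
  "'i set \<Rightarrow> ('i \<Rightarrow> ('a, 'm, 'y) rmodule_scheme) \<Rightarrow> ('a, 'i \<Rightarrow> 'm) rmodule" where
  "dsum I F =
     \<lparr>carrier = {f \<in> (\<Pi>\<^sub>E i\<in>I. carrier (F i)). finite {i\<in>I. f i \<noteq> \<zero>\<^bsub>F i\<^esub>}},
      monoid.mult = undefined, one = undefined,
      ring.zero = (\<lambda>i\<in>I. \<zero>\<^bsub>F i\<^esub>),
      ring.add = (\<lambda>f g. \<lambda>i\<in>I. f i \<oplus>\<^bsub>F i\<^esub> g i),
      ract = (\<lambda>f a. \<lambda>i\<in>I. f i \<star>\<^bsub>F i\<^esub> a)\<rparr>"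


section \<open>Finitely generated modules\<close>

text \<open>Finitely generated modules are taken with carriers consisting of lists over \<open>A\<close>. This
  loses nothing up to isomorphism: if \<open>M\<close> is generated by \<open>x\<^sub>1, \<dots>, x\<^sub>n\<close>, choosing for each element
  of \<open>M\<close> one list of coefficients \<open>a\<^sub>1, \<dots>, a\<^sub>n\<close> with respect to these generators is an injection of
  \<open>M\<close> into the lists over \<open>A\<close>.\<close>

type_synonym 'a fgmod = "('a, 'a list) rmodule"

definition fgmods :: "('a, 'x) ring_scheme \<Rightarrow> 'a fgmod set" where
  "fgmods A = {M. right_module A M \<and> fin_gen A M}"

definition simple_rmod :: "('a, 'x) ring_scheme \<Rightarrow> ('a, 'm, 'y) rmodule_scheme \<Rightarrow> bool" where
  "simple_rmod A M \<longleftrightarrow>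
     carrier M \<noteq> {\<zero>\<^bsub>M\<^esub>} \<and> (\<forall>U. submod A U M \<longrightarrow> U = {\<zero>\<^bsub>M\<^esub>} \<or> U = carrier M)"

definition projective_rmod :: "('a, 'x) ring_scheme \<Rightarrow> ('a, 'm, 'y) rmodule_scheme \<Rightarrow> bool" where
  "projective_rmod A P \<longleftrightarrow>
     (\<forall>L\<in>fgmods A. \<forall>N\<in>fgmods A. \<forall>g\<in>rmod_hom A L N. \<forall>f\<in>rmod_hom A P N.
        g ` carrier L = carrier N \<longrightarrow>
        (\<exists>h\<in>rmod_hom A P L. \<forall>x\<in>carrier P. g (h x) = f x))"

definition injective_rmod :: "('a, 'x) ring_scheme \<Rightarrow> ('a, 'm, 'y) rmodule_scheme \<Rightarrow> bool" where
  "injective_rmod A I \<longleftrightarrow>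
     (\<forall>L\<in>fgmods A. \<forall>N\<in>fgmods A. \<forall>g\<in>rmod_hom A L N. \<forall>f\<in>rmod_hom A L I.
        inj_on g (carrier L) \<longrightarrow>
        (\<exists>h\<in>rmod_hom A N I. \<forall>x\<in>carrier L. h (g x) = f x))"

definition selfinjective :: "('a, 'x) ring_scheme \<Rightarrow> bool" where
  "selfinjective A \<longleftrightarrow> injective_rmod A (regular_rmod A)"

definition indecomposable_rmod ::
  "('a, 'x) ring_scheme \<Rightarrow> ('a, 'm, 'y) rmodule_scheme \<Rightarrow> bool" where
  "indecomposable_rmod A M \<longleftrightarrow>
     carrier M \<noteq> {\<zero>\<^bsub>M\<^esub>} \<and>
     (\<forall>N\<in>fgmods A. \<forall>N'\<in>fgmods A. rmod_iso A M (dsum2 N N') \<longrightarrow>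
        carrier N = {\<zero>\<^bsub>N\<^esub>} \<or> carrier N' = {\<zero>\<^bsub>N'\<^esub>})"

definition iso_class ::
  "('a, 'x) ring_scheme \<Rightarrow> ('a, 'm, 'y) rmodule_scheme \<Rightarrow> 'a fgmod set" where
  "iso_class A M = {N \<in> fgmods A. rmod_iso A M N}"


section \<open>The group \<open>K\<^sub>0\<close>, the syzygy endomorphism and the \<open>\<phi>\<close>-dimension\<close>

definition K0_relations :: "('a, 'x) ring_scheme \<Rightarrow> ('a fgmod set \<Rightarrow>\<^sub>0 int) set" where
  "K0_relations A =
     {frag_of (iso_class A M) - frag_of (iso_class A M') - frag_of (iso_class A M'') | M M' M''.
        M \<in> fgmods A \<and> M' \<in> fgmods A \<and> M'' \<in> fgmods A \<and> rmod_iso A M (dsum2 M' M'')}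
     \<union> {frag_of (iso_class A P) | P. P \<in> fgmods A \<and> projective_rmod A P}"

definition K0_subgroup :: "('a, 'x) ring_scheme \<Rightarrow> ('a fgmod set \<Rightarrow>\<^sub>0 int) set" where
  "K0_subgroup A = generate (free_Abelian_group (iso_class A ` fgmods A)) (K0_relations A)"

definition K0 :: "('a, 'x) ring_scheme \<Rightarrow> ('a fgmod set \<Rightarrow>\<^sub>0 int) set monoid" where
  "K0 A = free_Abelian_group (iso_class A ` fgmods A) Mod K0_subgroup A"

definition K0_class ::
  "('a, 'x) ring_scheme \<Rightarrow> ('a, 'm, 'y) rmodule_scheme \<Rightarrow> ('a fgmod set \<Rightarrow>\<^sub>0 int) set" where
  "K0_class A M =
     K0_subgroup A #>\<^bsub>free_Abelian_group (iso_class A ` fgmods A)\<^esub> frag_of (iso_class A M)"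

definition projective_cover ::
  "('a, 'x) ring_scheme \<Rightarrow> ('a, 'p, 'y) rmodule_scheme \<Rightarrow> ('p \<Rightarrow> 'm)
     \<Rightarrow> ('a, 'm, 'z) rmodule_scheme \<Rightarrow> bool" where
  "projective_cover A P p M \<longleftrightarrow>
     projective_rmod A P \<and> p \<in> rmod_hom A P M \<and> p ` carrier P = carrier M \<and>
     (\<forall>U. submod A U P \<and> U <+>\<^bsub>P\<^esub> {x \<in> carrier P. p x = \<zero>\<^bsub>M\<^esub>} = carrier P
        \<longrightarrow> U = carrier P)"

definition is_syzygy ::
  "('a, 'x) ring_scheme \<Rightarrow> ('a, 'n, 'y) rmodule_scheme \<Rightarrow> ('a, 'm, 'z) rmodule_scheme
     \<Rightarrow> bool" where
  "is_syzygy A N M \<longleftrightarrow>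
     (\<exists>P\<in>fgmods A. \<exists>p. projective_cover A P p M \<and>
        rmod_iso A N (P\<lparr>carrier := {x \<in> carrier P. p x = \<zero>\<^bsub>M\<^esub>}\<rparr>))"

text \<open>\<open>K\<^sub>0\<close> is generated by the classes of modules, so there is at most one such map; restricting to
  \<^const>\<open>extensional\<close> functions fixes its values outside the carrier.\<close>

definition Omega_bar ::
  "('a, 'x) ring_scheme \<Rightarrow> ('a fgmod set \<Rightarrow>\<^sub>0 int) set \<Rightarrow> ('a fgmod set \<Rightarrow>\<^sub>0 int) set" where
  "Omega_bar A =
     (THE h. h \<in> hom (K0 A) (K0 A) \<and> h \<in> extensional (carrier (K0 A)) \<and>
        (\<forall>M\<in>fgmods A. \<forall>N\<in>fgmods A. is_syzygy A N M \<longrightarrow> h (K0_class A M) = K0_class A N))"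

definition add_subgroup ::
  "('a, 'x) ring_scheme \<Rightarrow> ('a, 'm, 'y) rmodule_scheme \<Rightarrow> ('a fgmod set \<Rightarrow>\<^sub>0 int) set set" where
  "add_subgroup A M =
     generate (K0 A)
       {K0_class A N | N. N \<in> fgmods A \<and> indecomposable_rmod A N \<and>
          (\<exists>N'\<in>fgmods A. rmod_iso A M (dsum2 N N'))}"

definition phi :: "('a, 'x) ring_scheme \<Rightarrow> ('a, 'm, 'y) rmodule_scheme \<Rightarrow> nat" where
  "phi A M =
     (LEAST l. \<forall>s. inj_on (Omega_bar A) ((Omega_bar A ^^ (l + s)) ` add_subgroup A M))"

definition phi_dim :: "('a, 'x) ring_scheme \<Rightarrow> enat" where
  "phi_dim A = (SUP M\<in>fgmods A. enat (phi A M))"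

definition S_D :: "('a, 'x) ring_scheme \<Rightarrow> 'a fgmod set set" where
  "S_D A =
     iso_class A ` {S \<in> fgmods A. simple_rmod A S \<and> \<not> projective_rmod A S \<and> \<not> injective_rmod A S}"

definition sum_S_D :: "('a, 'x) ring_scheme \<Rightarrow> ('a, 'a fgmod set \<Rightarrow> 'a list) rmodule" where
  "sum_S_D A = dsum (S_D A) (\<lambda>c. SOME S. S \<in> c)"

end

theory Submission
  imports Defs "Jordan_Normal_Form.Missing_VectorSpace"
begin

text \<open>Syzygies over a radical square zero algebra are semisimple, and up to projectives they only involve the
  simple modules at the vertices in \<open>Dv\<close>, those with both incoming and outgoing arrows. These are exactly
  the simple modules in \<open>S_D\<close>, and their classes freely generate a subgroup \<open>L\<close> of \<open>K\<^sub>0\<close> which contains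
  the image of the syzygy endomorphism. Freeness, like the computation of syzygies, comes from two
  additive invariants that vanish on projective modules, namely the multiplicities of a simple module in
  the syzygy and as a direct summand. Hence \<open>\<phi>(M) \<le> \<phi>(\<Oplus>S) + 1\<close> for every \<open>M\<close>.

  For the converse, every simple module at a vertex in \<open>Dv\<close> is the syzygy of a quotient \<open>e\<^sub>v A / a A\<close>, so some
  \<open>\<langle>add M\<rangle>\<close> is mapped onto \<open>L\<close>, and this \<open>M\<close> attains the bound if \<open>\<phi>(\<Oplus>S) > 0\<close>. If \<open>\<phi>(\<Oplus>S) = 0\<close>, one
  only needs some class in the kernel of the syzygy endomorphism: it exists if a vertex has two outgoing
  arrows, if an arrow ends in a sink, or if two arrows have the same head. In the remaining case every
  vertex is isolated or has exactly one incoming and one outgoing arrow, and the algebra is selfinjective.\<close>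

section \<open>Linear algebra over a field\<close>

text \<open>The invariants \<open>om\<close> and \<open>sx\<close> are differences of dimensions, so
  their additivity is immediate. That they vanish on every projective module is not, because
  projectivity is given only by a lifting property. For this reason projective covers are built by
  hand from the modules \<open>tm v (out v)\<close>, whose invariants can be computed. An arbitrary
  projective module is a direct summand of such a cover, and nonnegativity of \<open>om\<close> and
  \<open>sx\<close> then forces the value zero, for \<open>sx\<close> away from sinks. The same
  explicit covers control every other projective cover and hence all syzygies. A second obstacle is
  that \<open>phi\<close> is a \<open>LEAST\<close>, which says nothing unless the iterated images
  stabilize. The group generated by the simple classes is therefore mapped into a rational vector
  space, where a decreasing chain of images of a linear map has eventually constant dimension. The
  summand 1 in the formula is the delay of one syzygy after which a class lies in the span of the
  simple classes; the remaining question is whether some module really needs that delay.\<close>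

definition scalars :: "'k::field ring" where
  "scalars = \<lparr>carrier = UNIV, monoid.mult = (*), one = 1, ring.zero = 0, ring.add = (+)\<rparr>"

lemma scalars_simps [simp]:
  "carrier scalars = UNIV" "monoid.mult scalars = (*)" "one scalars = 1"
  "ring.zero scalars = 0" "ring.add scalars = (+)"
  by (simp_all add: scalars_def)

lemma field_scalars: "Ring.field (scalars :: 'k::field ring)"
proof -
  have "cring (scalars :: 'k ring)"
  proof (rule cringI)
    show "abelian_group (scalars :: 'k ring)"
      by (rule abelian_groupI) (auto simp: algebra_simps intro: exI [of _ "- x" for x])
    show "Group.comm_monoid (scalars :: 'k ring)"
      by (rule comm_monoidI) (auto simp: algebra_simps)
  qed (auto simp: algebra_simps)
  then show ?thesis
    by (rule cring.cring_fieldI2) (auto intro: right_inverse)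
qed

text \<open>Subspaces are sets inside a fixed \<open>V\<close>, so that vertex spaces, socles and
  radicals of one module can be compared without changing the ambient structure.\<close>

definition ksub :: "('k::field, 'm, 'z) module_scheme \<Rightarrow> 'm set \<Rightarrow> bool" where
  "ksub V U \<longleftrightarrow> U \<subseteq> carrier V \<and> \<zero>\<^bsub>V\<^esub> \<in> U \<and> (\<forall>x\<in>U. \<forall>y\<in>U. x \<oplus>\<^bsub>V\<^esub> y \<in> U)
     \<and> (\<forall>k. \<forall>x\<in>U. k \<odot>\<^bsub>V\<^esub> x \<in> U)"

text \<open>A number is assigned to every set \<open>U\<close>, but it is a dimension only under
  \<open>ksub V U\<close>. Since the carrier is overwritten, the dimension of a piece of a submodule
  can be computed in the ambient module.\<close>

definition kdim :: "('k::field, 'm, 'z) module_scheme \<Rightarrow> 'm set \<Rightarrow> nat" where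
  "kdim V U = vectorspace.dim scalars (V\<lparr>carrier := U\<rparr>)"

text \<open>Linearity is asked on a subspace, so that one map can be restricted to several subspaces
  without changing \<open>V\<close>.\<close>

definition klin :: "('k::field, 'm, 'y) module_scheme \<Rightarrow> ('k, 'n, 'z) module_scheme \<Rightarrow> 'm set
    \<Rightarrow> ('m \<Rightarrow> 'n) \<Rightarrow> bool" where
  "klin V W U f \<longleftrightarrow> f \<in> U \<rightarrow> carrier W \<and> (\<forall>x\<in>U. \<forall>y\<in>U. f (x \<oplus>\<^bsub>V\<^esub> y) = f x \<oplus>\<^bsub>W\<^esub> f y)
     \<and> (\<forall>k. \<forall>x\<in>U. f (k \<odot>\<^bsub>V\<^esub> x) = k \<odot>\<^bsub>W\<^esub> f x)"

locale kspace = vectorspace scalars V for V :: "('k::field, 'm, 'z) module_scheme" (structure)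

lemma kspaceI:
  fixes V :: "('k::field, 'm, 'z) module_scheme" (structure)
  assumes "abelian_group V"
    and "\<And>k x. x \<in> carrier V \<Longrightarrow> k \<odot> x \<in> carrier V"
    and "\<And>k l x. x \<in> carrier V \<Longrightarrow> (k + l) \<odot> x = k \<odot> x \<oplus> l \<odot> x"
    and "\<And>k x y. \<lbrakk>x \<in> carrier V; y \<in> carrier V\<rbrakk> \<Longrightarrow> k \<odot> (x \<oplus> y) = k \<odot> x \<oplus> k \<odot> y"
    and "\<And>k l x. x \<in> carrier V \<Longrightarrow> (k * l) \<odot> x = k \<odot> (l \<odot> x)"
    and "\<And>x. x \<in> carrier V \<Longrightarrow> 1 \<odot> x = x"
  shows "kspace V"
proof -
  interpret K: Ring.field "scalars :: 'k ring" by (rule field_scalars)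
  show ?thesis
    unfolding kspace_def vectorspace_def
    using assms by (auto intro!: moduleI K.is_cring K.field_axioms)
qed

context kspace
begin

lemma kspace: "kspace V" ..

lemma smult_zero_scalar: "x \<in> carrier V \<Longrightarrow> 0 \<odot>\<^bsub>V\<^esub> x = \<zero>\<^bsub>V\<^esub>"
  using smult_l_null by simp

lemma smult_zero_vector: "k \<odot>\<^bsub>V\<^esub> \<zero>\<^bsub>V\<^esub> = \<zero>\<^bsub>V\<^esub>"
  using smult_r_null by simp

lemma smult_in: "x \<in> carrier V \<Longrightarrow> k \<odot>\<^bsub>V\<^esub> x \<in> carrier V"
  using smult_closed by simp

lemma smult_add: "\<lbrakk>x \<in> carrier V; y \<in> carrier V\<rbrakk> \<Longrightarrow> k \<odot>\<^bsub>V\<^esub> (x \<oplus>\<^bsub>V\<^esub> y) = k \<odot>\<^bsub>V\<^esub> x \<oplus>\<^bsub>V\<^esub> k \<odot>\<^bsub>V\<^esub> y"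
  using smult_r_distr by simp

lemma smult_plus: "x \<in> carrier V \<Longrightarrow> (k + l) \<odot>\<^bsub>V\<^esub> x = k \<odot>\<^bsub>V\<^esub> x \<oplus>\<^bsub>V\<^esub> l \<odot>\<^bsub>V\<^esub> x"
  using smult_l_distr [of k l x] by simp

lemma smult_smult: "x \<in> carrier V \<Longrightarrow> k \<odot>\<^bsub>V\<^esub> (l \<odot>\<^bsub>V\<^esub> x) = (k * l) \<odot>\<^bsub>V\<^esub> x"
  using smult_assoc1 [of k l x] by simp

lemma smult_unit: "x \<in> carrier V \<Longrightarrow> 1 \<odot>\<^bsub>V\<^esub> x = x"
  using smult_one by simp

lemma smult_neg1: "x \<in> carrier V \<Longrightarrow> (- 1) \<odot>\<^bsub>V\<^esub> x = \<ominus>\<^bsub>V\<^esub> x"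
  using smult_plus [of x "-1" 1] smult_zero_scalar smult_unit
  by (metis add.left_inverse smult_in M.minus_equality)

lemma ksub_neg: "\<lbrakk>ksub V U; x \<in> U\<rbrakk> \<Longrightarrow> \<ominus>\<^bsub>V\<^esub> x \<in> U"
  unfolding ksub_def by (metis smult_neg1 subsetD)

lemma ksub_minus: "\<lbrakk>ksub V U; x \<in> U; y \<in> U\<rbrakk> \<Longrightarrow> x \<ominus>\<^bsub>V\<^esub> y \<in> U"
  using ksub_neg unfolding a_minus_def by (metis ksub_def)

lemma ksub_carrier: "ksub V (carrier V)"
  by (auto simp: ksub_def smult_in)

lemma ksub_zero: "ksub V {\<zero>\<^bsub>V\<^esub>}"
  by (auto simp: ksub_def smult_zero_vector)

lemma submoduleD: "ksub V U \<Longrightarrow> submodule scalars U V"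
  using module_axioms by (auto simp: ksub_def LinearCombinations.submodule_def)

lemma subspaceD: "ksub V U \<Longrightarrow> subspace scalars U V"
  using submoduleD vectorspace_axioms by (auto simp: subspace_def)

lemma kspace_sub: "ksub V U \<Longrightarrow> kspace (V\<lparr>carrier := U\<rparr>)"
  using subspace_is_vs [OF subspaceD] by (simp add: kspace_def)

text \<open>Independent subsets of \<open>U\<close> stay independent in \<open>V\<close>, so their
  size is bounded by \<open>dim\<close>. A maximal one therefore exists, and it is a basis of
  \<open>U\<close>.\<close>

lemma fin_dim_sub:
  assumes "fin_dim" "ksub V U"
  shows "vectorspace.fin_dim scalars (V\<lparr>carrier := U\<rparr>)"
proof -
  interpret U: kspace "V\<lparr>carrier := U\<rparr>" using kspace_sub assms by auto
  have UV: "U \<subseteq> carrier V" using assms by (simp add: ksub_def)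
  have "\<exists>A. finite A \<and> maximal A (\<lambda>S. S \<subseteq> carrier (V\<lparr>carrier := U\<rparr>) \<and> U.lin_indpt S)"
  proof (rule maximal_exists [where N = dim and B = "{}"])
    fix A assume A: "A \<subseteq> carrier (V\<lparr>carrier := U\<rparr>) \<and> U.lin_indpt A"
    then have "lin_indpt A"
      using span_li_not_depend(2) [OF _ submoduleD [OF assms(2)], of A] by simp
    with A UV assms(1) li_le_dim [of A] show "finite A \<and> card A \<le> dim" by auto
  next
    show "{} \<subseteq> carrier (V\<lparr>carrier := U\<rparr>) \<and> U.lin_indpt {}"
      by (auto simp: U.lin_dep_def)
  qed
  then obtain A where "finite A" "U.basis A" using U.max_li_is_basis by auto
  then show ?thesis unfolding U.fin_dim_def U.basis_def by auto
qed

text \<open>A basis of \<open>U\<close> is an independent set in \<open>V\<close>. If it has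
  \<open>dim\<close> elements it is already a basis of \<open>V\<close>, whence \<open>U\<close> is
  everything.\<close>

lemma kdim_sub_carrier:
  assumes "fin_dim" "ksub V U"
  shows "kdim V U \<le> dim" and "kdim V U = dim \<Longrightarrow> U = carrier V"
proof -
  interpret U: kspace "V\<lparr>carrier := U\<rparr>" using kspace_sub assms by auto
  have UV: "U \<subseteq> carrier V" using assms by (simp add: ksub_def)
  obtain b where b: "finite b" "U.basis b"
    using U.finite_basis_exists fin_dim_sub [OF assms] by auto
  then have bU: "b \<subseteq> U" and li: "U.lin_indpt b" and sp: "U.span b = U"
    by (auto simp: U.basis_def)
  have li': "lin_indpt b"
    using span_li_not_depend(2) [OF _ submoduleD [OF assms(2)], of b] bU li by simp
  have sp': "span b = U"
    using span_li_not_depend(1) [OF _ submoduleD [OF assms(2)], of b] bU sp by simp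
  have d: "kdim V U = card b" using U.dim_basis [OF b] by (simp add: kdim_def)
  show "kdim V U \<le> dim" using d li_le_dim(2) [OF assms(1) _ li'] bU UV by auto
  assume "kdim V U = dim"
  then have "basis b" using dim_li_is_basis [OF assms(1) b(1) _ li'] bU UV d by auto
  then show "U = carrier V" using sp' by (simp add: basis_def)
qed

end

lemma ksub_sub: "ksub (V\<lparr>carrier := U'\<rparr>) U \<longleftrightarrow> U \<subseteq> U' \<and> ksub V U"
  if "U' \<subseteq> carrier V"
  using that by (auto simp: ksub_def)

locale fkspace = kspace V for V :: "('k::field, 'm, 'z) module_scheme" (structure) +
  assumes fd: "fin_dim"
begin

lemma fkspace: "fkspace V" ..

lemma fkspace_sub: "ksub V U \<Longrightarrow> fkspace (V\<lparr>carrier := U\<rparr>)"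
  using kspace_sub fin_dim_sub [OF fd] by (simp add: fkspace_def fkspace_axioms_def)

lemma kdim_mono: "\<lbrakk>ksub V U; ksub V U'; U \<subseteq> U'\<rbrakk> \<Longrightarrow> kdim V U \<le> kdim V U'"
  and kdim_mono_eq: "\<lbrakk>ksub V U; ksub V U'; U \<subseteq> U'; kdim V U = kdim V U'\<rbrakk> \<Longrightarrow> U = U'"
proof -
  assume a: "ksub V U" "ksub V U'" "U \<subseteq> U'"
  interpret U: fkspace "V\<lparr>carrier := U'\<rparr>" using fkspace_sub a by auto
  have *: "ksub (V\<lparr>carrier := U'\<rparr>) U" using a ksub_sub by (auto simp: ksub_def)
  have **: "kdim (V\<lparr>carrier := U'\<rparr>) U = kdim V U" "U.dim = kdim V U'"
    by (auto simp: kdim_def)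
  show "kdim V U \<le> kdim V U'" using U.kdim_sub_carrier(1) [OF U.fd *] ** by simp
  assume "kdim V U = kdim V U'"
  then show "U = U'" using U.kdim_sub_carrier(2) [OF U.fd *] ** by simp
qed

lemma kdim_zero: "kdim V {\<zero>\<^bsub>V\<^esub>} = 0"
proof -
  interpret U: kspace "V\<lparr>carrier := {\<zero>\<^bsub>V\<^esub>}\<rparr>" using kspace_sub ksub_zero by auto
  have "U.dim = 0" by (rule U.dim0I) (use U.span_self [of "\<zero>\<^bsub>V\<^esub>"] U.span_closed [of "{\<zero>\<^bsub>V\<^esub>}"] in fastforce)
  then show ?thesis by (simp add: kdim_def)
qed

lemma kdim_eq_0: "\<lbrakk>ksub V U; kdim V U = 0\<rbrakk> \<Longrightarrow> U = {\<zero>\<^bsub>V\<^esub>}"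
  using kdim_mono_eq [of "{\<zero>\<^bsub>V\<^esub>}" U] ksub_zero kdim_zero by (auto simp: ksub_def)

lemma ksub_line: "x \<in> carrier V \<Longrightarrow> ksub V (range (\<lambda>k. k \<odot>\<^bsub>V\<^esub> x))"
  unfolding ksub_def
proof (intro conjI ballI allI)
  assume x: "x \<in> carrier V"
  let ?U = "range (\<lambda>k. k \<odot>\<^bsub>V\<^esub> x)"
  show "?U \<subseteq> carrier V" using smult_in x by auto
  show "\<zero>\<^bsub>V\<^esub> \<in> ?U" using smult_zero_scalar [OF x] by (metis rangeI)
  show "y \<oplus>\<^bsub>V\<^esub> z \<in> ?U" if "y \<in> ?U" "z \<in> ?U" for y z
  proof -
    obtain k l where "y = k \<odot>\<^bsub>V\<^esub> x" "z = l \<odot>\<^bsub>V\<^esub> x" using \<open>y \<in> ?U\<close> \<open>z \<in> ?U\<close> by blast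
    then show ?thesis using smult_plus [OF x, of k l, symmetric] by simp
  qed
  show "k \<odot>\<^bsub>V\<^esub> y \<in> ?U" if "y \<in> ?U" for k y
    using that smult_smult [OF x] by auto
qed

lemma kdim_line:
  assumes "x \<in> carrier V" "x \<noteq> \<zero>\<^bsub>V\<^esub>"
  shows "kdim V (range (\<lambda>k. k \<odot>\<^bsub>V\<^esub> x)) = 1"
proof -
  let ?U = "range (\<lambda>k. k \<odot>\<^bsub>V\<^esub> x)"
  interpret U: kspace "V\<lparr>carrier := ?U\<rparr>" using kspace_sub ksub_line assms by auto
  have xU: "x \<in> ?U" using smult_unit [OF assms(1)] by (metis rangeI)
  have "?U \<subseteq> U.span {x}"
  proof
    fix y assume "y \<in> ?U"
    then obtain k where k: "y = k \<odot>\<^bsub>V\<^esub> x" by auto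
    have "U.lincomb (\<lambda>_. k) {x} = y"
      using U.smult_in [of x k] smult_in [OF assms(1)] xU k by (auto simp: U.lincomb_def)
    then show "y \<in> U.span {x}" unfolding U.span_def by (auto intro!: exI [of _ "\<lambda>_. k"] exI [of _ "{x}"])
  qed
  then have "U.dim = 1"
    using xU assms U.span_closed [of "{x}"] by (intro U.dim1I) auto
  then show ?thesis by (simp add: kdim_def)
qed

end

lemma klin_linear_map:
  assumes "kspace V" "kspace W" "klin V W (carrier V) f"
  shows "linear_map scalars V W f"
  using assms by (auto simp: linear_map_def kspace_def vectorspace_def mod_hom_def mod_hom_axioms_def klin_def LinearCombinations.module_hom_def)

text \<open>Rank-nullity for the restriction of \<open>f\<close> to \<open>U\<close>. Finite
  dimension of the image is part of the conclusion, because the target is an arbitrary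
  space.\<close>

theorem kdim_rank_nullity:
  assumes "fkspace V" "kspace W" "ksub V U" "klin V W U f"
  shows "kdim V U = kdim W (f ` U) + kdim V {x \<in> U. f x = \<zero>\<^bsub>W\<^esub>}"
    and "fkspace (W\<lparr>carrier := f ` U\<rparr>)" and "ksub W (f ` U)" and "ksub V {x \<in> U. f x = \<zero>\<^bsub>W\<^esub>}"
proof -
  interpret V: fkspace V by fact
  interpret U: fkspace "V\<lparr>carrier := U\<rparr>" using V.fkspace_sub assms by auto
  interpret W: kspace W by fact
  have U: "U \<subseteq> carrier V" "\<zero>\<^bsub>V\<^esub> \<in> U" using assms by (auto simp: ksub_def)
  have lin: "klin (V\<lparr>carrier := U\<rparr>) W (carrier (V\<lparr>carrier := U\<rparr>)) f"
    using assms by (auto simp: klin_def)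
  interpret L: linear_map scalars "V\<lparr>carrier := U\<rparr>" W f
    by (rule klin_linear_map) (use lin U.kspace W.kspace in auto)
  have im: "L.imT = f ` U" by (auto simp: L.im_def)
  have ker: "L.kerT = {x \<in> U. f x = \<zero>\<^bsub>W\<^esub>}" by (auto simp: L.ker_def)
  show "kdim V U = kdim W (f ` U) + kdim V {x \<in> U. f x = \<zero>\<^bsub>W\<^esub>}"
    using L.rank_nullity [OF U.fd] unfolding im ker by (simp add: kdim_def)
  have f0: "f \<zero>\<^bsub>V\<^esub> = \<zero>\<^bsub>W\<^esub>" using L.T0_is_0 by simp
  show kim: "ksub W (f ` U)"
    unfolding ksub_def
  proof (intro conjI ballI allI)
    show "f ` U \<subseteq> carrier W" using assms by (auto simp: klin_def)
    show "\<zero>\<^bsub>W\<^esub> \<in> f ` U" using f0 U by (metis imageI)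
    fix y z assume "y \<in> f ` U" "z \<in> f ` U"
    then obtain x x' where "x \<in> U" "x' \<in> U" "y = f x" "z = f x'" by auto
    then have "y \<oplus>\<^bsub>W\<^esub> z = f (x \<oplus>\<^bsub>V\<^esub> x')" "x \<oplus>\<^bsub>V\<^esub> x' \<in> U"
      using assms by (auto simp: klin_def ksub_def)
    then show "y \<oplus>\<^bsub>W\<^esub> z \<in> f ` U" by auto
  next
    fix k y assume "y \<in> f ` U"
    then obtain x where "x \<in> U" "y = f x" by auto
    then have "k \<odot>\<^bsub>W\<^esub> y = f (k \<odot>\<^bsub>V\<^esub> x)" "k \<odot>\<^bsub>V\<^esub> x \<in> U"
      using assms by (auto simp: klin_def ksub_def)
    then show "k \<odot>\<^bsub>W\<^esub> y \<in> f ` U" by auto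
  qed
  show "ksub V {x \<in> U. f x = \<zero>\<^bsub>W\<^esub>}"
    using assms f0 W.smult_zero_vector unfolding ksub_def klin_def by auto
  have ks: "kspace (W\<lparr>carrier := f ` U\<rparr>)" using W.kspace_sub kim by auto
  interpret L': linear_map scalars "V\<lparr>carrier := U\<rparr>" "W\<lparr>carrier := f ` U\<rparr>" f
    by (rule klin_linear_map) (use lin U.kspace ks in \<open>auto simp: klin_def\<close>)
  show "fkspace (W\<lparr>carrier := f ` U\<rparr>)"
    using ks L'.rank_nullity_main(2) [OF U.fd] by (simp add: fkspace_def fkspace_axioms_def)
qed


theorem kdim_inj:
  assumes "fkspace V" "kspace W" "ksub V U" "klin V W U f" "inj_on f U"
  shows "kdim W (f ` U) = kdim V U"
proof -
  interpret V: fkspace V by fact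
  interpret W: kspace W by fact
  have z: "\<zero>\<^bsub>V\<^esub> \<in> U" using assms by (auto simp: ksub_def)
  then have "f \<zero>\<^bsub>V\<^esub> = 0 \<odot>\<^bsub>W\<^esub> f \<zero>\<^bsub>V\<^esub>"
    using assms(4) V.smult_zero_vector [of 0] unfolding klin_def by metis
  then have "f \<zero>\<^bsub>V\<^esub> = \<zero>\<^bsub>W\<^esub>"
    using z assms(4) W.smult_zero_scalar [of "f \<zero>\<^bsub>V\<^esub>"] by (auto simp: klin_def)
  then have "x \<in> U \<and> f x = \<zero>\<^bsub>W\<^esub> \<longleftrightarrow> x = \<zero>\<^bsub>V\<^esub>" for x
    using z inj_onD [OF assms(5), of x "\<zero>\<^bsub>V\<^esub>"] by metis
  then have "{x \<in> U. f x = \<zero>\<^bsub>W\<^esub>} = {\<zero>\<^bsub>V\<^esub>}" by blast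
  then show ?thesis using kdim_rank_nullity(1) [OF assms(1-4)] V.kdim_zero by simp
qed

text \<open>Spanning is expressed by subspaces containing \<open>S\<close>, in the style of
  \<open>fin_gen\<close>; this makes the comparison of finite generation with finite dimension
  direct.\<close>

lemma (in kspace) fkspaceI:
  assumes "finite S" "S \<subseteq> carrier V" "\<And>U. \<lbrakk>ksub V U; S \<subseteq> U\<rbrakk> \<Longrightarrow> U = carrier V"
  shows "fkspace V"
proof -
  have "ksub V (span S)"
    using span_is_submodule [OF assms(2)]
    by (auto simp: ksub_def LinearCombinations.submodule_def)
  then have "span S = carrier V" using assms(3) in_own_span [OF assms(2)] by simp
  then have "fin_dim" using assms(1,2) unfolding fin_dim_def by blast
  then show ?thesis by (simp add: fkspace_def fkspace_axioms_def kspace)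
qed

lemma (in fkspace) finite_spanning:
  obtains S where "finite S" "S \<subseteq> carrier V" "\<And>U. \<lbrakk>ksub V U; S \<subseteq> U\<rbrakk> \<Longrightarrow> U = carrier V"
proof -
  obtain b where b: "finite b" "basis b" using finite_basis_exists fd by auto
  show ?thesis
  proof (rule that [of b])
    fix U assume "ksub V U" "b \<subseteq> U"
    then have "span b \<subseteq> U" using span_is_subset [of b U] submoduleD by auto
    then show "U = carrier V" using b \<open>ksub V U\<close> by (auto simp: basis_def ksub_def)
  qed (use b in \<open>auto simp: basis_def\<close>)
qed

text \<open>This injection into lists of scalars is the source of the list-carrier copies in
  \<open>fgmod_copy\<close>. Any choice of coefficients will do, since a vector is recovered from
  its coefficients.\<close>

lemma (in fkspace) finite_coordinates:
  obtains j :: "'m \<Rightarrow> 'k list" where "inj_on j (carrier V)"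
proof -
  obtain b where b: "finite b" "basis b" using finite_basis_exists fd by auto
  then have bV: "b \<subseteq> carrier V" and sp: "span b = carrier V" by (auto simp: basis_def)
  obtain bs where bs: "set bs = b" using b finite_list by auto
  define a where "a x = (SOME a. x = lincomb a b)" for x
  have a: "x = lincomb (a x) b" if "x \<in> carrier V" for x
  proof -
    have "\<exists>a. x = lincomb a b" using that sp finite_span [OF b(1) bV] by auto
    then show ?thesis unfolding a_def by (rule someI_ex)
  qed
  have "inj_on (\<lambda>x. map (a x) bs) (carrier V)"
  proof (rule inj_onI)
    fix x y assume xy: "x \<in> carrier V" "y \<in> carrier V" and "map (a x) bs = map (a y) bs"
    then have "\<And>v. v \<in> b \<Longrightarrow> a x v = a y v" using bs by auto
    then have "lincomb (a x) b = lincomb (a y) b"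
      using bV smult_in unfolding lincomb_def by (intro M.finsum_cong') auto
    then show "x = y" using a xy by metis
  qed
  then show ?thesis by (rule that)
qed

text \<open>Among the subspaces meeting \<open>U\<close> trivially, one of largest dimension is a
  complement: a vector outside of the sum could be adjoined to it without meeting
  \<open>U\<close>.\<close>

lemma (in fkspace) complement_exists:
  assumes "ksub V U"
  obtains W where "ksub V W" "U \<inter> W = {\<zero>\<^bsub>V\<^esub>}"
    "\<And>x. x \<in> carrier V \<Longrightarrow> \<exists>u\<in>U. \<exists>w\<in>W. x = u \<oplus>\<^bsub>V\<^esub> w"
proof -
  let ?P = "\<lambda>W. ksub V W \<and> U \<inter> W = {\<zero>\<^bsub>V\<^esub>}"
  have U0: "\<zero>\<^bsub>V\<^esub> \<in> U" "U \<subseteq> carrier V" using assms by (auto simp: ksub_def)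
  have "?P {\<zero>\<^bsub>V\<^esub>}" using ksub_zero U0 by auto
  moreover have "\<forall>W. ?P W \<longrightarrow> kdim V W < Suc dim"
    using kdim_sub_carrier(1) [OF fd] by (auto simp: less_Suc_eq_le)
  ultimately have "\<exists>W. ?P W \<and> (\<forall>W'. ?P W' \<longrightarrow> kdim V W' \<le> kdim V W)"
    by (rule Lattices_Big.ex_has_greatest_nat)
  then obtain W where W: "?P W" and max: "\<And>W'. ?P W' \<Longrightarrow> kdim V W' \<le> kdim V W"
    by auto
  have Wc: "W \<subseteq> carrier V" "\<zero>\<^bsub>V\<^esub> \<in> W" using W by (auto simp: ksub_def)
  have "\<exists>u\<in>U. \<exists>w\<in>W. x = u \<oplus>\<^bsub>V\<^esub> w" if x: "x \<in> carrier V" for x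
  proof (rule ccontr)
    assume no: "\<not> ?thesis"
    \<comment> \<open>The span of \<open>W\<close> and \<open>x\<close>; it will contradict
      maximality.\<close>
    define W' where "W' = {w \<oplus>\<^bsub>V\<^esub> k \<odot>\<^bsub>V\<^esub> x | w k. w \<in> W}"
    have "ksub V W'"
      unfolding ksub_def
    proof (intro conjI ballI allI)
      show "W' \<subseteq> carrier V" using Wc x smult_in by (auto simp: W'_def)
      have "\<zero>\<^bsub>V\<^esub> = \<zero>\<^bsub>V\<^esub> \<oplus>\<^bsub>V\<^esub> 0 \<odot>\<^bsub>V\<^esub> x" using x smult_zero_scalar by simp
      then show "\<zero>\<^bsub>V\<^esub> \<in> W'" using Wc unfolding W'_def by blast
      fix y z assume "y \<in> W'" "z \<in> W'"
      then obtain w k w' k' where "y = w \<oplus>\<^bsub>V\<^esub> k \<odot>\<^bsub>V\<^esub> x" "z = w' \<oplus>\<^bsub>V\<^esub> k' \<odot>\<^bsub>V\<^esub> x" "w \<in> W" "w' \<in> W"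
        by (auto simp: W'_def)
      moreover from this have "y \<oplus>\<^bsub>V\<^esub> z = (w \<oplus>\<^bsub>V\<^esub> w') \<oplus>\<^bsub>V\<^esub> (k + k') \<odot>\<^bsub>V\<^esub> x"
        using Wc x smult_in [OF x] by (simp add: smult_plus M.a_ac subset_iff)
      ultimately show "y \<oplus>\<^bsub>V\<^esub> z \<in> W'" using W by (auto simp: W'_def ksub_def)
    next
      fix k y assume "y \<in> W'"
      then obtain w l where "y = w \<oplus>\<^bsub>V\<^esub> l \<odot>\<^bsub>V\<^esub> x" "w \<in> W" by (auto simp: W'_def)
      moreover from this have "k \<odot>\<^bsub>V\<^esub> y = k \<odot>\<^bsub>V\<^esub> w \<oplus>\<^bsub>V\<^esub> (k * l) \<odot>\<^bsub>V\<^esub> x"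
        using Wc x smult_in by (simp add: smult_add smult_smult subset_iff)
      ultimately show "k \<odot>\<^bsub>V\<^esub> y \<in> W'" using W by (auto simp: W'_def ksub_def)
    qed
    moreover have "U \<inter> W' = {\<zero>\<^bsub>V\<^esub>}"
    proof (rule equalityI)
      show "U \<inter> W' \<subseteq> {\<zero>\<^bsub>V\<^esub>}"
      proof
        fix u assume u: "u \<in> U \<inter> W'"
        then obtain w k where w: "u = w \<oplus>\<^bsub>V\<^esub> k \<odot>\<^bsub>V\<^esub> x" "w \<in> W" by (auto simp: W'_def)
        have cl: "w \<in> carrier V" "u \<in> carrier V" using w u Wc U0 by auto
        show "u \<in> {\<zero>\<^bsub>V\<^esub>}"
        proof (cases "k = 0")
          case True
          then have "u = w" using w cl x smult_zero_scalar by simp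
          then show ?thesis using u w W by auto
        next
          \<comment> \<open>Dividing by \<open>k\<close> would express \<open>x\<close> as an
            element of \<open>U\<close> plus an element of \<open>W\<close>, which was
            excluded.\<close>
          case False
          have "k \<odot>\<^bsub>V\<^esub> x = u \<oplus>\<^bsub>V\<^esub> (- 1) \<odot>\<^bsub>V\<^esub> w"
            using w cl x smult_in smult_neg1 by (simp add: M.a_ac M.r_neg1 M.r_neg2)
          then have "inverse k \<odot>\<^bsub>V\<^esub> (k \<odot>\<^bsub>V\<^esub> x)
              = inverse k \<odot>\<^bsub>V\<^esub> u \<oplus>\<^bsub>V\<^esub> inverse k \<odot>\<^bsub>V\<^esub> ((- 1) \<odot>\<^bsub>V\<^esub> w)"
            using cl smult_in by (simp add: smult_add)
          then have "x = inverse k \<odot>\<^bsub>V\<^esub> u \<oplus>\<^bsub>V\<^esub> inverse k \<odot>\<^bsub>V\<^esub> ((- 1) \<odot>\<^bsub>V\<^esub> w)"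
            using False x by (simp add: smult_smult smult_unit)
          moreover have "inverse k \<odot>\<^bsub>V\<^esub> u \<in> U" "inverse k \<odot>\<^bsub>V\<^esub> ((- 1) \<odot>\<^bsub>V\<^esub> w) \<in> W"
            using assms W u w by (auto simp: ksub_def)
          ultimately show ?thesis using no by auto
        qed
      qed
    qed (use \<open>ksub V W'\<close> U0 in \<open>auto simp: ksub_def\<close>)
    ultimately have le: "kdim V W' \<le> kdim V W" using max by auto
    have sub: "W \<subseteq> W'"
    proof
      fix w assume "w \<in> W"
      then have "w = w \<oplus>\<^bsub>V\<^esub> 0 \<odot>\<^bsub>V\<^esub> x" using Wc x smult_zero_scalar by auto
      then show "w \<in> W'" using \<open>w \<in> W\<close> unfolding W'_def by blast
    qed
    have "W = W'"
      using kdim_mono_eq [of W W'] kdim_mono [of W W'] le W sub \<open>ksub V W'\<close> by auto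
    moreover have "x = \<zero>\<^bsub>V\<^esub> \<oplus>\<^bsub>V\<^esub> 1 \<odot>\<^bsub>V\<^esub> x" using x by (simp add: smult_unit)
    then have "x \<in> W'" unfolding W'_def using Wc by blast
    moreover have "x = \<zero>\<^bsub>V\<^esub> \<oplus>\<^bsub>V\<^esub> x" using x by simp
    ultimately show False using no U0 by metis
  qed
  then show ?thesis using W that by blast
qed

text \<open>Compose \<open>g\<close> with the projection onto \<open>U\<close> along a complement.
  Both injectivity proofs, for simple modules at sources and for the regular module, come down to
  this extension.\<close>

lemma (in fkspace) extend_functional:
  fixes g :: "'m \<Rightarrow> 'k"
  assumes U: "ksub V U"
    and add: "\<And>x y. \<lbrakk>x \<in> U; y \<in> U\<rbrakk> \<Longrightarrow> g (x \<oplus>\<^bsub>V\<^esub> y) = g x + g y"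
    and smult: "\<And>k x. x \<in> U \<Longrightarrow> g (k \<odot>\<^bsub>V\<^esub> x) = k * g x"
  obtains h where "\<And>x. x \<in> U \<Longrightarrow> h x = g x"
    "\<And>x y. \<lbrakk>x \<in> carrier V; y \<in> carrier V\<rbrakk> \<Longrightarrow> h (x \<oplus>\<^bsub>V\<^esub> y) = h x + h y"
    "\<And>k x. x \<in> carrier V \<Longrightarrow> h (k \<odot>\<^bsub>V\<^esub> x) = k * h x"
proof -
  obtain W where W: "ksub V W" "U \<inter> W = {\<zero>\<^bsub>V\<^esub>}"
    "\<And>x. x \<in> carrier V \<Longrightarrow> \<exists>u\<in>U. \<exists>w\<in>W. x = u \<oplus>\<^bsub>V\<^esub> w"
    using complement_exists [OF U] by blast
  have UW: "U \<subseteq> carrier V" "W \<subseteq> carrier V" "\<zero>\<^bsub>V\<^esub> \<in> U" "\<zero>\<^bsub>V\<^esub> \<in> W" using U W by (auto simp: ksub_def)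
  \<comment> \<open>The projection onto \<open>U\<close> along \<open>W\<close>; the description is
    unique because \<open>U\<close> and \<open>W\<close> meet only in zero.\<close>
  define p where "p x = (THE u. u \<in> U \<and> (\<exists>w\<in>W. x = u \<oplus>\<^bsub>V\<^esub> w))" for x
  have pI: "p (u \<oplus>\<^bsub>V\<^esub> w) = u" if "u \<in> U" "w \<in> W" for u w
    unfolding p_def
  proof (rule the_equality)
    fix u' assume "u' \<in> U \<and> (\<exists>w'\<in>W. u \<oplus>\<^bsub>V\<^esub> w = u' \<oplus>\<^bsub>V\<^esub> w')"
    then obtain w' where w': "u' \<in> U" "w' \<in> W" "u \<oplus>\<^bsub>V\<^esub> w = u' \<oplus>\<^bsub>V\<^esub> w'" by auto
    then have cl: "u \<in> carrier V" "u' \<in> carrier V" "w \<in> carrier V" "w' \<in> carrier V" using that UW by auto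
    have "u' \<ominus>\<^bsub>V\<^esub> u = (u' \<oplus>\<^bsub>V\<^esub> w') \<ominus>\<^bsub>V\<^esub> w' \<ominus>\<^bsub>V\<^esub> u"
      using cl by (simp add: a_minus_def M.a_assoc M.r_neg)
    also have "\<dots> = (u \<oplus>\<^bsub>V\<^esub> w) \<ominus>\<^bsub>V\<^esub> w' \<ominus>\<^bsub>V\<^esub> u" using w' by simp
    also have "\<dots> = w \<ominus>\<^bsub>V\<^esub> w'" using cl
      using M.r_neg2 [of u "w \<oplus>\<^bsub>V\<^esub> \<ominus>\<^bsub>V\<^esub> w'"] by (simp add: a_minus_def M.a_ac)
    finally have "u' \<ominus>\<^bsub>V\<^esub> u \<in> U \<inter> W" using ksub_minus U W that w' by (metis IntI)
    then show "u' = u" using W(2) cl by (simp add: a_minus_def) (metis M.a_inv_closed M.minus_equality M.minus_minus)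
  qed (use that in auto)
  show ?thesis
  proof (rule that [of "g \<circ> p"])
    fix x assume "x \<in> U"
    then show "(g \<circ> p) x = g x" using pI [of x "\<zero>\<^bsub>V\<^esub>"] UW by auto
  next
    fix x y assume "x \<in> carrier V" "y \<in> carrier V"
    then obtain u w u' w' where *: "u \<in> U" "w \<in> W" "x = u \<oplus>\<^bsub>V\<^esub> w" "u' \<in> U" "w' \<in> W" "y = u' \<oplus>\<^bsub>V\<^esub> w'"
      using W(3) by meson
    then have "x \<oplus>\<^bsub>V\<^esub> y = (u \<oplus>\<^bsub>V\<^esub> u') \<oplus>\<^bsub>V\<^esub> (w \<oplus>\<^bsub>V\<^esub> w')"
      using UW by (simp add: M.a_ac subset_iff)
    moreover have "u \<oplus>\<^bsub>V\<^esub> u' \<in> U" "w \<oplus>\<^bsub>V\<^esub> w' \<in> W" using * U W by (auto simp: ksub_def)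
    ultimately show "(g \<circ> p) (x \<oplus>\<^bsub>V\<^esub> y) = (g \<circ> p) x + (g \<circ> p) y"
      using * pI add by simp
  next
    fix k x assume "x \<in> carrier V"
    then obtain u w where *: "u \<in> U" "w \<in> W" "x = u \<oplus>\<^bsub>V\<^esub> w"
      using W(3) by meson
    then have "k \<odot>\<^bsub>V\<^esub> x = k \<odot>\<^bsub>V\<^esub> u \<oplus>\<^bsub>V\<^esub> k \<odot>\<^bsub>V\<^esub> w"
      using UW by (simp add: smult_add subset_iff)
    moreover have "k \<odot>\<^bsub>V\<^esub> u \<in> U" "k \<odot>\<^bsub>V\<^esub> w \<in> W" using * U W by (auto simp: ksub_def)
    ultimately show "(g \<circ> p) (k \<odot>\<^bsub>V\<^esub> x) = k * (g \<circ> p) x"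
      using * pI smult by simp
  qed
qed

section \<open>Products and sums of vector spaces\<close>

definition kprod :: "('k::field, 'm, 'y) module_scheme \<Rightarrow> ('k, 'n, 'z) module_scheme \<Rightarrow> ('k, 'm \<times> 'n) module"
  where
  "kprod V W = \<lparr>carrier = carrier V \<times> carrier W, monoid.mult = undefined, one = undefined,
     ring.zero = (\<zero>\<^bsub>V\<^esub>, \<zero>\<^bsub>W\<^esub>), ring.add = (\<lambda>(x, y) (x', y'). (x \<oplus>\<^bsub>V\<^esub> x', y \<oplus>\<^bsub>W\<^esub> y')),
     smult = (\<lambda>k (x, y). (k \<odot>\<^bsub>V\<^esub> x, k \<odot>\<^bsub>W\<^esub> y))\<rparr>"

lemma kprod_simps [simp]:
  "carrier (kprod V W) = carrier V \<times> carrier W"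
  "\<zero>\<^bsub>kprod V W\<^esub> = (\<zero>\<^bsub>V\<^esub>, \<zero>\<^bsub>W\<^esub>)"
  "(x, y) \<oplus>\<^bsub>kprod V W\<^esub> (x', y') = (x \<oplus>\<^bsub>V\<^esub> x', y \<oplus>\<^bsub>W\<^esub> y')"
  "k \<odot>\<^bsub>kprod V W\<^esub> (x, y) = (k \<odot>\<^bsub>V\<^esub> x, k \<odot>\<^bsub>W\<^esub> y)"
  by (simp_all add: kprod_def)

lemma fkspace_kprod:
  assumes "fkspace V" "fkspace W"
  shows "fkspace (kprod V W)"
proof -
  interpret V: fkspace V by fact
  interpret W: fkspace W by fact
  interpret P: kspace "kprod V W"
  proof (rule kspaceI)
    show "abelian_group (kprod V W)"
    proof (rule abelian_groupI)
      fix x assume "x \<in> carrier (kprod V W)"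
      then show "\<exists>y\<in>carrier (kprod V W). y \<oplus>\<^bsub>kprod V W\<^esub> x = \<zero>\<^bsub>kprod V W\<^esub>"
        by (intro bexI [of _ "(\<ominus>\<^bsub>V\<^esub> fst x, \<ominus>\<^bsub>W\<^esub> snd x)"]) (auto simp: V.M.l_neg W.M.l_neg)
    qed (auto simp: V.M.a_ac W.M.a_ac)
  qed (auto simp: V.smult_in W.smult_in V.smult_plus W.smult_plus V.smult_add W.smult_add
         V.smult_smult W.smult_smult V.smult_unit W.smult_unit)
  obtain S where S: "finite S" "S \<subseteq> carrier V" "\<And>U. \<lbrakk>ksub V U; S \<subseteq> U\<rbrakk> \<Longrightarrow> U = carrier V"
    using V.finite_spanning by blast
  obtain T where T: "finite T" "T \<subseteq> carrier W" "\<And>U. \<lbrakk>ksub W U; T \<subseteq> U\<rbrakk> \<Longrightarrow> U = carrier W"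
    using W.finite_spanning by blast
  show ?thesis
  proof (rule P.fkspaceI)
    let ?S = "S \<times> {\<zero>\<^bsub>W\<^esub>} \<union> {\<zero>\<^bsub>V\<^esub>} \<times> T"
    show "finite ?S" "?S \<subseteq> carrier (kprod V W)" using S T by auto
    fix U assume U: "ksub (kprod V W) U" "?S \<subseteq> U"
    have a: "{x \<in> carrier V. (x, \<zero>\<^bsub>W\<^esub>) \<in> U} = carrier V"
    proof (rule S(3))
      show "ksub V {x \<in> carrier V. (x, \<zero>\<^bsub>W\<^esub>) \<in> U}"
        using U(1) unfolding ksub_def
        by (auto simp: V.smult_in) (metis W.M.r_zero W.M.zero_closed kprod_simps(3), metis W.smult_zero_vector kprod_simps(4))
    qed (use U S in auto)
    have b: "{x \<in> carrier W. (\<zero>\<^bsub>V\<^esub>, x) \<in> U} = carrier W"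
    proof (rule T(3))
      show "ksub W {x \<in> carrier W. (\<zero>\<^bsub>V\<^esub>, x) \<in> U}"
        using U(1) unfolding ksub_def
        by (auto simp: W.smult_in) (metis V.M.r_zero V.M.zero_closed kprod_simps(3), metis V.smult_zero_vector kprod_simps(4))
    qed (use U T in auto)
    show "U = carrier (kprod V W)"
    proof (rule equalityI)
      show "carrier (kprod V W) \<subseteq> U"
      proof
        fix z assume "z \<in> carrier (kprod V W)"
        then obtain x y where z: "z = (x, y)" "x \<in> carrier V" "y \<in> carrier W" by auto
        then have "(x, \<zero>\<^bsub>W\<^esub>) \<oplus>\<^bsub>kprod V W\<^esub> (\<zero>\<^bsub>V\<^esub>, y) \<in> U"
          using a b U(1) unfolding ksub_def by blast
        then show "z \<in> U" using z by simp
      qed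
    qed (use U in \<open>simp add: ksub_def\<close>)
  qed
qed

lemma kdim_kprod:
  assumes "fkspace V" "fkspace W" "ksub V U" "ksub W U'"
  shows "ksub (kprod V W) (U \<times> U')" "kdim (kprod V W) (U \<times> U') = kdim V U + kdim W U'"
proof -
  interpret V: fkspace V by fact
  interpret W: fkspace W by fact
  interpret P: fkspace "kprod V W" by (rule fkspace_kprod) fact+
  have z: "\<zero>\<^bsub>V\<^esub> \<in> U" "\<zero>\<^bsub>W\<^esub> \<in> U'" "U \<subseteq> carrier V" "U' \<subseteq> carrier W" using assms by (auto simp: ksub_def)
  show s: "ksub (kprod V W) (U \<times> U')" using assms by (auto simp: ksub_def)
  have l1: "klin (kprod V W) V (U \<times> U') fst" using z by (auto simp: klin_def)
  have e: "kdim (kprod V W) (U \<times> U') = kdim V (fst ` (U \<times> U'))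
      + kdim (kprod V W) {x \<in> U \<times> U'. fst x = \<zero>\<^bsub>V\<^esub>}"
    using kdim_rank_nullity(1) [OF P.fkspace V.kspace s l1] .
  have k: "{x \<in> U \<times> U'. fst x = \<zero>\<^bsub>V\<^esub>} = {\<zero>\<^bsub>V\<^esub>} \<times> U'" "fst ` (U \<times> U') = U" using z by force+
  have s2: "ksub (kprod V W) ({\<zero>\<^bsub>V\<^esub>} \<times> U')" using assms V.smult_zero_vector by (auto simp: ksub_def)
  have l2: "klin (kprod V W) W ({\<zero>\<^bsub>V\<^esub>} \<times> U') snd" using z by (auto simp: klin_def)
  have "kdim W (snd ` ({\<zero>\<^bsub>V\<^esub>} \<times> U')) = kdim (kprod V W) ({\<zero>\<^bsub>V\<^esub>} \<times> U')"
    using kdim_inj [OF P.fkspace W.kspace s2 l2] by (auto simp: inj_on_def)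
  then show "kdim (kprod V W) (U \<times> U') = kdim V U + kdim W U'" using e k by simp
qed

text \<open>The sum is the image of the product under addition, so rank-nullity bounds its dimension
  by that of the product.\<close>

lemma (in fkspace) kdim_sum_le:
  assumes "ksub V U" "ksub V U'"
  defines "S \<equiv> (\<lambda>(x, y). x \<oplus>\<^bsub>V\<^esub> y) ` (U \<times> U')"
  shows "ksub V S" "kdim V S \<le> kdim V U + kdim V U'"
proof -
  interpret P: fkspace "kprod V V" by (rule fkspace_kprod) (rule fkspace)+
  have c: "U \<subseteq> carrier V" "U' \<subseteq> carrier V" using assms by (auto simp: ksub_def)
  have l: "klin (kprod V V) V (U \<times> U') (\<lambda>(x, y). x \<oplus>\<^bsub>V\<^esub> y)"
    using c by (auto simp: klin_def M.a_ac subset_iff smult_add)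
  note s = kdim_kprod [OF fkspace fkspace assms(1,2)]
  note r = kdim_rank_nullity [OF P.fkspace kspace s(1) l]
  show "ksub V S" using r(3) by (simp add: S_def)
  show "kdim V S \<le> kdim V U + kdim V U'" using r(1) s(2) by (simp add: S_def)
qed

text \<open>The images of the powers of \<open>f\<close> decrease. Once their dimension is minimal,
  \<open>f\<close> maps each onto the next one of equal dimension, and rank-nullity leaves no
  kernel.\<close>

theorem (in fkspace) eventually_injective:
  assumes f: "klin V V (carrier V) f"
  obtains l where "\<And>s x. \<lbrakk>x \<in> carrier V; f ((f ^^ (l + s)) x) = \<zero>\<^bsub>V\<^esub>\<rbrakk> \<Longrightarrow> (f ^^ (l + s)) x = \<zero>\<^bsub>V\<^esub>"
proof -
  define I where "I n = (f ^^ n) ` carrier V" for n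
  have I: "ksub V (I n)" for n
  proof (induction n)
    case (Suc n)
    have "klin V V (I n) f" using f Suc by (auto simp: klin_def ksub_def subset_iff)
    from kdim_rank_nullity(3) [OF fkspace kspace Suc this]
    show ?case by (simp add: I_def image_image)
  qed (simp add: I_def ksub_carrier)
  \<comment> \<open>An image of least dimension. As the images are nested, all later ones have the
    same dimension.\<close>
  obtain l where min: "\<And>n. kdim V (I l) \<le> kdim V (I n)"
    using ex_has_least_nat [of "\<lambda>_. True" _ "\<lambda>n. kdim V (I n)"] by auto
  have Il: "I (l + s) \<subseteq> I l" for s
  proof
    fix y assume "y \<in> I (l + s)"
    then obtain x where x: "x \<in> carrier V" "y = (f ^^ (l + s)) x" by (auto simp: I_def)
    have "(f ^^ s) x \<in> carrier V" using I [of s] x by (auto simp: I_def ksub_def)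
    then show "y \<in> I l" using x by (auto simp: I_def funpow_add)
  qed
  have eq: "kdim V (I (l + s)) = kdim V (I l)" for s
    using kdim_mono [OF I I Il [of s]] min [of "l + s"] by simp
  show ?thesis
  proof (rule that)
    fix s x assume x: "x \<in> carrier V" "f ((f ^^ (l + s)) x) = \<zero>\<^bsub>V\<^esub>"
    let ?J = "I (l + s)"
    have lin: "klin V V ?J f" using f I [of "l + s"] by (auto simp: klin_def ksub_def subset_iff)
    have "f ` ?J = I (l + Suc s)" by (simp add: I_def image_image)
    then have "kdim V {x \<in> ?J. f x = \<zero>\<^bsub>V\<^esub>} = 0"
      using kdim_rank_nullity(1) [OF fkspace kspace I lin] eq [of s] eq [of "Suc s"] by simp
    then have "{x \<in> ?J. f x = \<zero>\<^bsub>V\<^esub>} = {\<zero>\<^bsub>V\<^esub>}"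
      using kdim_eq_0 kdim_rank_nullity(4) [OF fkspace kspace I lin] by blast
    then show "(f ^^ (l + s)) x = \<zero>\<^bsub>V\<^esub>" using x by (auto simp: I_def)
  qed
qed

section \<open>Functions on a finite set as a vector space\<close>

definition fun_space :: "'v set \<Rightarrow> ('k::field, 'v \<Rightarrow> 'k) module" where
  "fun_space D = \<lparr>carrier = {f. \<forall>v. v \<notin> D \<longrightarrow> f v = 0}, monoid.mult = undefined, one = undefined,
     ring.zero = (\<lambda>_. 0), ring.add = (\<lambda>f g v. f v + g v), smult = (\<lambda>k f v. k * f v)\<rparr>"

lemma fun_space_simps [simp]:
  "carrier (fun_space D) = {f. \<forall>v. v \<notin> D \<longrightarrow> f v = 0}"
  "\<zero>\<^bsub>fun_space D\<^esub> = (\<lambda>_. 0)"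
  "f \<oplus>\<^bsub>fun_space D\<^esub> g = (\<lambda>v. f v + g v)"
  "k \<odot>\<^bsub>fun_space D\<^esub> f = (\<lambda>v. k * f v)"
  by (simp_all add: fun_space_def)

lemma kspace_fun_space: "kspace (fun_space D :: ('k::field, 'v \<Rightarrow> 'k) module)"
proof (rule kspaceI)
  show "abelian_group (fun_space D :: ('k, 'v \<Rightarrow> 'k) module)"
  proof (rule abelian_groupI)
    fix x :: "'v \<Rightarrow> 'k" assume "x \<in> carrier (fun_space D)"
    then show "\<exists>y\<in>carrier (fun_space D). y \<oplus>\<^bsub>fun_space D\<^esub> x = \<zero>\<^bsub>fun_space D\<^esub>"
      by (intro bexI [of _ "\<lambda>v. - x v"]) auto
  qed (auto simp: algebra_simps)
qed (auto simp: algebra_simps)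

lemma fkspace_fun_space:
  assumes "finite D"
  shows "fkspace (fun_space D :: ('k::field, 'v \<Rightarrow> 'k) module)"
proof -
  let ?V = "fun_space D :: ('k, 'v \<Rightarrow> 'k) module"
  interpret kspace ?V by (rule kspace_fun_space)
  let ?d = "\<lambda>v w. if w = v then 1 else (0 :: 'k)"
  show ?thesis
  proof (rule fkspaceI)
    show "finite (?d ` D)" "?d ` D \<subseteq> carrier ?V" using assms by auto
    fix U assume U: "ksub ?V U" "?d ` D \<subseteq> U"
    have "f \<in> U" if "F \<subseteq> D" "\<forall>v. v \<notin> F \<longrightarrow> f v = 0" for F f
      using finite_subset [OF that(1) assms] that
    proof (induction F arbitrary: f)
      case empty
      then have "f = (\<lambda>_. 0)" by auto
      then show ?case using U by (simp add: ksub_def)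
    next
      case (insert w F)
      have "f(w := 0) \<in> U" using insert by (intro insert.IH) auto
      moreover have "?d w \<in> U" using U insert.prems by blast
      then have "f w \<odot>\<^bsub>?V\<^esub> ?d w \<in> U" using U(1) unfolding ksub_def by blast
      then have "(\<lambda>v. f w * ?d w v) \<in> U" by simp
      ultimately have "f(w := 0) \<oplus>\<^bsub>?V\<^esub> (\<lambda>v. f w * ?d w v) \<in> U"
        using U(1) unfolding ksub_def by blast
      then have "(\<lambda>v. (f(w := 0)) v + f w * ?d w v) \<in> U" by simp
      moreover have "(\<lambda>v. (f(w := 0)) v + f w * ?d w v) = f" by auto
      ultimately show ?case by simp
    qed
    then have "carrier ?V \<subseteq> U" by auto
    then show "U = carrier ?V" using U(1) unfolding ksub_def by blast
  qed
qed

text \<open>Induction on the support: isolating the value at the new point has a line as its image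
  and the functions supported on the old set as its kernel.\<close>

lemma kdim_fun_space:
  assumes "finite D" "F \<subseteq> D"
  defines "W \<equiv> (\<lambda>F. {f. \<forall>v. v \<notin> F \<longrightarrow> f v = (0::'k::field)})"
  shows "kdim (fun_space D :: ('k::field, 'v \<Rightarrow> 'k) module) (W F) = card F"
proof -
  let ?V = "fun_space D :: ('k, 'v \<Rightarrow> 'k) module"
  interpret fkspace ?V by (rule fkspace_fun_space) fact
  have sub: "ksub ?V (W G)" if "G \<subseteq> D" for G
    using that by (auto simp: ksub_def W_def)
  from finite_subset [OF assms(2,1)] assms(2) show ?thesis
  proof (induction F)
    case empty
    have "W {} = {\<zero>\<^bsub>?V\<^esub>}" by (auto simp: W_def)
    then show ?case using kdim_zero by simp
  next
    case (insert w F)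
    let ?d = "\<lambda>v. if v = w then 1 else (0 :: 'k)"
    let ?f = "\<lambda>f v. f w * ?d v"
    have "klin ?V ?V (W (insert w F)) ?f"
      using insert.prems by (auto simp: klin_def algebra_simps fun_eq_iff)
    from kdim_rank_nullity(1) [OF fkspace kspace sub [OF insert.prems] this]
    have "kdim ?V (W (insert w F)) = kdim ?V (?f ` W (insert w F))
       + kdim ?V {x \<in> W (insert w F). ?f x = \<zero>\<^bsub>?V\<^esub>}" .
    moreover have "?f ` W (insert w F) = range (\<lambda>k. k \<odot>\<^bsub>?V\<^esub> ?d)"
    proof (intro equalityI subsetI)
      fix g assume "g \<in> range (\<lambda>k. k \<odot>\<^bsub>?V\<^esub> ?d)"
      then obtain k where "g = k \<odot>\<^bsub>?V\<^esub> ?d" by auto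
      then have "g \<in> W (insert w F)" "g = ?f g" by (auto simp: W_def fun_eq_iff)
      then show "g \<in> ?f ` W (insert w F)" by blast
    qed auto
    moreover have "kdim ?V (range (\<lambda>k. k \<odot>\<^bsub>?V\<^esub> ?d)) = 1"
      using insert.prems by (intro kdim_line) (auto simp: fun_eq_iff)
    moreover have "{x \<in> W (insert w F). ?f x = \<zero>\<^bsub>?V\<^esub>} = W F"
      using insert.hyps by (auto simp: W_def fun_eq_iff)
    ultimately show ?case using insert by simp
  qed
qed

section \<open>Right modules\<close>

context right_module
begin

lemma ract_zero_right: "x \<in> carrier M \<Longrightarrow> x \<star>\<^bsub>M\<^esub> \<zero>\<^bsub>A\<^esub> = \<zero>\<^bsub>M\<^esub>"
  using ract_add_right [of x "\<zero>\<^bsub>A\<^esub>" "\<zero>\<^bsub>A\<^esub>"] ract_closed [of x "\<zero>\<^bsub>A\<^esub>"]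
  by (metis M.add.l_cancel_one' R.l_zero R.zero_closed)

lemma ract_zero_left: "a \<in> carrier A \<Longrightarrow> \<zero>\<^bsub>M\<^esub> \<star>\<^bsub>M\<^esub> a = \<zero>\<^bsub>M\<^esub>"
  using ract_add_left [of "\<zero>\<^bsub>M\<^esub>" "\<zero>\<^bsub>M\<^esub>" a] ract_closed [of "\<zero>\<^bsub>M\<^esub>" a]
  by (metis M.add.l_cancel_one' M.l_zero M.zero_closed)

text \<open>Negation is an instance of the action. A set closed under addition and the action is
  therefore closed under negation, which is what \<open>submodI\<close> exploits.\<close>

lemma ract_minus_one: "x \<in> carrier M \<Longrightarrow> x \<star>\<^bsub>M\<^esub> (\<ominus>\<^bsub>A\<^esub> \<one>\<^bsub>A\<^esub>) = \<ominus>\<^bsub>M\<^esub> x"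
  using ract_add_right [of x "\<ominus>\<^bsub>A\<^esub> \<one>\<^bsub>A\<^esub>" "\<one>\<^bsub>A\<^esub>"]
  by (metis M.minus_equality R.a_inv_closed R.l_neg R.one_closed ract_closed ract_one ract_zero_right)

end

section \<open>Submodules, direct sums and homomorphisms\<close>

lemma submodI:
  assumes "right_module A M" "U \<subseteq> carrier M" "\<zero>\<^bsub>M\<^esub> \<in> U"
    "\<And>x y. \<lbrakk>x \<in> U; y \<in> U\<rbrakk> \<Longrightarrow> x \<oplus>\<^bsub>M\<^esub> y \<in> U"
    "\<And>x a. \<lbrakk>x \<in> U; a \<in> carrier A\<rbrakk> \<Longrightarrow> x \<star>\<^bsub>M\<^esub> a \<in> U"
  shows "submod A U M"
proof -
  interpret right_module A M by fact
  have "\<ominus>\<^bsub>M\<^esub> x \<in> U" if "x \<in> U" for x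
    using ract_minus_one [of x] assms that by (metis R.a_inv_closed R.one_closed subsetD)
  then have "subgroup U (add_monoid M)"
    using assms by (intro M.add.subgroupI) (auto simp: a_inv_def)
  then show ?thesis using assms by (auto simp: submod_def additive_subgroup_def)
qed

lemma submodD:
  assumes "submod A U M"
  shows "U \<subseteq> carrier M" "\<zero>\<^bsub>M\<^esub> \<in> U" "\<And>x y. \<lbrakk>x \<in> U; y \<in> U\<rbrakk> \<Longrightarrow> x \<oplus>\<^bsub>M\<^esub> y \<in> U"
    "\<And>x a. \<lbrakk>x \<in> U; a \<in> carrier A\<rbrakk> \<Longrightarrow> x \<star>\<^bsub>M\<^esub> a \<in> U"
  using assms additive_subgroup.a_subset additive_subgroup.zero_closed additive_subgroup.a_closed
  by (fastforce simp: submod_def)+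

lemma submod_neg:
  assumes "right_module A M" "submod A U M" "x \<in> U"
  shows "\<ominus>\<^bsub>M\<^esub> x \<in> U"
proof -
  interpret right_module A M by fact
  show ?thesis using ract_minus_one [of x] submodD [OF assms(2)] assms(3)
    by (metis R.a_inv_closed R.one_closed subsetD)
qed

lemma right_moduleI:
  assumes "ring A" "abelian_group M"
    "\<And>x a. \<lbrakk>x \<in> carrier M; a \<in> carrier A\<rbrakk> \<Longrightarrow> x \<star>\<^bsub>M\<^esub> a \<in> carrier M"
    "\<And>x y a. \<lbrakk>x \<in> carrier M; y \<in> carrier M; a \<in> carrier A\<rbrakk> \<Longrightarrow>
       (x \<oplus>\<^bsub>M\<^esub> y) \<star>\<^bsub>M\<^esub> a = x \<star>\<^bsub>M\<^esub> a \<oplus>\<^bsub>M\<^esub> y \<star>\<^bsub>M\<^esub> a"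
    "\<And>x a b. \<lbrakk>x \<in> carrier M; a \<in> carrier A; b \<in> carrier A\<rbrakk> \<Longrightarrow>
       x \<star>\<^bsub>M\<^esub> (a \<oplus>\<^bsub>A\<^esub> b) = x \<star>\<^bsub>M\<^esub> a \<oplus>\<^bsub>M\<^esub> x \<star>\<^bsub>M\<^esub> b"
    "\<And>x a b. \<lbrakk>x \<in> carrier M; a \<in> carrier A; b \<in> carrier A\<rbrakk> \<Longrightarrow>
       x \<star>\<^bsub>M\<^esub> (a \<otimes>\<^bsub>A\<^esub> b) = (x \<star>\<^bsub>M\<^esub> a) \<star>\<^bsub>M\<^esub> b"
    "\<And>x. x \<in> carrier M \<Longrightarrow> x \<star>\<^bsub>M\<^esub> \<one>\<^bsub>A\<^esub> = x"
  shows "right_module A M"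
  using assms by (simp add: right_module_def right_module_axioms_def)

lemma right_module_submod:
  assumes "right_module A M" "submod A U M"
  shows "right_module A (M\<lparr>carrier := U\<rparr>)"
proof -
  interpret right_module A M by fact
  note U = submodD [OF assms(2)]
  have c: "x \<in> U \<Longrightarrow> x \<in> carrier M" for x using U by auto
  show ?thesis
  proof (rule right_moduleI)
    show "ring A" ..
    show "abelian_group (M\<lparr>carrier := U\<rparr>)"
    proof (rule abelian_groupI)
      fix x assume x: "x \<in> carrier (M\<lparr>carrier := U\<rparr>)"
      then show "\<exists>y\<in>carrier (M\<lparr>carrier := U\<rparr>). y \<oplus>\<^bsub>M\<lparr>carrier := U\<rparr>\<^esub> x = \<zero>\<^bsub>M\<lparr>carrier := U\<rparr>\<^esub>"
        using submod_neg [OF assms] c by (intro bexI [of _ "\<ominus>\<^bsub>M\<^esub> x"]) (auto simp: M.l_neg)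
    qed (use U in \<open>auto simp: M.a_ac subset_iff\<close>)
  qed (use U c in \<open>auto simp: ract_add_left ract_add_right ract_assoc ract_one\<close>)
qed

lemma dsum2_simps [simp]:
  "carrier (dsum2 M N) = carrier M \<times> carrier N"
  "\<zero>\<^bsub>dsum2 M N\<^esub> = (\<zero>\<^bsub>M\<^esub>, \<zero>\<^bsub>N\<^esub>)"
  "(x, y) \<oplus>\<^bsub>dsum2 M N\<^esub> (x', y') = (x \<oplus>\<^bsub>M\<^esub> x', y \<oplus>\<^bsub>N\<^esub> y')"
  "(x, y) \<star>\<^bsub>dsum2 M N\<^esub> a = (x \<star>\<^bsub>M\<^esub> a, y \<star>\<^bsub>N\<^esub> a)"
  by (simp_all add: dsum2_def)

lemma right_module_dsum2:
  assumes "right_module A M" "right_module A N"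
  shows "right_module A (dsum2 M N)"
proof -
  interpret M: right_module A M by fact
  interpret N: right_module A N by fact
  show ?thesis
  proof (rule right_moduleI)
    show "ring A" ..
    show "abelian_group (dsum2 M N)"
    proof (rule abelian_groupI)
      fix x assume x: "x \<in> carrier (dsum2 M N)"
      then show "\<exists>y\<in>carrier (dsum2 M N). y \<oplus>\<^bsub>dsum2 M N\<^esub> x = \<zero>\<^bsub>dsum2 M N\<^esub>"
        by (intro bexI [of _ "(\<ominus>\<^bsub>M\<^esub> fst x, \<ominus>\<^bsub>N\<^esub> snd x)"]) (auto simp: M.M.l_neg N.M.l_neg)
    qed (auto simp: M.M.a_ac N.M.a_ac)
  qed (auto simp: M.ract_closed N.ract_closed M.ract_add_left M.ract_add_right M.ract_assoc M.ract_one
         N.ract_add_left N.ract_add_right N.ract_assoc N.ract_one)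
qed

lemma rmod_homD:
  assumes "f \<in> rmod_hom A M N"
  shows "x \<in> carrier M \<Longrightarrow> f x \<in> carrier N"
    "\<lbrakk>x \<in> carrier M; y \<in> carrier M\<rbrakk> \<Longrightarrow> f (x \<oplus>\<^bsub>M\<^esub> y) = f x \<oplus>\<^bsub>N\<^esub> f y"
    "\<lbrakk>x \<in> carrier M; a \<in> carrier A\<rbrakk> \<Longrightarrow> f (x \<star>\<^bsub>M\<^esub> a) = f x \<star>\<^bsub>N\<^esub> a"
  using assms by (auto simp: rmod_hom_def)

lemma rmod_homI:
  assumes "\<And>x. x \<in> carrier M \<Longrightarrow> f x \<in> carrier N"
    "\<And>x y. \<lbrakk>x \<in> carrier M; y \<in> carrier M\<rbrakk> \<Longrightarrow> f (x \<oplus>\<^bsub>M\<^esub> y) = f x \<oplus>\<^bsub>N\<^esub> f y"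
    "\<And>x a. \<lbrakk>x \<in> carrier M; a \<in> carrier A\<rbrakk> \<Longrightarrow> f (x \<star>\<^bsub>M\<^esub> a) = f x \<star>\<^bsub>N\<^esub> a"
  shows "f \<in> rmod_hom A M N"
  using assms by (auto simp: rmod_hom_def)

lemma rmod_hom_zero:
  assumes "right_module A M" "right_module A N" "f \<in> rmod_hom A M N"
  shows "f \<zero>\<^bsub>M\<^esub> = \<zero>\<^bsub>N\<^esub>"
proof -
  interpret M: right_module A M by fact
  interpret N: right_module A N by fact
  have "f \<zero>\<^bsub>M\<^esub> = f (\<zero>\<^bsub>M\<^esub> \<star>\<^bsub>M\<^esub> \<zero>\<^bsub>A\<^esub>)" using M.ract_zero_left by simp
  also have "\<dots> = \<zero>\<^bsub>N\<^esub>" using assms(3) N.ract_zero_right by (simp add: rmod_homD)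
  finally show ?thesis .
qed

lemma rmod_hom_neg:
  assumes "right_module A M" "right_module A N" "f \<in> rmod_hom A M N" "x \<in> carrier M"
  shows "f (\<ominus>\<^bsub>M\<^esub> x) = \<ominus>\<^bsub>N\<^esub> f x"
proof -
  interpret M: right_module A M by fact
  interpret N: right_module A N by fact
  show ?thesis
    using assms(3,4) M.ract_minus_one [of x] N.ract_minus_one [of "f x"] by (metis M.R.a_inv_closed M.R.one_closed rmod_homD(1,3))
qed

lemma rmod_hom_comp:
  "\<lbrakk>f \<in> rmod_hom A M N; g \<in> rmod_hom A N L\<rbrakk> \<Longrightarrow> g \<circ> f \<in> rmod_hom A M L"
  by (rule rmod_homI) (simp_all add: rmod_homD)

lemma rmod_hom_id: "(\<lambda>x. x) \<in> rmod_hom A M M"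
  by (auto simp: rmod_hom_def)

lemma submod_kernel:
  assumes "right_module A M" "right_module A N" "f \<in> rmod_hom A M N"
  shows "submod A {x \<in> carrier M. f x = \<zero>\<^bsub>N\<^esub>} M"
proof -
  interpret M: right_module A M by fact
  interpret N: right_module A N by fact
  show ?thesis
    using assms rmod_hom_zero [OF assms]
    by (intro submodI) (auto simp: rmod_homD [OF assms(3)] M.ract_closed N.ract_zero_left)
qed

lemma submod_image:
  assumes "right_module A M" "right_module A N" "f \<in> rmod_hom A M N" "submod A U M"
  shows "submod A (f ` U) N"
proof (rule submodI)
  interpret M: right_module A M by fact
  note U = submodD [OF assms(4)]
  note f = rmod_homD [OF assms(3)]
  show "f ` U \<subseteq> carrier N" using f U by auto
  show "\<zero>\<^bsub>N\<^esub> \<in> f ` U" using rmod_hom_zero [OF assms(1-3)] U by (metis imageI)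
  fix y z assume "y \<in> f ` U" "z \<in> f ` U"
  then obtain x x' where "x \<in> U" "x' \<in> U" "y = f x" "z = f x'" by auto
  then have "y \<oplus>\<^bsub>N\<^esub> z = f (x \<oplus>\<^bsub>M\<^esub> x')" "x \<oplus>\<^bsub>M\<^esub> x' \<in> U" using f(2) U by (auto simp: subset_iff)
  then show "y \<oplus>\<^bsub>N\<^esub> z \<in> f ` U" by auto
next
  note U = submodD [OF assms(4)]
  note f = rmod_homD [OF assms(3)]
  fix y a assume "y \<in> f ` U" "a \<in> carrier A"
  then obtain x where "x \<in> U" "y = f x" by auto
  then have "y \<star>\<^bsub>N\<^esub> a = f (x \<star>\<^bsub>M\<^esub> a)" "x \<star>\<^bsub>M\<^esub> a \<in> U" using f(3) U \<open>a \<in> carrier A\<close> by (auto simp: subset_iff)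
  then show "y \<star>\<^bsub>N\<^esub> a \<in> f ` U" by auto
qed (fact assms)

lemma submod_carrier: "right_module A M \<Longrightarrow> submod A (carrier M) M"
proof -
  assume "right_module A M"
  then interpret right_module A M .
  show ?thesis by (rule submodI) (use right_module_axioms ract_closed in auto)
qed

lemma rmod_hom_inj_iff:
  assumes "right_module A M" "right_module A N" "f \<in> rmod_hom A M N"
  shows "inj_on f (carrier M) \<longleftrightarrow> (\<forall>x\<in>carrier M. f x = \<zero>\<^bsub>N\<^esub> \<longrightarrow> x = \<zero>\<^bsub>M\<^esub>)"
proof -
  interpret M: right_module A M by fact
  interpret N: right_module A N by fact
  note f = rmod_homD [OF assms(3)]
  show ?thesis
  proof
    assume "inj_on f (carrier M)"
    then show "\<forall>x\<in>carrier M. f x = \<zero>\<^bsub>N\<^esub> \<longrightarrow> x = \<zero>\<^bsub>M\<^esub>"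
      using rmod_hom_zero [OF assms] M.M.zero_closed by (metis inj_onD)
  next
    assume *: "\<forall>x\<in>carrier M. f x = \<zero>\<^bsub>N\<^esub> \<longrightarrow> x = \<zero>\<^bsub>M\<^esub>"
    show "inj_on f (carrier M)"
    proof (rule inj_onI)
      fix x y assume xy: "x \<in> carrier M" "y \<in> carrier M" "f x = f y"
      then have "f (x \<oplus>\<^bsub>M\<^esub> \<ominus>\<^bsub>M\<^esub> y) = \<zero>\<^bsub>N\<^esub>"
        using f rmod_hom_neg [OF assms] by (simp add: N.M.r_neg)
      then have "x \<oplus>\<^bsub>M\<^esub> \<ominus>\<^bsub>M\<^esub> y = \<zero>\<^bsub>M\<^esub>" using * xy by auto
      then show "x = y" using xy by (metis M.M.a_inv_closed M.M.minus_equality M.M.minus_minus)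
    qed
  qed
qed

section \<open>Isomorphisms, transport of structure and retracts\<close>

lemma rmod_iso_refl: "rmod_iso A M M"
  unfolding rmod_iso_def by (intro bexI [of _ "\<lambda>x. x"] rmod_hom_id) (simp add: bij_betw_def)

lemma rmod_iso_inverse:
  assumes "right_module A M" "rmod_iso A M N"
  obtains f g where "f \<in> rmod_hom A M N" "g \<in> rmod_hom A N M"
    "\<And>x. x \<in> carrier M \<Longrightarrow> g (f x) = x" "\<And>y. y \<in> carrier N \<Longrightarrow> f (g y) = y"
proof -
  interpret right_module A M by fact
  obtain f where f: "f \<in> rmod_hom A M N" and bij: "bij_betw f (carrier M) (carrier N)"
    using assms by (auto simp: rmod_iso_def)
  define g where "g = inv_into (carrier M) f"
  have g: "g y \<in> carrier M" "f (g y) = y" if "y \<in> carrier N" for y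
    using bij that by (auto simp: g_def bij_betw_def inv_into_into f_inv_into_f)
  have gf: "g (f x) = x" if "x \<in> carrier M" for x
    using bij that by (simp add: g_def bij_betw_def)
  note F = rmod_homD [OF f]
  have "g \<in> rmod_hom A N M"
  proof (rule rmod_homI)
    fix x y assume xy: "x \<in> carrier N" "y \<in> carrier N"
    then have "g (f (g x) \<oplus>\<^bsub>N\<^esub> f (g y)) = g (f (g x \<oplus>\<^bsub>M\<^esub> g y))"
      using g F by simp
    then show "g (x \<oplus>\<^bsub>N\<^esub> y) = g x \<oplus>\<^bsub>M\<^esub> g y" using g gf xy by simp
  next
    fix x a assume xa: "x \<in> carrier N" "a \<in> carrier A"
    then have "g (f (g x) \<star>\<^bsub>N\<^esub> a) = g (f (g x \<star>\<^bsub>M\<^esub> a))"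
      using g F by simp
    then show "g (x \<star>\<^bsub>N\<^esub> a) = g x \<star>\<^bsub>M\<^esub> a" using g gf xa ract_closed by simp
  qed (use g in auto)
  then show ?thesis using that f g gf by blast
qed

lemma rmod_isoI:
  assumes "f \<in> rmod_hom A M N" "g \<in> rmod_hom A N M"
    "\<And>x. x \<in> carrier M \<Longrightarrow> g (f x) = x" "\<And>y. y \<in> carrier N \<Longrightarrow> f (g y) = y"
  shows "rmod_iso A M N"
  unfolding rmod_iso_def
  using assms by (intro bexI [of _ f] bij_betw_byWitness [where f' = g]) (auto simp: rmod_hom_def)

lemma rmod_iso_sym:
  assumes "right_module A M" "rmod_iso A M N"
  shows "rmod_iso A N M"
  using rmod_iso_inverse [OF assms] rmod_isoI by metis

lemma rmod_iso_trans:
  "\<lbrakk>rmod_iso A M N; rmod_iso A N L\<rbrakk> \<Longrightarrow> rmod_iso A M L"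
  unfolding rmod_iso_def by (metis bij_betw_trans rmod_hom_comp)

text \<open>Transport of structure along a map that is injective on the carrier. It moves modules
  with arbitrary carriers into the type \<open>'a fgmod\<close>.\<close>

definition transport :: "('m \<Rightarrow> 'n) \<Rightarrow> ('a, 'm, 'y) rmodule_scheme \<Rightarrow> ('a, 'n) rmodule" where
  "transport j M = (let i = inv_into (carrier M) j in
     \<lparr>carrier = j ` carrier M, monoid.mult = undefined, one = undefined, ring.zero = j \<zero>\<^bsub>M\<^esub>,
      ring.add = (\<lambda>x y. j (i x \<oplus>\<^bsub>M\<^esub> i y)), ract = (\<lambda>x a. j (i x \<star>\<^bsub>M\<^esub> a))\<rparr>)"

lemma transport:
  assumes "right_module A M" "inj_on j (carrier M)"
  shows "right_module A (transport j M)" "j \<in> rmod_hom A M (transport j M)"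
    "bij_betw j (carrier M) (carrier (transport j M))" "rmod_iso A M (transport j M)"
proof -
  interpret right_module A M by fact
  have i: "inv_into (carrier M) j (j x) = x" if "x \<in> carrier M" for x
    using that assms(2) by simp
  have s: "carrier (transport j M) = j ` carrier M" "\<zero>\<^bsub>transport j M\<^esub> = j \<zero>\<^bsub>M\<^esub>"
    by (simp_all add: transport_def Let_def)
  have p: "j x \<oplus>\<^bsub>transport j M\<^esub> j y = j (x \<oplus>\<^bsub>M\<^esub> y)" if "x \<in> carrier M" "y \<in> carrier M" for x y
    using that i by (simp add: transport_def Let_def)
  have r: "j x \<star>\<^bsub>transport j M\<^esub> a = j (x \<star>\<^bsub>M\<^esub> a)" if "x \<in> carrier M" for x a
    using that i by (simp add: transport_def Let_def)
  show "right_module A (transport j M)"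
  proof (rule right_moduleI)
    show "ring A" ..
    show "abelian_group (transport j M)"
    proof (rule abelian_groupI)
      fix x assume x: "x \<in> carrier (transport j M)"
      then obtain y where "x = j y" "y \<in> carrier M" using s by auto
      then show "\<exists>y\<in>carrier (transport j M). y \<oplus>\<^bsub>transport j M\<^esub> x = \<zero>\<^bsub>transport j M\<^esub>"
        using s p by (intro bexI [of _ "j (\<ominus>\<^bsub>M\<^esub> y)"]) (auto simp: M.l_neg)
    qed (auto simp: s p M.a_ac)
  qed (auto simp: s p r ract_closed ract_add_left ract_add_right ract_assoc ract_one)
  show j: "j \<in> rmod_hom A M (transport j M)"
    by (rule rmod_homI) (auto simp: s p r)
  show b: "bij_betw j (carrier M) (carrier (transport j M))"
    using assms(2) by (simp add: s bij_betw_def)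
  show "rmod_iso A M (transport j M)" using j b by (auto simp: rmod_iso_def)
qed

lemma fin_gen_image:
  assumes "right_module A M" "right_module A N" "fin_gen A M" "f \<in> rmod_hom A M N"
    "f ` carrier M = carrier N"
  shows "fin_gen A N"
proof -
  interpret right_module A M by fact
  obtain S where S: "finite S" "S \<subseteq> carrier M" "\<And>U. \<lbrakk>submod A U M; S \<subseteq> U\<rbrakk> \<Longrightarrow> U = carrier M"
    using assms(3) unfolding fin_gen_def by blast
  note f = rmod_homD [OF assms(4)]
  show ?thesis unfolding fin_gen_def
  proof (intro exI conjI allI impI)
    show "finite (f ` S)" "f ` S \<subseteq> carrier N" using S f by auto
    fix U assume U: "submod A U N \<and> f ` S \<subseteq> U"
    then have U': "submod A U N" by simp
    have "submod A {x \<in> carrier M. f x \<in> U} M"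
      using submodD [OF U'] f rmod_hom_zero [OF assms(1,2,4)] assms(1)
      by (intro submodI) (auto simp: ract_closed)
    then have "{x \<in> carrier M. f x \<in> U} = carrier M" using S U by blast
    then have "f x \<in> U" if "x \<in> carrier M" for x using that by auto
    then have "carrier N \<subseteq> U" unfolding assms(5) [symmetric] by (rule image_subsetI)
    then show "U = carrier N" using submodD(1) [OF U'] by blast
  qed
qed

lemma fin_gen_iso:
  assumes "right_module A M" "right_module A N" "fin_gen A M" "rmod_iso A M N"
  shows "fin_gen A N"
proof -
  obtain f where "f \<in> rmod_hom A M N" "f ` carrier M = carrier N"
    using assms(4) by (auto simp: rmod_iso_def bij_betw_def)
  then show ?thesis using fin_gen_image assms(1-3) by metis
qed

text \<open>For finitely generated modules retracts and direct summands are the same, but being a retract is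
  visibly transitive.\<close>

definition rmod_retract :: "('a, 'x) ring_scheme \<Rightarrow> ('a, 'n, 'y) rmodule_scheme \<Rightarrow> ('a, 'm, 'z) rmodule_scheme \<Rightarrow> bool"
  where "rmod_retract A N M \<longleftrightarrow> (\<exists>i\<in>rmod_hom A N M. \<exists>p\<in>rmod_hom A M N. \<forall>x\<in>carrier N. p (i x) = x)"

lemma rmod_retract_refl: "rmod_retract A M M"
  unfolding rmod_retract_def
  by (intro bexI [of _ "\<lambda>x. x"] ballI refl rmod_hom_id)

lemma rmod_retract_trans:
  assumes "rmod_retract A L N" "rmod_retract A N M"
  shows "rmod_retract A L M"
proof -
  obtain i p where ip: "i \<in> rmod_hom A L N" "p \<in> rmod_hom A N L" "\<And>x. x \<in> carrier L \<Longrightarrow> p (i x) = x"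
    using assms by (auto simp: rmod_retract_def)
  obtain j q where jq: "j \<in> rmod_hom A N M" "q \<in> rmod_hom A M N" "\<And>x. x \<in> carrier N \<Longrightarrow> q (j x) = x"
    using assms by (auto simp: rmod_retract_def)
  show ?thesis unfolding rmod_retract_def
    using rmod_hom_comp [OF ip(1) jq(1)] rmod_hom_comp [OF jq(2) ip(2)] ip jq
    by (intro bexI [of _ "j \<circ> i"] bexI [of _ "p \<circ> q"]) (auto simp: rmod_homD(1) [OF ip(1)])
qed

lemma rmod_retract_iso:
  assumes "right_module A M" "rmod_iso A M N"
  shows "rmod_retract A M N" "rmod_retract A N M"
  using rmod_iso_inverse [OF assms] unfolding rmod_retract_def by metis+

lemma rmod_retract_dsum2:
  assumes "right_module A M" "right_module A N"
  shows "rmod_retract A M (dsum2 M N)" "rmod_retract A N (dsum2 M N)"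
proof -
  interpret M: right_module A M by fact
  interpret N: right_module A N by fact
  show "rmod_retract A M (dsum2 M N)" unfolding rmod_retract_def
    by (intro bexI [of _ "\<lambda>x. (x, \<zero>\<^bsub>N\<^esub>)"] bexI [of _ fst] rmod_homI) (auto simp: N.ract_zero_left)
  show "rmod_retract A N (dsum2 M N)" unfolding rmod_retract_def
    by (intro bexI [of _ "\<lambda>x. (\<zero>\<^bsub>M\<^esub>, x)"] bexI [of _ snd] rmod_homI) (auto simp: M.ract_zero_left)
qed

lemma internal_direct_sum:
  assumes "right_module A M" "submod A U M" "submod A W M" "U \<inter> W = {\<zero>\<^bsub>M\<^esub>}"
    "\<And>x. x \<in> carrier M \<Longrightarrow> \<exists>u\<in>U. \<exists>w\<in>W. x = u \<oplus>\<^bsub>M\<^esub> w"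
  shows "rmod_iso A (dsum2 (M\<lparr>carrier := U\<rparr>) (M\<lparr>carrier := W\<rparr>)) M"
proof -
  interpret right_module A M by fact
  note U = submodD [OF assms(2)] and W = submodD [OF assms(3)]
  let ?D = "dsum2 (M\<lparr>carrier := U\<rparr>) (M\<lparr>carrier := W\<rparr>)"
  let ?f = "\<lambda>(x, y). x \<oplus>\<^bsub>M\<^esub> y"
  have c: "x \<in> U \<Longrightarrow> x \<in> carrier M" "x \<in> W \<Longrightarrow> x \<in> carrier M" for x using U W by auto
  have rD: "right_module A ?D"
    using right_module_dsum2 right_module_submod assms by blast
  have f: "?f \<in> rmod_hom A ?D M"
    by (rule rmod_homI) (auto simp: c M.a_ac ract_add_left)
  have "inj_on ?f (carrier ?D)"
    unfolding rmod_hom_inj_iff [OF rD assms(1) f]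
  proof clarsimp
    fix x y assume xy: "x \<in> U" "y \<in> W" "x \<oplus>\<^bsub>M\<^esub> y = \<zero>\<^bsub>M\<^esub>"
    then have "x = \<ominus>\<^bsub>M\<^esub> y" using c by (simp add: M.minus_equality)
    then have "x \<in> W" using submod_neg [OF assms(1,3)] xy by simp
    then have "x = \<zero>\<^bsub>M\<^esub>" using xy assms(4) by auto
    then show "x = \<zero>\<^bsub>M\<^esub> \<and> y = \<zero>\<^bsub>M\<^esub>" using xy c by simp
  qed
  moreover have "?f ` carrier ?D = carrier M"
    using assms(5) c by (force simp: image_iff)
  ultimately show ?thesis using f by (auto simp: rmod_iso_def bij_betw_def)
qed

text \<open>The idempotent \<open>i \<circ> p\<close> splits \<open>M\<close> into the image of
  \<open>i\<close> and the kernel of \<open>p\<close>.\<close>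

lemma rmod_retract_complement:
  assumes "right_module A M" "right_module A N" "i \<in> rmod_hom A N M" "p \<in> rmod_hom A M N"
    "\<And>x. x \<in> carrier N \<Longrightarrow> p (i x) = x"
  shows "rmod_iso A M (dsum2 N (M\<lparr>carrier := {x \<in> carrier M. p x = \<zero>\<^bsub>N\<^esub>}\<rparr>))"
proof -
  interpret M: right_module A M by fact
  interpret N: right_module A N by fact
  note I = rmod_homD [OF assms(3)] and P = rmod_homD [OF assms(4)]
  let ?K = "{x \<in> carrier M. p x = \<zero>\<^bsub>N\<^esub>}"
  let ?L = "M\<lparr>carrier := ?K\<rparr>"
  note K = submodD [OF submod_kernel [OF assms(1,2,4)]]
  have rL: "right_module A ?L" using right_module_submod submod_kernel assms by blast
  let ?f = "\<lambda>(x, y). i x \<oplus>\<^bsub>M\<^esub> y"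
  have rD: "right_module A (dsum2 N ?L)" using right_module_dsum2 assms(2) rL by blast
  have f: "?f \<in> rmod_hom A (dsum2 N ?L) M"
    by (rule rmod_homI) (auto simp: I M.M.a_ac M.ract_add_left M.ract_closed)
  have pf: "p (i x \<oplus>\<^bsub>M\<^esub> y) = x" if "x \<in> carrier N" "y \<in> ?K" for x y
    using that P I assms(5) by simp
  have "inj_on ?f (carrier (dsum2 N ?L))"
    unfolding rmod_hom_inj_iff [OF rD assms(1) f]
  proof clarsimp
    fix x y assume xy: "x \<in> carrier N" "y \<in> carrier M" "p y = \<zero>\<^bsub>N\<^esub>" "i x \<oplus>\<^bsub>M\<^esub> y = \<zero>\<^bsub>M\<^esub>"
    have "x = \<zero>\<^bsub>N\<^esub>" using pf [of x y] xy rmod_hom_zero [OF assms(1,2,4)] by simp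
    then show "x = \<zero>\<^bsub>N\<^esub> \<and> y = \<zero>\<^bsub>M\<^esub>" using xy rmod_hom_zero [OF assms(2,1,3)] by simp
  qed
  moreover have "?f ` carrier (dsum2 N ?L) = carrier M"
  proof (intro equalityI subsetI)
    fix m assume m: "m \<in> carrier M"
    \<comment> \<open>The component of \<open>m\<close> in the kernel of \<open>p\<close>.\<close>
    let ?y = "m \<oplus>\<^bsub>M\<^esub> \<ominus>\<^bsub>M\<^esub> i (p m)"
    have "p ?y = \<zero>\<^bsub>N\<^esub>" using m P I rmod_hom_neg [OF assms(1,2,4)] assms(5) by (simp add: N.M.r_neg)
    then have "?y \<in> ?K" using m P I by simp
    moreover have "m = i (p m) \<oplus>\<^bsub>M\<^esub> ?y" using m P I by (simp add: M.M.a_ac M.M.r_neg1 M.M.r_neg2 M.M.r_neg)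
    ultimately show "m \<in> ?f ` carrier (dsum2 N ?L)"
      using m P by (intro image_eqI [of _ _ "(p m, ?y)"]) auto
  qed (use I in auto)
  ultimately have "rmod_iso A (dsum2 N ?L) M" using f by (auto simp: rmod_iso_def bij_betw_def)
  then show ?thesis using rmod_iso_sym rD by blast
qed

section \<open>Projective modules: lifts, retracts and sums\<close>

lemma projective_lift:
  assumes "projective_rmod A P" "L \<in> fgmods A" "N \<in> fgmods A" "g \<in> rmod_hom A L N"
    "f \<in> rmod_hom A P N" "g ` carrier L = carrier N"
  obtains h where "h \<in> rmod_hom A P L" "\<And>x. x \<in> carrier P \<Longrightarrow> g (h x) = f x"
proof -
  have "\<exists>h\<in>rmod_hom A P L. \<forall>x\<in>carrier P. g (h x) = f x"
    using assms(1) [unfolded projective_rmod_def, rule_format, OF assms(2-6)] .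
  then show ?thesis using that by auto
qed

lemma projective_retract:
  assumes "projective_rmod A P" "right_module A P" "right_module A N" "rmod_retract A N P"
  shows "projective_rmod A N"
  unfolding projective_rmod_def
proof (intro ballI impI)
  fix L K g f
  assume *: "L \<in> fgmods A" "K \<in> fgmods A" "g \<in> rmod_hom A L K" "f \<in> rmod_hom A N K" "g ` carrier L = carrier K"
  obtain i p where ip: "i \<in> rmod_hom A N P" "p \<in> rmod_hom A P N" "\<And>x. x \<in> carrier N \<Longrightarrow> p (i x) = x"
    using assms by (auto simp: rmod_retract_def)
  have "f \<circ> p \<in> rmod_hom A P K" using rmod_hom_comp ip * by blast
  then obtain h where h: "h \<in> rmod_hom A P L" "\<And>x. x \<in> carrier P \<Longrightarrow> g (h x) = (f \<circ> p) x"
    using projective_lift [OF assms(1) *(1-3) _ *(5)] by metis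
  show "\<exists>h\<in>rmod_hom A N L. \<forall>x\<in>carrier N. g (h x) = f x"
    using rmod_hom_comp [OF ip(1) h(1)] h ip rmod_homD(1) [OF ip(1)]
    by (intro bexI [of _ "h \<circ> i"]) auto
qed

lemma projective_dsum2:
  assumes "projective_rmod A P" "right_module A P" "projective_rmod A P'" "right_module A P'"
  shows "projective_rmod A (dsum2 P P')"
  unfolding projective_rmod_def
proof (intro ballI impI)
  interpret P: right_module A P by fact
  interpret P': right_module A P' by fact
  fix L K g f
  assume *: "L \<in> fgmods A" "K \<in> fgmods A" "g \<in> rmod_hom A L K" "f \<in> rmod_hom A (dsum2 P P') K" "g ` carrier L = carrier K"
  interpret L: right_module A L using * by (simp add: fgmods_def)
  interpret K: right_module A K using * by (simp add: fgmods_def)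
  note F = rmod_homD [OF *(4)]
  have "(\<lambda>x. f (x, \<zero>\<^bsub>P'\<^esub>)) \<in> rmod_hom A P K"
    using F(2) [of "(_, \<zero>\<^bsub>P'\<^esub>)" "(_, \<zero>\<^bsub>P'\<^esub>)"] F(3) [of "(_, \<zero>\<^bsub>P'\<^esub>)"]
    by (intro rmod_homI) (auto simp: F(1) P'.ract_zero_left)
  then obtain h where h: "h \<in> rmod_hom A P L" "\<And>x. x \<in> carrier P \<Longrightarrow> g (h x) = f (x, \<zero>\<^bsub>P'\<^esub>)"
    using projective_lift [OF assms(1) *(1-3) _ *(5)] by metis
  have "(\<lambda>x. f (\<zero>\<^bsub>P\<^esub>, x)) \<in> rmod_hom A P' K"
    using F(2) [of "(\<zero>\<^bsub>P\<^esub>, _)" "(\<zero>\<^bsub>P\<^esub>, _)"] F(3) [of "(\<zero>\<^bsub>P\<^esub>, _)"]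
    by (intro rmod_homI) (auto simp: F(1) P.ract_zero_left)
  then obtain h' where h': "h' \<in> rmod_hom A P' L" "\<And>x. x \<in> carrier P' \<Longrightarrow> g (h' x) = f (\<zero>\<^bsub>P\<^esub>, x)"
    using projective_lift [OF assms(3) *(1-3) _ *(5)] by metis
  note H = rmod_homD [OF h(1)] and H' = rmod_homD [OF h'(1)]
  show "\<exists>h\<in>rmod_hom A (dsum2 P P') L. \<forall>x\<in>carrier (dsum2 P P'). g (h x) = f x"
  proof (intro bexI [of _ "\<lambda>(x, y). h x \<oplus>\<^bsub>L\<^esub> h' y"] ballI)
    show "(\<lambda>(x, y). h x \<oplus>\<^bsub>L\<^esub> h' y) \<in> rmod_hom A (dsum2 P P') L"
      by (rule rmod_homI) (auto simp: H H' L.M.a_ac L.ract_add_left L.ract_closed)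
    fix z assume "z \<in> carrier (dsum2 P P')"
    then obtain x y where z: "z = (x, y)" "x \<in> carrier P" "y \<in> carrier P'" by auto
    have "g (h x \<oplus>\<^bsub>L\<^esub> h' y) = f ((x, \<zero>\<^bsub>P'\<^esub>) \<oplus>\<^bsub>dsum2 P P'\<^esub> (\<zero>\<^bsub>P\<^esub>, y))"
      using z H H' h h' rmod_homD(2) [OF *(3)] by (subst F(2)) auto
    then show "g (case z of (x, y) \<Rightarrow> h x \<oplus>\<^bsub>L\<^esub> h' y) = f z" using z by simp
  qed
qed

section \<open>Radical square zero algebras in coordinates\<close>

text \<open>The algebra enters only through its coordinates: \<open>cv x v\<close> and \<open>ca x a\<close> are the coefficients of \<open>x\<close>
  at the trivial path at \<open>v\<close> and at the arrow \<open>a\<close>.\<close>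

locale radsq = A: ring A + Q: fin_digraph Q
  for A :: "'a ring" and Q :: "('v, 'e) pre_digraph" +
  fixes cv :: "'a \<Rightarrow> 'v \<Rightarrow> 'k::field" and ca :: "'a \<Rightarrow> 'e \<Rightarrow> 'k"
  assumes verts_nonempty: "verts Q \<noteq> {}"
    and cv_add: "\<lbrakk>x \<in> carrier A; y \<in> carrier A; v \<in> verts Q\<rbrakk> \<Longrightarrow> cv (x \<oplus>\<^bsub>A\<^esub> y) v = cv x v + cv y v"
    and ca_add: "\<lbrakk>x \<in> carrier A; y \<in> carrier A; a \<in> arcs Q\<rbrakk> \<Longrightarrow> ca (x \<oplus>\<^bsub>A\<^esub> y) a = ca x a + ca y a"
    and cv_mult: "\<lbrakk>x \<in> carrier A; y \<in> carrier A; v \<in> verts Q\<rbrakk> \<Longrightarrow> cv (x \<otimes>\<^bsub>A\<^esub> y) v = cv x v * cv y v"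
    and ca_mult: "\<lbrakk>x \<in> carrier A; y \<in> carrier A; a \<in> arcs Q\<rbrakk> \<Longrightarrow>
      ca (x \<otimes>\<^bsub>A\<^esub> y) a = cv x (tail Q a) * ca y a + ca x a * cv y (head Q a)"
    and cv_one: "v \<in> verts Q \<Longrightarrow> cv \<one>\<^bsub>A\<^esub> v = 1"
    and ca_one: "a \<in> arcs Q \<Longrightarrow> ca \<one>\<^bsub>A\<^esub> a = 0"
    and coord_eqI: "\<lbrakk>x \<in> carrier A; y \<in> carrier A; \<And>v. v \<in> verts Q \<Longrightarrow> cv x v = cv y v;
      \<And>a. a \<in> arcs Q \<Longrightarrow> ca x a = ca y a\<rbrakk> \<Longrightarrow> x = y"
    and coord_ex: "\<exists>x\<in>carrier A. (\<forall>v\<in>verts Q. cv x v = c v) \<and> (\<forall>a\<in>arcs Q. ca x a = d a)"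
begin

definition el :: "('v \<Rightarrow> 'k) \<Rightarrow> ('e \<Rightarrow> 'k) \<Rightarrow> 'a" where
  "el c d = (SOME x. x \<in> carrier A \<and> (\<forall>v\<in>verts Q. cv x v = c v) \<and> (\<forall>a\<in>arcs Q. ca x a = d a))"

lemma el [simp]: "el c d \<in> carrier A" "v \<in> verts Q \<Longrightarrow> cv (el c d) v = c v"
  "a \<in> arcs Q \<Longrightarrow> ca (el c d) a = d a"
proof -
  have "\<exists>x. x \<in> carrier A \<and> (\<forall>v\<in>verts Q. cv x v = c v) \<and> (\<forall>a\<in>arcs Q. ca x a = d a)"
    using coord_ex [of c d] by blast
  from someI_ex [OF this, folded el_def]
  show "el c d \<in> carrier A" "v \<in> verts Q \<Longrightarrow> cv (el c d) v = c v"
    "a \<in> arcs Q \<Longrightarrow> ca (el c d) a = d a" by auto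
qed

lemma cv_zero: "v \<in> verts Q \<Longrightarrow> cv \<zero>\<^bsub>A\<^esub> v = 0"
  using cv_add [of "\<zero>\<^bsub>A\<^esub>" "\<zero>\<^bsub>A\<^esub>" v] by (metis A.l_zero A.zero_closed add_cancel_right_left)

lemma ca_zero: "a \<in> arcs Q \<Longrightarrow> ca \<zero>\<^bsub>A\<^esub> a = 0"
  using ca_add [of "\<zero>\<^bsub>A\<^esub>" "\<zero>\<^bsub>A\<^esub>" a] by (metis A.l_zero A.zero_closed add_cancel_right_left)

lemmas coords = cv_add ca_add cv_mult ca_mult cv_one ca_one cv_zero ca_zero

text \<open>Scalar multiples of the identity, trivial paths and arrows. Modules carry only an action
  of the ring, so their vector space structure has to be recovered by acting with
  \<open>sc k\<close>.\<close>

definition sc :: "'k \<Rightarrow> 'a" where "sc k = el (\<lambda>_. k) (\<lambda>_. 0)"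
definition ev :: "'v \<Rightarrow> 'a" where "ev v = el (\<lambda>u. if u = v then 1 else 0) (\<lambda>_. 0)"
definition ar :: "'e \<Rightarrow> 'a" where "ar a = el (\<lambda>_. 0) (\<lambda>b. if b = a then 1 else 0)"

lemma basis_closed [simp]: "sc k \<in> carrier A" "ev v \<in> carrier A" "ar a \<in> carrier A"
  by (simp_all add: sc_def ev_def ar_def)

lemma basis_coords [simp]:
  "v \<in> verts Q \<Longrightarrow> cv (sc k) v = k" "a \<in> arcs Q \<Longrightarrow> ca (sc k) a = 0"
  "v \<in> verts Q \<Longrightarrow> cv (ev u) v = (if v = u then 1 else 0)" "a \<in> arcs Q \<Longrightarrow> ca (ev u) a = 0"
  "v \<in> verts Q \<Longrightarrow> cv (ar b) v = 0" "a \<in> arcs Q \<Longrightarrow> ca (ar b) a = (if a = b then 1 else 0)"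
  by (simp_all add: sc_def ev_def ar_def)

lemma sc_plus: "sc (k + l) = sc k \<oplus>\<^bsub>A\<^esub> sc l"
  by (rule coord_eqI) (auto simp: coords)

lemma sc_times: "sc (k * l) = sc k \<otimes>\<^bsub>A\<^esub> sc l"
  by (rule coord_eqI) (auto simp: coords)

lemma sc_one: "sc 1 = \<one>\<^bsub>A\<^esub>"
  by (rule coord_eqI) (auto simp: coords)

lemma sc_zero: "sc 0 = \<zero>\<^bsub>A\<^esub>"
  by (rule coord_eqI) (auto simp: coords)

lemma sc_commute: "x \<in> carrier A \<Longrightarrow> sc k \<otimes>\<^bsub>A\<^esub> x = x \<otimes>\<^bsub>A\<^esub> sc k"
  by (rule coord_eqI) (auto simp: coords)

lemma ev_ev: "ev u \<otimes>\<^bsub>A\<^esub> ev v = (if u = v then ev u else \<zero>\<^bsub>A\<^esub>)"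
  by (rule coord_eqI) (auto simp: coords)

lemma ev_ar: "b \<in> arcs Q \<Longrightarrow> ev u \<otimes>\<^bsub>A\<^esub> ar b = (if u = tail Q b then ar b else \<zero>\<^bsub>A\<^esub>)"
  by (rule coord_eqI) (auto simp: coords)

lemma ar_ev: "b \<in> arcs Q \<Longrightarrow> ar b \<otimes>\<^bsub>A\<^esub> ev u = (if u = head Q b then ar b else \<zero>\<^bsub>A\<^esub>)"
  by (rule coord_eqI) (auto simp: coords)

lemma ar_ar: "ar a \<otimes>\<^bsub>A\<^esub> ar b = \<zero>\<^bsub>A\<^esub>"
  by (rule coord_eqI) (auto simp: coords)

lemma sc_inj: "sc k = sc l \<Longrightarrow> k = l"
proof -
  obtain v where "v \<in> verts Q" using verts_nonempty by auto
  then show "sc k = sc l \<Longrightarrow> k = l" using basis_coords(1) by metis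
qed

text \<open>Trivial paths and arrows form a basis of the algebra. Building the scalar into the cases
  \<open>vert\<close> and \<open>arc\<close> leaves closure under addition as the only other
  obligation.\<close>

lemma alg_induct [consumes 1, case_names zero add vert arc]:
  assumes "x \<in> carrier A" and zero: "P \<zero>\<^bsub>A\<^esub>"
    and add: "\<And>x y. \<lbrakk>x \<in> carrier A; y \<in> carrier A; P x; P y\<rbrakk> \<Longrightarrow> P (x \<oplus>\<^bsub>A\<^esub> y)"
    and vert: "\<And>k v. v \<in> verts Q \<Longrightarrow> P (sc k \<otimes>\<^bsub>A\<^esub> ev v)"
    and arc: "\<And>k a. a \<in> arcs Q \<Longrightarrow> P (sc k \<otimes>\<^bsub>A\<^esub> ar a)"
  shows "P x"
proof -
  have 1: "P (el (\<lambda>v. if v \<in> F then c v else 0) (\<lambda>_. 0))" if "finite F" "F \<subseteq> verts Q" for F c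
    using that
  proof (induction F)
    case empty
    have "el (\<lambda>v. 0) (\<lambda>_. 0) = \<zero>\<^bsub>A\<^esub>" by (rule coord_eqI) (auto simp: coords)
    then show ?case using zero by simp
  next
    case (insert v F)
    have "el (\<lambda>u. if u \<in> insert v F then c u else 0) (\<lambda>_. 0)
       = el (\<lambda>u. if u \<in> F then c u else 0) (\<lambda>_. 0) \<oplus>\<^bsub>A\<^esub> sc (c v) \<otimes>\<^bsub>A\<^esub> ev v"
      by (rule coord_eqI) (use insert in \<open>auto simp: coords\<close>)
    then show ?case using insert add vert by auto
  qed
  have 2: "P (el c (\<lambda>a. if a \<in> F then d a else 0))" if "finite F" "F \<subseteq> arcs Q" for F c d
    using that
  proof (induction F)
    case empty
    have "el (\<lambda>v. if v \<in> verts Q then c v else 0) (\<lambda>_. 0) = el c (\<lambda>_. 0)"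
      by (rule coord_eqI) (auto simp: coords)
    then show ?case using 1 [of "verts Q" c] by simp
  next
    case (insert a F)
    have "el c (\<lambda>b. if b \<in> insert a F then d b else 0)
       = el c (\<lambda>b. if b \<in> F then d b else 0) \<oplus>\<^bsub>A\<^esub> sc (d a) \<otimes>\<^bsub>A\<^esub> ar a"
      by (rule coord_eqI) (use insert in \<open>auto simp: coords\<close>)
    then show ?case using insert add arc by auto
  qed
  have "x = el (cv x) (\<lambda>a. if a \<in> arcs Q then ca x a else 0)"
    by (rule coord_eqI) (use assms in auto)
  then show ?thesis using 2 [of "arcs Q" "cv x" "ca x"] by simp
qed

lemma basis_act:
  assumes "right_module A M" "x \<in> carrier M"
  shows "(x \<star>\<^bsub>M\<^esub> ev u) \<star>\<^bsub>M\<^esub> ev v = (if u = v then x \<star>\<^bsub>M\<^esub> ev u else \<zero>\<^bsub>M\<^esub>)"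
    "b \<in> arcs Q \<Longrightarrow> (x \<star>\<^bsub>M\<^esub> ev u) \<star>\<^bsub>M\<^esub> ar b = (if u = tail Q b then x \<star>\<^bsub>M\<^esub> ar b else \<zero>\<^bsub>M\<^esub>)"
    "b \<in> arcs Q \<Longrightarrow> (x \<star>\<^bsub>M\<^esub> ar b) \<star>\<^bsub>M\<^esub> ev u = (if u = head Q b then x \<star>\<^bsub>M\<^esub> ar b else \<zero>\<^bsub>M\<^esub>)"
    "(x \<star>\<^bsub>M\<^esub> ar a) \<star>\<^bsub>M\<^esub> ar b = \<zero>\<^bsub>M\<^esub>"
    "y \<in> carrier A \<Longrightarrow> (x \<star>\<^bsub>M\<^esub> sc k) \<star>\<^bsub>M\<^esub> y = (x \<star>\<^bsub>M\<^esub> y) \<star>\<^bsub>M\<^esub> sc k"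
proof -
  interpret M: right_module A M by fact
  note a = M.ract_assoc [symmetric] and z = M.ract_zero_right
  show "(x \<star>\<^bsub>M\<^esub> ev u) \<star>\<^bsub>M\<^esub> ev v = (if u = v then x \<star>\<^bsub>M\<^esub> ev u else \<zero>\<^bsub>M\<^esub>)"
    "b \<in> arcs Q \<Longrightarrow> (x \<star>\<^bsub>M\<^esub> ev u) \<star>\<^bsub>M\<^esub> ar b = (if u = tail Q b then x \<star>\<^bsub>M\<^esub> ar b else \<zero>\<^bsub>M\<^esub>)"
    "b \<in> arcs Q \<Longrightarrow> (x \<star>\<^bsub>M\<^esub> ar b) \<star>\<^bsub>M\<^esub> ev u = (if u = head Q b then x \<star>\<^bsub>M\<^esub> ar b else \<zero>\<^bsub>M\<^esub>)"
    "(x \<star>\<^bsub>M\<^esub> ar a) \<star>\<^bsub>M\<^esub> ar b = \<zero>\<^bsub>M\<^esub>"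
    using assms(2) by (simp_all add: a ev_ev ev_ar ar_ev ar_ar z)
  show "y \<in> carrier A \<Longrightarrow> (x \<star>\<^bsub>M\<^esub> sc k) \<star>\<^bsub>M\<^esub> y = (x \<star>\<^bsub>M\<^esub> y) \<star>\<^bsub>M\<^esub> sc k"
    using assms(2) by (simp add: a sc_commute)
qed

text \<open>The hypotheses concern the translates of one vector \<open>x\<close>, which need not
  itself lie in \<open>U\<close>. Taking the identity for \<open>y\<close> then yields
  \<open>x\<close> in \<open>U\<close>, and this is how several later proofs show
  membership.\<close>

lemma closed_under_basis:
  assumes M: "right_module A M" and U: "U \<subseteq> carrier M" "\<zero>\<^bsub>M\<^esub> \<in> U"
    "\<And>x y. \<lbrakk>x \<in> U; y \<in> U\<rbrakk> \<Longrightarrow> x \<oplus>\<^bsub>M\<^esub> y \<in> U"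
    "\<And>x k. x \<in> U \<Longrightarrow> x \<star>\<^bsub>M\<^esub> sc k \<in> U"
    "x \<in> carrier M" "\<And>v. v \<in> verts Q \<Longrightarrow> x \<star>\<^bsub>M\<^esub> ev v \<in> U"
    "\<And>a. a \<in> arcs Q \<Longrightarrow> x \<star>\<^bsub>M\<^esub> ar a \<in> U" "y \<in> carrier A"
  shows "x \<star>\<^bsub>M\<^esub> y \<in> U"
  using \<open>y \<in> carrier A\<close>
proof (induction rule: alg_induct)
  interpret M: right_module A M by fact
  case zero then show ?case using U M.ract_zero_right by simp
next
  interpret M: right_module A M by fact
  case (add y z) then show ?case using U M.ract_add_right by simp
next
  interpret M: right_module A M by fact
  case (vert k v)
  then show ?case using U(4) [OF U(6)] U(5) by (simp add: sc_commute M.ract_assoc)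
next
  interpret M: right_module A M by fact
  case (arc k a)
  then show ?case using U(4) [OF U(7)] U(5) by (simp add: sc_commute M.ract_assoc)
qed

lemma submod_basisI:
  assumes M: "right_module A M" and U: "U \<subseteq> carrier M" "\<zero>\<^bsub>M\<^esub> \<in> U"
    "\<And>x y. \<lbrakk>x \<in> U; y \<in> U\<rbrakk> \<Longrightarrow> x \<oplus>\<^bsub>M\<^esub> y \<in> U"
    "\<And>x k. x \<in> U \<Longrightarrow> x \<star>\<^bsub>M\<^esub> sc k \<in> U"
    "\<And>x v. \<lbrakk>x \<in> U; v \<in> verts Q\<rbrakk> \<Longrightarrow> x \<star>\<^bsub>M\<^esub> ev v \<in> U"
    "\<And>x a. \<lbrakk>x \<in> U; a \<in> arcs Q\<rbrakk> \<Longrightarrow> x \<star>\<^bsub>M\<^esub> ar a \<in> U"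
  shows "submod A U M"
  using assms by (intro submodI) (auto intro: closed_under_basis)

lemma hom_basisI:
  assumes M: "right_module A M" and N: "right_module A N"
    and f: "\<And>x. x \<in> carrier M \<Longrightarrow> f x \<in> carrier N"
    "\<And>x y. \<lbrakk>x \<in> carrier M; y \<in> carrier M\<rbrakk> \<Longrightarrow> f (x \<oplus>\<^bsub>M\<^esub> y) = f x \<oplus>\<^bsub>N\<^esub> f y"
    "\<And>x k. x \<in> carrier M \<Longrightarrow> f (x \<star>\<^bsub>M\<^esub> sc k) = f x \<star>\<^bsub>N\<^esub> sc k"
    "\<And>x v. \<lbrakk>x \<in> carrier M; v \<in> verts Q\<rbrakk> \<Longrightarrow> f (x \<star>\<^bsub>M\<^esub> ev v) = f x \<star>\<^bsub>N\<^esub> ev v"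
    "\<And>x a. \<lbrakk>x \<in> carrier M; a \<in> arcs Q\<rbrakk> \<Longrightarrow> f (x \<star>\<^bsub>M\<^esub> ar a) = f x \<star>\<^bsub>N\<^esub> ar a"
  shows "f \<in> rmod_hom A M N"
proof (rule rmod_homI)
  interpret M: right_module A M by fact
  interpret N: right_module A N by fact
  fix x y assume x: "x \<in> carrier M" and "y \<in> carrier A"
  from this(2) show "f (x \<star>\<^bsub>M\<^esub> y) = f x \<star>\<^bsub>N\<^esub> y"
  proof (induction rule: alg_induct)
    case zero then show ?case using f(3) [OF x, of 0] by (simp add: sc_zero)
  next
    case (add y z) then show ?case using f x M.ract_closed by (simp add: M.ract_add_right N.ract_add_right)
  next
    case (vert k v)
    then show ?case using f x M.ract_closed by (simp add: M.ract_assoc N.ract_assoc)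
  next
    case (arc k v)
    then show ?case using f x M.ract_closed by (simp add: M.ract_assoc N.ract_assoc)
  qed
qed (erule f(1), erule (1) f(2))

section \<open>The underlying vector space of a module\<close>

definition KM :: "('a, 'm, 'y) rmodule_scheme \<Rightarrow> ('k, 'm) module" where
  "KM M = \<lparr>carrier = carrier M, monoid.mult = undefined, one = undefined, ring.zero = \<zero>\<^bsub>M\<^esub>,
     ring.add = ring.add M, smult = (\<lambda>k x. x \<star>\<^bsub>M\<^esub> sc k)\<rparr>"

lemma KM_simps [simp]:
  "carrier (KM M) = carrier M" "\<zero>\<^bsub>KM M\<^esub> = \<zero>\<^bsub>M\<^esub>" "ring.add (KM M) = ring.add M"
  "k \<odot>\<^bsub>KM M\<^esub> x = x \<star>\<^bsub>M\<^esub> sc k"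
  by (simp_all add: KM_def)

lemma KM_sub: "KM (M\<lparr>carrier := U\<rparr>) = KM M\<lparr>carrier := U\<rparr>"
  by (simp add: KM_def)

text \<open>\<open>kprod\<close> copies the record of \<open>dsum2\<close>, so this is an equality
  of structures and dimensions of direct sums need no transport.\<close>

lemma KM_dsum2: "KM (dsum2 M N) = kprod (KM M) (KM N)"
  by (simp add: KM_def kprod_def dsum2_def fun_eq_iff)

lemma kspace_KM: "right_module A M \<Longrightarrow> kspace (KM M)"
proof -
  assume "right_module A M"
  then interpret M: right_module A M .
  show ?thesis
  proof (rule kspaceI)
    show "abelian_group (KM M)"
    proof (rule abelian_groupI)
      fix x assume "x \<in> carrier (KM M)"
      then show "\<exists>y\<in>carrier (KM M). y \<oplus>\<^bsub>KM M\<^esub> x = \<zero>\<^bsub>KM M\<^esub>"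
        by (intro bexI [of _ "\<ominus>\<^bsub>M\<^esub> x"]) (auto simp: M.M.l_neg)
    qed (auto simp: M.M.a_ac)
    fix k l x y assume x: "x \<in> carrier (KM M)"
    have "x \<star>\<^bsub>M\<^esub> sc (l * k) = (x \<star>\<^bsub>M\<^esub> sc l) \<star>\<^bsub>M\<^esub> sc k"
      using x unfolding sc_times by (simp add: M.ract_assoc)
    then show "(k * l) \<odot>\<^bsub>KM M\<^esub> x = k \<odot>\<^bsub>KM M\<^esub> (l \<odot>\<^bsub>KM M\<^esub> x)" by (simp add: mult.commute)
    assume "y \<in> carrier (KM M)"
    with x show "k \<odot>\<^bsub>KM M\<^esub> (x \<oplus>\<^bsub>KM M\<^esub> y) = k \<odot>\<^bsub>KM M\<^esub> x \<oplus>\<^bsub>KM M\<^esub> k \<odot>\<^bsub>KM M\<^esub> y"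
      by (simp add: M.ract_add_left)
  qed (simp_all add: M.ract_closed sc_plus sc_one M.ract_add_right M.ract_one)
qed

lemma klin_hom: "\<lbrakk>f \<in> rmod_hom A M N; U \<subseteq> carrier M\<rbrakk> \<Longrightarrow> klin (KM M) (KM N) U f"
  by (auto simp: klin_def rmod_homD subset_iff)

lemma ksub_submod: "submod A U M \<Longrightarrow> ksub (KM M) U"
  using submodD [of A U M] by (auto simp: ksub_def)

text \<open>Polymorphic in the carrier type, so that models such as \<open>tm v F\<close> and direct
  sums are covered; membership in \<open>fgmods A\<close> makes sense only for carriers of
  lists.\<close>

definition fdmod :: "('a, 'm, 'y) rmodule_scheme \<Rightarrow> bool" where
  "fdmod M \<longleftrightarrow> right_module A M \<and> fkspace (KM M)"

lemma fdmodD: "fdmod M \<Longrightarrow> right_module A M" "fdmod M \<Longrightarrow> fkspace (KM M)" "fdmod M \<Longrightarrow> kspace (KM M)"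
  by (auto simp: fdmod_def kspace_KM)

text \<open>The algebra has finite dimension, so the translates of finitely many generators by the
  basis of the algebra span the module.\<close>

lemma fdmod_iff_fin_gen: "fdmod M \<longleftrightarrow> right_module A M \<and> fin_gen A M"
proof (cases "right_module A M")
  case True
  then interpret M: right_module A M .
  interpret kspace "KM M" using kspace_KM [OF True] .
  show ?thesis
  proof
    assume "fdmod M"
    then interpret fkspace "KM M" by (simp add: fdmod_def)
    obtain S where S: "finite S" "S \<subseteq> carrier (KM M)" "\<And>U. \<lbrakk>ksub (KM M) U; S \<subseteq> U\<rbrakk> \<Longrightarrow> U = carrier (KM M)"
      using finite_spanning by blast
    have "fin_gen A M" unfolding fin_gen_def
    proof (intro exI [of _ S] conjI allI impI)
      fix U assume "submod A U M \<and> S \<subseteq> U"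
      then show "U = carrier M" using S(3) [OF ksub_submod] by simp
    qed (use S in auto)
    then show "right_module A M \<and> fin_gen A M" using True by simp
  next
    assume "right_module A M \<and> fin_gen A M"
    then obtain S where S: "finite S" "S \<subseteq> carrier M" "\<forall>U. submod A U M \<and> S \<subseteq> U \<longrightarrow> U = carrier M"
      unfolding fin_gen_def by (elim conjE exE) rule
    let ?T = "(\<Union>v\<in>verts Q. (\<lambda>x. x \<star>\<^bsub>M\<^esub> ev v) ` S) \<union> (\<Union>a\<in>arcs Q. (\<lambda>x. x \<star>\<^bsub>M\<^esub> ar a) ` S)"
    have "fkspace (KM M)"
    proof (rule fkspaceI)
      show "finite ?T" using S by simp
      show "?T \<subseteq> carrier (KM M)" using S M.ract_closed by auto
      fix U assume U: "ksub (KM M) U" "?T \<subseteq> U"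
      have U': "U \<subseteq> carrier M" "\<zero>\<^bsub>M\<^esub> \<in> U" "\<And>x y. \<lbrakk>x \<in> U; y \<in> U\<rbrakk> \<Longrightarrow> x \<oplus>\<^bsub>M\<^esub> y \<in> U"
        "\<And>x k. x \<in> U \<Longrightarrow> x \<star>\<^bsub>M\<^esub> sc k \<in> U"
        using U(1) by (auto simp: ksub_def)
      \<comment> \<open>The largest submodule inside \<open>U\<close>. It contains the generators
        because \<open>U\<close> contains all their translates, hence it is everything.\<close>
      define W where "W = {y \<in> carrier M. (\<forall>v\<in>verts Q. y \<star>\<^bsub>M\<^esub> ev v \<in> U) \<and> (\<forall>a\<in>arcs Q. y \<star>\<^bsub>M\<^esub> ar a \<in> U)}"
      note act = basis_act [OF True]
      have "submod A W M"
      proof (rule submod_basisI [OF True])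
        show "W \<subseteq> carrier M" "\<zero>\<^bsub>M\<^esub> \<in> W" using U'(2) by (simp_all add: W_def M.ract_zero_left)
        show "x \<oplus>\<^bsub>M\<^esub> y \<in> W" if "x \<in> W" "y \<in> W" for x y
          using that U'(3) by (simp add: W_def M.ract_add_left)
        show "x \<star>\<^bsub>M\<^esub> sc k \<in> W" if "x \<in> W" for x k
          using that U'(4) by (simp add: W_def M.ract_closed act)
        show "x \<star>\<^bsub>M\<^esub> ev v \<in> W" if "x \<in> W" "v \<in> verts Q" for x v
          using that U'(2) by (simp add: W_def M.ract_closed act)
        show "x \<star>\<^bsub>M\<^esub> ar a \<in> W" if "x \<in> W" "a \<in> arcs Q" for x a
          using that U'(2) by (simp add: W_def M.ract_closed act)
      qed
      moreover have "S \<subseteq> W" using S(2) U(2) unfolding W_def by blast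
      ultimately have W: "W = carrier M" using S(3) by simp
      have "x \<in> U" if x: "x \<in> carrier M" for x
      proof -
        have "x \<in> W" using W x by simp
        then have "x \<star>\<^bsub>M\<^esub> \<one>\<^bsub>A\<^esub> \<in> U"
          using closed_under_basis [OF True U' x _ _ A.one_closed] by (simp add: W_def)
        then show ?thesis using M.ract_one x by simp
      qed
      then show "U = carrier (KM M)" using U' by auto
    qed
    then show "fdmod M" using True by (simp add: fdmod_def)
  qed
qed (auto simp: fdmod_def)

lemma fgmods_iff: "M \<in> fgmods A \<longleftrightarrow> fdmod M"
  by (simp add: fgmods_def fdmod_iff_fin_gen)

lemma fdmod_submod: "\<lbrakk>fdmod M; submod A U M\<rbrakk> \<Longrightarrow> fdmod (M\<lparr>carrier := U\<rparr>)"
  using right_module_submod fkspace.fkspace_sub [OF _ ksub_submod] by (auto simp: fdmod_def KM_sub)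

lemma fdmod_dsum2: "\<lbrakk>fdmod M; fdmod N\<rbrakk> \<Longrightarrow> fdmod (dsum2 M N)"
  using right_module_dsum2 fkspace_kprod by (auto simp: fdmod_def KM_dsum2)

lemma fdmod_iso: "\<lbrakk>fdmod M; right_module A N; rmod_iso A M N\<rbrakk> \<Longrightarrow> fdmod N"
  using fin_gen_iso by (auto simp: fdmod_iff_fin_gen)

text \<open>Coordinate lists over the field become lists over the algebra through the injection
  \<open>sc\<close>; the structure is then transported. Since \<open>projective_rmod\<close> and
  \<open>injective_rmod\<close> test only against \<open>fgmods A\<close>, such copies are needed
  whenever a model serves as a test object.\<close>

lemma fgmod_copy:
  assumes "fdmod M"
  obtains M' where "M' \<in> fgmods A" "rmod_iso A M M'"
proof -
  interpret fkspace "KM M" using fdmodD assms by auto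
  obtain j :: "'b \<Rightarrow> 'k list" where j: "inj_on j (carrier M)"
    using finite_coordinates by auto
  have "inj sc" by (rule injI) (rule sc_inj)
  then have "inj_on (map sc) (j ` carrier M)"
    by (rule inj_on_subset [OF inj_mapI subset_UNIV])
  then have "inj_on (map sc \<circ> j) (carrier M)" using j by (intro comp_inj_on)
  note t = transport [OF fdmodD(1) [OF assms] this]
  show ?thesis
    using that [of "transport (map sc \<circ> j) M"] t fdmod_iso [OF assms t(1,4)] by (simp add: fgmods_iff)
qed

section \<open>Radical layers and dimensions\<close>

abbreviation inn :: "'v \<Rightarrow> 'e set" where "inn w \<equiv> {a \<in> arcs Q. head Q a = w}"
abbreviation out :: "'v \<Rightarrow> 'e set" where "out w \<equiv> {a \<in> arcs Q. tail Q a = w}"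

text \<open>For a module \<open>M\<close>, \<open>pt M w\<close> is the subspace \<open>M e\<^sub>w\<close>, \<open>so M w\<close> is its intersection with the elements killed
  by all arrows, and \<open>rd M F\<close> is the sum of the subspaces \<open>M a\<close> for \<open>a \<in> F\<close>. Since \<open>J\<^sup>2 = 0\<close>,
  the part \<open>rd M (inn w)\<close> of the radical at \<open>w\<close> lies in \<open>so M w\<close>.\<close>

definition pt :: "('a, 'm, 'y) rmodule_scheme \<Rightarrow> 'v \<Rightarrow> 'm set" where
  "pt M w = {x \<in> carrier M. x \<star>\<^bsub>M\<^esub> ev w = x}"

definition so :: "('a, 'm, 'y) rmodule_scheme \<Rightarrow> 'v \<Rightarrow> 'm set" where
  "so M w = {x \<in> pt M w. \<forall>a\<in>arcs Q. x \<star>\<^bsub>M\<^esub> ar a = \<zero>\<^bsub>M\<^esub>}"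

inductive_set rd :: "('a, 'm, 'y) rmodule_scheme \<Rightarrow> 'e set \<Rightarrow> 'm set"
  for M :: "('a, 'm, 'y) rmodule_scheme" and F :: "'e set" where
  zero: "\<zero>\<^bsub>M\<^esub> \<in> rd M F"
| add: "\<lbrakk>y \<in> rd M F; x \<in> carrier M; a \<in> F\<rbrakk> \<Longrightarrow> y \<oplus>\<^bsub>M\<^esub> x \<star>\<^bsub>M\<^esub> ar a \<in> rd M F"

context
  fixes M :: "('a, 'm, 'y) rmodule_scheme"
  assumes M: "right_module A M"
begin

interpretation M: right_module A M by (rule M)

lemma ksub_pt: "ksub (KM M) (pt M w)"
  by (auto simp: ksub_def pt_def M.ract_zero_left M.ract_add_left M.ract_closed basis_act(5) [OF M])

lemma ksub_so: "ksub (KM M) (so M w)"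
  using ksub_pt [of w] M.ract_zero_left
  by (auto simp: ksub_def so_def M.ract_add_left basis_act(5) [OF M] pt_def)

lemma rd_carrier: "rd M F \<subseteq> carrier M"
proof
  fix x assume "x \<in> rd M F" then show "x \<in> carrier M" by induction (auto simp: M.ract_closed)
qed

lemma rd_plus: "\<lbrakk>x \<in> rd M F; y \<in> rd M F\<rbrakk> \<Longrightarrow> x \<oplus>\<^bsub>M\<^esub> y \<in> rd M F"
proof -
  assume x: "x \<in> rd M F"
  have xc: "x \<in> carrier M" using x rd_carrier by auto
  assume "y \<in> rd M F" then show ?thesis
  proof induction
    case zero then show ?case using x xc by simp
  next
    case (add y z a)
    then have "y \<in> carrier M" using rd_carrier by auto
    then have "x \<oplus>\<^bsub>M\<^esub> (y \<oplus>\<^bsub>M\<^esub> z \<star>\<^bsub>M\<^esub> ar a) = (x \<oplus>\<^bsub>M\<^esub> y) \<oplus>\<^bsub>M\<^esub> z \<star>\<^bsub>M\<^esub> ar a"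
      using add xc by (simp add: M.M.a_assoc M.ract_closed)
    then show ?case using add rd.add by simp
  qed
qed

lemma rd_gen: "\<lbrakk>x \<in> carrier M; a \<in> F\<rbrakk> \<Longrightarrow> x \<star>\<^bsub>M\<^esub> ar a \<in> rd M F"
  using rd.add [OF rd.zero, of x M a F] by (simp add: M.ract_closed)

lemma rd_sc: "x \<in> rd M F \<Longrightarrow> x \<star>\<^bsub>M\<^esub> sc k \<in> rd M F"
proof (induction rule: rd.induct)
  case zero then show ?case using rd.zero M.ract_zero_left by simp
next
  case (add y x a)
  moreover have "y \<in> carrier M" using add rd_carrier by auto
  ultimately show ?case
    using rd.add [of "y \<star>\<^bsub>M\<^esub> sc k" M F "x \<star>\<^bsub>M\<^esub> sc k" a] by (simp add: M.ract_add_left M.ract_closed basis_act(5) [OF M])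
qed

lemma ksub_rd: "ksub (KM M) (rd M F)"
  using rd_carrier rd.zero rd_plus rd_sc by (auto simp: ksub_def)

lemma rd_mono: "F \<subseteq> G \<Longrightarrow> rd M F \<subseteq> rd M G"
proof
  fix x assume "F \<subseteq> G" "x \<in> rd M F"
  from this(2,1) show "x \<in> rd M G" by induction (auto intro: rd.intros)
qed

lemma rd_ar: "x \<in> rd M F \<Longrightarrow> x \<star>\<^bsub>M\<^esub> ar b = \<zero>\<^bsub>M\<^esub>"
proof (induction rule: rd.induct)
  case zero then show ?case using M.ract_zero_left by simp
next
  case (add y x a)
  moreover have "y \<in> carrier M" using add rd_carrier by auto
  ultimately show ?case by (simp add: M.ract_add_left M.ract_closed basis_act(4) [OF M])
qed

lemma rd_ev: "\<lbrakk>x \<in> rd M F; F \<subseteq> arcs Q\<rbrakk> \<Longrightarrow> x \<star>\<^bsub>M\<^esub> ev w \<in> rd M {a \<in> F. head Q a = w}"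
proof (induction rule: rd.induct)
  case zero then show ?case using rd.zero M.ract_zero_left by simp
next
  case (add y x a)
  have y: "y \<in> carrier M" using add rd_carrier by auto
  have *: "(x \<star>\<^bsub>M\<^esub> ar a) \<star>\<^bsub>M\<^esub> ev w = (if w = head Q a then x \<star>\<^bsub>M\<^esub> ar a else \<zero>\<^bsub>M\<^esub>)"
    using add by (intro basis_act(3) [OF M]) auto
  have "y \<star>\<^bsub>M\<^esub> ev w \<oplus>\<^bsub>M\<^esub> \<zero>\<^bsub>M\<^esub> = y \<star>\<^bsub>M\<^esub> ev w" using y M.ract_closed by simp
  then show ?case
    using add y * rd.add [of "y \<star>\<^bsub>M\<^esub> ev w" M "{a \<in> F. head Q a = w}" x a]
    by (auto simp: M.ract_add_left M.ract_closed)
qed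

lemma rd_inn: "x \<in> rd M (inn w) \<Longrightarrow> x \<star>\<^bsub>M\<^esub> ev w = x"
proof (induction rule: rd.induct)
  case zero then show ?case using M.ract_zero_left by simp
next
  case (add y x a)
  moreover have "y \<in> carrier M" using add rd_carrier by auto
  ultimately show ?case by (simp add: M.ract_add_left M.ract_closed basis_act(3) [OF M])
qed

lemma rd_sub_so: "rd M (inn w) \<subseteq> so M w"
  using rd_carrier [of "inn w"] by (auto simp: so_def pt_def rd_inn rd_ar)

lemma so_sub_pt: "so M w \<subseteq> pt M w"
  by (auto simp: so_def)

lemma rd_sub_pt: "rd M (inn w) \<subseteq> pt M w"
  using rd_sub_so so_sub_pt by auto

text \<open>Acting with \<open>ev w\<close> removes from a sum of arrow translates all terms whose
  arrow does not end in \<open>w\<close>.\<close>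

lemma rd_arcs_pt: "x \<in> pt M w \<Longrightarrow> x \<in> rd M (arcs Q) \<longleftrightarrow> x \<in> rd M (inn w)"
  using rd_ev [of x "arcs Q" w] rd_mono [of "inn w" "arcs Q"] by (auto simp: pt_def)

lemma submod_rad: "submod A (rd M (arcs Q)) M"
proof (rule submod_basisI [OF M])
  fix x v assume "x \<in> rd M (arcs Q)"
  then have "x \<star>\<^bsub>M\<^esub> ev v \<in> rd M (inn v)" by (rule rd_ev) simp
  then show "x \<star>\<^bsub>M\<^esub> ev v \<in> rd M (arcs Q)" using rd_mono [of "inn v" "arcs Q"] by auto
qed (use rd_carrier rd.zero rd_plus rd_sc rd_ar rd.zero in auto)

text \<open>One step suffices because the radical is killed by arrows: if \<open>x\<close> is
  \<open>u\<close> plus a radical element, then \<open>x\<close> and \<open>u\<close> have the same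
  translate by any arrow. Hence the radical lies in \<open>U\<close>, and so does
  everything.\<close>

lemma nakayama:
  assumes "submod A U M" "\<And>x. x \<in> carrier M \<Longrightarrow> \<exists>u\<in>U. \<exists>r\<in>rd M (arcs Q). x = u \<oplus>\<^bsub>M\<^esub> r"
  shows "U = carrier M"
proof -
  note U = submodD [OF assms(1)]
  have "r \<in> U" if "r \<in> rd M (arcs Q)" for r
    using that
  proof (induction rule: rd.induct)
    case (add y x a)
    obtain u r where "u \<in> U" "r \<in> rd M (arcs Q)" "x = u \<oplus>\<^bsub>M\<^esub> r" using assms(2) add by blast
    then have "x \<star>\<^bsub>M\<^esub> ar a = u \<star>\<^bsub>M\<^esub> ar a"
      using rd_ar [of r "arcs Q" a] rd_carrier [of "arcs Q"] U
      by (auto simp: M.ract_add_left M.ract_closed subset_iff)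
    then show ?case using add U \<open>u \<in> U\<close> by auto
  qed (use U in auto)
  then have "x \<in> U" if "x \<in> carrier M" for x using assms(2) [OF that] U(3) by blast
  then show ?thesis using U(1) by blast
qed

text \<open>The translate of \<open>x\<close> by \<open>a\<close> depends only on the component of
  \<open>x\<close> at the tail of \<open>a\<close>. Confining the new summand to that vertex space
  is what makes the dimension bound in \<open>om_nonneg\<close> sharp enough.\<close>

lemma rd_insert:
  assumes "a \<in> arcs Q"
  shows "rd M (insert a F) = (\<lambda>(y, z). y \<oplus>\<^bsub>M\<^esub> z) ` (rd M F \<times> (\<lambda>x. x \<star>\<^bsub>M\<^esub> ar a) ` pt M (tail Q a))"
    (is "_ = ?R")
proof (intro equalityI subsetI)
  fix x assume "x \<in> rd M (insert a F)"
  then show "x \<in> ?R"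
  proof (induction rule: rd.induct)
    case zero
    have "\<zero>\<^bsub>M\<^esub> = \<zero>\<^bsub>M\<^esub> \<oplus>\<^bsub>M\<^esub> \<zero>\<^bsub>M\<^esub> \<star>\<^bsub>M\<^esub> ar a" "\<zero>\<^bsub>M\<^esub> \<in> pt M (tail Q a)"
      by (simp_all add: M.ract_zero_left pt_def)
    then show ?case using rd.zero [of M F] by force
  next
    case (add y x b)
    then obtain z t where zt: "z \<in> rd M F" "t \<in> pt M (tail Q a)" "y = z \<oplus>\<^bsub>M\<^esub> t \<star>\<^bsub>M\<^esub> ar a" by auto
    have c: "z \<in> carrier M" "t \<in> carrier M" using zt rd_carrier by (auto simp: pt_def)
    show ?case
    proof (cases "b \<in> F")
      case True
      have "y \<oplus>\<^bsub>M\<^esub> x \<star>\<^bsub>M\<^esub> ar b = (z \<oplus>\<^bsub>M\<^esub> x \<star>\<^bsub>M\<^esub> ar b) \<oplus>\<^bsub>M\<^esub> t \<star>\<^bsub>M\<^esub> ar a"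
        using zt c add by (simp add: M.M.a_ac M.ract_closed)
      moreover have "z \<oplus>\<^bsub>M\<^esub> x \<star>\<^bsub>M\<^esub> ar b \<in> rd M F" using zt add True by (intro rd.add)
      ultimately show ?thesis using zt by force
    next
      case False
      then have b: "b = a" using add by auto
      have "x \<star>\<^bsub>M\<^esub> ar a = (x \<star>\<^bsub>M\<^esub> ev (tail Q a)) \<star>\<^bsub>M\<^esub> ar a"
        using add assms basis_act(2) [OF M, of x a "tail Q a"] by simp
      then have "y \<oplus>\<^bsub>M\<^esub> x \<star>\<^bsub>M\<^esub> ar b = z \<oplus>\<^bsub>M\<^esub> (t \<oplus>\<^bsub>M\<^esub> x \<star>\<^bsub>M\<^esub> ev (tail Q a)) \<star>\<^bsub>M\<^esub> ar a"
        using zt c add b by (simp add: M.M.a_assoc M.ract_closed M.ract_add_left)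
      moreover have "t \<oplus>\<^bsub>M\<^esub> x \<star>\<^bsub>M\<^esub> ev (tail Q a) \<in> pt M (tail Q a)"
        using zt c add by (simp add: pt_def M.ract_closed M.ract_add_left basis_act(1) [OF M])
      ultimately show ?thesis using zt by force
    qed
  qed
next
  fix x assume "x \<in> ?R"
  then obtain z t where zt: "z \<in> rd M F" "t \<in> pt M (tail Q a)" "x = z \<oplus>\<^bsub>M\<^esub> t \<star>\<^bsub>M\<^esub> ar a" by auto
  then have "z \<in> rd M (insert a F)" using rd_mono [of F "insert a F"] by auto
  then show "x \<in> rd M (insert a F)" using zt by (auto simp: pt_def intro: rd.add)
qed

end

lemma rd_hom:
  assumes "right_module A M" "right_module A N" "f \<in> rmod_hom A M N" "x \<in> rd M F"
  shows "f x \<in> rd N F"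
  using assms(4)
proof (induction rule: rd.induct)
  case zero then show ?case using rmod_hom_zero [OF assms(1-3)] rd.zero by simp
next
  interpret M: right_module A M by fact
  case (add y x a)
  then have "y \<in> carrier M" using rd_carrier [OF assms(1)] by auto
  then show ?case using add rmod_homD [OF assms(3)] M.ract_closed by (auto intro: rd.add)
qed

lemma rd_hom_surj:
  assumes "right_module A M" "right_module A N" "f \<in> rmod_hom A M N" "f ` carrier M = carrier N"
  shows "f ` rd M F = rd N F"
proof (intro equalityI subsetI)
  interpret M: right_module A M by fact
  fix y assume "y \<in> rd N F"
  then show "y \<in> f ` rd M F"
  proof (induction rule: rd.induct)
    case zero then show ?case using rmod_hom_zero [OF assms(1-3)] rd.zero [of M F] by (metis imageI)
  next
    case (add y x a)
    then obtain y' where y': "y' \<in> rd M F" "y = f y'" by auto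
    obtain x' where x': "x' \<in> carrier M" "x = f x'" using add(2) assms(4) by (metis imageE)
    have "y' \<in> carrier M" using y' rd_carrier [OF assms(1)] by auto
    then have "y \<oplus>\<^bsub>N\<^esub> x \<star>\<^bsub>N\<^esub> ar a = f (y' \<oplus>\<^bsub>M\<^esub> x' \<star>\<^bsub>M\<^esub> ar a)"
      using x' y' rmod_homD [OF assms(3)] M.ract_closed by simp
    moreover have "y' \<oplus>\<^bsub>M\<^esub> x' \<star>\<^bsub>M\<^esub> ar a \<in> rd M F" using x' y' add by (intro rd.add)
    ultimately show ?case by blast
  qed
qed (use rd_hom [OF assms(1-3)] in auto)

lemma pt_hom: "\<lbrakk>f \<in> rmod_hom A M N; x \<in> pt M w\<rbrakk> \<Longrightarrow> f x \<in> pt N w"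
  using rmod_homD(3) [of f A M N x "ev w"] by (auto simp: pt_def rmod_homD(1))

lemma pt_hom_surj:
  assumes "right_module A M" "f \<in> rmod_hom A M N" "f ` carrier M = carrier N"
  shows "f ` pt M w = pt N w"
proof (intro equalityI subsetI)
  interpret M: right_module A M by fact
  fix y assume y: "y \<in> pt N w"
  then obtain x where x: "x \<in> carrier M" "y = f x" using assms(3) by (auto simp: pt_def)
  then have "f (x \<star>\<^bsub>M\<^esub> ev w) = y" using y rmod_homD(3) [OF assms(2)] by (simp add: pt_def)
  moreover have "x \<star>\<^bsub>M\<^esub> ev w \<in> pt M w" using x by (simp add: pt_def M.ract_closed basis_act(1) [OF assms(1)])
  ultimately show "y \<in> f ` pt M w" by blast
qed (use pt_hom assms in auto)

end

lemma kdim_carrier_update [simp]: "kdim (V\<lparr>carrier := U'\<rparr>) U = kdim V U"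
  by (simp add: kdim_def)

context radsq
begin

section \<open>Dimensions at a vertex and the two additive invariants\<close>

definition dp :: "('a, 'm, 'y) rmodule_scheme \<Rightarrow> 'v \<Rightarrow> int" where
  "dp M w = int (kdim (KM M) (pt M w))"

definition dr :: "('a, 'm, 'y) rmodule_scheme \<Rightarrow> 'v \<Rightarrow> int" where
  "dr M w = int (kdim (KM M) (rd M (inn w)))"

definition ds :: "('a, 'm, 'y) rmodule_scheme \<Rightarrow> 'v \<Rightarrow> int" where
  "ds M w = int (kdim (KM M) (so M w))"

text \<open>The projective cover of \<open>M\<close> has \<open>dp M v - dr M v\<close> copies of \<open>e\<^sub>v A\<close>, so that \<open>om M w\<close> is the multiplicity
  of the simple module at \<open>w\<close> in the syzygy of \<open>M\<close>; its multiplicity as a direct summand of \<open>M\<close> is \<open>sx M w\<close>.\<close>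

definition om :: "('a, 'm, 'y) rmodule_scheme \<Rightarrow> 'v \<Rightarrow> int" where
  "om M w = (\<Sum>a\<in>inn w. dp M (tail Q a) - dr M (tail Q a)) - dr M w"

definition sx :: "('a, 'm, 'y) rmodule_scheme \<Rightarrow> 'v \<Rightarrow> int" where
  "sx M w = ds M w - dr M w"

lemma dims_iso:
  assumes M: "fdmod M" and N: "right_module A N" and iso: "rmod_iso A M N"
  shows "dp M w = dp N w" "dr M w = dr N w" "ds M w = ds N w"
proof -
  note rM = fdmodD(1) [OF M]
  interpret M: right_module A M by (rule rM)
  interpret N: right_module A N by (rule N)
  obtain f g where f: "f \<in> rmod_hom A M N" and g: "g \<in> rmod_hom A N M"
    and gf: "\<And>x. x \<in> carrier M \<Longrightarrow> g (f x) = x" and fg: "\<And>y. y \<in> carrier N \<Longrightarrow> f (g y) = y"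
    using rmod_iso_inverse [OF rM iso] by metis
  have inj: "inj_on f U" if "U \<subseteq> carrier M" for U
    using that gf by (intro inj_on_inverseI [of _ g]) auto
  have surj: "f ` carrier M = carrier N"
  proof (intro equalityI subsetI)
    fix y assume "y \<in> carrier N"
    then show "y \<in> f ` carrier M" using fg rmod_homD(1) [OF g] by (intro image_eqI [of _ _ "g y"]) auto
  qed (use rmod_homD(1) [OF f] in auto)
  have key: "kdim (KM N) (f ` U) = kdim (KM M) U" if "ksub (KM M) U" for U
  proof -
    have "U \<subseteq> carrier M" using that by (simp add: ksub_def)
    then show ?thesis
      using kdim_inj [OF fdmodD(2) [OF M] kspace_KM [OF N] that klin_hom [OF f] inj] by simp
  qed
  show "dp M w = dp N w"
    using key [OF ksub_pt [OF rM, of w]] pt_hom_surj [OF rM f surj, of w] by (simp add: dp_def)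
  show "dr M w = dr N w"
    using key [OF ksub_rd [OF rM, of "inn w"]] rd_hom_surj [OF rM N f surj, of "inn w"] by (simp add: dr_def)
  have "f ` so M w = so N w"
  proof (intro equalityI subsetI)
    fix y assume "y \<in> f ` so M w"
    then obtain x where x: "y = f x" "x \<in> so M w" by auto
    then have xc: "x \<in> pt M w" "x \<in> carrier M" by (auto simp: so_def pt_def)
    have "y \<star>\<^bsub>N\<^esub> ar a = \<zero>\<^bsub>N\<^esub>" if "a \<in> arcs Q" for a
    proof -
      have "y \<star>\<^bsub>N\<^esub> ar a = f (x \<star>\<^bsub>M\<^esub> ar a)" using rmod_homD(3) [OF f xc(2)] x by simp
      then show ?thesis using x that rmod_hom_zero [OF rM N f] by (simp add: so_def)
    qed
    then show "y \<in> so N w" using pt_hom [OF f xc(1)] x by (simp add: so_def)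
  next
    fix y assume y: "y \<in> so N w"
    then have yc: "y \<in> pt N w" "y \<in> carrier N" by (auto simp: so_def pt_def)
    have "g y \<star>\<^bsub>M\<^esub> ar a = \<zero>\<^bsub>M\<^esub>" if "a \<in> arcs Q" for a
    proof -
      have "g y \<star>\<^bsub>M\<^esub> ar a = g (y \<star>\<^bsub>N\<^esub> ar a)" using rmod_homD(3) [OF g yc(2)] by simp
      then show ?thesis using y that rmod_hom_zero [OF N rM g] by (simp add: so_def)
    qed
    then have "g y \<in> so M w" using pt_hom [OF g yc(1)] by (simp add: so_def)
    then show "y \<in> f ` so M w" using fg [OF yc(2)] by force
  qed
  then show "ds M w = ds N w" using key [OF ksub_so [OF rM, of w]] by (simp add: ds_def)
qed

lemma rd_dsum2:
  assumes "right_module A M" "right_module A N"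
  shows "rd (dsum2 M N) F = rd M F \<times> rd N F"
proof (intro equalityI subsetI)
  interpret M: right_module A M by fact
  interpret N: right_module A N by fact
  note D = right_module_dsum2 [OF assms]
  have p: "fst \<in> rmod_hom A (dsum2 M N) M" "snd \<in> rmod_hom A (dsum2 M N) N"
    by (rule rmod_homI; auto)+
  have i: "(\<lambda>x. (x, \<zero>\<^bsub>N\<^esub>)) \<in> rmod_hom A M (dsum2 M N)" "(\<lambda>x. (\<zero>\<^bsub>M\<^esub>, x)) \<in> rmod_hom A N (dsum2 M N)"
    by (rule rmod_homI; simp add: M.ract_zero_left N.ract_zero_left)+
  fix z
  show "z \<in> rd M F \<times> rd N F" if "z \<in> rd (dsum2 M N) F"
    using rd_hom [OF D assms(1) p(1) that] rd_hom [OF D assms(2) p(2) that] by (simp add: mem_Times_iff)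
  assume z: "z \<in> rd M F \<times> rd N F"
  then have c: "fst z \<in> carrier M" "snd z \<in> carrier N"
    using subsetD [OF rd_carrier [OF assms(1)]] subsetD [OF rd_carrier [OF assms(2)]]
    by (auto simp: mem_Times_iff)
  have "(fst z, \<zero>\<^bsub>N\<^esub>) \<oplus>\<^bsub>dsum2 M N\<^esub> (\<zero>\<^bsub>M\<^esub>, snd z) \<in> rd (dsum2 M N) F"
    using z rd_hom [OF assms(1) D i(1)] rd_hom [OF assms(2) D i(2)] by (intro rd_plus [OF D]) auto
  then show "z \<in> rd (dsum2 M N) F" using c by simp
qed

lemma dims_dsum2:
  assumes "fdmod M" "fdmod N"
  shows "dp (dsum2 M N) w = dp M w + dp N w" "dr (dsum2 M N) w = dr M w + dr N w"
    "ds (dsum2 M N) w = ds M w + ds N w"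
proof -
  note M = fdmodD [OF assms(1)] and N = fdmodD [OF assms(2)]
  have "pt (dsum2 M N) w = pt M w \<times> pt N w" by (auto simp: pt_def)
  then show "dp (dsum2 M N) w = dp M w + dp N w"
    using kdim_kprod(2) [OF M(2) N(2) ksub_pt [OF M(1)] ksub_pt [OF N(1)]] by (simp add: dp_def KM_dsum2)
  show "dr (dsum2 M N) w = dr M w + dr N w"
    using kdim_kprod(2) [OF M(2) N(2) ksub_rd [OF M(1)] ksub_rd [OF N(1)]] rd_dsum2 [OF M(1) N(1)]
    by (simp add: dr_def KM_dsum2)
  have "so (dsum2 M N) w = so M w \<times> so N w" by (auto simp: so_def pt_def)
  then show "ds (dsum2 M N) w = ds M w + ds N w"
    using kdim_kprod(2) [OF M(2) N(2) ksub_so [OF M(1)] ksub_so [OF N(1)]] by (simp add: ds_def KM_dsum2)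
qed

lemma om_sx_iso:
  assumes "fdmod M" "right_module A N" "rmod_iso A M N"
  shows "om M w = om N w" "sx M w = sx N w"
  using dims_iso [OF assms] by (simp_all add: om_def sx_def)

lemma om_sx_dsum2:
  assumes "fdmod M" "fdmod N"
  shows "om (dsum2 M N) w = om M w + om N w" "sx (dsum2 M N) w = sx M w + sx N w"
  using dims_dsum2 [OF assms] by (simp_all add: om_def sx_def sum.distrib sum_subtractf)

lemma sx_nonneg: "fdmod M \<Longrightarrow> 0 \<le> sx M w"
  using fkspace.kdim_mono [OF fdmodD(2) ksub_rd ksub_so rd_sub_so, of M w] fdmodD(1)
  by (auto simp: sx_def ds_def dr_def)

text \<open>Each arrow \<open>a\<close> contributes to the radical at its head a space of dimension
  at most \<open>dp - dr\<close> at its tail, because the radical at the tail is killed.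
  Nonnegativity is what later forces \<open>om\<close> to vanish on direct summands of modules where
  it vanishes.\<close>

lemma om_nonneg:
  assumes "fdmod M"
  shows "0 \<le> om M w"
proof -
  note M = fdmodD(1) [OF assms]
  interpret M: right_module A M by (rule M)
  interpret K: fkspace "KM M" by (rule fdmodD(2) [OF assms])
  have "finite F \<Longrightarrow> F \<subseteq> arcs Q \<Longrightarrow>
      int (kdim (KM M) (rd M F)) \<le> (\<Sum>a\<in>F. dp M (tail Q a) - dr M (tail Q a))" for F
  proof (induction F rule: finite_induct)
    case empty
    have "rd M {} = {\<zero>\<^bsub>KM M\<^esub>}"
    proof (intro equalityI subsetI)
      fix x assume "x \<in> rd M {}" then show "x \<in> {\<zero>\<^bsub>KM M\<^esub>}" by induction auto
    qed (auto intro: rd.zero)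
    then show ?case using K.kdim_zero by simp
  next
    case (insert a F)
    let ?t = "tail Q a"
    let ?f = "\<lambda>x. x \<star>\<^bsub>M\<^esub> ar a"
    have lin: "klin (KM M) (KM M) (pt M ?t) ?f"
      by (auto simp: klin_def pt_def M.ract_closed M.ract_add_left basis_act(5) [OF M])
    note rn = kdim_rank_nullity [OF K.fkspace K.kspace ksub_pt [OF M] lin]
    \<comment> \<open>The radical at the tail lies in the kernel of the arrow, since products of two
      arrows vanish.\<close>
    have "rd M (inn ?t) \<subseteq> {x \<in> pt M ?t. ?f x = \<zero>\<^bsub>KM M\<^esub>}"
      using rd_sub_pt [OF M, of ?t] rd_ar [OF M] by auto
    then have "kdim (KM M) (rd M (inn ?t)) \<le> kdim (KM M) {x \<in> pt M ?t. ?f x = \<zero>\<^bsub>KM M\<^esub>}"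
      by (rule K.kdim_mono [OF ksub_rd [OF M] rn(4)])
    then have 1: "int (kdim (KM M) (?f ` pt M ?t)) \<le> dp M ?t - dr M ?t"
      using rn(1) by (simp add: dp_def dr_def)
    have "rd M (insert a F) = (\<lambda>(x, y). x \<oplus>\<^bsub>KM M\<^esub> y) ` (rd M F \<times> ?f ` pt M ?t)"
      using rd_insert [OF M] insert.prems by simp
    then have "kdim (KM M) (rd M (insert a F)) \<le> kdim (KM M) (rd M F) + kdim (KM M) (?f ` pt M ?t)"
      using K.kdim_sum_le(2) [OF ksub_rd [OF M] rn(3)] by simp
    then show ?case using 1 insert by simp
  qed
  from this [of "inn w"] show ?thesis by (simp add: om_def dr_def)
qed

lemma zero_module_dims:
  assumes "fdmod M" "carrier M = {\<zero>\<^bsub>M\<^esub>}"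
  shows "dp M w = 0" "dr M w = 0" "ds M w = 0" "om M w = 0" "sx M w = 0"
proof -
  interpret K: fkspace "KM M" by (rule fdmodD(2) [OF assms(1)])
  note M = fdmodD(1) [OF assms(1)]
  have *: "kdim (KM M) U = 0" if "ksub (KM M) U" for U
  proof -
    have "U = {\<zero>\<^bsub>KM M\<^esub>}" using that assms(2) by (auto simp: ksub_def)
    then show ?thesis using K.kdim_zero by simp
  qed
  have d: "dp M w = 0" "dr M w = 0" "ds M w = 0" for w
    using * [OF ksub_pt [OF M]] * [OF ksub_rd [OF M]] * [OF ksub_so [OF M]]
    by (simp_all add: dp_def dr_def ds_def)
  show "dp M w = 0" "dr M w = 0" "ds M w = 0" "om M w = 0" "sx M w = 0"
    using d by (simp_all add: om_def sx_def)
qed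

lemma zero_module_projective:
  assumes "fdmod M" "carrier M = {\<zero>\<^bsub>M\<^esub>}"
  shows "projective_rmod A M"
  unfolding projective_rmod_def
proof (intro ballI impI)
  interpret M: right_module A M using fdmodD assms by auto
  fix L N g f
  assume *: "L \<in> fgmods A" "N \<in> fgmods A" "g \<in> rmod_hom A L N" "f \<in> rmod_hom A M N"
  interpret L: right_module A L using * by (simp add: fgmods_def)
  interpret N: right_module A N using * by (simp add: fgmods_def)
  show "\<exists>h\<in>rmod_hom A M L. \<forall>x\<in>carrier M. g (h x) = f x"
    using assms(2) rmod_hom_zero [OF M.right_module_axioms N.right_module_axioms *(4)]
      rmod_hom_zero [OF L.right_module_axioms N.right_module_axioms *(3)]
    by (intro bexI [of _ "\<lambda>_. \<zero>\<^bsub>L\<^esub>"] rmod_homI) (auto simp: L.ract_zero_left)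
qed

text \<open>A model of the quotient of \<open>e\<^sub>v A\<close> by the arrows starting at \<open>v\<close> outside of \<open>F\<close>: the projective module
  for \<open>F = out v\<close>, the simple module for \<open>F = {}\<close>.\<close>

definition tm :: "'v \<Rightarrow> 'e set \<Rightarrow> ('a, 'k \<times> ('e \<Rightarrow> 'k)) rmodule" where
  "tm v F = \<lparr>carrier = {(c, d). \<forall>b. b \<notin> F \<longrightarrow> d b = 0}, monoid.mult = undefined, one = undefined,
     ring.zero = (0, \<lambda>_. 0), ring.add = (\<lambda>(c, d) (c', d'). (c + c', \<lambda>b. d b + d' b)),
     ract = (\<lambda>(c, d) x. (c * cv x v, \<lambda>b. if b \<in> F then c * ca x b + d b * cv x (head Q b) else 0))\<rparr>"

lemma tm_simps [simp]:
  "carrier (tm v F) = {(c, d). \<forall>b. b \<notin> F \<longrightarrow> d b = 0}"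
  "\<zero>\<^bsub>tm v F\<^esub> = (0, \<lambda>_. 0)"
  "(c, d) \<oplus>\<^bsub>tm v F\<^esub> (c', d') = (c + c', \<lambda>b. d b + d' b)"
  "(c, d) \<star>\<^bsub>tm v F\<^esub> x = (c * cv x v, \<lambda>b. if b \<in> F then c * ca x b + d b * cv x (head Q b) else 0)"
  by (simp_all add: tm_def)

context
  fixes v :: 'v and F :: "'e set"
  assumes v: "v \<in> verts Q" and F: "F \<subseteq> out v"
begin

lemma tm_verts: "b \<in> F \<Longrightarrow> b \<in> arcs Q" "b \<in> F \<Longrightarrow> tail Q b = v" "b \<in> F \<Longrightarrow> head Q b \<in> verts Q"
  using F Q.head_in_verts by auto

lemma right_module_tm: "right_module A (tm v F)"
proof (rule right_moduleI)
  show "ring A" ..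
  show "abelian_group (tm v F)"
  proof (rule abelian_groupI)
    fix x assume "x \<in> carrier (tm v F)"
    then show "\<exists>y\<in>carrier (tm v F). y \<oplus>\<^bsub>tm v F\<^esub> x = \<zero>\<^bsub>tm v F\<^esub>"
      by (intro bexI [of _ "(- fst x, \<lambda>b. - snd x b)"]) auto
  qed (auto simp: algebra_simps)
  show "x \<star>\<^bsub>tm v F\<^esub> a \<in> carrier (tm v F)" if "x \<in> carrier (tm v F)" for x a
    using that by auto
qed (auto simp: v tm_verts coords algebra_simps fun_eq_iff)

text \<open>The module is cyclic: acting on \<open>(1, \<lambda>_. 0)\<close> with an element that
  has coefficient \<open>c\<close> at \<open>v\<close> and \<open>d\<close> on \<open>F\<close>
  produces \<open>(c, d)\<close>.\<close>

lemma fdmod_tm: "fdmod (tm v F)"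
proof -
  have "fin_gen A (tm v F)" unfolding fin_gen_def
  proof (intro exI [of _ "{(1, \<lambda>_. 0)}"] conjI allI impI)
    fix U assume U: "submod A U (tm v F) \<and> {(1, \<lambda>_. 0)} \<subseteq> U"
    note U' = submodD [OF conjunct1 [OF U]]
    have "x \<in> U" if xc: "x \<in> carrier (tm v F)" for x
    proof -
      obtain c d where x: "x = (c, d)" "\<forall>b. b \<notin> F \<longrightarrow> d b = 0" using xc by (cases x) auto
      have "(1, \<lambda>_. 0) \<star>\<^bsub>tm v F\<^esub> el (\<lambda>_. c) d = x"
        using x v tm_verts by (auto simp: fun_eq_iff)
      then show ?thesis using U'(4) [of "(1, \<lambda>_. 0)" "el (\<lambda>_. c) d"] U by simp
    qed
    then show "U = carrier (tm v F)" using U'(1) by blast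
  qed auto
  then show ?thesis using right_module_tm by (simp add: fdmod_iff_fin_gen)
qed

interpretation K: fkspace "KM (tm v F)" by (rule fdmodD(2) [OF fdmod_tm])

lemma pt_tm: "u \<in> verts Q \<Longrightarrow> pt (tm v F) u
    = {(c, d). (u \<noteq> v \<longrightarrow> c = 0) \<and> (\<forall>b. b \<notin> {b \<in> F. head Q b = u} \<longrightarrow> d b = 0)}"
  using v tm_verts by (fastforce simp: pt_def fun_eq_iff split: if_splits)

lemma rd_tm: "G \<subseteq> arcs Q \<Longrightarrow> rd (tm v F) G = {(c, d). c = 0 \<and> (\<forall>b. b \<notin> F \<inter> G \<longrightarrow> d b = 0)}"
proof (intro equalityI subsetI)
  fix x assume "G \<subseteq> arcs Q" "x \<in> rd (tm v F) G"
  from this(2,1) show "x \<in> {(c, d). c = 0 \<and> (\<forall>b. b \<notin> F \<inter> G \<longrightarrow> d b = 0)}"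
    by induction (auto simp: v tm_verts split: if_splits)
next
  assume G: "G \<subseteq> arcs Q"
  have *: "(0, d) \<in> rd (tm v F) G" if "finite H" "H \<subseteq> F \<inter> G" "\<forall>b. b \<notin> H \<longrightarrow> d b = 0" for H d
    using that
  proof (induction H arbitrary: d)
    case empty
    then have "d = (\<lambda>_. 0)" by auto
    then show ?case using rd.zero [of "tm v F" G] by simp
  next
    \<comment> \<open>The coordinate at \<open>b\<close> arises by acting with the arrow
      \<open>b\<close> on \<open>d b\<close> times the generator.\<close>
    case (insert b H)
    have "(0, d(b := 0)) \<in> rd (tm v F) G" using insert by (intro insert.IH) auto
    then have "(0, d(b := 0)) \<oplus>\<^bsub>tm v F\<^esub> (d b, \<lambda>_. 0) \<star>\<^bsub>tm v F\<^esub> ar b \<in> rd (tm v F) G"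
      using insert by (intro rd.add) auto
    moreover have "(0, d(b := 0)) \<oplus>\<^bsub>tm v F\<^esub> (d b, \<lambda>_. 0) \<star>\<^bsub>tm v F\<^esub> ar b = (0, d)"
      using insert v tm_verts by (auto simp: fun_eq_iff)
    ultimately show ?case by (simp only:)
  qed
  fix x :: "'k \<times> ('e \<Rightarrow> 'k)" assume "x \<in> {(c, d). c = 0 \<and> (\<forall>b. b \<notin> F \<inter> G \<longrightarrow> d b = 0)}"
  then obtain d where "x = (0, d)" "\<forall>b. b \<notin> F \<inter> G \<longrightarrow> d b = 0" by auto
  moreover have "finite (F \<inter> G)" using G finite_subset [OF _ Q.finite_arcs] by blast
  ultimately show "x \<in> rd (tm v F) G" using * by blast
qed

lemma dr_tm: "dr (tm v F) u = int (card {b \<in> F. head Q b = u})"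
proof -
  let ?G = "{b \<in> F. head Q b = u}"
  let ?V = "fun_space (arcs Q) :: ('k, 'e \<Rightarrow> 'k) module"
  have G: "?G \<subseteq> arcs Q" using tm_verts by auto
  interpret V: fkspace ?V by (rule fkspace_fun_space) simp
  let ?U = "{f. \<forall>b. b \<notin> ?G \<longrightarrow> f b = (0::'k)}"
  have s: "ksub ?V ?U" using G by (auto simp: ksub_def)
  have l: "klin ?V (KM (tm v F)) ?U (\<lambda>d. (0, d))"
    using v tm_verts by (auto simp: klin_def fun_eq_iff mult.commute)
  have "rd (tm v F) (inn u) = (\<lambda>d. (0, d)) ` ?U"
    using rd_tm [of "inn u"] tm_verts by auto
  then show ?thesis
    using kdim_inj [OF V.fkspace K.kspace s l] kdim_fun_space [OF Q.finite_arcs G]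
    by (simp add: dr_def inj_on_def)
qed

text \<open>Beyond the radical there is only the line of the generator, and it sits at
  \<open>v\<close>.\<close>

lemma dp_tm: "u \<in> verts Q \<Longrightarrow> dp (tm v F) u = dr (tm v F) u + (if u = v then 1 else 0)"
proof -
  assume u: "u \<in> verts Q"
  have rd: "rd (tm v F) (inn u) = {(c, d). c = 0 \<and> (\<forall>b. b \<notin> {b \<in> F. head Q b = u} \<longrightarrow> d b = 0)}"
    using rd_tm [of "inn u"] tm_verts by auto
  show ?thesis
  proof (cases "u = v")
    case False
    then have "pt (tm v F) u = rd (tm v F) (inn u)" using pt_tm [OF u] rd by auto
    then show ?thesis using False by (simp add: dp_def dr_def)
  next
    case True
    let ?f = "\<lambda>(c, d). (c, \<lambda>_. 0) :: 'k \<times> ('e \<Rightarrow> 'k)"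
    let ?U = "pt (tm v F) u"
    have l: "klin (KM (tm v F)) (KM (tm v F)) ?U ?f"
      using pt_tm [OF u] v tm_verts by (auto simp: klin_def fun_eq_iff)
    note rn = kdim_rank_nullity(1) [OF K.fkspace K.kspace ksub_pt [OF right_module_tm] l]
    have e: "(1, \<lambda>_. 0) \<in> carrier (KM (tm v F))" "(1, \<lambda>_. 0) \<noteq> \<zero>\<^bsub>KM (tm v F)\<^esub>" by auto
    have "?f ` ?U = range (\<lambda>k. k \<odot>\<^bsub>KM (tm v F)\<^esub> (1, \<lambda>_. 0))"
    proof (intro equalityI subsetI)
      fix x assume "x \<in> ?f ` ?U"
      then obtain c where "x = (c, \<lambda>_. 0)" by auto
      then have "x = c \<odot>\<^bsub>KM (tm v F)\<^esub> (1, \<lambda>_. 0)" using v tm_verts by (auto simp: fun_eq_iff)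
      then show "x \<in> range (\<lambda>k. k \<odot>\<^bsub>KM (tm v F)\<^esub> (1, \<lambda>_. 0))" by blast
    next
      fix x assume "x \<in> range (\<lambda>k. k \<odot>\<^bsub>KM (tm v F)\<^esub> (1, \<lambda>_. 0))"
      then obtain k where "x = k \<odot>\<^bsub>KM (tm v F)\<^esub> (1, \<lambda>_. 0)" by auto
      then have "x = ?f (k, \<lambda>_. 0)" using v tm_verts by (auto simp: fun_eq_iff)
      moreover have "(k, \<lambda>_. 0) \<in> ?U" using pt_tm [OF u] True by auto
      ultimately show "x \<in> ?f ` ?U" by blast
    qed
    then have 1: "kdim (KM (tm v F)) (?f ` ?U) = 1" using K.kdim_line [OF e] by simp
    have "{x \<in> ?U. ?f x = \<zero>\<^bsub>KM (tm v F)\<^esub>} = rd (tm v F) (inn u)"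
      using pt_tm [OF u] rd True by auto
    then show ?thesis using rn 1 True by (simp add: dp_def dr_def)
  qed
qed

text \<open>If \<open>F\<close> contains an arrow \<open>a\<close>, acting with \<open>a\<close>
  moves the coefficient \<open>c\<close> of the generator to the coordinate \<open>a\<close>. An
  element killed by all arrows then has \<open>c = 0\<close> and lies in the radical, so no simple
  direct summand is left.\<close>

lemma sx_tm:
  assumes "u \<in> verts Q"
  shows "sx (tm v F) u = (if u = v \<and> F = {} then 1 else 0)"
proof (cases "F = {}")
  case True
  have "so (tm v F) u = pt (tm v F) u"
    using True by (auto simp: so_def pt_tm [OF assms] v)
  then show ?thesis using dp_tm [OF assms] True by (simp add: sx_def ds_def dp_def)
next
  case False
  then obtain a where a: "a \<in> F" by auto
  have "so (tm v F) u \<subseteq> rd (tm v F) (inn u)"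
  proof
    fix x assume x: "x \<in> so (tm v F) u"
    then obtain c d where cd: "x = (c, d)" "(c, d) \<in> pt (tm v F) u" by (cases x) (auto simp: so_def)
    have "x \<star>\<^bsub>tm v F\<^esub> ar a = (0, \<lambda>_. 0)" using x a tm_verts by (auto simp: so_def)
    then have "(\<lambda>b. if b \<in> F then c * ca (ar a) b + d b * cv (ar a) (head Q b) else 0) a = 0"
      using cd by (simp add: fun_eq_iff)
    then have "c = 0" using a tm_verts by simp
    then show "x \<in> rd (tm v F) (inn u)"
      using cd rd_tm [of "inn u"] tm_verts pt_tm [OF assms] by auto
  qed
  then have "so (tm v F) u = rd (tm v F) (inn u)" using rd_sub_so [OF right_module_tm] by auto
  then show ?thesis using False by (simp add: sx_def ds_def dr_def)
qed

text \<open>The kernel of the projection from \<open>tm v (out v)\<close> has the arrows outside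
  \<open>F\<close> as a basis; the difference counts those among them that end in
  \<open>u\<close>.\<close>

lemma om_tm:
  assumes "u \<in> verts Q"
  shows "om (tm v F) u = int (card (out v \<inter> inn u)) - int (card (F \<inter> inn u))"
proof -
  have "(\<Sum>a\<in>inn u. dp (tm v F) (tail Q a) - dr (tm v F) (tail Q a))
     = (\<Sum>a\<in>inn u. if tail Q a = v then 1 else 0)"
    by (rule sum.cong) (auto simp: dp_tm)
  also have "\<dots> = int (card {a \<in> inn u. tail Q a = v})"
    by (simp add: sum.If_cases Int_def)
  also have "{a \<in> inn u. tail Q a = v} = out v \<inter> inn u" by auto
  finally show ?thesis
    using F by (auto simp: om_def dr_tm intro!: arg_cong [where f = card])
qed

end

text \<open>The universal property of the module generated at \<open>v\<close>: a homomorphism is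
  given by an arbitrary element \<open>z\<close> of the vertex space at \<open>v\<close>, the image
  of the generator.\<close>

lemma tm_hom:
  assumes v: "v \<in> verts Q" and M: "right_module A M" and z: "z \<in> pt M v"
  defines "q \<equiv> \<lambda>(c, d). z \<star>\<^bsub>M\<^esub> el (\<lambda>u. if u = v then c else 0) d"
  shows "q \<in> rmod_hom A (tm v (out v)) M" "q (c, \<lambda>_. 0) = z \<star>\<^bsub>M\<^esub> sc c"
proof -
  interpret M: right_module A M by fact
  have zc: "z \<in> carrier M" using z by (simp add: pt_def)
  show "q \<in> rmod_hom A (tm v (out v)) M"
  proof (rule rmod_homI)
    fix x assume "x \<in> carrier (tm v (out v))"
    then show "q x \<in> carrier M" using zc by (auto simp: q_def M.ract_closed)
  next
    fix x y assume xy: "x \<in> carrier (tm v (out v))" "y \<in> carrier (tm v (out v))"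
    obtain c d c' d' where cd: "x = (c, d)" "y = (c', d')" by (cases x, cases y) auto
    have "el (\<lambda>u. if u = v then c + c' else 0) (\<lambda>b. d b + d' b)
       = el (\<lambda>u. if u = v then c else 0) d \<oplus>\<^bsub>A\<^esub> el (\<lambda>u. if u = v then c' else 0) d'"
      by (rule coord_eqI) (auto simp: coords)
    then show "q (x \<oplus>\<^bsub>tm v (out v)\<^esub> y) = q x \<oplus>\<^bsub>M\<^esub> q y"
      using zc by (simp add: cd q_def M.ract_add_right)
  next
    fix x y assume xy: "x \<in> carrier (tm v (out v))" "y \<in> carrier A"
    obtain c d where cd: "x = (c, d)" "\<And>b. b \<notin> out v \<Longrightarrow> d b = 0" using xy by (cases x) auto
    have "el (\<lambda>u. if u = v then c * cv y v else 0)
        (\<lambda>b. if b \<in> out v then c * ca y b + d b * cv y (head Q b) else 0)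
       = el (\<lambda>u. if u = v then c else 0) d \<otimes>\<^bsub>A\<^esub> y"
      using xy cd by (intro coord_eqI) (auto simp: coords)
    then show "q (x \<star>\<^bsub>tm v (out v)\<^esub> y) = q x \<star>\<^bsub>M\<^esub> y"
      using zc xy by (simp add: cd q_def M.ract_assoc)
  qed
  have "el (\<lambda>u. if u = v then c else 0) (\<lambda>_. 0) = ev v \<otimes>\<^bsub>A\<^esub> sc c"
    by (rule coord_eqI) (auto simp: coords)
  then show "q (c, \<lambda>_. 0) = z \<star>\<^bsub>M\<^esub> sc c"
    using zc z by (simp add: q_def M.ract_assoc pt_def)
qed

text \<open>A surjective homomorphism is surjective on vertex spaces, so the image of the generator
  has a preimage at \<open>v\<close>, which defines the lift.\<close>

lemma projective_tm:
  assumes v: "v \<in> verts Q"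
  shows "projective_rmod A (tm v (out v))"
  unfolding projective_rmod_def
proof (intro ballI impI)
  let ?P = "tm v (out v)"
  have rP: "right_module A ?P" using right_module_tm v by auto
  fix L N g f
  assume *: "L \<in> fgmods A" "N \<in> fgmods A" "g \<in> rmod_hom A L N" "f \<in> rmod_hom A ?P N" "g ` carrier L = carrier N"
  have rL: "right_module A L" and rN: "right_module A N" using * by (auto simp: fgmods_def)
  have "(1, \<lambda>_. 0) \<in> pt ?P v" using pt_tm [OF v, of "out v" v] v by auto
  then have "f (1, \<lambda>_. 0) \<in> pt N v" by (rule pt_hom [OF *(4)])
  then have "f (1, \<lambda>_. 0) \<in> g ` pt L v" unfolding pt_hom_surj [OF rL *(3,5)] .
  then obtain z where z: "z \<in> pt L v" "g z = f (1, \<lambda>_. 0)" by auto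
  define h where "h = (\<lambda>(c, d). z \<star>\<^bsub>L\<^esub> el (\<lambda>u. if u = v then c else 0) d)"
  note h = tm_hom [OF v rL z(1), folded h_def]
  have "g (h x) = f x" if x: "x \<in> carrier ?P" for x
  proof -
    obtain c d where cd: "x = (c, d)" "\<And>b. b \<notin> out v \<Longrightarrow> d b = 0" using x by (cases x) auto
    let ?e = "el (\<lambda>u. if u = v then c else 0) d"
    have "x = (1, \<lambda>_. 0) \<star>\<^bsub>?P\<^esub> ?e" using cd v by (auto simp: fun_eq_iff)
    then have "f x = f (1, \<lambda>_. 0) \<star>\<^bsub>N\<^esub> ?e" using rmod_homD(3) [OF *(4), of "(1, \<lambda>_. 0)" ?e] by simp
    also have "\<dots> = g (z \<star>\<^bsub>L\<^esub> ?e)" using rmod_homD(3) [OF *(3), of z ?e] z by (simp add: pt_def)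
    finally show ?thesis using cd by (simp add: h_def)
  qed
  then show "\<exists>h\<in>rmod_hom A ?P L. \<forall>x\<in>carrier ?P. g (h x) = f x" using h(1) by blast
qed

end

section \<open>Projective covers\<close>

lemma submod_sum:
  assumes M: "right_module A M" and U: "submod A U M" and W: "submod A W M"
  shows "submod A ((\<lambda>(x, y). x \<oplus>\<^bsub>M\<^esub> y) ` (U \<times> W)) M"
proof -
  interpret M: right_module A M by fact
  let ?S = "(\<lambda>(x, y). x \<oplus>\<^bsub>M\<^esub> y) ` (U \<times> W)"
  have I: "u \<oplus>\<^bsub>M\<^esub> w \<in> ?S" if "u \<in> U" "w \<in> W" for u w using that by force
  note U' = submodD [OF U] and W' = submodD [OF W]
  have c: "x \<in> U \<Longrightarrow> x \<in> carrier M" "x \<in> W \<Longrightarrow> x \<in> carrier M" for x using U'(1) W'(1) by auto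
  show ?thesis
  proof (rule submodI [OF M])
    show "?S \<subseteq> carrier M" using c by auto
    show "\<zero>\<^bsub>M\<^esub> \<in> ?S" using I [OF U'(2) W'(2)] by simp
    fix x y assume "x \<in> ?S" "y \<in> ?S"
    then obtain u w u' w' where *: "x = u \<oplus>\<^bsub>M\<^esub> w" "y = u' \<oplus>\<^bsub>M\<^esub> w'" "u \<in> U" "u' \<in> U" "w \<in> W" "w' \<in> W"
      by auto
    then have "x \<oplus>\<^bsub>M\<^esub> y = (u \<oplus>\<^bsub>M\<^esub> u') \<oplus>\<^bsub>M\<^esub> (w \<oplus>\<^bsub>M\<^esub> w')" using c by (simp add: M.M.a_ac)
    then show "x \<oplus>\<^bsub>M\<^esub> y \<in> ?S" using * I U'(3) W'(3) by simp
  next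
    fix x a assume "x \<in> ?S" "a \<in> carrier A"
    then obtain u w where *: "x = u \<oplus>\<^bsub>M\<^esub> w" "u \<in> U" "w \<in> W" by auto
    then have "x \<star>\<^bsub>M\<^esub> a = u \<star>\<^bsub>M\<^esub> a \<oplus>\<^bsub>M\<^esub> w \<star>\<^bsub>M\<^esub> a"
      using c \<open>a \<in> carrier A\<close> by (simp add: M.ract_add_left)
    then show "x \<star>\<^bsub>M\<^esub> a \<in> ?S" using * I U'(4) W'(4) \<open>a \<in> carrier A\<close> by simp
  qed
qed

lemma submod_zero: "right_module A M \<Longrightarrow> submod A {\<zero>\<^bsub>M\<^esub>} M"
proof -
  assume M: "right_module A M"
  then interpret M: right_module A M .
  show ?thesis by (rule submodI [OF M]) (auto simp: M.ract_zero_left)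
qed

lemma iso_zero_carrier:
  assumes "right_module A M" "right_module A N" "rmod_iso A M N" "carrier M = {\<zero>\<^bsub>M\<^esub>}"
  shows "carrier N = {\<zero>\<^bsub>N\<^esub>}"
proof -
  obtain f where f: "f \<in> rmod_hom A M N" "f ` carrier M = carrier N"
    using assms(3) by (auto simp: rmod_iso_def bij_betw_def)
  then have "carrier N = {f \<zero>\<^bsub>M\<^esub>}" using assms(4) by auto
  then show ?thesis using rmod_hom_zero [OF assms(1,2) f(1)] by simp
qed

lemma projective_iso:
  "\<lbrakk>projective_rmod A P; right_module A P; right_module A N; rmod_iso A P N\<rbrakk> \<Longrightarrow> projective_rmod A N"
  using projective_retract rmod_retract_iso(2) by metis

context radsq
begin

text \<open>If \<open>x\<close> is not reached modulo the radical, one of its vertex components is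
  not, and a copy of \<open>tm v (out v)\<close> is added to hit it. The new map is still injective
  modulo radicals because the new generator goes outside the old image plus radical. Projectivity
  and the values of \<open>om\<close> and \<open>sx\<close> are carried along for use on the
  finished cover.\<close>

lemma cover_step:
  assumes M: "right_module A M" and P: "P \<in> fgmods A" and p: "p \<in> rmod_hom A P M"
    and proj: "projective_rmod A P"
    and inv: "\<And>w. w \<in> verts Q \<Longrightarrow> om P w = 0" "\<And>w. \<lbrakk>w \<in> verts Q; out w \<noteq> {}\<rbrakk> \<Longrightarrow> sx P w = 0"
    and rad: "\<And>y. \<lbrakk>y \<in> carrier P; p y \<in> rd M (arcs Q)\<rbrakk> \<Longrightarrow> y \<in> rd P (arcs Q)"
  defines "S \<equiv> \<lambda>(P, p). (\<lambda>(x, y). x \<oplus>\<^bsub>M\<^esub> y) ` (p ` carrier P \<times> rd M (arcs Q))"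
  assumes x: "x \<in> carrier M" "x \<notin> S (P, p)"
  obtains P' p' where "P' \<in> fgmods A" "p' \<in> rmod_hom A P' M" "projective_rmod A P'"
    "\<And>w. w \<in> verts Q \<Longrightarrow> om P' w = 0" "\<And>w. \<lbrakk>w \<in> verts Q; out w \<noteq> {}\<rbrakk> \<Longrightarrow> sx P' w = 0"
    "\<And>y. \<lbrakk>y \<in> carrier P'; p' y \<in> rd M (arcs Q)\<rbrakk> \<Longrightarrow> y \<in> rd P' (arcs Q)"
    "S (P, p) \<subset> S (P', p')"
proof -
  interpret M: right_module A M by fact
  have rP: "right_module A P" and fP: "fdmod P" using P by (auto simp: fgmods_iff fdmodD)
  interpret P: right_module A P by (rule rP)
  note hp = rmod_homD [OF p]
  have subS: "submod A (S (P, p)) M"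
    unfolding S_def prod.case
    by (intro submod_sum [OF M] submod_rad [OF M] submod_image [OF rP M p] submod_carrier [OF rP])
  note S = submodD [OF subS]
  have SI: "p y \<oplus>\<^bsub>M\<^esub> r \<in> S (P, p)" if "y \<in> carrier P" "r \<in> rd M (arcs Q)" for y r
    using that by (force simp: S_def)
  note R = submodD [OF submod_rad [OF M]]
  have radS: "r \<in> S (P, p)" if "r \<in> rd M (arcs Q)" for r
    using SI [OF P.M.zero_closed that] rmod_hom_zero [OF rP M p] R(1) that by auto
  \<comment> \<open>The arrow translates of \<open>x\<close> lie in the radical, so if all vertex
    components were reached, \<open>x\<close> itself would be.\<close>
  have "\<exists>v\<in>verts Q. x \<star>\<^bsub>M\<^esub> ev v \<notin> S (P, p)"
  proof (rule ccontr)
    assume "\<not> ?thesis"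
    then have a: "x \<star>\<^bsub>M\<^esub> ev v \<in> S (P, p)" if "v \<in> verts Q" for v using that by blast
    have b: "x \<star>\<^bsub>M\<^esub> ar a \<in> S (P, p)" if "a \<in> arcs Q" for a by (rule radS [OF rd_gen [OF M x(1) that]])
    have "x \<star>\<^bsub>M\<^esub> \<one>\<^bsub>A\<^esub> \<in> S (P, p)"
      by (rule closed_under_basis [OF M S(1-3) S(4) x(1) a b A.one_closed]) simp_all
    then show False using x M.ract_one by simp
  qed
  then obtain v where v: "v \<in> verts Q" "x \<star>\<^bsub>M\<^esub> ev v \<notin> S (P, p)" by blast
  define z where "z = x \<star>\<^bsub>M\<^esub> ev v"
  have z: "z \<in> pt M v" "z \<in> carrier M" "z \<notin> S (P, p)"
    using v x by (auto simp: z_def pt_def M.ract_closed basis_act(1) [OF M])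
  let ?T = "tm v (out v)"
  have rT: "right_module A ?T" and fT: "fdmod ?T" using right_module_tm [OF v(1)] fdmod_tm [OF v(1)] by auto
  define q where "q = (\<lambda>(c, d). z \<star>\<^bsub>M\<^esub> el (\<lambda>u. if u = v then c else 0) d)"
  note q = tm_hom [OF v(1) M z(1), folded q_def]
  note hq = rmod_homD [OF q(1)]
  let ?D = "dsum2 ?T P"
  have fD: "fdmod ?D" using fdmod_dsum2 fT fP by auto
  have rD: "right_module A ?D" using fdmodD fD by auto
  obtain P' where P': "P' \<in> fgmods A" "rmod_iso A ?D P'" using fgmod_copy [OF fD] by auto
  have rP': "right_module A P'" using P' by (simp add: fgmods_def)
  obtain f g where f: "f \<in> rmod_hom A ?D P'" and g: "g \<in> rmod_hom A P' ?D"
    and gf: "\<And>x. x \<in> carrier ?D \<Longrightarrow> g (f x) = x" and fg: "\<And>y. y \<in> carrier P' \<Longrightarrow> f (g y) = y"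
    by (rule rmod_iso_inverse [OF rD P'(2)]) (rule that; assumption)
  \<comment> \<open>The map on the sum that sends the new generator to \<open>z\<close> and agrees
    with \<open>p\<close> on the old cover.\<close>
  define h where "h = (\<lambda>(s, y). q s \<oplus>\<^bsub>M\<^esub> p y)"
  have h: "h \<in> rmod_hom A ?D M"
  proof (rule rmod_homI)
    fix a b assume "a \<in> carrier ?D" "b \<in> carrier ?D"
    then obtain s y s' y' where ab: "a = (s, y)" "b = (s', y')" "s \<in> carrier ?T" "s' \<in> carrier ?T"
      "y \<in> carrier P" "y' \<in> carrier P" unfolding dsum2_simps by blast
    then show "h (a \<oplus>\<^bsub>?D\<^esub> b) = h a \<oplus>\<^bsub>M\<^esub> h b"
      using hq(1) hq(2) [of s s'] hp by (simp add: h_def M.M.a_ac del: tm_simps)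
  next
    fix a b assume "a \<in> carrier ?D" "b \<in> carrier A"
    then obtain s y where ab: "a = (s, y)" "s \<in> carrier ?T" "y \<in> carrier P" unfolding dsum2_simps by blast
    then show "h (a \<star>\<^bsub>?D\<^esub> b) = h a \<star>\<^bsub>M\<^esub> b"
      using hq(1) hq(3) [of s b] hp \<open>b \<in> carrier A\<close> by (simp add: h_def M.ract_add_left del: tm_simps)
  qed (use hq(1) hp(1) in \<open>auto simp: h_def\<close>)
  define p' where "p' = h \<circ> g"
  have p': "p' \<in> rmod_hom A P' M" unfolding p'_def by (rule rmod_hom_comp [OF g h])
  have hD: "a \<in> rd ?D (arcs Q)" if a: "a \<in> carrier ?D" "h a \<in> rd M (arcs Q)" for a
  proof -
    obtain c d y where cd: "a = ((c, d), y)" "(c, d) \<in> carrier ?T" "y \<in> carrier P"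
    proof
      show "a = ((fst (fst a), snd (fst a)), snd a)" by simp
      show "(fst (fst a), snd (fst a)) \<in> carrier ?T" "snd a \<in> carrier P"
        using a(1) by (auto simp: mem_Times_iff)
    qed
    have "(0, d) \<in> rd ?T (arcs Q)" using cd(2) rd_tm [OF v(1), of "out v" "arcs Q"] by auto
    then have r1: "q (0, d) \<in> rd M (arcs Q)" by (rule rd_hom [OF rT M q(1)])
    have "q ((c, \<lambda>_. 0) \<oplus>\<^bsub>?T\<^esub> (0, d)) = q (c, \<lambda>_. 0) \<oplus>\<^bsub>M\<^esub> q (0, d)"
      using cd(2) by (intro hq(2)) auto
    then have qcd: "q (c, d) = z \<star>\<^bsub>M\<^esub> sc c \<oplus>\<^bsub>M\<^esub> q (0, d)" using q(2) by simp
    have cl: "q (0, d) \<in> carrier M" "z \<star>\<^bsub>M\<^esub> sc c \<in> carrier M" "p y \<in> carrier M"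
      using r1 R(1) z(2) cd(3) hp(1) by (auto simp: M.ract_closed)
    \<comment> \<open>A nonzero coefficient of the new generator could be inverted, which would put
      \<open>z\<close> into the old image plus radical.\<close>
    have c0: "c = 0"
    proof (rule ccontr)
      assume c: "c \<noteq> 0"
      let ?r = "h a \<oplus>\<^bsub>M\<^esub> \<ominus>\<^bsub>M\<^esub> q (0, d)"
      have r: "?r \<in> rd M (arcs Q)"
        using a(2) r1 R(3) submod_neg [OF M submod_rad [OF M]] by auto
      have "z \<star>\<^bsub>M\<^esub> sc c = p (\<ominus>\<^bsub>P\<^esub> y) \<oplus>\<^bsub>M\<^esub> ?r"
        using cl cd qcd rmod_hom_neg [OF rP M p cd(3)]
        by (simp add: h_def M.M.a_ac M.M.r_neg1 M.M.r_neg2 M.M.r_neg)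
      then have "z \<star>\<^bsub>M\<^esub> sc c \<in> S (P, p)" using SI [OF _ r] cd(3) by simp
      then have "(z \<star>\<^bsub>M\<^esub> sc c) \<star>\<^bsub>M\<^esub> sc (inverse c) \<in> S (P, p)" by (rule S(4)) simp
      moreover have "(z \<star>\<^bsub>M\<^esub> sc c) \<star>\<^bsub>M\<^esub> sc (inverse c) = z \<star>\<^bsub>M\<^esub> sc (c * inverse c)"
        using z(2) by (simp add: sc_times M.ract_assoc)
      moreover have "z \<star>\<^bsub>M\<^esub> sc (c * inverse c) = z"
        using c M.ract_one [OF z(2)] by (simp add: sc_one)
      ultimately show False using z(3) by (simp only:)
    qed
    have "p y = h a \<oplus>\<^bsub>M\<^esub> \<ominus>\<^bsub>M\<^esub> q (0, d)"
      using cl cd c0 qcd z(2) by (simp add: h_def sc_zero M.ract_zero_right M.M.a_ac M.M.r_neg M.M.r_neg1 M.M.r_neg2)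
    then have "p y \<in> rd M (arcs Q)" using a(2) r1 R(3) submod_neg [OF M submod_rad [OF M]] by auto
    then have "y \<in> rd P (arcs Q)" using rad cd(3) by simp
    then show ?thesis using \<open>(0, d) \<in> rd ?T (arcs Q)\<close> c0 cd rd_dsum2 [OF rT rP] by simp
  qed
  show ?thesis
  proof (rule that [of P' p'])
    show "P' \<in> fgmods A" "p' \<in> rmod_hom A P' M" by fact+
    show "projective_rmod A P'"
      using projective_iso [OF projective_dsum2 [OF projective_tm [OF v(1)] rT proj rP] rD rP' P'(2)] .
    show "om P' w = 0" if "w \<in> verts Q" for w
      using om_sx_iso(1) [OF fD rP' P'(2), of w] om_sx_dsum2(1) [OF fT fP, of w] inv(1) [OF that]
        om_tm [OF v(1) _ that, of "out v"] by simp
    show "sx P' w = 0" if "w \<in> verts Q" "out w \<noteq> {}" for w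
    proof -
      have "sx ?T w = (if w = v \<and> out v = {} then 1 else 0)" by (rule sx_tm [OF v(1) order_refl that(1)])
      also have "\<dots> = 0" using that(2) by metis
      finally show ?thesis
        using om_sx_iso(2) [OF fD rP' P'(2), of w] om_sx_dsum2(2) [OF fT fP, of w] inv(2) [OF that] by simp
    qed
    show "y \<in> rd P' (arcs Q)" if y: "y \<in> carrier P'" "p' y \<in> rd M (arcs Q)" for y
    proof -
      have "g y \<in> rd ?D (arcs Q)" using hD [of "g y"] rmod_homD(1) [OF g y(1)] y(2) by (simp add: p'_def)
      then have "f (g y) \<in> rd P' (arcs Q)" by (rule rd_hom [OF rD rP' f])
      then show ?thesis using fg y(1) by simp
    qed
    have p'f: "p' (f a) = h a" if "a \<in> carrier ?D" for a using gf that by (simp add: p'_def)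
    have SI': "h a \<oplus>\<^bsub>M\<^esub> r \<in> S (P', p')" if a: "a \<in> carrier ?D" and r: "r \<in> rd M (arcs Q)" for a r
    proof -
      have "p' (f a) \<oplus>\<^bsub>M\<^esub> r \<in> S (P', p')"
        using rmod_homD(1) [OF f a] r by (force simp: S_def)
      then show ?thesis using p'f a by simp
    qed
    have "S (P, p) \<subseteq> S (P', p')"
    proof
      fix s assume "s \<in> S (P, p)"
      then obtain y r where y: "s = p y \<oplus>\<^bsub>M\<^esub> r" "y \<in> carrier P" "r \<in> rd M (arcs Q)" by (auto simp: S_def)
      have "q (0, \<lambda>_. 0) = \<zero>\<^bsub>M\<^esub>" using rmod_hom_zero [OF rT M q(1)] by simp
      then have "h ((0, \<lambda>_. 0), y) = p y" using y hp by (simp add: h_def)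
      then show "s \<in> S (P', p')" using SI' [of "((0, \<lambda>_. 0), y)" r] y by simp
    qed
    moreover have "z \<in> S (P', p')"
    proof -
      have "h ((1, \<lambda>_. 0), \<zero>\<^bsub>P\<^esub>) = z"
        using q(2) [of 1] rmod_hom_zero [OF rP M p] z(2) by (simp add: h_def sc_one M.ract_one)
      then show ?thesis using SI' [of "((1, \<lambda>_. 0), \<zero>\<^bsub>P\<^esub>)" "\<zero>\<^bsub>M\<^esub>"] rd.zero [of M "arcs Q"] z(2) by simp
    qed
    ultimately show "S (P, p) \<subset> S (P', p')" using z by auto
  qed
qed

text \<open>Choose a pair whose image plus radical has largest dimension. By
  \<open>cover_step\<close> this sum is all of \<open>M\<close>, and Nakayama removes the radical
  from it.\<close>

theorem cover_exists:
  fixes M :: "('a, 'm, 'y) rmodule_scheme"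
  assumes fM: "fdmod M"
  obtains P p where "P \<in> fgmods A" "p \<in> rmod_hom A P M" "projective_rmod A P"
    "\<And>w. w \<in> verts Q \<Longrightarrow> om P w = 0" "\<And>w. \<lbrakk>w \<in> verts Q; out w \<noteq> {}\<rbrakk> \<Longrightarrow> sx P w = 0"
    "\<And>y. \<lbrakk>y \<in> carrier P; p y \<in> rd M (arcs Q)\<rbrakk> \<Longrightarrow> y \<in> rd P (arcs Q)"
    "p ` carrier P = carrier M"
proof -
  have M: "right_module A M" using fdmodD fM by auto
  interpret M: right_module A M by (rule M)
  interpret K: fkspace "KM M" by (rule fdmodD(2) [OF fM])
  define S :: "('a, 'a list) rmodule \<times> ('a list \<Rightarrow> 'm) \<Rightarrow> 'm set" where "S = (\<lambda>(P, p). (\<lambda>(x, y). x \<oplus>\<^bsub>M\<^esub> y) ` (p ` carrier P \<times> rd M (arcs Q)))"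
  define good where "good = (\<lambda>(P, p). P \<in> fgmods A \<and> p \<in> rmod_hom A P M \<and> projective_rmod A P \<and>
    (\<forall>w\<in>verts Q. om P w = 0) \<and> (\<forall>w\<in>verts Q. out w \<noteq> {} \<longrightarrow> sx P w = 0) \<and>
    (\<forall>y\<in>carrier P. p y \<in> rd M (arcs Q) \<longrightarrow> y \<in> rd P (arcs Q)))"
  have subS: "submod A (S Pp) M" if gX: "good Pp" for Pp
  proof -
    obtain P p where Pp: "Pp = (P, p)" by (cases Pp)
    have "P \<in> fgmods A" "p \<in> rmod_hom A P M" using gX by (auto simp: Pp good_def)
    then show ?thesis
      unfolding S_def Pp prod.case
      by (intro submod_sum [OF M] submod_rad [OF M] submod_image [OF _ M] submod_carrier) (auto simp: fgmods_def intro: submod_carrier)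
  qed
  \<comment> \<open>The zero module is the starting point; its copy with a list carrier provides a
    first good pair.\<close>
  let ?Z = "M\<lparr>carrier := {\<zero>\<^bsub>M\<^esub>}\<rparr>"
  have fZ: "fdmod ?Z" using fdmod_submod [OF fM submod_zero [OF M]] .
  obtain Z where Z: "Z \<in> fgmods A" "rmod_iso A ?Z Z" using fgmod_copy [OF fZ] by auto
  have rZ: "right_module A Z" and fdZ: "fdmod Z" using Z by (auto simp: fgmods_iff fdmodD)
  have Z0: "carrier Z = {\<zero>\<^bsub>Z\<^esub>}" using iso_zero_carrier [OF fdmodD(1) [OF fZ] rZ Z(2)] by simp
  interpret Z: right_module A Z by (rule rZ)
  have "good (Z, \<lambda>_. \<zero>\<^bsub>M\<^esub>)"
    using Z Z0 zero_module_dims(4,5) [OF fdZ Z0] zero_module_projective [OF fdZ Z0] rd.zero [of Z "arcs Q"]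
    by (auto simp: good_def intro!: rmod_homI simp: M.ract_zero_left)
  moreover have "\<forall>Pp. good Pp \<longrightarrow> kdim (KM M) (S Pp) < Suc (kdim (KM M) (carrier M))"
    using K.kdim_mono [OF _ ksub_submod [OF submod_carrier [OF M]]] ksub_submod [OF subS] submodD(1) [OF subS]
    by (auto simp: less_Suc_eq_le)
  ultimately have "\<exists>Pp. good Pp \<and> (\<forall>Y. good Y \<longrightarrow> kdim (KM M) (S Y) \<le> kdim (KM M) (S Pp))"
    by (rule Lattices_Big.ex_has_greatest_nat)
  then obtain P p where g: "good (P, p)" and max: "\<And>Y. good Y \<Longrightarrow> kdim (KM M) (S Y) \<le> kdim (KM M) (S (P, p))"
    by auto
  have P: "P \<in> fgmods A" "p \<in> rmod_hom A P M" "projective_rmod A P"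
    "\<And>w. w \<in> verts Q \<Longrightarrow> om P w = 0" "\<And>w. \<lbrakk>w \<in> verts Q; out w \<noteq> {}\<rbrakk> \<Longrightarrow> sx P w = 0"
    "\<And>y. \<lbrakk>y \<in> carrier P; p y \<in> rd M (arcs Q)\<rbrakk> \<Longrightarrow> y \<in> rd P (arcs Q)"
    using g by (auto simp: good_def)
  have rP: "right_module A P" using P by (simp add: fgmods_def)
  have full: "x \<in> S (P, p)" if x: "x \<in> carrier M" for x
  proof (rule ccontr)
    assume nx: "x \<notin> S (P, p)"
    have "\<exists>P' p'. good (P', p') \<and> S (P, p) \<subset> S (P', p')"
      by (rule cover_step [where M = M and P = P and p = p and x = x, folded S_def];
          (fact M P x nx | (intro exI conjI; simp add: good_def)))
    then obtain P' p' where g': "good (P', p')" and less: "S (P, p) \<subset> S (P', p')" by blast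
    have "S (P, p) = S (P', p')"
      using K.kdim_mono_eq [OF ksub_submod [OF subS [OF g]] ksub_submod [OF subS [OF g']]]
        K.kdim_mono [OF ksub_submod [OF subS [OF g]] ksub_submod [OF subS [OF g']]] max [OF g'] less
      by (auto dest: psubset_imp_subset)
    then show False using less by simp
  qed
  have "p ` carrier P = carrier M"
  proof (rule nakayama [OF M submod_image [OF rP M P(2) submod_carrier [OF rP]]])
    fix x assume "x \<in> carrier M"
    then have "x \<in> S (P, p)" by (rule full)
    then show "\<exists>u\<in>p ` carrier P. \<exists>r\<in>rd M (arcs Q). x = u \<oplus>\<^bsub>M\<^esub> r" by (auto simp: S_def)
  qed
  then show ?thesis using that [OF P] by simp
qed

text \<open>Nakayama for a part of the radical; this is the minimality demanded by
  \<open>projective_cover\<close>.\<close>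

lemma superfluous_rad:
  assumes P: "right_module A P" and K: "K \<subseteq> rd P (arcs Q)" and U: "submod A U P"
    and sum: "U <+>\<^bsub>P\<^esub> K = carrier P"
  shows "U = carrier P"
proof (rule nakayama [OF P U])
  fix x assume "x \<in> carrier P"
  then have "x \<in> U <+>\<^bsub>P\<^esub> K" using sum by simp
  then show "\<exists>u\<in>U. \<exists>r\<in>rd P (arcs Q). x = u \<oplus>\<^bsub>P\<^esub> r" using K by (auto simp: set_add_def')
qed

lemma ker_sub_rad:
  assumes "right_module A M" "\<And>y. \<lbrakk>y \<in> carrier P; p y \<in> rd M (arcs Q)\<rbrakk> \<Longrightarrow> y \<in> rd P (arcs Q)"
  shows "{x \<in> carrier P. p x = \<zero>\<^bsub>M\<^esub>} \<subseteq> rd P (arcs Q)"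
  using assms(2) rd.zero [of M "arcs Q"] by auto

lemma syzygy_exists:
  assumes "fdmod M"
  obtains N where "N \<in> fgmods A" "is_syzygy A N M"
proof -
  obtain P p where P: "P \<in> fgmods A" "p \<in> rmod_hom A P M" "projective_rmod A P"
    "\<And>w. w \<in> verts Q \<Longrightarrow> om P w = 0" "\<And>w. \<lbrakk>w \<in> verts Q; out w \<noteq> {}\<rbrakk> \<Longrightarrow> sx P w = 0"
    "\<And>y. \<lbrakk>y \<in> carrier P; p y \<in> rd M (arcs Q)\<rbrakk> \<Longrightarrow> y \<in> rd P (arcs Q)"
    "p ` carrier P = carrier M"
    by (rule cover_exists [OF assms]) (rule that; assumption)
  have rP: "right_module A P" using P by (simp add: fgmods_def)
  note rM = fdmodD(1) [OF assms]
  have "projective_cover A P p M"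
    using P superfluous_rad [OF rP ker_sub_rad [OF rM P(6)]] by (auto simp: projective_cover_def)
  moreover have "P\<lparr>carrier := {x \<in> carrier P. p x = \<zero>\<^bsub>M\<^esub>}\<rparr> \<in> fgmods A"
    using fdmod_submod [OF _ submod_kernel [OF rP rM P(2)]] P(1) by (simp add: fgmods_iff)
  ultimately show ?thesis using that rmod_iso_refl P(1) by (fastforce simp: is_syzygy_def)
qed

text \<open>The identity of \<open>N\<close> lifts to the constructed cover, so \<open>N\<close> is
  a direct summand of it. Two nonnegative values with sum zero are both zero. Sinks are exempt for
  \<open>sx\<close> because the simple module there is itself projective.\<close>

lemma projective_om_sx:
  assumes N: "N \<in> fgmods A" and proj: "projective_rmod A N" and w: "w \<in> verts Q"
  shows "om N w = 0" "out w \<noteq> {} \<Longrightarrow> sx N w = 0"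
proof -
  have fN: "fdmod N" and rN: "right_module A N" using N by (auto simp: fgmods_iff fdmodD)
  obtain P p where P: "P \<in> fgmods A" "p \<in> rmod_hom A P N" "projective_rmod A P"
    "\<And>w. w \<in> verts Q \<Longrightarrow> om P w = 0" "\<And>w. \<lbrakk>w \<in> verts Q; out w \<noteq> {}\<rbrakk> \<Longrightarrow> sx P w = 0"
    "\<And>y. \<lbrakk>y \<in> carrier P; p y \<in> rd N (arcs Q)\<rbrakk> \<Longrightarrow> y \<in> rd P (arcs Q)"
    "p ` carrier P = carrier N"
    by (rule cover_exists [OF fN]) (rule that; assumption)
  have rP: "right_module A P" and fP: "fdmod P" using P by (auto simp: fgmods_iff fdmodD)
  obtain h where h: "h \<in> rmod_hom A N P" "\<And>x. x \<in> carrier N \<Longrightarrow> p (h x) = x"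
    using projective_lift [OF proj P(1) N P(2) rmod_hom_id P(7)] by metis
  let ?L = "P\<lparr>carrier := {x \<in> carrier P. p x = \<zero>\<^bsub>N\<^esub>}\<rparr>"
  have iso: "rmod_iso A P (dsum2 N ?L)" using rmod_retract_complement [OF rP rN h(1) P(2) h(2)] .
  have fL: "fdmod ?L" using fdmod_submod [OF fP submod_kernel [OF rP rN P(2)]] .
  note rD = fdmodD(1) [OF fdmod_dsum2 [OF fN fL]]
  note e = om_sx_iso [OF fP rD iso, of w] om_sx_dsum2 [OF fN fL, of w]
  show "om N w = 0" using e om_nonneg [OF fN, of w] om_nonneg [OF fL, of w] P(4) [OF w] by simp
  show "out w \<noteq> {} \<Longrightarrow> sx N w = 0"
    using e sx_nonneg [OF fN, of w] sx_nonneg [OF fL, of w] P(5) [OF w] by simp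
qed

theorem syzygy_dims:
  assumes M: "M \<in> fgmods A" and N: "N \<in> fgmods A" and syz: "is_syzygy A N M"
  shows "\<lbrakk>x \<in> carrier N; a \<in> arcs Q\<rbrakk> \<Longrightarrow> x \<star>\<^bsub>N\<^esub> ar a = \<zero>\<^bsub>N\<^esub>"
    and "w \<in> verts Q \<Longrightarrow> dp N w = om M w"
proof -
  have fM: "fdmod M" and rM: "right_module A M" and fN: "fdmod N" and rN: "right_module A N"
    using M N by (auto simp: fgmods_iff fdmodD)
  obtain P p where P: "P \<in> fgmods A" and pc: "projective_cover A P p M"
    and iso: "rmod_iso A N (P\<lparr>carrier := {x \<in> carrier P. p x = \<zero>\<^bsub>M\<^esub>}\<rparr>)"
    using syz by (auto simp: is_syzygy_def)
  have proj: "projective_rmod A P" and p: "p \<in> rmod_hom A P M" and surj: "p ` carrier P = carrier M"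
    and superfl: "\<And>U. \<lbrakk>submod A U P; U <+>\<^bsub>P\<^esub> {x \<in> carrier P. p x = \<zero>\<^bsub>M\<^esub>} = carrier P\<rbrakk> \<Longrightarrow> U = carrier P"
    using pc by (auto simp: projective_cover_def)
  have rP: "right_module A P" and fP: "fdmod P" using P by (auto simp: fgmods_iff fdmodD)
  interpret P: right_module A P by (rule rP)
  interpret M: right_module A M by (rule rM)
  let ?K = "{x \<in> carrier P. p x = \<zero>\<^bsub>M\<^esub>}"
  let ?L = "P\<lparr>carrier := ?K\<rparr>"
  obtain P0 p0 where P0: "P0 \<in> fgmods A" "p0 \<in> rmod_hom A P0 M" "projective_rmod A P0"
    "\<And>w. w \<in> verts Q \<Longrightarrow> om P0 w = 0" "\<And>w. \<lbrakk>w \<in> verts Q; out w \<noteq> {}\<rbrakk> \<Longrightarrow> sx P0 w = 0"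
    "\<And>y. \<lbrakk>y \<in> carrier P0; p0 y \<in> rd M (arcs Q)\<rbrakk> \<Longrightarrow> y \<in> rd P0 (arcs Q)"
    "p0 ` carrier P0 = carrier M"
    by (rule cover_exists [OF fM]) (rule that; assumption)
  have rP0: "right_module A P0" using P0 by (simp add: fgmods_def)
  interpret P0: right_module A P0 by (rule rP0)
  obtain h where h: "h \<in> rmod_hom A P P0" "\<And>x. x \<in> carrier P \<Longrightarrow> p0 (h x) = p x"
    using projective_lift [OF proj P0(1) M P0(2) p P0(7)] by metis
  \<comment> \<open>Any \<open>y\<close> differs from some \<open>h x\<close> by an element of the
    kernel of \<open>p0\<close>, which lies in the radical.\<close>
  have hs: "h ` carrier P = carrier P0"
  proof (rule nakayama [OF rP0 submod_image [OF rP rP0 h(1) submod_carrier [OF rP]]])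
    fix y assume y: "y \<in> carrier P0"
    then have "p0 y \<in> p ` carrier P" using rmod_homD(1) [OF P0(2)] surj by simp
    then obtain x where x: "x \<in> carrier P" "p x = p0 y" by auto
    let ?r = "y \<oplus>\<^bsub>P0\<^esub> \<ominus>\<^bsub>P0\<^esub> h x"
    have hx: "h x \<in> carrier P0" using x rmod_homD(1) [OF h(1)] by simp
    then have "p0 ?r = \<zero>\<^bsub>M\<^esub>"
      using x y h(2) rmod_homD [OF P0(2)] rmod_hom_neg [OF rP0 rM P0(2)] by (simp add: M.M.r_neg)
    then have "?r \<in> rd P0 (arcs Q)" using y hx rd.zero [of M "arcs Q"] by (intro P0(6)) auto
    moreover have "y = h x \<oplus>\<^bsub>P0\<^esub> ?r" using y hx by (simp add: P0.M.a_ac P0.M.r_neg P0.M.r_neg1 P0.M.r_neg2)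
    ultimately show "\<exists>u\<in>h ` carrier P. \<exists>r\<in>rd P0 (arcs Q). y = u \<oplus>\<^bsub>P0\<^esub> r" using x by blast
  qed
  obtain s where s: "s \<in> rmod_hom A P0 P" "\<And>x. x \<in> carrier P0 \<Longrightarrow> h (s x) = x"
    using projective_lift [OF P0(3) P P0(1) h(1) rmod_hom_id hs] by metis
  \<comment> \<open>Here superfluity enters: every \<open>y\<close> is \<open>s (h y)\<close> plus
    an element of the kernel of \<open>p\<close>.\<close>
  have "s ` carrier P0 = carrier P"
  proof (rule superfl [OF submod_image [OF rP0 rP s(1) submod_carrier [OF rP0]]])
    show "s ` carrier P0 <+>\<^bsub>P\<^esub> ?K = carrier P"
    proof (intro equalityI subsetI)
      fix y assume y: "y \<in> carrier P"
      let ?u = "s (h y)"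
      have c: "h y \<in> carrier P0" "?u \<in> carrier P" using y rmod_homD(1) [OF h(1)] rmod_homD(1) [OF s(1)] by auto
      let ?r = "y \<oplus>\<^bsub>P\<^esub> \<ominus>\<^bsub>P\<^esub> ?u"
      have "p ?u = p y" using h(2) [OF c(2)] h(2) [OF y] s(2) [OF c(1)] by simp
      then have "p ?r = \<zero>\<^bsub>M\<^esub>"
        using y c rmod_homD [OF p] rmod_hom_neg [OF rP rM p] by (simp add: M.M.r_neg)
      moreover have "y = ?u \<oplus>\<^bsub>P\<^esub> ?r" using y c by (simp add: P.M.a_ac P.M.r_neg P.M.r_neg1 P.M.r_neg2)
      ultimately show "y \<in> s ` carrier P0 <+>\<^bsub>P\<^esub> ?K" using y c unfolding set_add_def' by blast
    next
      fix y assume "y \<in> s ` carrier P0 <+>\<^bsub>P\<^esub> ?K"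
      then show "y \<in> carrier P" using rmod_homD(1) [OF s(1)] by (auto simp: set_add_def')
    qed
  qed
  then have sh: "s (h x) = x" if "x \<in> carrier P" for x
  proof -
    have "x \<in> s ` carrier P0" using that \<open>s ` carrier P0 = carrier P\<close> by simp
    then show ?thesis using s(2) by auto
  qed
  have Krad: "?K \<subseteq> rd P (arcs Q)"
  proof
    fix x assume x: "x \<in> ?K"
    then have "p0 (h x) = \<zero>\<^bsub>M\<^esub>" using h(2) by simp
    then have "h x \<in> rd P0 (arcs Q)"
      using x rmod_homD(1) [OF h(1)] rd.zero [of M "arcs Q"] by (intro P0(6)) auto
    then have "s (h x) \<in> rd P (arcs Q)" by (rule rd_hom [OF rP0 rP s(1)])
    then show "x \<in> rd P (arcs Q)" using sh x by simp
  qed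
  have subK: "submod A ?K P" by (rule submod_kernel [OF rP rM p])
  have fL: "fdmod ?L" using fdmod_submod [OF fP subK] .
  note rL = fdmodD(1) [OF fL]
  show "x \<star>\<^bsub>N\<^esub> ar a = \<zero>\<^bsub>N\<^esub>" if x: "x \<in> carrier N" "a \<in> arcs Q" for x a
  proof -
    obtain f g where f: "f \<in> rmod_hom A N ?L" and g: "g \<in> rmod_hom A ?L N"
      and gf: "\<And>x. x \<in> carrier N \<Longrightarrow> g (f x) = x"
      by (rule rmod_iso_inverse [OF rN iso]) (rule that; assumption)
    have fx: "f x \<in> carrier ?L" using rmod_homD(1) [OF f x(1)] .
    then have "f x \<in> rd P (arcs Q)" using Krad by auto
    then have "f x \<star>\<^bsub>P\<^esub> ar a = \<zero>\<^bsub>P\<^esub>" by (rule rd_ar [OF rP])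
    then have "f (x \<star>\<^bsub>N\<^esub> ar a) = \<zero>\<^bsub>?L\<^esub>" using rmod_homD(3) [OF f x(1)] by simp
    then show ?thesis
      using gf [of "x \<star>\<^bsub>N\<^esub> ar a"] right_module.ract_closed [OF rN x(1)] rmod_hom_zero [OF rL rN g] by simp
  qed
  assume w: "w \<in> verts Q"
  \<comment> \<open>As the kernel lies in the radical, passing from \<open>P\<close> to
    \<open>M\<close> lowers \<open>dp\<close> and \<open>dr\<close> by the same amount. So
    \<open>dp - dr\<close> agrees for \<open>P\<close> and \<open>M\<close>, and
    \<open>om P w = 0\<close> yields the dimension of the kernel.\<close>
  have key: "dp P w = dp M w + dp ?L w \<and> dr P w = dr M w + dp ?L w" for w
  proof -
    have ptL: "pt ?L w = {x \<in> pt P w. p x = \<zero>\<^bsub>KM M\<^esub>}" by (auto simp: pt_def)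
    have rdL: "pt ?L w = {x \<in> rd P (inn w). p x = \<zero>\<^bsub>KM M\<^esub>}"
    proof (intro equalityI subsetI)
      fix x assume x: "x \<in> pt ?L w"
      then have "x \<in> pt P w" "x \<in> rd P (arcs Q)" using Krad by (auto simp: pt_def)
      then show "x \<in> {x \<in> rd P (inn w). p x = \<zero>\<^bsub>KM M\<^esub>}" using rd_arcs_pt [OF rP] x ptL by auto
    qed (use rd_sub_pt [OF rP, of w] ptL in auto)
    have "pt P w \<subseteq> carrier P" by (auto simp: pt_def)
    from kdim_rank_nullity(1) [OF fdmodD(2) [OF fP] kspace_KM [OF rM] ksub_pt [OF rP] klin_hom [OF p this]]
    have 1: "dp P w = dp M w + dp ?L w"
      unfolding ptL [symmetric] pt_hom_surj [OF rP p surj] by (simp add: dp_def KM_sub)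
    from kdim_rank_nullity(1) [OF fdmodD(2) [OF fP] kspace_KM [OF rM] ksub_rd [OF rP] klin_hom [OF p rd_carrier [OF rP]], of "inn w"]
    have 2: "dr P w = dr M w + dp ?L w"
      unfolding rdL [symmetric] rd_hom_surj [OF rP rM p surj] by (simp add: dp_def dr_def KM_sub)
    show ?thesis using 1 2 by simp
  qed
  have "om P w = 0" using projective_om_sx(1) [OF P proj w] .
  then have "dr P w = (\<Sum>a\<in>inn w. dp P (tail Q a) - dr P (tail Q a))" by (simp add: om_def)
  also have "\<dots> = (\<Sum>a\<in>inn w. dp M (tail Q a) - dr M (tail Q a))"
    using key by (intro sum.cong) auto
  finally have "dp ?L w = om M w" using key [of w] by (simp add: om_def)
  then show "dp N w = om M w" using dims_iso(1) [OF fN rL iso, of w] by simp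
qed

end

lemma rmod_iso_dsum2_right:
  assumes "rmod_iso A K K'"
  shows "rmod_iso A (dsum2 L K) (dsum2 L K')"
proof -
  obtain f where f: "f \<in> rmod_hom A K K'" "bij_betw f (carrier K) (carrier K')"
    using assms by (auto simp: rmod_iso_def)
  have "map_prod (\<lambda>x. x) f \<in> rmod_hom A (dsum2 L K) (dsum2 L K')"
    using rmod_homD [OF f(1)] by (intro rmod_homI) auto
  moreover have "bij_betw (map_prod (\<lambda>x. x) f) (carrier (dsum2 L K)) (carrier (dsum2 L K'))"
    using bij_betw_map_prod [OF _ f(2), of "\<lambda>x. x" "carrier L" "carrier L"] by (simp add: bij_betw_def)
  ultimately show ?thesis by (auto simp: rmod_iso_def)
qed

lemma iso_class_eqI:
  assumes "right_module A M" "rmod_iso A M N"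
  shows "iso_class A M = iso_class A N"
proof -
  have N: "rmod_iso A N M" using rmod_iso_sym [OF assms] .
  show ?thesis unfolding iso_class_def
    by (intro Collect_cong conj_cong iffI refl) (erule rmod_iso_trans [OF N] rmod_iso_trans [OF assms(2)])+
qed

lemma iso_class_self: "M \<in> fgmods A \<Longrightarrow> M \<in> iso_class A M"
  by (simp add: iso_class_def rmod_iso_refl)

section \<open>Closure under integer combinations in free abelian groups\<close>

lemma frag_cmul_closed:
  assumes "(0::'c \<Rightarrow>\<^sub>0 int) \<in> X'" "\<And>x y. \<lbrakk>x \<in> X'; y \<in> X'\<rbrakk> \<Longrightarrow> x - y \<in> X'" "x \<in> X'"
  shows "frag_cmul n x \<in> X'"
proof -
  have neg: "- y \<in> X'" if "y \<in> X'" for y using assms(2) [OF assms(1) that] by simp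
  have add: "y + z \<in> X'" if "y \<in> X'" "z \<in> X'" for y z using assms(2) [OF that(1) neg [OF that(2)]] by simp
  have nat: "frag_cmul (int m) x \<in> X'" for m
  proof (induction m)
    case (Suc m)
    have "frag_cmul (int (Suc m)) x = x + frag_cmul (int m) x" by (simp add: frag_cmul_distrib)
    then show ?case using add [OF assms(3) Suc] by simp
  qed (simp add: assms(1))
  show ?thesis
  proof (cases "0 \<le> n")
    case True then show ?thesis using nat [of "nat n"] by simp
  next
    case False
    then have "n = - int (nat (- n))" by linarith
    then have "frag_cmul n x = - frag_cmul (int (nat (- n))) x" unfolding minus_frag_cmul by (rule arg_cong)
    then show ?thesis using neg [OF nat [of "nat (- n)"]] by (simp only:)
  qed
qed

lemma frag_sum_closed:
  assumes "(0::'c \<Rightarrow>\<^sub>0 int) \<in> X'" "\<And>x y. \<lbrakk>x \<in> X'; y \<in> X'\<rbrakk> \<Longrightarrow> x - y \<in> X'" "\<And>i. i \<in> I \<Longrightarrow> f i \<in> X'"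
  shows "sum f I \<in> X'"
proof -
  have neg: "- y \<in> X'" if "y \<in> X'" for y using assms(2) [OF assms(1) that] by simp
  have add: "y + z \<in> X'" if "y \<in> X'" "z \<in> X'" for y z using assms(2) [OF that(1) neg [OF that(2)]] by simp
  show ?thesis using assms(3) by (induction I rule: infinite_finite_induct) (auto simp: assms(1) add)
qed

section \<open>The group \<open>K\<^sub>0\<close>\<close>

abbreviation K0_free :: "('a, 'x) ring_scheme \<Rightarrow> ('a fgmod set \<Rightarrow>\<^sub>0 int) monoid" where
  "K0_free A \<equiv> free_Abelian_group (iso_class A ` fgmods A)"

definition cl :: "('a, 'x) ring_scheme \<Rightarrow> ('a, 'm, 'y) rmodule_scheme \<Rightarrow> 'a fgmod set \<Rightarrow>\<^sub>0 int" where
  "cl A M = frag_of (iso_class A M)"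

text \<open>Calculations take place on representatives in the free group, with the arithmetic of the
  type; by \<open>kcos_eq_iff\<close> an equality in the quotient becomes membership of a
  difference.\<close>

definition kcos :: "('a, 'x) ring_scheme \<Rightarrow> ('a fgmod set \<Rightarrow>\<^sub>0 int) \<Rightarrow> ('a fgmod set \<Rightarrow>\<^sub>0 int) set" where
  "kcos A x = K0_subgroup A #>\<^bsub>K0_free A\<^esub> x"

lemma K0_class_eq: "K0_class A M = kcos A (cl A M)"
  by (simp add: K0_class_def kcos_def cl_def)

lemma cl_carrier: "M \<in> fgmods A \<Longrightarrow> cl A M \<in> carrier (K0_free A)"
  by (simp add: cl_def)

lemma K0_free_closed:
  "0 \<in> carrier (K0_free A)"
  "\<lbrakk>x \<in> carrier (K0_free A); y \<in> carrier (K0_free A)\<rbrakk> \<Longrightarrow> x + y \<in> carrier (K0_free A)"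
  "\<lbrakk>x \<in> carrier (K0_free A); y \<in> carrier (K0_free A)\<rbrakk> \<Longrightarrow> x - y \<in> carrier (K0_free A)"
  using keys_add [of x y] keys_diff [of x y] by auto

lemma K0_relations_sub: "K0_relations A \<subseteq> carrier (K0_free A)"
  unfolding K0_relations_def cl_def [symmetric]
  using K0_free_closed(3) cl_carrier by blast

lemma K0_subgroup: "subgroup (K0_subgroup A) (K0_free A)"
  unfolding K0_subgroup_def by (intro group.generate_is_subgroup K0_relations_sub) simp

lemma K0_normal: "normal (K0_subgroup A) (K0_free A)"
  by (intro comm_group.subgroup_imp_normal abelian_free_Abelian_group K0_subgroup)

lemma K0_subgroup_sub: "x \<in> K0_subgroup A \<Longrightarrow> x \<in> carrier (K0_free A)"
  using subgroup.mem_carrier [OF K0_subgroup] by auto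

lemma K0_subgroup_closed:
  "0 \<in> K0_subgroup A"
  "\<lbrakk>x \<in> K0_subgroup A; y \<in> K0_subgroup A\<rbrakk> \<Longrightarrow> x + y \<in> K0_subgroup A"
  "x \<in> K0_subgroup A \<Longrightarrow> - x \<in> K0_subgroup A"
  "\<lbrakk>x \<in> K0_subgroup A; y \<in> K0_subgroup A\<rbrakk> \<Longrightarrow> x - y \<in> K0_subgroup A"
proof -
  note S = K0_subgroup [of A]
  show 0: "0 \<in> K0_subgroup A" using subgroup.one_closed [OF S] by simp
  show add: "\<lbrakk>x \<in> K0_subgroup A; y \<in> K0_subgroup A\<rbrakk> \<Longrightarrow> x + y \<in> K0_subgroup A" for x y
    using subgroup.m_closed [OF S] by simp
  show neg: "x \<in> K0_subgroup A \<Longrightarrow> - x \<in> K0_subgroup A" for x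
    using subgroup.m_inv_closed [OF S] K0_subgroup_sub [of x A] by (metis carrier_free_Abelian_group_iff inv_free_Abelian_group)
  show "\<lbrakk>x \<in> K0_subgroup A; y \<in> K0_subgroup A\<rbrakk> \<Longrightarrow> x - y \<in> K0_subgroup A"
    using add [of x "- y"] neg [of y] by simp
qed

lemma kcos_eq: "kcos A x = (\<lambda>h. h + x) ` K0_subgroup A"
  by (auto simp: kcos_def r_coset_def)

lemma kcos_eq_iff: "kcos A x = kcos A y \<longleftrightarrow> x - y \<in> K0_subgroup A"
proof
  assume e: "kcos A x = kcos A y"
  have "0 + x \<in> kcos A x" unfolding kcos_eq using K0_subgroup_closed(1) [of A] by (rule imageI)
  then have "x \<in> kcos A y" using e by simp
  then obtain h where "h \<in> K0_subgroup A" "x = h + y" by (auto simp: kcos_eq)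
  then show "x - y \<in> K0_subgroup A" by simp
next
  have *: "kcos A x \<subseteq> kcos A y" if "x - y \<in> K0_subgroup A" for x y
  proof
    fix z assume "z \<in> kcos A x"
    then obtain h where h: "h \<in> K0_subgroup A" "z = h + x" by (auto simp: kcos_eq)
    then have "z = (h + (x - y)) + y" by simp
    then show "z \<in> kcos A y" unfolding kcos_eq using K0_subgroup_closed(2) [OF h(1) that] by (rule image_eqI)
  qed
  assume d: "x - y \<in> K0_subgroup A"
  then have "y - x \<in> K0_subgroup A" using K0_subgroup_closed(3) by fastforce
  then show "kcos A x = kcos A y" using * d by (intro equalityI) auto
qed

lemma K0_group: "group (K0 A)"
  unfolding K0_def by (rule normal.factorgroup_is_group [OF K0_normal])

lemma K0_carrier: "carrier (K0 A) = kcos A ` carrier (K0_free A)"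
  by (auto simp: K0_def FactGroup_def RCOSETS_def kcos_def)

lemma K0_mult: "\<lbrakk>x \<in> carrier (K0_free A); y \<in> carrier (K0_free A)\<rbrakk> \<Longrightarrow>
    kcos A x \<otimes>\<^bsub>K0 A\<^esub> kcos A y = kcos A (x + y)"
  using normal.rcos_sum [OF K0_normal, of x A y] by (simp add: K0_def FactGroup_def kcos_def)

lemma K0_one: "\<one>\<^bsub>K0 A\<^esub> = kcos A 0"
proof -
  have "kcos A 0 = K0_subgroup A" by (simp add: kcos_eq)
  then show ?thesis by (simp add: K0_def FactGroup_def)
qed

lemma K0_inv:
  assumes "x \<in> carrier (K0_free A)"
  shows "inv\<^bsub>K0 A\<^esub> kcos A x = kcos A (- x)"
proof -
  have m: "- x \<in> carrier (K0_free A)" using assms by simp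
  show ?thesis
    using assms m K0_mult [OF m assms] by (intro group.inv_equality [OF K0_group]) (auto simp: K0_one K0_carrier)
qed

lemma cl_iso: "\<lbrakk>right_module A M; rmod_iso A M N\<rbrakk> \<Longrightarrow> cl A M = cl A N"
  by (simp add: cl_def iso_class_eqI)

lemma cl_dsum:
  assumes "M \<in> fgmods A" "M' \<in> fgmods A" "M'' \<in> fgmods A" "rmod_iso A M (dsum2 M' M'')"
  shows "cl A M - cl A M' - cl A M'' \<in> K0_subgroup A"
  unfolding K0_subgroup_def using assms
  by (intro generate.incl) (auto simp: K0_relations_def cl_def)

lemma cl_projective: "\<lbrakk>M \<in> fgmods A; projective_rmod A M\<rbrakk> \<Longrightarrow> cl A M \<in> K0_subgroup A"
  unfolding K0_subgroup_def by (intro generate.incl) (auto simp: K0_relations_def cl_def)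

text \<open>The additive extension of an integer valued isomorphism invariant \<open>g\<close> to the free abelian group.\<close>

definition fint :: "('a fgmod \<Rightarrow> int) \<Rightarrow> ('a fgmod set \<Rightarrow>\<^sub>0 int) \<Rightarrow> int" where
  "fint g x = Poly_Mapping.lookup (frag_extend (\<lambda>C. frag_cmul (g (SOME M. M \<in> C)) (frag_of ())) x) ()"

lemma fint_arith [simp]:
  "fint g 0 = 0" "fint g (x + y) = fint g x + fint g y" "fint g (x - y) = fint g x - fint g y"
  "fint g (- x) = - fint g x" "fint g (frag_cmul n x) = n * fint g x"
  by (simp_all add: fint_def frag_extend_add frag_extend_diff frag_extend_minus frag_extend_cmul
      lookup_add lookup_minus)

lemma fint_sum: "fint g (sum f I) = (\<Sum>i\<in>I. fint g (f i))"
  by (induction I rule: infinite_finite_induct) auto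

text \<open>The representative chosen from the class may differ from \<open>M\<close>, which is
  harmless for an isomorphism invariant.\<close>

lemma fint_cl:
  assumes "\<And>M N. \<lbrakk>M \<in> fgmods A; N \<in> fgmods A; rmod_iso A M N\<rbrakk> \<Longrightarrow> g M = g N" "M \<in> fgmods A"
  shows "fint g (cl A M) = g M"
proof -
  have "(SOME N. N \<in> iso_class A M) \<in> iso_class A M"
    using iso_class_self [OF assms(2)] by (rule someI)
  then have "g M = g (SOME N. N \<in> iso_class A M)"
    using assms by (auto simp: iso_class_def)
  then show ?thesis by (simp add: fint_def cl_def)
qed

text \<open>The universal property of \<open>K0\<close>: it suffices to check the two kinds of
  relations, as the extension of \<open>g\<close> is additive.\<close>

lemma fint_K0_subgroup:
  assumes iso: "\<And>M N. \<lbrakk>M \<in> fgmods A; N \<in> fgmods A; rmod_iso A M N\<rbrakk> \<Longrightarrow> g M = g N"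
    and add: "\<And>M M' M''. \<lbrakk>M \<in> fgmods A; M' \<in> fgmods A; M'' \<in> fgmods A; rmod_iso A M (dsum2 M' M'')\<rbrakk>
      \<Longrightarrow> g M = g M' + g M''"
    and proj: "\<And>P. \<lbrakk>P \<in> fgmods A; projective_rmod A P\<rbrakk> \<Longrightarrow> g P = 0"
    and x: "x \<in> K0_subgroup A"
  shows "fint g x = 0"
proof -
  have c: "fint g (frag_of (iso_class A M)) = g M" if "M \<in> fgmods A" for M
    using fint_cl [OF iso that] by (simp add: cl_def)
  have r: "fint g x = 0" if "x \<in> K0_relations A" for x
    using that unfolding K0_relations_def by (auto simp: c add proj)
  show ?thesis
    using x unfolding K0_subgroup_def
  proof (induction rule: generate.induct)
    case (inv h)
    then have "inv\<^bsub>K0_free A\<^esub> h = - h" using K0_relations_sub [of A] by auto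
    then show ?case using r inv by simp
  qed (auto simp: r)
qed

section \<open>Syzygies in \<open>K\<^sub>0\<close>\<close>

context radsq
begin

definition OM :: "'v \<Rightarrow> ('a fgmod set \<Rightarrow>\<^sub>0 int) \<Rightarrow> int" where "OM w = fint (\<lambda>M. om M w)"
definition SX :: "'v \<Rightarrow> ('a fgmod set \<Rightarrow>\<^sub>0 int) \<Rightarrow> int" where "SX w = fint (\<lambda>M. sx M w)"

lemma OM_cl: "M \<in> fgmods A \<Longrightarrow> OM w (cl A M) = om M w"
  unfolding OM_def by (rule fint_cl) (auto simp: fgmods_iff intro!: om_sx_iso fdmodD)

lemma SX_cl: "M \<in> fgmods A \<Longrightarrow> SX w (cl A M) = sx M w"
  unfolding SX_def by (rule fint_cl) (auto simp: fgmods_iff intro!: om_sx_iso fdmodD)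

lemma om_sx_split:
  assumes "M \<in> fgmods A" "M' \<in> fgmods A" "M'' \<in> fgmods A" "rmod_iso A M (dsum2 M' M'')"
  shows "om M w = om M' w + om M'' w" "sx M w = sx M' w + sx M'' w"
  using om_sx_iso [OF _ _ assms(4), of w] om_sx_dsum2 [of M' M'' w] assms fdmod_dsum2 [of M' M''] fdmodD
  by (auto simp: fgmods_iff)

lemma OM_K0: "\<lbrakk>x \<in> K0_subgroup A; w \<in> verts Q\<rbrakk> \<Longrightarrow> OM w x = 0"
  unfolding OM_def
  by (rule fint_K0_subgroup)
    (auto simp: om_sx_split projective_om_sx intro: om_sx_iso(1) [OF _ fdmodD(1)] simp: fgmods_iff [symmetric] dest: fgmods_iff [THEN iffD1])

lemma SX_K0: "\<lbrakk>x \<in> K0_subgroup A; w \<in> verts Q; out w \<noteq> {}\<rbrakk> \<Longrightarrow> SX w x = 0"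
  unfolding SX_def
  by (rule fint_K0_subgroup)
    (auto simp: om_sx_split projective_om_sx intro: om_sx_iso(2) [OF _ fdmodD(1)] simp: fgmods_iff [symmetric] dest: fgmods_iff [THEN iffD1])

section \<open>Classes of simple modules at the vertices in \<open>Dv\<close>\<close>

definition tmod :: "'v \<Rightarrow> 'e set \<Rightarrow> 'a fgmod" where
  "tmod v F = (SOME M. M \<in> fgmods A \<and> rmod_iso A (tm v F) M)"

lemma tmod:
  assumes "v \<in> verts Q" "F \<subseteq> out v"
  shows "tmod v F \<in> fgmods A" "rmod_iso A (tm v F) (tmod v F)"
    "cl A (tmod v F) = cl A (tm v F)"
    "u \<in> verts Q \<Longrightarrow> sx (tmod v F) u = (if u = v \<and> F = {} then 1 else 0)"
    "u \<in> verts Q \<Longrightarrow> om (tmod v F) u = int (card (out v \<inter> inn u)) - int (card (F \<inter> inn u))"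
proof -
  have fT: "fdmod (tm v F)" using fdmod_tm assms by auto
  have rT: "right_module A (tm v F)" using fdmodD fT by auto
  have "\<exists>M. M \<in> fgmods A \<and> rmod_iso A (tm v F) M"
    using fgmod_copy [OF fT] by metis
  from someI_ex [OF this] show t: "tmod v F \<in> fgmods A" "rmod_iso A (tm v F) (tmod v F)"
    by (simp_all add: tmod_def)
  show "cl A (tmod v F) = cl A (tm v F)" using cl_iso [OF rT t(2)] by simp
  have r: "right_module A (tmod v F)" using t by (simp add: fgmods_def)
  note i = om_sx_iso [OF fT r t(2), of u]
  show "u \<in> verts Q \<Longrightarrow> sx (tmod v F) u = (if u = v \<and> F = {} then 1 else 0)"
    using i sx_tm [OF assms, of u] by simp
  show "u \<in> verts Q \<Longrightarrow> om (tmod v F) u = int (card (out v \<inter> inn u)) - int (card (F \<inter> inn u))"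
    using i om_tm [OF assms, of u] by simp
qed

definition Dv :: "'v set" where "Dv = {v \<in> verts Q. out v \<noteq> {} \<and> inn v \<noteq> {}}"

lemma Dv: "finite Dv" "v \<in> Dv \<Longrightarrow> v \<in> verts Q" "v \<in> Dv \<Longrightarrow> out v \<noteq> {}" "v \<in> Dv \<Longrightarrow> inn v \<noteq> {}"
  by (auto simp: Dv_def)

definition combo :: "('v \<Rightarrow> int) \<Rightarrow> ('a fgmod set \<Rightarrow>\<^sub>0 int)" where
  "combo c = (\<Sum>v\<in>Dv. frag_cmul (c v) (cl A (tmod v {})))"

lemma combo_cong: "(\<And>v. v \<in> Dv \<Longrightarrow> c v = d v) \<Longrightarrow> combo c = combo d"
  unfolding combo_def by (intro sum.cong) auto

lemma combo_arith: "combo (\<lambda>v. c v + d v) = combo c + combo d" "combo (\<lambda>v. c v - d v) = combo c - combo d"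
  by (simp_all add: combo_def frag_cmul_distrib frag_cmul_diff_distrib sum.distrib sum_subtractf)

lemma combo_zero [simp]: "combo (\<lambda>_. 0) = 0"
  by (simp add: combo_def)

lemma combo_carrier: "combo c \<in> carrier (K0_free A)"
  unfolding combo_def
  by (intro frag_sum_closed frag_cmul_closed K0_free_closed cl_carrier tmod(1)) (auto simp: Dv)

lemma combo_unit: "v \<in> Dv \<Longrightarrow> combo (\<lambda>u. if u = v then 1 else 0) = cl A (tmod v {})"
proof -
  assume v: "v \<in> Dv"
  have "combo (\<lambda>u. if u = v then 1 else 0) = (\<Sum>u\<in>Dv. if u = v then cl A (tmod u {}) else 0)"
    unfolding combo_def by (rule sum.cong) auto
  then show ?thesis using v Dv(1) by simp
qed

lemma SX_combo: "w \<in> Dv \<Longrightarrow> SX w (combo c) = c w"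
proof -
  assume w: "w \<in> Dv"
  have "SX w (combo c) = (\<Sum>v\<in>Dv. c v * SX w (cl A (tmod v {})))"
    by (simp add: combo_def SX_def fint_sum)
  also have "\<dots> = (\<Sum>v\<in>Dv. if w = v then c v else 0)"
    using w by (intro sum.cong) (auto simp: SX_cl tmod(1,4) Dv)
  finally show ?thesis using w Dv(1) by simp
qed

lemma OM_combo: "w \<in> verts Q \<Longrightarrow> OM w (combo c) = (\<Sum>v\<in>Dv. c v * int (card (out v \<inter> inn w)))"
proof -
  assume w: "w \<in> verts Q"
  have "OM w (combo c) = (\<Sum>v\<in>Dv. c v * OM w (cl A (tmod v {})))"
    by (simp add: combo_def OM_def fint_sum)
  also have "\<dots> = (\<Sum>v\<in>Dv. c v * int (card (out v \<inter> inn w)))"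
    using w by (intro sum.cong) (auto simp: OM_cl tmod(1,5) Dv)
  finally show ?thesis .
qed

text \<open>\<open>SX w\<close> reads off the coefficient at \<open>w\<close>, and it factors
  through \<open>K0\<close> for \<open>w\<close> in \<open>Dv\<close> because such a vertex is not a
  sink.\<close>

lemma combo_inj: "kcos A (combo c) = kcos A (combo d) \<longleftrightarrow> (\<forall>v\<in>Dv. c v = d v)"
proof
  assume "kcos A (combo c) = kcos A (combo d)"
  then have "combo (\<lambda>v. c v - d v) \<in> K0_subgroup A" by (simp add: kcos_eq_iff combo_arith)
  then have "SX w (combo (\<lambda>v. c v - d v)) = 0" if "w \<in> Dv" for w using SX_K0 Dv(2,3) that by blast
  then show "\<forall>v\<in>Dv. c v = d v" by (simp add: SX_combo)
qed (metis combo_cong)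

section \<open>Modules killed by all arrows\<close>

lemma ex_pt:
  assumes N: "right_module A N" and "carrier N \<noteq> {\<zero>\<^bsub>N\<^esub>}"
    and ar0: "\<And>x a. \<lbrakk>x \<in> carrier N; a \<in> arcs Q\<rbrakk> \<Longrightarrow> x \<star>\<^bsub>N\<^esub> ar a = \<zero>\<^bsub>N\<^esub>"
  obtains w x where "w \<in> verts Q" "x \<in> pt N w" "x \<noteq> \<zero>\<^bsub>N\<^esub>"
proof -
  interpret N: right_module A N by (rule N)
  have "\<exists>w\<in>verts Q. \<exists>x\<in>pt N w. x \<noteq> \<zero>\<^bsub>N\<^esub>"
  proof (rule ccontr)
    assume no: "\<not> ?thesis"
    have "x = \<zero>\<^bsub>N\<^esub>" if x: "x \<in> carrier N" for x
    proof -
      have ex: "x \<star>\<^bsub>N\<^esub> ev w \<in> {\<zero>\<^bsub>N\<^esub>}" if "w \<in> verts Q" for w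
      proof -
        have "x \<star>\<^bsub>N\<^esub> ev w \<in> pt N w" using x by (simp add: pt_def N.ract_closed basis_act(1) [OF N])
        then show ?thesis using no that by blast
      qed
      have "x \<star>\<^bsub>N\<^esub> \<one>\<^bsub>A\<^esub> \<in> {\<zero>\<^bsub>N\<^esub>}"
        by (rule closed_under_basis [OF N _ _ _ _ x ex _ A.one_closed])
          (use ar0 x in \<open>auto simp: N.ract_zero_left\<close>)
      then show ?thesis using x N.ract_one by simp
    qed
    then show False using assms(2) N.M.zero_closed by blast
  qed
  then show ?thesis using that by blast
qed

context
  fixes N :: "('a, 'm, 'y) rmodule_scheme" and x :: 'm and w :: 'v
  assumes rN: "right_module A N" and x: "x \<in> pt N w"
    and xar: "\<And>a. a \<in> arcs Q \<Longrightarrow> x \<star>\<^bsub>N\<^esub> ar a = \<zero>\<^bsub>N\<^esub>"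
begin

interpretation N: right_module A N by (rule rN)

lemma line_act:
  "(x \<star>\<^bsub>N\<^esub> sc c) \<star>\<^bsub>N\<^esub> ev v = (if v = w then x \<star>\<^bsub>N\<^esub> sc c else \<zero>\<^bsub>N\<^esub>)"
  "a \<in> arcs Q \<Longrightarrow> (x \<star>\<^bsub>N\<^esub> sc c) \<star>\<^bsub>N\<^esub> ar a = \<zero>\<^bsub>N\<^esub>"
proof -
  have xc: "x \<in> carrier N" using x by (simp add: pt_def)
  show "(x \<star>\<^bsub>N\<^esub> sc c) \<star>\<^bsub>N\<^esub> ev v = (if v = w then x \<star>\<^bsub>N\<^esub> sc c else \<zero>\<^bsub>N\<^esub>)"
    using basis_act(1) [OF rN xc, of w v] basis_act(5) [OF rN xc, of "ev v" c] x N.ract_zero_left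
    by (auto simp: pt_def)
  show "a \<in> arcs Q \<Longrightarrow> (x \<star>\<^bsub>N\<^esub> sc c) \<star>\<^bsub>N\<^esub> ar a = \<zero>\<^bsub>N\<^esub>"
    using basis_act(5) [OF rN xc, of "ar a" c] xar N.ract_zero_left by simp
qed

lemma line_submod: "submod A (range (\<lambda>k. x \<star>\<^bsub>N\<^esub> sc k)) N"
proof (rule submod_basisI [OF rN])
  have xc: "x \<in> carrier N" using x by (simp add: pt_def)
  let ?L = "range (\<lambda>k. x \<star>\<^bsub>N\<^esub> sc k)"
  show "?L \<subseteq> carrier N" using xc N.ract_closed by auto
  show z: "\<zero>\<^bsub>N\<^esub> \<in> ?L" using N.ract_zero_right [OF xc] by (intro range_eqI [of _ _ 0]) (simp add: sc_zero)
  fix y assume "y \<in> ?L"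
  then obtain k where y: "y = x \<star>\<^bsub>N\<^esub> sc k" by auto
  show "y \<oplus>\<^bsub>N\<^esub> z \<in> ?L" if z: "z \<in> ?L" for z
  proof -
    obtain l where "z = x \<star>\<^bsub>N\<^esub> sc l" using z by auto
    then have "y \<oplus>\<^bsub>N\<^esub> z = x \<star>\<^bsub>N\<^esub> sc (k + l)" using y xc by (simp add: sc_plus N.ract_add_right)
    then show ?thesis by simp
  qed
  show "y \<star>\<^bsub>N\<^esub> sc l \<in> ?L" for l
  proof -
    have "y \<star>\<^bsub>N\<^esub> sc l = x \<star>\<^bsub>N\<^esub> sc (k * l)" using y xc by (simp add: sc_times N.ract_assoc)
    then show ?thesis by simp
  qed
  show "y \<star>\<^bsub>N\<^esub> ev v \<in> ?L" for v using y line_act(1) [of k v] z by auto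
  show "y \<star>\<^bsub>N\<^esub> ar a \<in> ?L" if "a \<in> arcs Q" for a using y line_act(2) [OF that, of k] z by auto
qed

lemma line_iso:
  assumes x0: "x \<noteq> \<zero>\<^bsub>N\<^esub>" and w: "w \<in> verts Q"
  shows "rmod_iso A (tm w {}) (N\<lparr>carrier := range (\<lambda>k. x \<star>\<^bsub>N\<^esub> sc k)\<rparr>)"
proof -
  have xc: "x \<in> carrier N" using x by (simp add: pt_def)
  let ?L = "N\<lparr>carrier := range (\<lambda>k. x \<star>\<^bsub>N\<^esub> sc k)\<rparr>"
  have rT: "right_module A (tm w {})" by (rule right_module_tm [OF w]) simp
  have rL: "right_module A ?L" by (rule right_module_submod [OF rN line_submod])
  let ?f = "\<lambda>(c, d :: 'e \<Rightarrow> 'k). x \<star>\<^bsub>N\<^esub> sc c"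
  have f: "?f \<in> rmod_hom A (tm w {}) ?L"
  proof (rule hom_basisI [OF rT rL])
    fix y k assume "y \<in> carrier (tm w {})"
    then show "?f (y \<star>\<^bsub>tm w {}\<^esub> sc k) = ?f y \<star>\<^bsub>?L\<^esub> sc k"
      using w xc by (cases y) (simp add: sc_times N.ract_assoc)
  next
    fix y v assume "y \<in> carrier (tm w {})" "v \<in> verts Q"
    then show "?f (y \<star>\<^bsub>tm w {}\<^esub> ev v) = ?f y \<star>\<^bsub>?L\<^esub> ev v"
      using w xc line_act(1) by (cases y) (auto simp: sc_zero N.ract_zero_right)
  next
    fix y a assume "y \<in> carrier (tm w {})" "a \<in> arcs Q"
    then show "?f (y \<star>\<^bsub>tm w {}\<^esub> ar a) = ?f y \<star>\<^bsub>?L\<^esub> ar a"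
      using w xc line_act(2) by (cases y) (auto simp: sc_zero N.ract_zero_right)
  next
    fix y z assume "y \<in> carrier (tm w {})" "z \<in> carrier (tm w {})"
    then show "?f (y \<oplus>\<^bsub>tm w {}\<^esub> z) = ?f y \<oplus>\<^bsub>?L\<^esub> ?f z"
      using xc by (cases y; cases z) (simp add: sc_plus N.ract_add_right)
  qed auto
  have "inj_on ?f (carrier (tm w {}))"
    unfolding rmod_hom_inj_iff [OF rT rL f]
  proof clarsimp
    fix c and d :: "'e \<Rightarrow> 'k" assume d: "\<forall>b. d b = 0" "x \<star>\<^bsub>N\<^esub> sc c = \<zero>\<^bsub>N\<^esub>"
    have "c = 0"
    proof (rule ccontr)
      assume c: "c \<noteq> 0"
      have "(x \<star>\<^bsub>N\<^esub> sc c) \<star>\<^bsub>N\<^esub> sc (inverse c) = x \<star>\<^bsub>N\<^esub> sc (c * inverse c)"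
        using xc by (simp add: sc_times N.ract_assoc)
      also have "\<dots> = x" using c xc by (simp add: sc_one N.ract_one)
      finally show False using d(2) x0 N.ract_zero_left by simp
    qed
    then show "c = 0 \<and> d = (\<lambda>_. 0)" using d by auto
  qed
  moreover have "?f ` carrier (tm w {}) = carrier ?L" by (auto simp: image_iff)
  ultimately show ?thesis using f by (auto simp: rmod_iso_def bij_betw_def)
qed

end

text \<open>Induction on the dimension, splitting off one line at a vertex \<open>w\<close>. The
  third hypothesis excludes sources, so either \<open>w\<close> lies in \<open>Dv\<close> and the
  line counts, or \<open>w\<close> is a sink and the line is projective and zero in
  \<open>K0\<close>.\<close>

lemma semisimple_class:
  assumes "N \<in> fgmods A" "\<And>x a. \<lbrakk>x \<in> carrier N; a \<in> arcs Q\<rbrakk> \<Longrightarrow> x \<star>\<^bsub>N\<^esub> ar a = \<zero>\<^bsub>N\<^esub>"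
    "\<And>w. \<lbrakk>w \<in> verts Q; inn w = {}\<rbrakk> \<Longrightarrow> pt N w \<subseteq> {\<zero>\<^bsub>N\<^esub>}"
  shows "cl A N - combo (dp N) \<in> K0_subgroup A"
  using assms
proof (induction "kdim (KM N) (carrier N)" arbitrary: N rule: less_induct)
  case less
  have fN: "fdmod N" and rN: "right_module A N" using less.prems(1) by (auto simp: fgmods_iff fdmodD)
  interpret N: right_module A N by (rule rN)
  interpret K: fkspace "KM N" by (rule fdmodD(2) [OF fN])
  show ?case
  proof (cases "carrier N = {\<zero>\<^bsub>N\<^esub>}")
    case True
    have "combo (dp N) = combo (\<lambda>_. 0)" by (rule combo_cong) (simp add: zero_module_dims [OF fN True])
    then show ?thesis
      using cl_projective [OF less.prems(1) zero_module_projective [OF fN True]] by simp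
  next
    case False
    have "\<exists>w\<in>verts Q. \<exists>x\<in>pt N w. x \<noteq> \<zero>\<^bsub>N\<^esub>"
      using ex_pt [OF rN False less.prems(2)] by blast
    then obtain w x where w: "w \<in> verts Q" and x: "x \<in> pt N w" "x \<noteq> \<zero>\<^bsub>N\<^esub>" by blast
    have xc: "x \<in> carrier N" using x by (simp add: pt_def)
    define L where "L = range (\<lambda>k. x \<star>\<^bsub>N\<^esub> sc k)"
    have kL: "ksub (KM N) L" using K.ksub_line [of x] xc by (simp add: L_def)
    have Lpt: "L \<subseteq> pt N w" using x ksub_pt [OF rN, of w] by (auto simp: L_def ksub_def)
    interpret Pt: fkspace "KM N\<lparr>carrier := pt N w\<rparr>" by (rule K.fkspace_sub [OF ksub_pt [OF rN]])
    have "ksub (KM N\<lparr>carrier := pt N w\<rparr>) L" using kL Lpt by (auto simp: ksub_def)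
    then obtain W where W: "ksub (KM N\<lparr>carrier := pt N w\<rparr>) W" "L \<inter> W = {\<zero>\<^bsub>N\<^esub>}"
      "\<And>y. y \<in> pt N w \<Longrightarrow> \<exists>u\<in>L. \<exists>z\<in>W. y = u \<oplus>\<^bsub>N\<^esub> z"
      using Pt.complement_exists [of L] by auto
    have kW: "ksub (KM N) W" "W \<subseteq> pt N w" using W(1) by (auto simp: ksub_def pt_def)
    \<comment> \<open>A complement of the line is needed only inside the vertex space at
      \<open>w\<close>. Its preimage under \<open>ev w\<close> contains all other vertex components
      and is a submodule because arrows act by zero.\<close>
    define U where "U = {y \<in> carrier N. y \<star>\<^bsub>N\<^esub> ev w \<in> W}"
    have W': "\<zero>\<^bsub>N\<^esub> \<in> W" "\<And>y z. \<lbrakk>y \<in> W; z \<in> W\<rbrakk> \<Longrightarrow> y \<oplus>\<^bsub>N\<^esub> z \<in> W" "\<And>k y. y \<in> W \<Longrightarrow> y \<star>\<^bsub>N\<^esub> sc k \<in> W"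
      using kW by (auto simp: ksub_def)
    have subL: "submod A L N" unfolding L_def
      by (rule line_submod [OF rN x(1) less.prems(2) [OF xc]])
    have subU: "submod A U N"
    proof (rule submod_basisI [OF rN])
      show "U \<subseteq> carrier N" "\<zero>\<^bsub>N\<^esub> \<in> U" using W'(1) by (auto simp: U_def N.ract_zero_left)
      show "y \<oplus>\<^bsub>N\<^esub> z \<in> U" if "y \<in> U" "z \<in> U" for y z
        using that W'(2) by (simp add: U_def N.ract_add_left)
      show "y \<star>\<^bsub>N\<^esub> sc k \<in> U" if "y \<in> U" for y k
        using that W'(3) by (simp add: U_def N.ract_closed basis_act(5) [OF rN])
      show "y \<star>\<^bsub>N\<^esub> ev v \<in> U" if "y \<in> U" for y v
        using that W'(1) by (simp add: U_def N.ract_closed basis_act(1) [OF rN])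
      show "y \<star>\<^bsub>N\<^esub> ar a \<in> U" if "y \<in> U" "a \<in> arcs Q" for y a
        using that W'(1) less.prems(2) by (simp add: U_def N.ract_zero_left)
    qed
    have LU: "L \<inter> U = {\<zero>\<^bsub>N\<^esub>}"
    proof (intro equalityI subsetI)
      fix y assume "y \<in> L \<inter> U"
      then have "y \<star>\<^bsub>N\<^esub> ev w = y" "y \<star>\<^bsub>N\<^esub> ev w \<in> W" "y \<in> L" using Lpt by (auto simp: pt_def U_def)
      then show "y \<in> {\<zero>\<^bsub>N\<^esub>}" using W(2) by (metis IntI)
    qed (use submodD(2) [OF subL] submodD(2) [OF subU] in auto)
    have LUsum: "\<exists>u\<in>L. \<exists>z\<in>U. y = u \<oplus>\<^bsub>N\<^esub> z" if y: "y \<in> carrier N" for y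
    proof -
      have "y \<star>\<^bsub>N\<^esub> ev w \<in> pt N w" using y by (simp add: pt_def N.ract_closed basis_act(1) [OF rN])
      then obtain u z where uz: "u \<in> L" "z \<in> W" "y \<star>\<^bsub>N\<^esub> ev w = u \<oplus>\<^bsub>N\<^esub> z" using W(3) by blast
      have c: "u \<in> carrier N" "z \<in> carrier N" "u \<star>\<^bsub>N\<^esub> ev w = u"
        using uz Lpt kW by (auto simp: pt_def)
      let ?r = "y \<oplus>\<^bsub>N\<^esub> \<ominus>\<^bsub>N\<^esub> u"
      have nu: "\<ominus>\<^bsub>N\<^esub> u = u \<star>\<^bsub>N\<^esub> (\<ominus>\<^bsub>A\<^esub> \<one>\<^bsub>A\<^esub>)" using c by (simp add: N.ract_minus_one)
      have "\<ominus>\<^bsub>N\<^esub> u \<in> L" using submod_neg [OF rN subL] uz by simp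
      then have "\<ominus>\<^bsub>N\<^esub> u \<star>\<^bsub>N\<^esub> ev w = \<ominus>\<^bsub>N\<^esub> u" using Lpt by (auto simp: pt_def)
      then have "?r \<star>\<^bsub>N\<^esub> ev w = z"
        using c y uz(3) N.M.r_neg2 [of u z] by (simp add: N.ract_add_left N.M.a_ac)
      then have "?r \<in> U" using c y uz by (simp add: U_def)
      moreover have "y = u \<oplus>\<^bsub>N\<^esub> ?r" using c y N.M.r_neg2 [of u y] by (simp add: N.M.a_ac)
      ultimately show ?thesis using uz(1) by blast
    qed
    let ?L = "N\<lparr>carrier := L\<rparr>" and ?U = "N\<lparr>carrier := U\<rparr>"
    have fL: "fdmod ?L" and fU: "fdmod ?U" using fdmod_submod [OF fN] subL subU by auto
    note rL = fdmodD(1) [OF fL] and rU = fdmodD(1) [OF fU]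
    have iso: "rmod_iso A N (dsum2 ?L ?U)"
      using rmod_iso_sym [OF right_module_dsum2 [OF rL rU] internal_direct_sum [OF rN subL subU LU LUsum]] .
    have isoL: "rmod_iso A (tm w {}) ?L" unfolding L_def
      by (rule line_iso [OF rN x(1) less.prems(2) [OF xc] x(2) w])
    have Lm: "?L \<in> fgmods A" and Um: "?U \<in> fgmods A" using fL fU by (auto simp: fgmods_iff)
    have clL: "cl A ?L = cl A (tmod w {})"
      using cl_iso [OF right_module_tm [OF w] isoL] tmod(3) [OF w, of "{}"] by simp
    have dpL: "dp ?L u = (if u = w then 1 else 0)" if "u \<in> verts Q" for u
      using dims_iso(1) [OF fdmod_tm [OF w] rL isoL, of u] dp_tm [OF w _ that, of "{}"] dr_tm [OF w, of "{}" u] by simp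
    have dpN: "dp N u = dp ?L u + dp ?U u" for u
      using dims_iso(1) [OF fN right_module_dsum2 [OF rL rU] iso, of u] dims_dsum2(1) [OF fL fU, of u] by simp
    have "U \<noteq> carrier N"
    proof
      assume "U = carrier N"
      then have "x \<in> L \<inter> U"
        using xc N.ract_one [OF xc] by (auto simp: L_def sc_one [symmetric] intro!: range_eqI [of _ _ 1])
      then show False using LU x(2) by simp
    qed
    then have "kdim (KM N) U < kdim (KM N) (carrier N)"
      using K.kdim_mono [OF ksub_submod [OF subU] ksub_submod [OF submod_carrier [OF rN]] submodD(1) [OF subU]]
        K.kdim_mono_eq [OF ksub_submod [OF subU] ksub_submod [OF submod_carrier [OF rN]] submodD(1) [OF subU]]
      by linarith
    then have IH: "cl A ?U - combo (dp ?U) \<in> K0_subgroup A"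
    proof (intro less.hyps [OF _ Um])
      show "kdim (KM ?U) (carrier ?U) < kdim (KM N) (carrier N)"
        if "kdim (KM N) U < kdim (KM N) (carrier N)" using that by (simp add: KM_sub)
      show "y \<star>\<^bsub>?U\<^esub> ar a = \<zero>\<^bsub>?U\<^esub>" if "y \<in> carrier ?U" "a \<in> arcs Q" for y a
        using less.prems(2) [of y a] that submodD(1) [OF subU] by auto
      show "pt ?U v \<subseteq> {\<zero>\<^bsub>?U\<^esub>}" if "v \<in> verts Q" "inn v = {}" for v
        using less.prems(3) [OF that] submodD(1) [OF subU] by (auto simp: pt_def)
    qed
    have split: "cl A N - cl A ?L - cl A ?U \<in> K0_subgroup A"
      by (rule cl_dsum [OF less.prems(1) Lm Um iso])
    have inw: "inn w \<noteq> {}" using less.prems(3) [OF w] x by auto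
    show ?thesis
    proof (cases "w \<in> Dv")
      case True
      have "combo (dp N) = combo (\<lambda>u. (if u = w then 1 else 0) + dp ?U u)"
        by (rule combo_cong) (simp add: dpN dpL Dv)
      then have "combo (dp N) = cl A ?L + combo (dp ?U)" using combo_unit [OF True] clL by (simp add: combo_arith)
      then have "cl A N - combo (dp N) = (cl A N - cl A ?L - cl A ?U) + (cl A ?U - combo (dp ?U))" by simp
      then show ?thesis using K0_subgroup_closed(2) [OF split IH] by (simp only:)
    next
      case False
      \<comment> \<open>Sources having been excluded, a vertex outside \<open>Dv\<close> can only be
        a sink here.\<close>
      then have ow: "out w = {}" using inw w unfolding Dv_def by blast
      have "projective_rmod A (tm w {})" using projective_tm [OF w] ow by simp
      then have "projective_rmod A ?L"
        using projective_iso [OF _ right_module_tm [OF w] rL isoL] by simp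
      then have pL: "cl A ?L \<in> K0_subgroup A" by (rule cl_projective [OF Lm])
      have "combo (dp N) = combo (dp ?U)"
        by (rule combo_cong) (use False dpN dpL Dv(2) in auto)
      then have "cl A N - combo (dp N) = (cl A N - cl A ?L - cl A ?U) + cl A ?L + (cl A ?U - combo (dp ?U))" by simp
      then show ?thesis using K0_subgroup_closed(2) [OF K0_subgroup_closed(2) [OF split pL] IH] by (simp only:)
    qed
  qed
qed

lemma om_source:
  assumes "M \<in> fgmods A" "inn w = {}"
  shows "om M w = 0"
proof -
  have fM: "fdmod M" using assms by (simp add: fgmods_iff)
  interpret K: fkspace "KM M" by (rule fdmodD(2) [OF fM])
  have "rd M {} = {\<zero>\<^bsub>KM M\<^esub>}"
  proof (intro equalityI subsetI)
    fix x assume "x \<in> rd M {}" then show "x \<in> {\<zero>\<^bsub>KM M\<^esub>}" by induction auto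
  qed (auto intro: rd.zero)
  then show ?thesis using K.kdim_zero by (simp add: om_def dr_def assms(2))
qed

lemma dp_zero_pt:
  assumes "fdmod M" "dp M w = 0"
  shows "pt M w = {\<zero>\<^bsub>M\<^esub>}"
  using fkspace.kdim_eq_0 [OF fdmodD(2) [OF assms(1)] ksub_pt [OF fdmodD(1) [OF assms(1)]], of w] assms(2)
  by (simp add: dp_def)

text \<open>A syzygy is killed by all arrows and has nothing at sources, since \<open>om\<close> is
  zero there; its vertex dimensions are the values of \<open>om\<close>.\<close>

lemma syzygy_class:
  assumes M: "M \<in> fgmods A" and N: "N \<in> fgmods A" and syz: "is_syzygy A N M"
  shows "kcos A (cl A N) = kcos A (combo (om M))"
proof -
  note d = syzygy_dims [OF M N syz]
  have "pt N w \<subseteq> {\<zero>\<^bsub>N\<^esub>}" if "w \<in> verts Q" "inn w = {}" for w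
    using dp_zero_pt [of N w] d(2) [OF that(1)] om_source [OF M that(2)] N by (simp add: fgmods_iff)
  then have "cl A N - combo (dp N) \<in> K0_subgroup A" using d(1) by (intro semisimple_class [OF N])
  moreover have "combo (dp N) = combo (om M)" by (rule combo_cong) (simp add: d(2) Dv)
  ultimately show ?thesis by (simp add: kcos_eq_iff)
qed

text \<open>Simple modules at sinks vanish in \<open>K\<^sub>0\<close> and simple modules at sources do not occur in syzygies, so that
  the syzygy of any class is an integer combination of the simple modules at the vertices in \<open>Dv\<close>.\<close>

theorem Omega_bar_kcos:
  assumes "x \<in> carrier (K0_free A)"
  shows "Omega_bar A (kcos A x) = kcos A (combo (\<lambda>w. OM w x))"
proof -
  define P where "P h \<longleftrightarrow> h \<in> hom (K0 A) (K0 A) \<and> h \<in> extensional (carrier (K0 A)) \<and>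
        (\<forall>M\<in>fgmods A. \<forall>N\<in>fgmods A. is_syzygy A N M \<longrightarrow> h (K0_class A M) = K0_class A N)" for h
  \<comment> \<open>The value is computed from a chosen representative; it is independent of the
    choice because \<open>OM\<close> vanishes on the relations.\<close>
  define h where "h = (\<lambda>C\<in>carrier (K0 A). kcos A (combo (\<lambda>w. OM w (SOME x. x \<in> carrier (K0_free A) \<and> C = kcos A x))))"
  have h: "h (kcos A x) = kcos A (combo (\<lambda>w. OM w x))" if x: "x \<in> carrier (K0_free A)" for x
  proof -
    define y where "y = (SOME y. y \<in> carrier (K0_free A) \<and> kcos A x = kcos A y)"
    have "\<exists>y. y \<in> carrier (K0_free A) \<and> kcos A x = kcos A y" using x by blast
    from someI_ex [OF this] have "kcos A x = kcos A y" by (simp add: y_def)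
    then have "x - y \<in> K0_subgroup A" by (simp add: kcos_eq_iff)
    then have "OM w (x - y) = 0" if "w \<in> verts Q" for w using OM_K0 that by blast
    then have "combo (\<lambda>w. OM w x) = combo (\<lambda>w. OM w y)"
      by (intro combo_cong) (simp add: OM_def Dv)
    then show ?thesis using x by (simp add: h_def K0_carrier y_def)
  qed
  have "P h" unfolding P_def
  proof (intro conjI ballI impI)
    show "h \<in> hom (K0 A) (K0 A)"
    proof (rule homI)
      fix C assume "C \<in> carrier (K0 A)"
      then show "h C \<in> carrier (K0 A)" using h combo_carrier by (auto simp: K0_carrier)
      fix C' assume "C' \<in> carrier (K0 A)"
      with \<open>C \<in> carrier (K0 A)\<close> obtain x y where xy: "x \<in> carrier (K0_free A)" "y \<in> carrier (K0_free A)"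
        "C = kcos A x" "C' = kcos A y" unfolding K0_carrier by blast
      then show "h (C \<otimes>\<^bsub>K0 A\<^esub> C') = h C \<otimes>\<^bsub>K0 A\<^esub> h C'"
        using h [OF K0_free_closed(2)] combo_arith(1) [of "\<lambda>w. OM w x" "\<lambda>w. OM w y"]
        by (simp only: K0_mult combo_carrier h) (simp add: OM_def)
    qed
    show "h \<in> extensional (carrier (K0 A))" by (simp add: h_def)
    fix M N assume "M \<in> fgmods A" "N \<in> fgmods A" "is_syzygy A N M"
    then show "h (K0_class A M) = K0_class A N"
      using syzygy_class h [OF cl_carrier] by (simp add: K0_class_eq OM_cl)
  qed
  \<comment> \<open>Every finitely generated module has a syzygy, so the defining property fixes a
    homomorphism on all generators of \<open>K0\<close>. This makes the \<open>THE\<close> in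
    \<open>Omega_bar\<close> determined.\<close>
  moreover have "h' = h" if h': "P h'" for h'
  proof (rule extensionalityI [of _ "carrier (K0 A)"])
    fix C assume "C \<in> carrier (K0 A)"
    then obtain x where x: "x \<in> carrier (K0_free A)" "C = kcos A x" by (auto simp: K0_carrier)
    have H: "h' \<in> hom (K0 A) (K0 A)" "h \<in> hom (K0 A) (K0 A)" using h' \<open>P h\<close> by (auto simp: P_def)
    interpret G: group "K0 A" by (rule K0_group)
    interpret h': group_hom "K0 A" "K0 A" h' by unfold_locales (rule H)
    interpret h: group_hom "K0 A" "K0 A" h by unfold_locales (rule H)
    have xk: "Poly_Mapping.keys x \<subseteq> iso_class A ` fgmods A" using x by simp
    have "h' (kcos A x) = h (kcos A x)"
    proof (rule free_Abelian_group_induct [OF xk])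
      show "h' (kcos A 0) = h (kcos A 0)" using h'.hom_one h.hom_one by (simp add: K0_one)
      fix x y assume xy: "Poly_Mapping.keys x \<subseteq> iso_class A ` fgmods A" "Poly_Mapping.keys y \<subseteq> iso_class A ` fgmods A"
        and e: "h' (kcos A x) = h (kcos A x)" "h' (kcos A y) = h (kcos A y)"
      have xy': "x \<in> carrier (K0_free A)" "y \<in> carrier (K0_free A)" "- y \<in> carrier (K0_free A)"
        using xy by auto
      have c: "kcos A x \<in> carrier (K0 A)" "kcos A y \<in> carrier (K0 A)" using xy' by (auto simp: K0_carrier)
      have d: "kcos A (x - y) = kcos A x \<otimes>\<^bsub>K0 A\<^esub> inv\<^bsub>K0 A\<^esub> kcos A y"
        using K0_mult [OF xy'(1,3)] K0_inv [OF xy'(2)] by simp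
      show "h' (kcos A (x - y)) = h (kcos A (x - y))"
        unfolding d using c e by simp
    next
      fix C assume "C \<in> iso_class A ` fgmods A"
      then obtain M where M: "C = iso_class A M" "M \<in> fgmods A" by auto
      obtain N where N: "N \<in> fgmods A" "is_syzygy A N M" using syzygy_exists M(2) by (auto simp: fgmods_iff)
      then have "h' (K0_class A M) = K0_class A N" "h (K0_class A M) = K0_class A N"
        using h' \<open>P h\<close> M by (auto simp: P_def)
      then show "h' (kcos A (frag_of C)) = h (kcos A (frag_of C))"
        using M by (simp add: K0_class_eq cl_def)
    qed
    then show "h' C = h C" using x by simp
  qed (use h' in \<open>auto simp: P_def h_def\<close>)
  ultimately have "(THE h. P h) = h" by (intro the_equality)
  then have "Omega_bar A = h" by (simp add: Omega_bar_def P_def)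
  then show ?thesis using h [OF assms] by simp
qed

end

section \<open>Stabilization of iterated images\<close>

definition phi_stable :: "('g \<Rightarrow> 'g) \<Rightarrow> 'g set \<Rightarrow> nat \<Rightarrow> bool" where
  "phi_stable h G l \<longleftrightarrow> (\<forall>s. inj_on h ((h ^^ (l + s)) ` G))"

lemma phi_eq: "phi A M = (LEAST l. phi_stable (Omega_bar A) (add_subgroup A M) l)"
  by (simp add: phi_def phi_stable_def)

lemma phi_stable_mono: "\<lbrakk>phi_stable h G l; G' \<subseteq> G\<rbrakk> \<Longrightarrow> phi_stable h G' l"
  unfolding phi_stable_def by (meson image_mono inj_on_subset)

lemma phi_stable_le: "\<lbrakk>phi_stable h G l; l \<le> m\<rbrakk> \<Longrightarrow> phi_stable h G m"
  unfolding phi_stable_def by (metis le_iff_add add.assoc)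

text \<open>The index shift responsible for the summand 1 in the theorem.\<close>

lemma phi_stable_image: "phi_stable h (h ` G) l \<longleftrightarrow> phi_stable h G (Suc l)"
proof -
  have "(h ^^ (l + s)) ` h ` G = (h ^^ (Suc l + s)) ` G" for s
    by (simp add: image_image funpow_swap1)
  then show ?thesis by (simp add: phi_stable_def)
qed

context radsq
begin

section \<open>The subgroups \<open>\<langle>add M\<rangle>\<close>\<close>

lemma summand_iff_retract:
  assumes M: "fdmod M" and L: "L \<in> fgmods A"
  shows "(\<exists>K\<in>fgmods A. rmod_iso A M (dsum2 L K)) \<longleftrightarrow> rmod_retract A L M"
proof
  have rL: "right_module A L" using L by (simp add: fgmods_def)
  note rM = fdmodD(1) [OF M]
  assume "\<exists>K\<in>fgmods A. rmod_iso A M (dsum2 L K)"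
  then obtain K where K: "K \<in> fgmods A" "rmod_iso A M (dsum2 L K)" by blast
  have "right_module A K" using K by (simp add: fgmods_def)
  then show "rmod_retract A L M"
    using rmod_retract_trans [OF rmod_retract_dsum2(1) [OF rL] rmod_retract_iso(2) [OF rM K(2)]] by simp
next
  have rL: "right_module A L" using L by (simp add: fgmods_def)
  note rM = fdmodD(1) [OF M]
  assume "rmod_retract A L M"
  then obtain i p where ip: "i \<in> rmod_hom A L M" "p \<in> rmod_hom A M L" "\<And>x. x \<in> carrier L \<Longrightarrow> p (i x) = x"
    by (auto simp: rmod_retract_def)
  let ?K = "M\<lparr>carrier := {x \<in> carrier M. p x = \<zero>\<^bsub>L\<^esub>}\<rparr>"
  have iso: "rmod_iso A M (dsum2 L ?K)" by (rule rmod_retract_complement [OF rM rL ip])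
  have "fdmod ?K" using fdmod_submod [OF M submod_kernel [OF rM rL ip(2)]] .
  then obtain K where K: "K \<in> fgmods A" "rmod_iso A ?K K" by (rule fgmod_copy) (rule that; assumption)
  then show "\<exists>K\<in>fgmods A. rmod_iso A M (dsum2 L K)"
    using rmod_iso_trans [OF iso rmod_iso_dsum2_right [OF K(2)]] by blast
qed

definition add_gens :: "('a, 'm, 'y) rmodule_scheme \<Rightarrow> ('a fgmod set \<Rightarrow>\<^sub>0 int) set set" where
  "add_gens M = {K0_class A N | N. N \<in> fgmods A \<and> indecomposable_rmod A N \<and> rmod_retract A N M}"

lemma add_subgroup_eq: "fdmod M \<Longrightarrow> add_subgroup A M = generate (K0 A) (add_gens M)"
  unfolding add_subgroup_def add_gens_def using summand_iff_retract by (metis (no_types, lifting))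

lemma add_gens_carrier: "add_gens M \<subseteq> carrier (K0 A)"
  unfolding add_gens_def K0_class_eq K0_carrier using cl_carrier by blast

lemma add_subgroup_subgroup: "fdmod M \<Longrightarrow> subgroup (add_subgroup A M) (K0 A)"
  by (simp add: add_subgroup_eq group.generate_is_subgroup [OF K0_group add_gens_carrier])

lemma add_subgroup_retract:
  assumes "fdmod M" "fdmod N" "rmod_retract A N M"
  shows "add_subgroup A N \<subseteq> add_subgroup A M"
proof -
  have "add_gens N \<subseteq> add_gens M"
    using rmod_retract_trans [OF _ assms(3)] unfolding add_gens_def by blast
  then show ?thesis
    using group.mono_generate [OF K0_group] assms by (simp add: add_subgroup_eq)
qed

text \<open>The preimage of \<open>add_subgroup A M\<close> in the free group, where membership can
  be shown by adding, subtracting and adjusting by relations.\<close>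

definition addset :: "('a, 'm, 'y) rmodule_scheme \<Rightarrow> ('a fgmod set \<Rightarrow>\<^sub>0 int) set" where
  "addset M = {x \<in> carrier (K0_free A). kcos A x \<in> add_subgroup A M}"

lemma addset_closed:
  assumes "fdmod M"
  shows "0 \<in> addset M" "\<lbrakk>x \<in> addset M; y \<in> addset M\<rbrakk> \<Longrightarrow> x - y \<in> addset M"
    "\<lbrakk>x \<in> addset M; y \<in> addset M\<rbrakk> \<Longrightarrow> x + y \<in> addset M"
    "\<lbrakk>x \<in> addset M; y \<in> carrier (K0_free A); y - x \<in> K0_subgroup A\<rbrakk> \<Longrightarrow> y \<in> addset M"
proof -
  note S = add_subgroup_subgroup [OF assms]
  show "0 \<in> addset M" using subgroup.one_closed [OF S] K0_free_closed(1) by (simp add: addset_def K0_one)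
  show "x - y \<in> addset M" if xy: "x \<in> addset M" "y \<in> addset M" for x y
  proof -
    have c: "x \<in> carrier (K0_free A)" "y \<in> carrier (K0_free A)" "- y \<in> carrier (K0_free A)"
      using xy by (auto simp: addset_def)
    have "kcos A x \<otimes>\<^bsub>K0 A\<^esub> inv\<^bsub>K0 A\<^esub> kcos A y \<in> add_subgroup A M"
      using xy subgroup.m_closed [OF S] subgroup.m_inv_closed [OF S] by (simp add: addset_def)
    then have "kcos A (x - y) \<in> add_subgroup A M" using K0_mult [OF c(1,3)] K0_inv [OF c(2)] by simp
    then show ?thesis using K0_free_closed(3) [OF c(1,2)] by (simp add: addset_def)
  qed
  show "x + y \<in> addset M" if xy: "x \<in> addset M" "y \<in> addset M" for x y
  proof -
    have c: "x \<in> carrier (K0_free A)" "y \<in> carrier (K0_free A)"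
      using xy by (auto simp: addset_def)
    have "kcos A x \<otimes>\<^bsub>K0 A\<^esub> kcos A y \<in> add_subgroup A M"
      using xy subgroup.m_closed [OF S] by (simp add: addset_def)
    then show ?thesis using K0_mult [OF c] K0_free_closed(2) [OF c] by (simp add: addset_def)
  qed
  show "\<lbrakk>x \<in> addset M; y \<in> carrier (K0_free A); y - x \<in> K0_subgroup A\<rbrakk> \<Longrightarrow> y \<in> addset M"
    using kcos_eq_iff [of A y x] by (simp add: addset_def)
qed

lemma addset_cmul: "\<lbrakk>fdmod M; x \<in> addset M\<rbrakk> \<Longrightarrow> frag_cmul n x \<in> addset M"
  by (rule frag_cmul_closed [OF addset_closed(1,2)])

lemma addset_sum: "\<lbrakk>fdmod M; \<And>i. i \<in> I \<Longrightarrow> f i \<in> addset M\<rbrakk> \<Longrightarrow> sum f I \<in> addset M"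
  by (rule frag_sum_closed [OF addset_closed(1,2)])

lemma kdim_dsum2_carrier:
  assumes "fdmod N" "fdmod N'"
  shows "kdim (KM (dsum2 N N')) (carrier (dsum2 N N')) = kdim (KM N) (carrier N) + kdim (KM N') (carrier N')"
  using kdim_kprod(2) [OF fdmodD(2) [OF assms(1)] fdmodD(2) [OF assms(2)]
      ksub_submod [OF submod_carrier [OF fdmodD(1) [OF assms(1)]]] ksub_submod [OF submod_carrier [OF fdmodD(1) [OF assms(2)]]]]
  by (simp add: KM_dsum2)

lemma kdim_iso_carrier:
  assumes "fdmod M" "right_module A N" "rmod_iso A M N"
  shows "kdim (KM M) (carrier M) = kdim (KM N) (carrier N)"
proof -
  obtain f where f: "f \<in> rmod_hom A M N" "inj_on f (carrier M)" "f ` carrier M = carrier N"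
    using assms(3) by (auto simp: rmod_iso_def bij_betw_def)
  show ?thesis
    using kdim_inj [OF fdmodD(2) [OF assms(1)] kspace_KM [OF assms(2)]
        ksub_submod [OF submod_carrier [OF fdmodD(1) [OF assms(1)]]] klin_hom [OF f(1) order_refl] f(2)] f(3) by simp
qed

lemma kdim_pos:
  assumes "fdmod N" "carrier N \<noteq> {\<zero>\<^bsub>N\<^esub>}"
  shows "0 < kdim (KM N) (carrier N)"
  using fkspace.kdim_eq_0 [OF fdmodD(2) [OF assms(1)] ksub_submod [OF submod_carrier [OF fdmodD(1) [OF assms(1)]]]] assms(2)
  by auto

text \<open>\<open>add_subgroup\<close> is generated by indecomposable summands only. A decomposable
  module splits into two of smaller dimension, and the subgroups of its summands are contained in
  its own.\<close>

theorem cl_in_addset: "M \<in> fgmods A \<Longrightarrow> cl A M \<in> addset M"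
proof (induction "kdim (KM M) (carrier M)" arbitrary: M rule: less_induct)
  case less
  have fM: "fdmod M" and rM: "right_module A M" using less.prems by (auto simp: fgmods_iff fdmodD)
  consider "carrier M = {\<zero>\<^bsub>M\<^esub>}" | "indecomposable_rmod A M"
    | N N' where "N \<in> fgmods A" "N' \<in> fgmods A" "rmod_iso A M (dsum2 N N')"
      "carrier N \<noteq> {\<zero>\<^bsub>N\<^esub>}" "carrier N' \<noteq> {\<zero>\<^bsub>N'\<^esub>}"
    unfolding indecomposable_rmod_def by blast
  then show ?case
  proof cases
    case 1
    then have "cl A M - 0 \<in> K0_subgroup A"
      using cl_projective [OF less.prems zero_module_projective [OF fM 1]] by simp
    then show ?thesis by (rule addset_closed(4) [OF fM addset_closed(1) [OF fM] cl_carrier [OF less.prems]])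
  next
    case 2
    have "K0_class A M \<in> add_subgroup A M"
      using 2 less.prems rmod_retract_refl unfolding add_subgroup_eq [OF fM]
      by (intro generate.incl) (auto simp: add_gens_def)
    then show ?thesis using cl_carrier [OF less.prems] by (simp add: addset_def K0_class_eq)
  next
    case 3
    have f: "fdmod N" "fdmod N'" and r: "right_module A N" "right_module A N'" using 3 by (auto simp: fgmods_iff fdmodD)
    have d: "kdim (KM M) (carrier M) = kdim (KM N) (carrier N) + kdim (KM N') (carrier N')"
      using kdim_iso_carrier [OF fM right_module_dsum2 [OF r] 3(3)] kdim_dsum2_carrier [OF f] by simp
    have ret: "rmod_retract A N M" "rmod_retract A N' M"
      using rmod_retract_trans [OF rmod_retract_dsum2(1) [OF r] rmod_retract_iso(2) [OF rM 3(3)]]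
        rmod_retract_trans [OF rmod_retract_dsum2(2) [OF r] rmod_retract_iso(2) [OF rM 3(3)]] by auto
    have "cl A N \<in> addset N" "cl A N' \<in> addset N'"
      using d kdim_pos [OF f(1) 3(4)] kdim_pos [OF f(2) 3(5)] 3(1,2) by (auto intro: less.hyps)
    then have "cl A N \<in> addset M" "cl A N' \<in> addset M"
      using add_subgroup_retract [OF fM f(1) ret(1)] add_subgroup_retract [OF fM f(2) ret(2)]
      by (auto simp: addset_def)
    then have "cl A N + cl A N' \<in> addset M" by (rule addset_closed(3) [OF fM])
    moreover have "cl A M - (cl A N + cl A N') \<in> K0_subgroup A"
      using cl_dsum [OF less.prems 3(1-3)] by (simp add: diff_diff_eq)
    ultimately show ?thesis using addset_closed(4) [OF fM _ cl_carrier [OF less.prems]] by blast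
  qed
qed

lemma cl_in_addset_retract:
  assumes "N \<in> fgmods A" "fdmod M" "rmod_retract A N M"
  shows "cl A N \<in> addset M"
  using cl_in_addset [OF assms(1)] add_subgroup_retract [OF assms(2) _ assms(3)] assms(1)
  by (auto simp: addset_def fgmods_iff)

text \<open>Explicit elements of \<open>K0\<close> involve several modules; their direct sum,
  replaced at each step by a copy with a list carrier, holds all of them in one
  \<open>add_subgroup\<close>.\<close>

lemma common_module:
  assumes "finite S" "S \<subseteq> fgmods A"
  obtains M where "M \<in> fgmods A" "\<And>N. N \<in> S \<Longrightarrow> cl A N \<in> addset M"
proof -
  have "\<exists>M\<in>fgmods A. \<forall>N\<in>S. rmod_retract A N M"
    using assms
  proof (induction S rule: finite_induct)
    case empty
    obtain v where "v \<in> verts Q" using verts_nonempty by auto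
    then show ?case using tmod(1) [of v "{}"] by blast
  next
    case (insert N S)
    then obtain M where M: "M \<in> fgmods A" "\<forall>L\<in>S. rmod_retract A L M" by auto
    have N: "N \<in> fgmods A" using insert by simp
    have f: "fdmod N" "fdmod M" and r: "right_module A N" "right_module A M" using N M by (auto simp: fgmods_iff fdmodD)
    obtain M' where M': "M' \<in> fgmods A" "rmod_iso A (dsum2 N M) M'"
      using fgmod_copy [OF fdmod_dsum2 [OF f]] by metis
    note i = rmod_retract_iso(1) [OF right_module_dsum2 [OF r] M'(2)]
    have "rmod_retract A N M'" "rmod_retract A M M'"
      using rmod_retract_trans [OF rmod_retract_dsum2(1) [OF r] i] rmod_retract_trans [OF rmod_retract_dsum2(2) [OF r] i] by auto
    then have "\<forall>L\<in>insert N S. rmod_retract A L M'" using M(2) rmod_retract_trans by blast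
    then show ?case using M'(1) by blast
  qed
  then obtain M where M: "M \<in> fgmods A" "\<forall>N\<in>S. rmod_retract A N M" by blast
  show ?thesis
  proof (rule that [OF M(1)])
    fix N assume N: "N \<in> S"
    show "cl A N \<in> addset M"
      using cl_in_addset_retract [of N M] N M assms(2) fgmods_iff [of M] by blast
  qed
qed

section \<open>The syzygy endomorphism on the classes of the simple modules\<close>

definition simple_classes :: "('a fgmod set \<Rightarrow>\<^sub>0 int) set set" where
  "simple_classes = range (\<lambda>c. kcos A (combo c))"

text \<open>The adjacency matrix of the quiver, with rows in \<open>Dv\<close>: up to projectives
  the syzygy of the simple module at \<open>v\<close> contains the simple module at \<open>w\<close>
  once for each arrow from \<open>v\<close> to \<open>w\<close>.\<close>

definition Bop :: "('v \<Rightarrow> int) \<Rightarrow> 'v \<Rightarrow> int" where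
  "Bop c w = (\<Sum>v\<in>Dv. c v * int (card (out v \<inter> inn w)))"

lemma Omega_bar_combo: "Omega_bar A (kcos A (combo c)) = kcos A (combo (Bop c))"
proof -
  have "combo (\<lambda>w. OM w (combo c)) = combo (Bop c)"
    by (rule combo_cong) (simp add: OM_combo Dv Bop_def)
  then show ?thesis using Omega_bar_kcos [OF combo_carrier] by simp
qed

lemma Omega_bar_pow_combo: "(Omega_bar A ^^ n) (kcos A (combo c)) = kcos A (combo ((Bop ^^ n) c))"
  by (induction n) (simp_all add: Omega_bar_combo)

lemma Omega_bar_image:
  assumes "fdmod M"
  shows "Omega_bar A ` add_subgroup A M \<subseteq> simple_classes"
proof
  fix C assume "C \<in> Omega_bar A ` add_subgroup A M"
  then obtain B where B: "C = Omega_bar A B" "B \<in> add_subgroup A M" by auto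
  then have "B \<in> carrier (K0 A)" using subgroup.subset [OF add_subgroup_subgroup [OF assms]] by auto
  then obtain x where "x \<in> carrier (K0_free A)" "B = kcos A x" by (auto simp: K0_carrier)
  then show "C \<in> simple_classes" using B Omega_bar_kcos by (auto simp: simple_classes_def)
qed

text \<open>By freeness the syzygy endomorphism on the simple classes is an integer matrix.
  Extending scalars to the rationals is faithful, and over a field injectivity sets in by dimension.
  Without this existence statement the \<open>LEAST\<close> in \<open>phi\<close> would carry no
  information.\<close>

lemma simple_classes_stable: "\<exists>l. phi_stable (Omega_bar A) simple_classes l"
proof -
  let ?V = "fun_space Dv :: (rat, 'v \<Rightarrow> rat) module"
  interpret V: fkspace ?V by (rule fkspace_fun_space [OF Dv(1)])
  define f :: "('v \<Rightarrow> rat) \<Rightarrow> 'v \<Rightarrow> rat" where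
    "f c w = (if w \<in> Dv then (\<Sum>v\<in>Dv. c v * of_nat (card (out v \<inter> inn w))) else 0)" for c w
  define g :: "('v \<Rightarrow> int) \<Rightarrow> 'v \<Rightarrow> rat" where "g c w = (if w \<in> Dv then of_int (c w) else 0)" for c w
  have "klin ?V ?V (carrier ?V) f"
    by (auto simp: klin_def f_def fun_eq_iff algebra_simps sum.distrib sum_distrib_left)
  then obtain l where l: "\<And>s x. \<lbrakk>x \<in> carrier ?V; f ((f ^^ (l + s)) x) = \<zero>\<^bsub>?V\<^esub>\<rbrakk> \<Longrightarrow> (f ^^ (l + s)) x = \<zero>\<^bsub>?V\<^esub>"
    using V.eventually_injective by metis
  have fg: "f (g c) = g (Bop c)" for c
    by (auto simp: f_def g_def Bop_def fun_eq_iff intro!: sum.cong)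
  have fgn: "(f ^^ n) (g c) = g ((Bop ^^ n) c)" for n c
    by (induction n) (simp_all add: fg)
  have Bdiff: "Bop (\<lambda>v. c v - d v) = (\<lambda>w. Bop c w - Bop d w)" for c d
    by (simp add: Bop_def fun_eq_iff algebra_simps sum_subtractf)
  have Bn: "(Bop ^^ n) (\<lambda>v. c v - d v) = (\<lambda>w. (Bop ^^ n) c w - (Bop ^^ n) d w)" for n c d
    by (induction n) (simp_all add: Bdiff)
  have "phi_stable (Omega_bar A) simple_classes l"
    unfolding phi_stable_def
  proof (intro allI inj_onI)
    fix s C C' assume "C \<in> (Omega_bar A ^^ (l + s)) ` simple_classes" "C' \<in> (Omega_bar A ^^ (l + s)) ` simple_classes"
    then obtain c d where cd: "C = kcos A (combo ((Bop ^^ (l + s)) c))" "C' = kcos A (combo ((Bop ^^ (l + s)) d))"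
      by (auto simp: simple_classes_def Omega_bar_pow_combo)
    assume "Omega_bar A C = Omega_bar A C'"
    then have e: "\<forall>w\<in>Dv. Bop ((Bop ^^ (l + s)) c) w = Bop ((Bop ^^ (l + s)) d) w"
      by (simp add: cd Omega_bar_combo combo_inj)
    \<comment> \<open>Injectivity is tested on the difference of two coefficient functions, which
      reduces it to a trivial kernel.\<close>
    let ?e = "\<lambda>v. c v - d v"
    have "f ((f ^^ (l + s)) (g ?e)) = \<zero>\<^bsub>?V\<^esub>"
      using e unfolding fgn fg Bn Bdiff by (auto simp: g_def fun_eq_iff)
    then have "(f ^^ (l + s)) (g ?e) = \<zero>\<^bsub>?V\<^esub>" by (intro l) (auto simp: g_def)
    then have z: "g (\<lambda>w. (Bop ^^ (l + s)) c w - (Bop ^^ (l + s)) d w) = (\<lambda>_. 0)" by (simp add: fgn Bn)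
    have "(Bop ^^ (l + s)) c w = (Bop ^^ (l + s)) d w" if "w \<in> Dv" for w
      using fun_cong [OF z, of w] that by (simp add: g_def)
    then show "C = C'" by (simp add: cd combo_inj)
  qed
  then show ?thesis by blast
qed

text \<open>After one syzygy the subgroup lies in \<open>simple_classes\<close>. Stability passes to
  smaller sets, so at most one further step is needed.\<close>

lemma phi_le:
  assumes "fdmod M" "phi_stable (Omega_bar A) simple_classes l"
  shows "phi_stable (Omega_bar A) (add_subgroup A M) (Suc l)"
  using phi_stable_mono [OF assms(2) Omega_bar_image [OF assms(1)]] by (simp add: phi_stable_image)

text \<open>The syzygy of \<open>tm v (out v - {a})\<close> is the simple module at the head of \<open>a\<close>.\<close>

lemma module_onto_simple_classes:
  obtains M where "M \<in> fgmods A" "simple_classes \<subseteq> Omega_bar A ` add_subgroup A M"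
proof -
  \<comment> \<open>For each vertex of \<open>Dv\<close> some arrow ending there is fixed.\<close>
  define b where "b w = (SOME a. a \<in> inn w)" for w
  have b: "b w \<in> inn w" if "w \<in> Dv" for w
    unfolding b_def using Dv(4) [OF that] by (meson ex_in_conv someI_ex)
  define T where "T w = tmod (tail Q (b w)) (out (tail Q (b w)) - {b w})" for w
  have T: "T w \<in> fgmods A" if "w \<in> Dv" for w
    unfolding T_def using b [OF that] by (intro tmod(1)) auto
  have omT: "om (T w) u = (if u = w then 1 else 0)" if "w \<in> Dv" "u \<in> Dv" for u w
  proof -
    let ?t = "tail Q (b w)"
    have bw: "b w \<in> arcs Q" "head Q (b w) = w" using b [OF that(1)] by auto
    have e: "om (T w) u = int (card (out ?t \<inter> inn u)) - int (card ((out ?t - {b w}) \<inter> inn u))"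
      unfolding T_def using bw Dv(2) [OF that(2)] by (intro tmod(5)) auto
    show ?thesis
    proof (cases "u = w")
      case True
      have "(out ?t - {b w}) \<inter> inn u = (out ?t \<inter> inn u) - {b w}" by auto
      moreover have m: "b w \<in> out ?t \<inter> inn u" using True bw by simp
      moreover have f: "finite (out ?t \<inter> inn u)" by simp
      ultimately have "card ((out ?t - {b w}) \<inter> inn u) = card (out ?t \<inter> inn u) - 1" by simp
      moreover have "0 < card (out ?t \<inter> inn u)" using m f card_gt_0_iff by blast
      ultimately show ?thesis using e True by simp
    next
      case False
      then have "(out ?t - {b w}) \<inter> inn u = out ?t \<inter> inn u" using bw by auto
      then show ?thesis using e False by simp
    qed
  qed
  obtain M where M: "M \<in> fgmods A" "\<And>N. N \<in> T ` Dv \<Longrightarrow> cl A N \<in> addset M"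
    using common_module [of "T ` Dv"] T Dv(1) by blast
  have fM: "fdmod M" using M by (simp add: fgmods_iff)
  have "simple_classes \<subseteq> Omega_bar A ` add_subgroup A M"
  proof
    fix C assume "C \<in> simple_classes"
    then obtain c where C: "C = kcos A (combo c)" by (auto simp: simple_classes_def)
    \<comment> \<open>The same coefficients, with each simple module replaced by a module having it
      as its syzygy in \<open>K0\<close>.\<close>
    let ?x = "\<Sum>w\<in>Dv. frag_cmul (c w) (cl A (T w))"
    have x: "?x \<in> addset M" using M(2) by (intro addset_sum [OF fM] addset_cmul [OF fM]) auto
    have "OM u ?x = c u" if "u \<in> Dv" for u
    proof -
      have "OM u ?x = (\<Sum>w\<in>Dv. c w * OM u (cl A (T w)))" by (simp add: OM_def fint_sum)
      also have "\<dots> = (\<Sum>w\<in>Dv. if u = w then c w else 0)"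
        using that by (intro sum.cong) (auto simp: OM_cl T omT)
      finally show ?thesis using that Dv(1) by simp
    qed
    then have "combo (\<lambda>u. OM u ?x) = combo c" by (intro combo_cong) simp
    then have "Omega_bar A (kcos A ?x) = C" using Omega_bar_kcos x C by (simp add: addset_def)
    then show "C \<in> Omega_bar A ` add_subgroup A M" using x by (auto simp: addset_def)
  qed
  then show ?thesis using that M(1) by blast
qed

text \<open>The class of \<open>x\<close> is in the kernel of the syzygy endomorphism, while
  \<open>SX v x\<close> certifies that it is nonzero.\<close>

lemma not_stable_0:
  assumes M: "M \<in> fgmods A" and x: "x \<in> addset M" "\<And>w. w \<in> Dv \<Longrightarrow> OM w x = 0"
    and v: "v \<in> verts Q" "out v \<noteq> {}" "SX v x \<noteq> 0"
  shows "\<not> phi_stable (Omega_bar A) (add_subgroup A M) 0"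
proof
  assume "phi_stable (Omega_bar A) (add_subgroup A M) 0"
  then have "inj_on (Omega_bar A) ((Omega_bar A ^^ (0 + 0)) ` add_subgroup A M)" unfolding phi_stable_def by blast
  then have inj: "inj_on (Omega_bar A) (add_subgroup A M)" by simp
  have fM: "fdmod M" using M by (simp add: fgmods_iff)
  have z: "0 \<in> addset M" using addset_closed(1) [OF fM] .
  have "combo (\<lambda>w. OM w x) = combo (\<lambda>w. OM w 0)"
    by (rule combo_cong) (simp add: x(2), simp add: OM_def)
  then have "Omega_bar A (kcos A x) = Omega_bar A (kcos A 0)"
    using Omega_bar_kcos x(1) z by (simp add: addset_def)
  then have "kcos A x = kcos A 0" using inj_onD [OF inj] x(1) z by (simp add: addset_def)
  then have "x \<in> K0_subgroup A" by (simp add: kcos_eq_iff)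
  then show False using SX_K0 v by blast
qed

text \<open>If \<open>v\<close> has several outgoing arrows, then the quotients of \<open>e\<^sub>v A\<close> by the single arrows together have the same
  syzygy as the simple module at \<open>v\<close>.\<close>

lemma phi_kernel_branch:
  assumes "\<exists>v\<in>verts Q. \<exists>a\<in>out v. \<exists>b\<in>out v. a \<noteq> b"
  obtains M where "M \<in> fgmods A" "\<not> phi_stable (Omega_bar A) (add_subgroup A M) 0"
proof -
  obtain v a b where v: "v \<in> verts Q" "a \<in> out v" "b \<in> out v" "a \<noteq> b" using assms by blast
  let ?T = "\<lambda>a. tmod v (out v - {a})"
  have T: "?T a \<in> fgmods A" for a using v(1) by (intro tmod(1)) auto
  have S: "tmod v {} \<in> fgmods A" using v(1) by (intro tmod(1)) auto
  obtain M where M: "M \<in> fgmods A" "\<And>N. N \<in> insert (tmod v {}) (?T ` out v) \<Longrightarrow> cl A N \<in> addset M"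
    using common_module [of "insert (tmod v {}) (?T ` out v)"] T S by (auto simp del: insert_iff)
  have fM: "fdmod M" using M by (simp add: fgmods_iff)
  let ?x = "(\<Sum>a\<in>out v. cl A (?T a)) - cl A (tmod v {})"
  have x: "?x \<in> addset M" using M(2) by (intro addset_closed(2) [OF fM] addset_sum [OF fM]) auto
  have "OM w ?x = 0" if "w \<in> Dv" for w
  proof -
    have w: "w \<in> verts Q" using Dv(2) that .
    have "om (?T a) w = (if head Q a = w then 1 else 0)" if a: "a \<in> out v" for a
    proof -
      have e: "om (?T a) w = int (card (out v \<inter> inn w)) - int (card ((out v - {a}) \<inter> inn w))"
        using v(1) w by (intro tmod(5)) auto
      show ?thesis
      proof (cases "head Q a = w")
        case True
        have "(out v - {a}) \<inter> inn w = (out v \<inter> inn w) - {a}" by auto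
        moreover have m: "a \<in> out v \<inter> inn w" using True a by simp
        moreover have f: "finite (out v \<inter> inn w)" by simp
        ultimately have "card ((out v - {a}) \<inter> inn w) = card (out v \<inter> inn w) - 1" by simp
        moreover have "0 < card (out v \<inter> inn w)" using m f card_gt_0_iff by blast
        ultimately show ?thesis using e True by simp
      next
        case False
        then have "(out v - {a}) \<inter> inn w = out v \<inter> inn w" by auto
        then show ?thesis using e False by simp
      qed
    qed
    then have "OM w (\<Sum>a\<in>out v. cl A (?T a)) = (\<Sum>a\<in>out v. if head Q a = w then 1 else 0)"
      using T by (simp add: OM_def fint_sum OM_cl [unfolded OM_def])
    also have "\<dots> = int (card (out v \<inter> inn w))"
      by (simp add: sum.If_cases Int_def conj_ac)
    finally show ?thesis
      using tmod(5) [OF v(1) _ w, of "{}"] S by (simp add: OM_def OM_cl [unfolded OM_def])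
  qed
  \<comment> \<open>Since \<open>v\<close> has a second arrow, none of the quotients is simple and
    they contribute zero; only the simple module at \<open>v\<close> remains.\<close>
  moreover have "SX v ?x \<noteq> 0"
  proof -
    have "sx (?T c) v = 0" if "c \<in> out v" for c
      using tmod(4) [OF v(1) _ v(1), of "out v - {c}"] v by auto
    then have "SX v (\<Sum>a\<in>out v. cl A (?T a)) = 0"
      using T by (simp add: SX_def fint_sum SX_cl [unfolded SX_def])
    then show ?thesis
      using tmod(4) [OF v(1) _ v(1), of "{}"] S by (simp add: SX_def SX_cl [unfolded SX_def])
  qed
  ultimately have "\<not> phi_stable (Omega_bar A) (add_subgroup A M) 0"
    using not_stable_0 [OF M(1) x _ v(1)] v(2) by blast
  then show ?thesis using that M(1) by blast
qed

text \<open>The simple module at the tail has the simple module at the sink as its syzygy. That one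
  is projective, so the class of the former is in the kernel.\<close>

lemma phi_kernel_sink:
  assumes "a \<in> arcs Q" "out (tail Q a) = {a}" "out (head Q a) = {}"
  obtains M where "M \<in> fgmods A" "\<not> phi_stable (Omega_bar A) (add_subgroup A M) 0"
proof -
  let ?v = "tail Q a"
  have v: "?v \<in> verts Q" using assms by simp
  let ?S = "tmod ?v {}"
  have S: "?S \<in> fgmods A" using v by (intro tmod(1)) auto
  have "OM w (cl A ?S) = 0" if "w \<in> Dv" for w
  proof -
    have "out ?v \<inter> inn w = {}" using assms Dv(3) [OF that] by auto
    then show ?thesis using tmod(5) [OF v _ Dv(2) [OF that], of "{}"] S by (simp add: OM_cl)
  qed
  moreover have "SX ?v (cl A ?S) \<noteq> 0" using tmod(4) [OF v _ v, of "{}"] S by (simp add: SX_cl)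
  ultimately have "\<not> phi_stable (Omega_bar A) (add_subgroup A ?S) 0"
    using not_stable_0 [OF S cl_in_addset [OF S] _ v] assms(2) by blast
  then show ?thesis using that S by blast
qed

text \<open>The simple modules at the two tails have the same syzygy, the simple module at the
  common head, so the difference of their classes is in the kernel.\<close>

lemma phi_kernel_join:
  assumes "a \<in> arcs Q" "b \<in> arcs Q" "tail Q a \<noteq> tail Q b" "head Q a = head Q b"
    "out (tail Q a) = {a}" "out (tail Q b) = {b}"
  obtains M where "M \<in> fgmods A" "\<not> phi_stable (Omega_bar A) (add_subgroup A M) 0"
proof -
  let ?u = "tail Q a" and ?v = "tail Q b"
  have uv: "?u \<in> verts Q" "?v \<in> verts Q" using assms by auto
  have S: "tmod ?u {} \<in> fgmods A" "tmod ?v {} \<in> fgmods A" using uv by (intro tmod(1); auto)+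
  obtain M where M: "M \<in> fgmods A" "\<And>N. N \<in> {tmod ?u {}, tmod ?v {}} \<Longrightarrow> cl A N \<in> addset M"
    using common_module [of "{tmod ?u {}, tmod ?v {}}"] S by (auto simp del: insert_iff)
  have fM: "fdmod M" using M by (simp add: fgmods_iff)
  let ?x = "cl A (tmod ?u {}) - cl A (tmod ?v {})"
  have x: "?x \<in> addset M" using M(2) by (intro addset_closed(2) [OF fM]) auto
  have "OM w ?x = 0" if "w \<in> Dv" for w
  proof -
    have "card ({a} \<inter> inn w) = card ({b} \<inter> inn w)" using assms(1,2,4) by (cases "head Q b = w") auto
    then show ?thesis
      using tmod(5) [OF uv(1) _ Dv(2) [OF that], of "{}"] tmod(5) [OF uv(2) _ Dv(2) [OF that], of "{}"] S assms(5,6)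
      by (simp add: OM_def OM_cl [unfolded OM_def])
  qed
  moreover have "SX ?u ?x \<noteq> 0"
    using tmod(4) [OF uv(1) _ uv(1), of "{}"] tmod(4) [OF uv(2) _ uv(1), of "{}"] S assms(3)
    by (simp add: SX_def SX_cl [unfolded SX_def])
  ultimately have "\<not> phi_stable (Omega_bar A) (add_subgroup A M) 0"
    using not_stable_0 [OF M(1) x _ uv(1)] assms(5) by blast
  then show ?thesis using that M(1) by blast
qed

end

section \<open>Finite direct sums of modules\<close>

lemma dsum_simps:
  assumes "finite I"
  shows "carrier (dsum I F) = (\<Pi>\<^sub>E i\<in>I. carrier (F i))"
    "\<zero>\<^bsub>dsum I F\<^esub> = (\<lambda>i\<in>I. \<zero>\<^bsub>F i\<^esub>)"
    "f \<oplus>\<^bsub>dsum I F\<^esub> g = (\<lambda>i\<in>I. f i \<oplus>\<^bsub>F i\<^esub> g i)"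
    "f \<star>\<^bsub>dsum I F\<^esub> a = (\<lambda>i\<in>I. f i \<star>\<^bsub>F i\<^esub> a)"
  using assms by (auto simp: dsum_def)

lemma right_module_dsum:
  assumes "finite I" "ring A" "\<And>i. i \<in> I \<Longrightarrow> right_module A (F i)"
  shows "right_module A (dsum I F)"
proof (rule right_moduleI)
  note s = dsum_simps [OF assms(1)]
  have ag: "abelian_group (F i)" if "i \<in> I" for i using assms(3) [OF that] by (simp add: right_module_def)
  have am: "abelian_monoid (F i)" if "i \<in> I" for i using ag [OF that] by (simp add: abelian_group_def)
  show "abelian_group (dsum I F)"
  proof (rule abelian_groupI; unfold s)
    fix x y z assume x: "x \<in> (\<Pi>\<^sub>E i\<in>I. carrier (F i))" and y: "y \<in> (\<Pi>\<^sub>E i\<in>I. carrier (F i))"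
    show "(\<lambda>i\<in>I. x i \<oplus>\<^bsub>F i\<^esub> y i) \<in> (\<Pi>\<^sub>E i\<in>I. carrier (F i))"
      using abelian_monoid.a_closed [OF am] PiE_mem [OF x] PiE_mem [OF y] by simp
    show "(\<lambda>i\<in>I. x i \<oplus>\<^bsub>F i\<^esub> y i) = (\<lambda>i\<in>I. y i \<oplus>\<^bsub>F i\<^esub> x i)"
      using abelian_monoid.a_comm [OF am] PiE_mem [OF x] PiE_mem [OF y] by (intro restrict_ext) simp
    assume z: "z \<in> (\<Pi>\<^sub>E i\<in>I. carrier (F i))"
    show "(\<lambda>i\<in>I. (\<lambda>i\<in>I. x i \<oplus>\<^bsub>F i\<^esub> y i) i \<oplus>\<^bsub>F i\<^esub> z i) = (\<lambda>i\<in>I. x i \<oplus>\<^bsub>F i\<^esub> (\<lambda>i\<in>I. y i \<oplus>\<^bsub>F i\<^esub> z i) i)"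
      using abelian_monoid.a_assoc [OF am] PiE_mem [OF x] PiE_mem [OF y] PiE_mem [OF z]
      by (intro restrict_ext) simp
  next
    show "(\<lambda>i\<in>I. \<zero>\<^bsub>F i\<^esub>) \<in> (\<Pi>\<^sub>E i\<in>I. carrier (F i))"
      using abelian_monoid.zero_closed [OF am] by auto
    fix x assume x: "x \<in> (\<Pi>\<^sub>E i\<in>I. carrier (F i))"
    have "(\<lambda>i\<in>I. (\<lambda>i\<in>I. \<zero>\<^bsub>F i\<^esub>) i \<oplus>\<^bsub>F i\<^esub> x i) = (\<lambda>i\<in>I. x i)"
      using abelian_monoid.l_zero [OF am] PiE_mem [OF x] by (intro restrict_ext) simp
    then show "(\<lambda>i\<in>I. (\<lambda>i\<in>I. \<zero>\<^bsub>F i\<^esub>) i \<oplus>\<^bsub>F i\<^esub> x i) = x"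
      using PiE_restrict [OF x] by simp
    have "(\<lambda>i\<in>I. (\<lambda>i\<in>I. \<ominus>\<^bsub>F i\<^esub> x i) i \<oplus>\<^bsub>F i\<^esub> x i) = (\<lambda>i\<in>I. \<zero>\<^bsub>F i\<^esub>)"
      using abelian_group.l_neg [OF ag] PiE_mem [OF x] by (intro restrict_ext) simp
    moreover have "(\<lambda>i\<in>I. \<ominus>\<^bsub>F i\<^esub> x i) \<in> (\<Pi>\<^sub>E i\<in>I. carrier (F i))"
      using abelian_group.a_inv_closed [OF ag] PiE_mem [OF x] by simp
    ultimately show "\<exists>y\<in>\<Pi>\<^sub>E i\<in>I. carrier (F i). (\<lambda>i\<in>I. y i \<oplus>\<^bsub>F i\<^esub> x i) = (\<lambda>i\<in>I. \<zero>\<^bsub>F i\<^esub>)"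
      by blast
  qed
  show "x \<star>\<^bsub>dsum I F\<^esub> a \<in> carrier (dsum I F)" if "x \<in> carrier (dsum I F)" "a \<in> carrier A" for x a
    using that(2) right_module.ract_closed [OF assms(3)] PiE_mem [OF that(1) [unfolded s]] by (simp add: s)
  show "(x \<oplus>\<^bsub>dsum I F\<^esub> y) \<star>\<^bsub>dsum I F\<^esub> a = x \<star>\<^bsub>dsum I F\<^esub> a \<oplus>\<^bsub>dsum I F\<^esub> y \<star>\<^bsub>dsum I F\<^esub> a"
    if "x \<in> carrier (dsum I F)" "y \<in> carrier (dsum I F)" "a \<in> carrier A" for x y a
    unfolding s using that(3) right_module.ract_add_left [OF assms(3)]
      PiE_mem [OF that(1) [unfolded s]] PiE_mem [OF that(2) [unfolded s]] by (intro restrict_ext) simp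
  show "x \<star>\<^bsub>dsum I F\<^esub> (a \<oplus>\<^bsub>A\<^esub> b) = x \<star>\<^bsub>dsum I F\<^esub> a \<oplus>\<^bsub>dsum I F\<^esub> x \<star>\<^bsub>dsum I F\<^esub> b"
    if "x \<in> carrier (dsum I F)" "a \<in> carrier A" "b \<in> carrier A" for x a b
    unfolding s using that(2,3) right_module.ract_add_right [OF assms(3)]
      PiE_mem [OF that(1) [unfolded s]] by (intro restrict_ext) simp
  show "x \<star>\<^bsub>dsum I F\<^esub> (a \<otimes>\<^bsub>A\<^esub> b) = (x \<star>\<^bsub>dsum I F\<^esub> a) \<star>\<^bsub>dsum I F\<^esub> b"
    if "x \<in> carrier (dsum I F)" "a \<in> carrier A" "b \<in> carrier A" for x a b
    unfolding s using that(2,3) right_module.ract_assoc [OF assms(3)]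
      PiE_mem [OF that(1) [unfolded s]] by (intro restrict_ext) simp
  show "x \<star>\<^bsub>dsum I F\<^esub> \<one>\<^bsub>A\<^esub> = x" if "x \<in> carrier (dsum I F)" for x
  proof -
    have x: "x \<in> (\<Pi>\<^sub>E i\<in>I. carrier (F i))" using that by (simp add: s)
    have "(\<lambda>i\<in>I. x i \<star>\<^bsub>F i\<^esub> \<one>\<^bsub>A\<^esub>) = (\<lambda>i\<in>I. x i)"
      using right_module.ract_one [OF assms(3)] PiE_mem [OF x] by (intro restrict_ext) simp
    then show ?thesis using PiE_restrict [OF x] by (simp add: s)
  qed
qed (fact assms(2))

text \<open>Peeling off one index reduces finite direct sums to \<open>dsum2\<close>, for which
  dimensions are already known.\<close>

lemma dsum_insert_iso:
  assumes "finite I" "i \<notin> I"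
  shows "rmod_iso A (dsum (insert i I) F) (dsum2 (F i) (dsum I F))"
proof (rule rmod_isoI)
  have fin: "finite (insert i I)" using assms by simp
  note s = dsum_simps [OF assms(1)] and s' = dsum_simps [OF fin]
  let ?f = "\<lambda>h. (h i, restrict h I)" and ?g = "\<lambda>(x, h). \<lambda>j\<in>insert i I. if j = i then x else h j"
  show "?f \<in> rmod_hom A (dsum (insert i I) F) (dsum2 (F i) (dsum I F))"
    by (rule rmod_homI) (auto simp: s s' PiE_mem intro!: restrict_ext)
  show "?g \<in> rmod_hom A (dsum2 (F i) (dsum I F)) (dsum (insert i I) F)"
  proof (rule rmod_homI)
    fix y assume "y \<in> carrier (dsum2 (F i) (dsum I F))"
    then obtain x h where y: "y = (x, h)" "x \<in> carrier (F i)" "h \<in> (\<Pi>\<^sub>E j\<in>I. carrier (F j))"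
      by (auto simp: s)
    show "?g y \<in> carrier (dsum (insert i I) F)"
      unfolding s' using y(1,2) PiE_mem [OF y(3)] by (simp add: restrict_PiE_iff)
  qed (use assms(2) in \<open>auto simp: s s' intro!: restrict_ext\<close>)
  show "?g (?f h) = h" if "h \<in> carrier (dsum (insert i I) F)" for h
    using that by (auto simp: s' fun_eq_iff PiE_def extensional_def)
  show "?f (?g y) = y" if "y \<in> carrier (dsum2 (F i) (dsum I F))" for y
    using that assms(2) by (auto simp: s fun_eq_iff PiE_def extensional_def)
qed

section \<open>Simplicity and injectivity under isomorphism\<close>

lemma simple_iso:
  assumes M: "right_module A M" and N: "right_module A N" and iso: "rmod_iso A M N" and s: "simple_rmod A M"
  shows "simple_rmod A N"
proof -
  obtain f g where f: "f \<in> rmod_hom A M N" and g: "g \<in> rmod_hom A N M"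
    and gf: "\<And>x. x \<in> carrier M \<Longrightarrow> g (f x) = x" and fg: "\<And>y. y \<in> carrier N \<Longrightarrow> f (g y) = y"
    by (rule rmod_iso_inverse [OF M iso]) (rule that; assumption)
  show ?thesis unfolding simple_rmod_def
  proof (intro conjI allI impI)
    show "carrier N \<noteq> {\<zero>\<^bsub>N\<^esub>}"
      using iso_zero_carrier [OF N M rmod_iso_sym [OF M iso]] s by (auto simp: simple_rmod_def)
    fix U assume U: "submod A U N"
    have eq: "U = f ` g ` U" using submodD(1) [OF U] fg by (force simp: image_image)
    have fM: "f ` carrier M = carrier N"
    proof (intro equalityI subsetI)
      fix y assume "y \<in> carrier N"
      then show "y \<in> f ` carrier M" using fg rmod_homD(1) [OF g] by (intro image_eqI [of _ _ "g y"]) auto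
    qed (use rmod_homD(1) [OF f] in auto)
    have "g ` U = {\<zero>\<^bsub>M\<^esub>} \<or> g ` U = carrier M"
      using s submod_image [OF N M g U] by (auto simp: simple_rmod_def)
    then show "U = {\<zero>\<^bsub>N\<^esub>} \<or> U = carrier N"
    proof
      assume "g ` U = {\<zero>\<^bsub>M\<^esub>}"
      then show ?thesis using eq rmod_hom_zero [OF M N f] by simp
    next
      assume "g ` U = carrier M"
      then show ?thesis using eq fM by simp
    qed
  qed
qed

lemma injective_iso:
  assumes M: "right_module A M" and iso: "rmod_iso A M N" and i: "injective_rmod A M"
  shows "injective_rmod A N"
  unfolding injective_rmod_def
proof (intro ballI impI)
  obtain f g where f: "f \<in> rmod_hom A M N" and g: "g \<in> rmod_hom A N M"
    and gf: "\<And>x. x \<in> carrier M \<Longrightarrow> g (f x) = x" and fg: "\<And>y. y \<in> carrier N \<Longrightarrow> f (g y) = y"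
    by (rule rmod_iso_inverse [OF M iso]) (rule that; assumption)
  fix L K e k assume *: "L \<in> fgmods A" "K \<in> fgmods A" "e \<in> rmod_hom A L K" "k \<in> rmod_hom A L N" "inj_on e (carrier L)"
  obtain h where h: "h \<in> rmod_hom A K M" "\<forall>x\<in>carrier L. h (e x) = (g \<circ> k) x"
    using i [unfolded injective_rmod_def, rule_format, OF *(1-3) rmod_hom_comp [OF *(4) g] *(5)] by blast
  show "\<exists>h\<in>rmod_hom A K N. \<forall>x\<in>carrier L. h (e x) = k x"
    using rmod_hom_comp [OF h(1) f] h(2) fg rmod_homD(1) [OF *(4)]
    by (intro bexI [of _ "f \<circ> h"]) auto
qed

context radsq
begin

section \<open>Simple modules\<close>

lemma simple_tm: "v \<in> verts Q \<Longrightarrow> simple_rmod A (tm v {})"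
  unfolding simple_rmod_def
proof (intro conjI allI impI)
  assume v: "v \<in> verts Q"
  show "carrier (tm v {}) \<noteq> {\<zero>\<^bsub>tm v {}\<^esub>}" by (auto simp: set_eq_iff intro!: exI [of _ 1] exI [of _ "\<lambda>_. 0"])
  fix U assume U: "submod A U (tm v {})"
  note U' = submodD [OF U]
  show "U = {\<zero>\<^bsub>tm v {}\<^esub>} \<or> U = carrier (tm v {})"
  proof (cases "U \<subseteq> {\<zero>\<^bsub>tm v {}\<^esub>}")
    case False
    then obtain c d where cd: "(c, d) \<in> U" "(c, d) \<noteq> \<zero>\<^bsub>tm v {}\<^esub>" by auto
    then have d: "d = (\<lambda>_. 0)" using U'(1) by auto
    then have c: "c \<noteq> 0" using cd by auto
    have "x \<in> U" if x: "x \<in> carrier (tm v {})" for x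
    proof -
      obtain c' where "x = (c', \<lambda>_. 0)" using x by (cases x) auto
      then have "x = (c, d) \<star>\<^bsub>tm v {}\<^esub> sc (inverse c * c')" using c v by simp
      then show ?thesis using U'(4) [OF cd(1)] by simp
    qed
    then show ?thesis using U'(1) by blast
  qed (use U'(2) in auto)
qed

text \<open>The radical of a simple module is zero, so a nonzero vector at a vertex spans a
  submodule, which must be everything.\<close>

lemma simple_classify:
  assumes S: "S \<in> fgmods A" and simple: "simple_rmod A S"
  obtains v where "v \<in> verts Q" "rmod_iso A (tm v {}) S"
proof -
  have rS: "right_module A S" using S by (simp add: fgmods_def)
  interpret S: right_module A S by (rule rS)
  have nz: "carrier S \<noteq> {\<zero>\<^bsub>S\<^esub>}" using simple by (simp add: simple_rmod_def)
  \<comment> \<open>If the radical were all of \<open>S\<close>, Nakayama for the zero submodule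
    would give \<open>S = 0\<close>.\<close>
  have "rd S (arcs Q) = {\<zero>\<^bsub>S\<^esub>}"
  proof (rule ccontr)
    assume "rd S (arcs Q) \<noteq> {\<zero>\<^bsub>S\<^esub>}"
    then have full: "rd S (arcs Q) = carrier S" using simple submod_rad [OF rS] by (auto simp: simple_rmod_def)
    have "{\<zero>\<^bsub>S\<^esub>} = carrier S"
      by (rule nakayama [OF rS submod_zero [OF rS]]) (use full in auto)
    then show False using nz by simp
  qed
  then have ar0: "x \<star>\<^bsub>S\<^esub> ar a = \<zero>\<^bsub>S\<^esub>" if "x \<in> carrier S" "a \<in> arcs Q" for x a
    using rd_gen [OF rS that] by auto
  obtain w x where w: "w \<in> verts Q" and x: "x \<in> pt S w" "x \<noteq> \<zero>\<^bsub>S\<^esub>"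
    by (rule ex_pt [OF rS nz ar0]) (assumption | rule that)+
  have xc: "x \<in> carrier S" using x by (simp add: pt_def)
  let ?L = "range (\<lambda>k. x \<star>\<^bsub>S\<^esub> sc k)"
  have "x \<in> ?L" using S.ract_one [OF xc] by (intro range_eqI [of _ _ 1]) (simp add: sc_one)
  moreover have "?L = {\<zero>\<^bsub>S\<^esub>} \<or> ?L = carrier S"
    using simple line_submod [OF rS x(1) ar0 [OF xc]] by (simp add: simple_rmod_def)
  ultimately have "?L = carrier S" using x(2) by auto
  moreover have "rmod_iso A (tm w {}) (S\<lparr>carrier := ?L\<rparr>)"
    by (rule line_iso [OF rS x(1) ar0 [OF xc] x(2) w])
  ultimately show ?thesis using that [OF w] by simp
qed

text \<open>Given an arrow \<open>a\<close> from \<open>u\<close> to \<open>v\<close>, the simple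
  module at \<open>v\<close> is the radical of the two-dimensional module \<open>tm u {a}\<close>.
  Extending its identity would give a retraction, but the radical is reached by acting with
  \<open>a\<close>, and \<open>a\<close> kills the simple module.\<close>

lemma simple_injective_source:
  assumes v: "v \<in> verts Q" and inj: "injective_rmod A (tm v {})"
  shows "inn v = {}"
proof (rule ccontr)
  assume "inn v \<noteq> {}"
  then obtain a where a: "a \<in> arcs Q" "head Q a = v" by auto
  let ?u = "tail Q a"
  let ?S = "tm v {}" and ?T = "tm ?u {a}"
  have u: "?u \<in> verts Q" using a by simp
  have rS: "right_module A ?S" and fS: "fdmod ?S" using right_module_tm [OF v, of "{}"] fdmod_tm [OF v, of "{}"] by auto
  have rT: "right_module A ?T" and fT: "fdmod ?T" using right_module_tm [OF u, of "{a}"] fdmod_tm [OF u, of "{a}"] a by auto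
  obtain L where L: "L \<in> fgmods A" "rmod_iso A ?S L" using fgmod_copy [OF fS] by metis
  obtain N where N: "N \<in> fgmods A" "rmod_iso A ?T N" using fgmod_copy [OF fT] by metis
  obtain i i' where i: "i \<in> rmod_hom A ?S L" "i' \<in> rmod_hom A L ?S"
    "\<And>x. x \<in> carrier ?S \<Longrightarrow> i' (i x) = x" "\<And>y. y \<in> carrier L \<Longrightarrow> i (i' y) = y"
    by (rule rmod_iso_inverse [OF rS L(2)]) (rule that; assumption)
  obtain j j' where j: "j \<in> rmod_hom A ?T N" "j' \<in> rmod_hom A N ?T"
    "\<And>x. x \<in> carrier ?T \<Longrightarrow> j' (j x) = x" "\<And>y. y \<in> carrier N \<Longrightarrow> j (j' y) = y"
    by (rule rmod_iso_inverse [OF rT N(2)]) (rule that; assumption)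
  \<comment> \<open>The embedding onto the coordinate of the arrow \<open>a\<close>.\<close>
  let ?e = "\<lambda>(c, d :: 'e \<Rightarrow> 'k). (0 :: 'k, \<lambda>b. if b = a then c else 0)"
  have e: "?e \<in> rmod_hom A ?S ?T"
    using a v u by (intro rmod_homI) (auto simp: fun_eq_iff)
  have einj: "inj_on ?e (carrier ?S)" by (auto simp: inj_on_def fun_eq_iff)
  have g: "j \<circ> (?e \<circ> i') \<in> rmod_hom A L N" by (intro rmod_hom_comp [OF _ j(1)] rmod_hom_comp [OF i(2) e])
  have "inj_on (j \<circ> (?e \<circ> i')) (carrier L)"
  proof (intro comp_inj_on)
    show "inj_on i' (carrier L)" using i(4) by (rule inj_on_inverseI)
    show "inj_on ?e (i' ` carrier L)" by (rule inj_on_subset [OF einj image_subsetI]) (rule rmod_homD(1) [OF i(2)])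
    have sub: "(?e \<circ> i') ` carrier L \<subseteq> carrier ?T"
      by (rule image_subsetI) (rule rmod_homD(1) [OF rmod_hom_comp [OF i(2) e]])
    have "inj_on j (carrier ?T)" using j(3) by (rule inj_on_inverseI)
    then show "inj_on j ((?e \<circ> i') ` carrier L)" using sub by (rule inj_on_subset)
  qed
  from inj [unfolded injective_rmod_def, rule_format, OF L(1) N(1) g i(2) this]
  obtain h where h: "h \<in> rmod_hom A N ?S" "\<forall>x\<in>carrier L. h ((j \<circ> (?e \<circ> i')) x) = i' x" by blast
  have k: "h \<circ> j \<in> rmod_hom A ?T ?S" by (rule rmod_hom_comp [OF j(1) h(1)])
  let ?o = "(1 :: 'k, \<lambda>_ :: 'e. 0 :: 'k)"
  have oc: "?o \<in> carrier ?S" "?o \<in> carrier ?T" by auto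
  have "i ?o \<in> carrier L" using rmod_homD(1) [OF i(1) oc(1)] .
  then have "(h \<circ> j) (?e ?o) = ?o" using h(2) i(3) [OF oc(1)] by auto
  \<comment> \<open>The image of the simple module is the translate of the generator by
    \<open>a\<close>, so its value under the retraction is a translate by \<open>a\<close> in the
    simple module and vanishes.\<close>
  moreover have "?e ?o = ?o \<star>\<^bsub>?T\<^esub> ar a" using a u by (auto simp: fun_eq_iff)
  ultimately have "?o = (h \<circ> j) ?o \<star>\<^bsub>?S\<^esub> ar a" using rmod_homD(3) [OF k oc(2), of "ar a"] by simp
  then show False using v by (cases "(h \<circ> j) ?o") simp
qed

text \<open>The functional is carried to the image of \<open>g\<close> by inverting \<open>g\<close>
  there, and then extended from this subspace.\<close>

lemma functional_extension:
  fixes L :: "('a, 'm, 'y) rmodule_scheme" and N :: "('a, 'n, 'z) rmodule_scheme"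
  assumes L: "fdmod L" and N: "fdmod N" and g: "g \<in> rmod_hom A L N" "inj_on g (carrier L)"
    and p: "\<And>x y. \<lbrakk>x \<in> carrier L; y \<in> carrier L\<rbrakk> \<Longrightarrow> p (x \<oplus>\<^bsub>L\<^esub> y) = p x + p y"
      "\<And>x k. x \<in> carrier L \<Longrightarrow> p (x \<star>\<^bsub>L\<^esub> sc k) = k * p x"
  obtains q :: "'n \<Rightarrow> 'k" where "\<And>x. x \<in> carrier L \<Longrightarrow> q (g x) = p x"
    "\<And>x y. \<lbrakk>x \<in> carrier N; y \<in> carrier N\<rbrakk> \<Longrightarrow> q (x \<oplus>\<^bsub>N\<^esub> y) = q x + q y"
    "\<And>x k. x \<in> carrier N \<Longrightarrow> q (x \<star>\<^bsub>N\<^esub> sc k) = k * q x"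
proof -
  have rL: "right_module A L" and rN: "right_module A N" using L N by (auto simp: fdmodD)
  interpret L: right_module A L by (rule rL)
  interpret K: fkspace "KM N" by (rule fdmodD(2) [OF N])
  define r where "r = p \<circ> inv_into (carrier L) g"
  have r: "r (g x) = p x" if "x \<in> carrier L" for x using that g(2) by (simp add: r_def)
  have U: "ksub (KM N) (g ` carrier L)" by (intro ksub_submod submod_image [OF rL rN g(1)] submod_carrier [OF rL])
  note G = rmod_homD [OF g(1)]
  have "r (y \<oplus>\<^bsub>KM N\<^esub> z) = r y + r z" if yz: "y \<in> g ` carrier L" "z \<in> g ` carrier L" for y z
  proof -
    obtain y' z' where *: "y = g y'" "z = g z'" "y' \<in> carrier L" "z' \<in> carrier L" using yz by blast
    then have "y \<oplus>\<^bsub>KM N\<^esub> z = g (y' \<oplus>\<^bsub>L\<^esub> z')" using G(2) by simp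
    then show ?thesis using * r p(1) by simp
  qed
  moreover have "r (k \<odot>\<^bsub>KM N\<^esub> y) = k * r y" if y: "y \<in> g ` carrier L" for k y
  proof -
    obtain y' where *: "y = g y'" "y' \<in> carrier L" using y by blast
    then have "k \<odot>\<^bsub>KM N\<^esub> y = g (y' \<star>\<^bsub>L\<^esub> sc k)" using G(3) by simp
    then show ?thesis using * r p(2) L.ract_closed by simp
  qed
  ultimately obtain q where q: "\<And>x. x \<in> g ` carrier L \<Longrightarrow> q x = r x"
    "\<And>x y. \<lbrakk>x \<in> carrier (KM N); y \<in> carrier (KM N)\<rbrakk> \<Longrightarrow> q (x \<oplus>\<^bsub>KM N\<^esub> y) = q x + q y"
    "\<And>k x. x \<in> carrier (KM N) \<Longrightarrow> q (k \<odot>\<^bsub>KM N\<^esub> x) = k * q x"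
    by (rule K.extend_functional [OF U]) (assumption | rule that)+
  show ?thesis by (rule that [of q]) (use q r in auto)
qed

text \<open>A homomorphism into this module is a functional concentrated at \<open>v\<close> and
  zero on the radical. An extended functional is cut down to the vertex space at \<open>v\<close>;
  the radical has no component there because no arrow ends in \<open>v\<close>.\<close>

lemma source_simple_injective:
  assumes v: "v \<in> verts Q" and src: "inn v = {}"
  shows "injective_rmod A (tm v {})"
  unfolding injective_rmod_def
proof (intro ballI impI)
  let ?S = "tm v {}"
  have rS: "right_module A ?S" using right_module_tm [OF v, of "{}"] by auto
  fix L N g f
  assume *: "L \<in> fgmods A" "N \<in> fgmods A" "g \<in> rmod_hom A L N" "f \<in> rmod_hom A L ?S" "inj_on g (carrier L)"
  have fL: "fdmod L" and fN: "fdmod N" and rL: "right_module A L" and rN: "right_module A N"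
    using * by (auto simp: fgmods_iff fdmodD)
  interpret L: right_module A L by (rule rL)
  interpret N: right_module A N by (rule rN)
  note F = rmod_homD [OF *(4)]
  have fpair: "fst (s \<oplus>\<^bsub>?S\<^esub> t) = fst s + fst t" "fst (s \<star>\<^bsub>?S\<^esub> y) = fst s * cv y v" for s t y
    by (cases s; cases t; simp)+
  obtain q where q: "\<And>x. x \<in> carrier L \<Longrightarrow> q (g x) = fst (f x)"
    "\<And>x y. \<lbrakk>x \<in> carrier N; y \<in> carrier N\<rbrakk> \<Longrightarrow> q (x \<oplus>\<^bsub>N\<^esub> y) = q x + q y"
    "\<And>x k. x \<in> carrier N \<Longrightarrow> q (x \<star>\<^bsub>N\<^esub> sc k) = k * q x"
  proof (rule functional_extension [OF fL fN *(3,5), of "\<lambda>x. fst (f x)"])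
    show "fst (f (x \<oplus>\<^bsub>L\<^esub> y)) = fst (f x) + fst (f y)" if "x \<in> carrier L" "y \<in> carrier L" for x y
      using that F(2) fpair by simp
    show "fst (f (x \<star>\<^bsub>L\<^esub> sc k)) = k * fst (f x)" if "x \<in> carrier L" for x k
      using that F(3) [of x "sc k"] fpair(2) [of "f x" "sc k"] v by simp
  qed (rule that; assumption)
  have q0: "q \<zero>\<^bsub>N\<^esub> = 0" using q(3) [of "\<zero>\<^bsub>N\<^esub>" 0] N.ract_zero_left by simp
  \<comment> \<open>Acting with \<open>ev v\<close> first discards the components at other vertices,
    where the extension \<open>q\<close> is uncontrolled.\<close>
  define h where "h y = (q (y \<star>\<^bsub>N\<^esub> ev v), \<lambda>_ :: 'e. 0 :: 'k)" for y
  have "h \<in> rmod_hom A N ?S"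
  proof (rule hom_basisI [OF rN rS])
    show "h (x \<oplus>\<^bsub>N\<^esub> y) = h x \<oplus>\<^bsub>?S\<^esub> h y" if "x \<in> carrier N" "y \<in> carrier N" for x y
      using that q(2) by (simp add: h_def N.ract_add_left N.ract_closed)
    show "h (x \<star>\<^bsub>N\<^esub> sc k) = h x \<star>\<^bsub>?S\<^esub> sc k" if "x \<in> carrier N" for x k
      using that q(3) v by (simp add: h_def N.ract_closed basis_act(5) [OF rN])
    show "h (x \<star>\<^bsub>N\<^esub> ev u) = h x \<star>\<^bsub>?S\<^esub> ev u" if "x \<in> carrier N" for x u
      using that q0 v by (simp add: h_def N.ract_closed basis_act(1) [OF rN])
    show "h (x \<star>\<^bsub>N\<^esub> ar a) = h x \<star>\<^bsub>?S\<^esub> ar a" if "x \<in> carrier N" "a \<in> arcs Q" for x a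
      using that q0 v src by (auto simp: h_def N.ract_closed basis_act(3) [OF rN])
  qed (simp add: h_def)
  moreover have "h (g x) = f x" if x: "x \<in> carrier L" for x
  proof -
    have "g x \<star>\<^bsub>N\<^esub> ev v = g (x \<star>\<^bsub>L\<^esub> ev v)" using rmod_homD(3) [OF *(3) x] by simp
    then have "q (g x \<star>\<^bsub>N\<^esub> ev v) = fst (f (x \<star>\<^bsub>L\<^esub> ev v))" using q(1) L.ract_closed [OF x] by simp
    also have "\<dots> = fst (f x)" using F(3) [OF x, of "ev v"] fpair(2) [of "f x" "ev v"] v by simp
    finally show ?thesis using F(1) [OF x] by (cases "f x") (auto simp: h_def)
  qed
  ultimately show "\<exists>h\<in>rmod_hom A N ?S. \<forall>x\<in>carrier L. h (g x) = f x" by blast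
qed

text \<open>A projective module has \<open>sx\<close> zero away from sinks, while the simple module
  at \<open>v\<close> has value 1. At a sink it coincides with the projective module generated
  there.\<close>

lemma tmod_simple_projective_iff:
  "v \<in> verts Q \<Longrightarrow> projective_rmod A (tmod v {}) \<longleftrightarrow> out v = {}"
proof
  assume v: "v \<in> verts Q"
  have t: "tmod v {} \<in> fgmods A" "rmod_iso A (tm v {}) (tmod v {})" using tmod(1,2) [OF v, of "{}"] by auto
  show "projective_rmod A (tmod v {}) \<Longrightarrow> out v = {}"
    using projective_om_sx(2) [OF t(1) _ v] tmod(4) [OF v _ v, of "{}"] by (cases "out v = {}") auto
  assume "out v = {}"
  then have "projective_rmod A (tm v {})" using projective_tm [OF v] by (simp only:)
  then show "projective_rmod A (tmod v {})"
    using projective_iso [OF _ right_module_tm [OF v] _ t(2)] t(1) by (simp add: fgmods_def)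
qed

lemma tmod_simple_injective_iff:
  "v \<in> verts Q \<Longrightarrow> injective_rmod A (tmod v {}) \<longleftrightarrow> inn v = {}"
proof -
  assume v: "v \<in> verts Q"
  have t: "tmod v {} \<in> fgmods A" "rmod_iso A (tm v {}) (tmod v {})" using tmod(1,2) [OF v, of "{}"] by auto
  have r: "right_module A (tm v {})" "right_module A (tmod v {})"
    using right_module_tm [OF v, of "{}"] t(1) by (auto simp: fgmods_def)
  show ?thesis
    using simple_injective_source [OF v] source_simple_injective [OF v]
      injective_iso [OF r(1) t(2)] injective_iso [OF r(2) rmod_iso_sym [OF r(1) t(2)]] by blast
qed

lemma S_D_eq: "S_D A = (\<lambda>v. iso_class A (tmod v {})) ` Dv"
proof (intro equalityI subsetI)
  fix c assume "c \<in> S_D A"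
  then obtain S where S: "S \<in> fgmods A" "simple_rmod A S" "\<not> projective_rmod A S" "\<not> injective_rmod A S" "c = iso_class A S"
    by (auto simp: S_D_def)
  obtain v where v: "v \<in> verts Q" "rmod_iso A (tm v {}) S" by (rule simple_classify [OF S(1,2)]) (rule that; assumption)
  have t: "tmod v {} \<in> fgmods A" "rmod_iso A (tm v {}) (tmod v {})" using tmod(1,2) [OF v(1), of "{}"] by auto
  have r: "right_module A (tm v {})" "right_module A (tmod v {})" "right_module A S"
    using right_module_tm [OF v(1), of "{}"] t(1) S(1) by (auto simp: fgmods_def)
  have i: "rmod_iso A (tmod v {}) S" using rmod_iso_trans [OF rmod_iso_sym [OF r(1) t(2)] v(2)] .
  have "out v \<noteq> {}" using projective_iso [OF _ r(2,3) i] tmod_simple_projective_iff [OF v(1)] S(3) by blast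
  moreover have "inn v \<noteq> {}" using injective_iso [OF r(2) i] tmod_simple_injective_iff [OF v(1)] S(4) by blast
  ultimately have "v \<in> Dv" using v(1) unfolding Dv_def by blast
  moreover have "c = iso_class A (tmod v {})" using iso_class_eqI [OF r(2) i] S(5) by simp
  ultimately show "c \<in> (\<lambda>v. iso_class A (tmod v {})) ` Dv" by blast
next
  fix c assume "c \<in> (\<lambda>v. iso_class A (tmod v {})) ` Dv"
  then obtain v where v: "v \<in> Dv" "c = iso_class A (tmod v {})" by blast
  note vv = Dv(2) [OF v(1)]
  have t: "tmod v {} \<in> fgmods A" "rmod_iso A (tm v {}) (tmod v {})" using tmod(1,2) [OF vv, of "{}"] by auto
  have r: "right_module A (tm v {})" "right_module A (tmod v {})"
    using right_module_tm [OF vv, of "{}"] t(1) by (auto simp: fgmods_def)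
  have "simple_rmod A (tmod v {})" by (rule simple_iso [OF r t(2) simple_tm [OF vv]])
  moreover have "\<not> projective_rmod A (tmod v {})" "\<not> injective_rmod A (tmod v {})"
    using tmod_simple_projective_iff [OF vv] tmod_simple_injective_iff [OF vv] Dv(3,4) [OF v(1)] by blast+
  ultimately show "c \<in> S_D A" using t(1) v(2) unfolding S_D_def by blast
qed

section \<open>The direct sum over \<open>S_D\<close>\<close>

definition srep :: "'a fgmod set \<Rightarrow> 'a fgmod" where "srep c = (SOME S. S \<in> c)"

lemma srep:
  assumes "v \<in> verts Q"
  shows "srep (iso_class A (tmod v {})) \<in> fgmods A" "rmod_iso A (tmod v {}) (srep (iso_class A (tmod v {})))"
proof -
  have "tmod v {} \<in> iso_class A (tmod v {})" using tmod(1) [OF assms, of "{}"] by (auto intro: iso_class_self)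
  then have "srep (iso_class A (tmod v {})) \<in> iso_class A (tmod v {})" unfolding srep_def by (rule someI)
  then show "srep (iso_class A (tmod v {})) \<in> fgmods A" "rmod_iso A (tmod v {}) (srep (iso_class A (tmod v {})))"
    by (auto simp: iso_class_def)
qed

lemma sum_S_D_eq: "sum_S_D A = dsum (S_D A) srep"
  by (simp add: sum_S_D_def srep_def [abs_def])

lemma finite_S_D: "finite (S_D A)"
  by (simp add: S_D_eq Dv)

lemma srep_S_D: "c \<in> S_D A \<Longrightarrow> srep c \<in> fgmods A"
  using srep(1) Dv(2) by (auto simp: S_D_eq)

lemma fdmod_dsum:
  assumes "finite I" "\<And>i. i \<in> I \<Longrightarrow> fdmod (F i)"
  shows "fdmod (dsum I F)"
  using assms
proof (induction I rule: finite_induct)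
  case empty
  have r: "right_module A (dsum {} F)" by (rule right_module_dsum) (auto intro: A.ring_axioms)
  have z: "carrier (dsum {} F) = {\<zero>\<^bsub>dsum {} F\<^esub>}" by (simp add: dsum_simps restrict_def)
  have "fin_gen A (dsum {} F)" unfolding fin_gen_def
  proof (intro exI [of _ "{}"] conjI allI impI)
    fix U assume "submod A U (dsum {} F) \<and> {} \<subseteq> U"
    then show "U = carrier (dsum {} F)" using submodD(1,2) [of A U "dsum {} F"] z by auto
  qed auto
  then show ?case using r by (simp add: fdmod_iff_fin_gen)
next
  case (insert i I)
  have r: "right_module A (dsum (insert i I) F)"
    using insert fdmodD by (intro right_module_dsum) (auto intro: A.ring_axioms)
  have f: "fdmod (dsum2 (F i) (dsum I F))" using insert by (intro fdmod_dsum2) auto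
  show ?case
    by (rule fdmod_iso [OF f r rmod_iso_sym [OF r dsum_insert_iso [OF insert.hyps(1,2)]]])
qed

lemma fdmod_sum_S_D: "fdmod (sum_S_D A)"
  unfolding sum_S_D_eq by (rule fdmod_dsum [OF finite_S_D]) (use srep_S_D fgmods_iff in blast)

lemma rmod_retract_srep:
  assumes "c \<in> S_D A"
  shows "rmod_retract A (srep c) (sum_S_D A)"
proof -
  note s = dsum_simps [OF finite_S_D]
  have r: "right_module A (srep c)" if "c \<in> S_D A" for c using srep_S_D [OF that] by (simp add: fgmods_def)
  have ag: "abelian_group (srep c)" if "c \<in> S_D A" for c using r [OF that] by (simp add: right_module_def)
  have am: "abelian_monoid (srep c)" if "c \<in> S_D A" for c using ag [OF that] by (simp add: abelian_group_def)
  show ?thesis unfolding rmod_retract_def sum_S_D_eq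
  proof (intro bexI ballI)
    show "(\<lambda>x. \<lambda>j\<in>S_D A. if j = c then x else \<zero>\<^bsub>srep j\<^esub>) \<in> rmod_hom A (srep c) (dsum (S_D A) srep)"
      using abelian_monoid.zero_closed [OF am] right_module.ract_zero_left [OF r] abelian_monoid.l_zero [OF am]
      by (intro rmod_homI) (auto simp: s intro!: restrict_ext)
    show "(\<lambda>f. f c) \<in> rmod_hom A (dsum (S_D A) srep) (srep c)"
      using assms by (intro rmod_homI) (auto simp: s)
  qed (use assms in auto)
qed

lemma subgroup_simple_classes: "subgroup simple_classes (K0 A)"
proof (rule group.subgroupI [OF K0_group])
  show "simple_classes \<subseteq> carrier (K0 A)" using combo_carrier by (auto simp: simple_classes_def K0_carrier)
  show "simple_classes \<noteq> {}" by (auto simp: simple_classes_def)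
  show "inv\<^bsub>K0 A\<^esub> C \<in> simple_classes" if C: "C \<in> simple_classes" for C
  proof -
    obtain c where "C = kcos A (combo c)" using C by (auto simp: simple_classes_def)
    then have "inv\<^bsub>K0 A\<^esub> C = kcos A (combo (\<lambda>v. 0 - c v))"
      using K0_inv [OF combo_carrier] combo_arith(2) [of "\<lambda>_. 0" c] by simp
    then show ?thesis by (auto simp: simple_classes_def)
  qed
  show "C \<otimes>\<^bsub>K0 A\<^esub> C' \<in> simple_classes" if C: "C \<in> simple_classes" "C' \<in> simple_classes" for C C'
  proof -
    obtain c c' where "C = kcos A (combo c)" "C' = kcos A (combo c')" using C by (auto simp: simple_classes_def)
    then have "C \<otimes>\<^bsub>K0 A\<^esub> C' = kcos A (combo (\<lambda>v. c v + c' v))"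
      using K0_mult [OF combo_carrier combo_carrier] by (simp add: combo_arith)
    then show ?thesis by (auto simp: simple_classes_def)
  qed
qed

text \<open>Each simple module is a retract of the sum, which gives one inclusion. Conversely every
  retract embeds into the sum, hence is killed by arrows and has nothing at sources, and
  \<open>semisimple_class\<close> puts its class into the span.\<close>

theorem add_subgroup_sum_S_D: "add_subgroup A (sum_S_D A) = simple_classes"
proof (intro equalityI)
  let ?M = "sum_S_D A"
  note fM = fdmod_sum_S_D
  note rM = fdmodD(1) [OF fM]
  note s = dsum_simps [OF finite_S_D]
  show "simple_classes \<subseteq> add_subgroup A ?M"
  proof
    fix C assume "C \<in> simple_classes"
    then obtain c where C: "C = kcos A (combo c)" by (auto simp: simple_classes_def)
    have "cl A (tmod v {}) \<in> addset ?M" if v: "v \<in> Dv" for v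
    proof -
      note vv = Dv(2) [OF v]
      have t: "tmod v {} \<in> fgmods A" using tmod(1) [OF vv, of "{}"] by simp
      then have "rmod_retract A (tmod v {}) (srep (iso_class A (tmod v {})))"
        using rmod_retract_iso(1) [OF _ srep(2) [OF vv]] by (simp add: fgmods_def)
      moreover have "rmod_retract A (srep (iso_class A (tmod v {}))) ?M"
        using v by (intro rmod_retract_srep) (simp add: S_D_eq)
      ultimately show ?thesis using cl_in_addset_retract [OF t fM] rmod_retract_trans by blast
    qed
    then have "combo c \<in> addset ?M"
      unfolding combo_def by (intro addset_sum [OF fM] addset_cmul [OF fM])
    then show "C \<in> add_subgroup A ?M" by (simp add: C addset_def)
  qed
  have *: "(\<forall>x\<in>carrier (srep c). \<forall>a\<in>arcs Q. x \<star>\<^bsub>srep c\<^esub> ar a = \<zero>\<^bsub>srep c\<^esub>)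
        \<and> (\<forall>w\<in>verts Q. inn w = {} \<longrightarrow> pt (srep c) w = {\<zero>\<^bsub>srep c\<^esub>})" if c: "c \<in> S_D A" for c
  proof -
      obtain v where v: "v \<in> Dv" "c = iso_class A (tmod v {})" using c by (auto simp: S_D_eq)
      note vv = Dv(2) [OF v(1)]
      have rT: "right_module A (tm v {})" and fT: "fdmod (tm v {})"
        using right_module_tm [OF vv, of "{}"] fdmod_tm [OF vv, of "{}"] by auto
      have iso: "rmod_iso A (tm v {}) (srep c)"
        using rmod_iso_trans [OF tmod(2) [OF vv] srep(2) [OF vv]] v(2) by simp
      have fS: "fdmod (srep c)" and rS: "right_module A (srep c)" using srep_S_D [OF c] by (auto simp: fgmods_iff fdmodD)
      obtain f g where f: "f \<in> rmod_hom A (tm v {}) (srep c)" "g \<in> rmod_hom A (srep c) (tm v {})"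
        "\<And>x. x \<in> carrier (tm v {}) \<Longrightarrow> g (f x) = x" "\<And>y. y \<in> carrier (srep c) \<Longrightarrow> f (g y) = y"
        by (rule rmod_iso_inverse [OF rT iso]) (rule that; assumption)
      have "x \<star>\<^bsub>srep c\<^esub> ar a = \<zero>\<^bsub>srep c\<^esub>" if x: "x \<in> carrier (srep c)" and a: "a \<in> arcs Q" for x a
      proof -
        have gx: "g x \<in> carrier (tm v {})" using rmod_homD(1) [OF f(2) x] .
        have "g x \<star>\<^bsub>tm v {}\<^esub> ar a = \<zero>\<^bsub>tm v {}\<^esub>" using vv by (cases "g x") simp
        then have "f (g x \<star>\<^bsub>tm v {}\<^esub> ar a) = \<zero>\<^bsub>srep c\<^esub>" using rmod_hom_zero [OF rT rS f(1)] by simp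
        then show ?thesis using rmod_homD(3) [OF f(1) gx, of "ar a"] f(4) [OF x] by simp
      qed
      moreover have "pt (srep c) w = {\<zero>\<^bsub>srep c\<^esub>}" if w: "w \<in> verts Q" "inn w = {}" for w
      proof -
        have "w \<noteq> v" using w(2) Dv(4) [OF v(1)] by blast
        then have "dp (tm v {}) w = 0" using dp_tm [OF vv _ w(1), of "{}"] dr_tm [OF vv, of "{}" w] by simp
        then show ?thesis using dp_zero_pt [OF fS] dims_iso(1) [OF fT rS iso, of w] by simp
      qed
      ultimately show ?thesis by blast
  qed
  have srep0: "x \<star>\<^bsub>srep c\<^esub> ar a = \<zero>\<^bsub>srep c\<^esub>"
    if c: "c \<in> S_D A" and x: "x \<in> carrier (srep c)" and a: "a \<in> arcs Q" for c x a
    using * [OF c] x a by blast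
  have srep1: "pt (srep c) w = {\<zero>\<^bsub>srep c\<^esub>}"
    if c: "c \<in> S_D A" and w: "w \<in> verts Q" "inn w = {}" for c w
    using * [OF c] w by blast
  have "add_gens ?M \<subseteq> simple_classes"
  proof
    fix C assume "C \<in> add_gens ?M"
    then obtain N where N: "C = K0_class A N" "N \<in> fgmods A" "rmod_retract A N ?M" by (auto simp: add_gens_def)
    have rN: "right_module A N" using N by (simp add: fgmods_def)
    interpret N: right_module A N by (rule rN)
    obtain i p where ip: "i \<in> rmod_hom A N ?M" "p \<in> rmod_hom A ?M N" "\<And>x. x \<in> carrier N \<Longrightarrow> p (i x) = x"
      using N(3) by (auto simp: rmod_retract_def)
    \<comment> \<open>The inclusion \<open>i\<close> reflects zero, so both properties can be
      checked componentwise in the sum.\<close>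
    have zero: "x = \<zero>\<^bsub>N\<^esub>" if "x \<in> carrier N" "i x = \<zero>\<^bsub>?M\<^esub>" for x
      using ip(3) [OF that(1)] rmod_hom_zero [OF rM rN ip(2)] that(2) by simp
    have "x \<star>\<^bsub>N\<^esub> ar a = \<zero>\<^bsub>N\<^esub>" if xa: "x \<in> carrier N" "a \<in> arcs Q" for x a
    proof (rule zero)
      have ix: "i x \<in> carrier ?M" using rmod_homD(1) [OF ip(1) xa(1)] .
      have "i (x \<star>\<^bsub>N\<^esub> ar a) = i x \<star>\<^bsub>?M\<^esub> ar a" using rmod_homD(3) [OF ip(1) xa(1)] by simp
      also have "\<dots> = \<zero>\<^bsub>?M\<^esub>"
        using ix srep0 xa(2) unfolding sum_S_D_eq s by (intro restrict_ext) (auto simp: PiE_mem)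
      finally show "i (x \<star>\<^bsub>N\<^esub> ar a) = \<zero>\<^bsub>?M\<^esub>" .
    qed (use xa N.ract_closed in auto)
    moreover have "pt N w \<subseteq> {\<zero>\<^bsub>N\<^esub>}" if w: "w \<in> verts Q" "inn w = {}" for w
    proof
      fix x assume x: "x \<in> pt N w"
      then have xc: "x \<in> carrier N" by (simp add: pt_def)
      have ix: "i x \<in> pt ?M w" using pt_hom [OF ip(1) x] .
      then have e: "i x \<in> (\<Pi>\<^sub>E c\<in>S_D A. carrier (srep c))" "(\<lambda>c\<in>S_D A. i x c \<star>\<^bsub>srep c\<^esub> ev w) = i x"
        by (auto simp: pt_def sum_S_D_eq s)
      have "i x c = \<zero>\<^bsub>srep c\<^esub>" if c: "c \<in> S_D A" for c
      proof -
        have "i x c \<star>\<^bsub>srep c\<^esub> ev w = i x c" using fun_cong [OF e(2), of c] c by simp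
        then have "i x c \<in> pt (srep c) w" using PiE_mem [OF e(1) c] by (simp add: pt_def)
        then show ?thesis using srep1 [OF c w] by simp
      qed
      then have "(\<lambda>c\<in>S_D A. i x c) = (\<lambda>c\<in>S_D A. \<zero>\<^bsub>srep c\<^esub>)" by (intro restrict_ext)
      then have "i x = \<zero>\<^bsub>?M\<^esub>" using PiE_restrict [OF e(1)] by (simp add: sum_S_D_eq s)
      then show "x \<in> {\<zero>\<^bsub>N\<^esub>}" using zero [OF xc] by simp
    qed
    ultimately have "cl A N - combo (dp N) \<in> K0_subgroup A" by (intro semisimple_class [OF N(2)])
    then have "C = kcos A (combo (dp N))" by (simp add: N(1) K0_class_eq kcos_eq_iff)
    then show "C \<in> simple_classes" by (auto simp: simple_classes_def)
  qed
  then show "add_subgroup A ?M \<subseteq> simple_classes"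
    unfolding add_subgroup_eq [OF fM]
    by (rule group.generate_subgroup_incl [OF K0_group _ subgroup_simple_classes])
qed

end

lemma regular_rmod_simps [simp]:
  "carrier (regular_rmod A) = carrier A" "\<zero>\<^bsub>regular_rmod A\<^esub> = \<zero>\<^bsub>A\<^esub>"
  "x \<oplus>\<^bsub>regular_rmod A\<^esub> y = x \<oplus>\<^bsub>A\<^esub> y" "x \<star>\<^bsub>regular_rmod A\<^esub> y = x \<otimes>\<^bsub>A\<^esub> y"
  by (simp_all add: regular_rmod_def)

context radsq
begin

section \<open>Selfinjectivity\<close>

text \<open>If every vertex is isolated or has exactly one incoming and one outgoing arrow, then summing the
  coordinates at the isolated vertices and at the arrows is a nondegenerate functional, so that
  homomorphisms into the regular module correspond to linear functionals, and these can be extended.\<close>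

lemma selfinjectiveI:
  assumes tail_inj: "\<And>a b. \<lbrakk>a \<in> arcs Q; b \<in> arcs Q; tail Q a = tail Q b\<rbrakk> \<Longrightarrow> a = b"
    and head_inj: "\<And>a b. \<lbrakk>a \<in> arcs Q; b \<in> arcs Q; head Q a = head Q b\<rbrakk> \<Longrightarrow> a = b"
    and no_sink: "\<And>a. a \<in> arcs Q \<Longrightarrow> out (head Q a) \<noteq> {}"
    and no_source: "\<And>a. a \<in> arcs Q \<Longrightarrow> inn (tail Q a) \<noteq> {}"
  shows "selfinjective A"
proof -
  \<comment> \<open>Under the hypotheses these vertices are isolated: an arrow ending in one of them
    would contradict \<open>no_sink\<close>.\<close>
  define V0 where "V0 = {v \<in> verts Q. out v = {}}"
  have fV0: "finite V0" by (simp add: V0_def)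
  define lam where "lam x = (\<Sum>a\<in>arcs Q. ca x a) + (\<Sum>v\<in>V0. cv x v)" for x
  have lam_add: "lam (x \<oplus>\<^bsub>A\<^esub> y) = lam x + lam y" if "x \<in> carrier A" "y \<in> carrier A" for x y
    using that by (simp add: lam_def V0_def coords sum.distrib)
  have lam_sc: "lam (x \<otimes>\<^bsub>A\<^esub> sc k) = k * lam x" if "x \<in> carrier A" for x k
    using that by (simp add: lam_def V0_def coords sum_distrib_left algebra_simps)
  have lam_ev: "lam (x \<otimes>\<^bsub>A\<^esub> ev w) = (\<Sum>a\<in>arcs Q. if head Q a = w then ca x a else 0) + (\<Sum>v\<in>V0. if v = w then cv x v else 0)"
    if "x \<in> carrier A" for x w
    unfolding lam_def using that by (intro arg_cong2 [where f = "(+)"] sum.cong) (auto simp: V0_def coords)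
  have lam_ar: "lam (x \<otimes>\<^bsub>A\<^esub> ar b) = cv x (tail Q b)" if "x \<in> carrier A" "b \<in> arcs Q" for x b
  proof -
    have "(\<Sum>a\<in>arcs Q. ca (x \<otimes>\<^bsub>A\<^esub> ar b) a) = (\<Sum>a\<in>arcs Q. if a = b then cv x (tail Q a) else 0)"
      using that by (intro sum.cong) (auto simp: coords)
    moreover have "(\<Sum>v\<in>V0. cv (x \<otimes>\<^bsub>A\<^esub> ar b) v) = 0"
      using that by (intro sum.neutral) (auto simp: V0_def coords)
    ultimately show ?thesis using that by (simp add: lam_def)
  qed
  have lam_ev_arc: "lam (x \<otimes>\<^bsub>A\<^esub> ev (head Q b)) = ca x b" if "x \<in> carrier A" "b \<in> arcs Q" for x b
  proof -
    have "(\<Sum>a\<in>arcs Q. if head Q a = head Q b then ca x a else 0) = (\<Sum>a\<in>arcs Q. if a = b then ca x a else 0)"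
    proof (rule sum.cong [OF refl])
      fix a assume "a \<in> arcs Q"
      then have "head Q a = head Q b \<longleftrightarrow> a = b" using head_inj [OF _ that(2)] by (metis (no_types))
      then show "(if head Q a = head Q b then ca x a else 0) = (if a = b then ca x a else 0)" by simp
    qed
    moreover have "(\<Sum>v\<in>V0. if v = head Q b then cv x v else 0) = 0"
      using no_sink [OF that(2)] by (intro sum.neutral) (auto simp: V0_def)
    ultimately show ?thesis using that by (simp add: lam_ev)
  qed
  have lam_ev_iso: "lam (x \<otimes>\<^bsub>A\<^esub> ev w) = cv x w" if "x \<in> carrier A" "w \<in> V0" for x w
  proof -
    have "(\<Sum>a\<in>arcs Q. if head Q a = w then ca x a else 0) = 0"
    proof (rule sum.neutral, rule ballI)
      fix a assume a: "a \<in> arcs Q"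
      have "head Q a \<noteq> w" using no_sink [OF a] that(2) unfolding V0_def by blast
      then show "(if head Q a = w then ca x a else 0) = 0" by simp
    qed
    then show ?thesis using that fV0 by (simp add: lam_ev)
  qed
  \<comment> \<open>The pairing of \<open>x\<close> and \<open>b\<close> by \<open>lam\<close> of
    their product has trivial left kernel, because \<open>lam\<close> applied to products with basis
    elements returns every coordinate of \<open>x\<close>.\<close>
  have nondeg: "x = y"
    if x: "x \<in> carrier A" and y: "y \<in> carrier A" and eq: "\<And>b. b \<in> carrier A \<Longrightarrow> lam (x \<otimes>\<^bsub>A\<^esub> b) = lam (y \<otimes>\<^bsub>A\<^esub> b)" for x y
  proof (rule coord_eqI [OF x y])
    show "ca x a = ca y a" if "a \<in> arcs Q" for a
      using eq [of "ev (head Q a)"] lam_ev_arc [OF x that] lam_ev_arc [OF y that] by simp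
    show "cv x v = cv y v" if v: "v \<in> verts Q" for v
    proof (cases "out v = {}")
      case True
      then have "v \<in> V0" using v unfolding V0_def by blast
      then show ?thesis using eq [of "ev v"] lam_ev_iso x y by simp
    next
      case False
      then obtain a where "a \<in> arcs Q" "tail Q a = v" by blast
      then show ?thesis using eq [of "ar a"] lam_ar x y by force
    qed
  qed
  show ?thesis unfolding selfinjective_def injective_rmod_def
  proof (intro ballI impI)
    fix L N g f
    assume *: "L \<in> fgmods A" "N \<in> fgmods A" "g \<in> rmod_hom A L N" "f \<in> rmod_hom A L (regular_rmod A)" "inj_on g (carrier L)"
    have fL: "fdmod L" and fN: "fdmod N" and rL: "right_module A L" and rN: "right_module A N"
      using * by (auto simp: fgmods_iff fdmodD)
    interpret L: right_module A L by (rule rL)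
    interpret N: right_module A N by (rule rN)
    note F = rmod_homD [OF *(4), simplified]
    obtain q where q: "\<And>x. x \<in> carrier L \<Longrightarrow> q (g x) = lam (f x)"
      "\<And>x y. \<lbrakk>x \<in> carrier N; y \<in> carrier N\<rbrakk> \<Longrightarrow> q (x \<oplus>\<^bsub>N\<^esub> y) = q x + q y"
      "\<And>x k. x \<in> carrier N \<Longrightarrow> q (x \<star>\<^bsub>N\<^esub> sc k) = k * q x"
    proof (rule functional_extension [OF fL fN *(3,5), of "\<lambda>x. lam (f x)"])
      show "lam (f (x \<oplus>\<^bsub>L\<^esub> y)) = lam (f x) + lam (f y)" if "x \<in> carrier L" "y \<in> carrier L" for x y
        using that F(1,2) lam_add by simp
      show "lam (f (x \<star>\<^bsub>L\<^esub> sc k)) = k * lam (f x)" if "x \<in> carrier L" for x k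
        using that F(1,3) lam_sc by simp
    qed (rule that; assumption)
    have q0: "q \<zero>\<^bsub>N\<^esub> = 0" using q(3) [of "\<zero>\<^bsub>N\<^esub>" 0] N.ract_zero_left by simp
    \<comment> \<open>The outgoing arrow at \<open>v\<close>, unique by \<open>tail_inj\<close>
      where it exists.\<close>
    define oa where "oa v = (SOME a. a \<in> out v)" for v
    have oa: "oa (tail Q a) = a" if "a \<in> arcs Q" for a
    proof -
      have "oa (tail Q a) \<in> out (tail Q a)" unfolding oa_def by (rule someI [of _ a]) (simp add: that)
      then have "oa (tail Q a) \<in> arcs Q" "tail Q (oa (tail Q a)) = tail Q a" by simp_all
      then show ?thesis using that by (intro tail_inj)
    qed
    \<comment> \<open>\<open>h y\<close> is to be the element that represents the functional taking
      \<open>b\<close> to \<open>q\<close> of the translate of \<open>y\<close> by \<open>b\<close>.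
      Its coordinates are forced by the formulas \<open>lam_ev_iso\<close>, \<open>lam_ar\<close>
      and \<open>lam_ev_arc\<close>.\<close>
    define h where "h y = el (\<lambda>v. if out v = {} then q (y \<star>\<^bsub>N\<^esub> ev v) else q (y \<star>\<^bsub>N\<^esub> ar (oa v))) (\<lambda>a. q (y \<star>\<^bsub>N\<^esub> ev (head Q a)))" for y
    have hc: "h y \<in> carrier A" for y by (simp add: h_def)
    have key: "lam (h y \<otimes>\<^bsub>A\<^esub> b) = q (y \<star>\<^bsub>N\<^esub> b)" if y: "y \<in> carrier N" and b: "b \<in> carrier A" for y b
      using b
    proof (induction rule: alg_induct)
      case zero
      have "lam \<zero>\<^bsub>A\<^esub> = 0" by (simp add: lam_def V0_def coords)
      then show ?case using y hc q0 by (simp add: N.ract_zero_right)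
    next
      case (add b c)
      then show ?case using y hc lam_add q(2) by (simp add: A.r_distr N.ract_add_right N.ract_closed)
    next
      case (vert k v)
      have "lam (h y \<otimes>\<^bsub>A\<^esub> ev v) = q (y \<star>\<^bsub>N\<^esub> ev v)"
      proof (cases "inn v = {}")
        case True
        have "out v = {}"
        proof (rule ccontr)
          assume "out v \<noteq> {}"
          then obtain a where "a \<in> arcs Q" "tail Q a = v" by blast
          then show False using no_source [of a] True by simp
        qed
        then show ?thesis using lam_ev_iso [OF hc] vert by (simp add: V0_def h_def)
      next
        case False
        then obtain a where "a \<in> arcs Q" "v = head Q a" by blast
        then show ?thesis using lam_ev_arc [OF hc] by (simp add: h_def)
      qed
      then have "lam ((h y \<otimes>\<^bsub>A\<^esub> ev v) \<otimes>\<^bsub>A\<^esub> sc k) = q ((y \<star>\<^bsub>N\<^esub> ev v) \<star>\<^bsub>N\<^esub> sc k)"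
        using hc y lam_sc q(3) by (simp add: N.ract_closed)
      then show ?case using hc y by (simp add: sc_commute N.ract_assoc A.m_assoc)
    next
      case (arc k a)
      have ne: "out (tail Q a) \<noteq> {}" using arc by blast
      have "cv (h y) (tail Q a) = q (y \<star>\<^bsub>N\<^esub> ar (oa (tail Q a)))"
        unfolding h_def using arc by (subst el(2)) (simp, simp only: if_not_P [OF ne])
      then have "lam (h y \<otimes>\<^bsub>A\<^esub> ar a) = q (y \<star>\<^bsub>N\<^esub> ar a)"
        unfolding lam_ar [OF hc arc] oa [OF arc] .
      then have "lam ((h y \<otimes>\<^bsub>A\<^esub> ar a) \<otimes>\<^bsub>A\<^esub> sc k) = q ((y \<star>\<^bsub>N\<^esub> ar a) \<star>\<^bsub>N\<^esub> sc k)"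
        using hc y lam_sc q(3) by (simp add: N.ract_closed)
      then show ?case using hc y by (simp add: sc_commute N.ract_assoc A.m_assoc)
    qed
    have "h \<in> rmod_hom A N (regular_rmod A)"
    proof (rule rmod_homI; unfold regular_rmod_simps)
      show "h (x \<oplus>\<^bsub>N\<^esub> y) = h x \<oplus>\<^bsub>A\<^esub> h y" if xy: "x \<in> carrier N" "y \<in> carrier N" for x y
      proof (rule nondeg)
        fix b assume b: "b \<in> carrier A"
        show "lam (h (x \<oplus>\<^bsub>N\<^esub> y) \<otimes>\<^bsub>A\<^esub> b) = lam ((h x \<oplus>\<^bsub>A\<^esub> h y) \<otimes>\<^bsub>A\<^esub> b)"
          using xy b hc by (simp add: key A.l_distr lam_add N.ract_add_left N.ract_closed q(2))
      qed (use hc in auto)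
      show "h (x \<star>\<^bsub>N\<^esub> a) = h x \<otimes>\<^bsub>A\<^esub> a" if xa: "x \<in> carrier N" "a \<in> carrier A" for x a
      proof (rule nondeg)
        fix b assume b: "b \<in> carrier A"
        have "lam (h (x \<star>\<^bsub>N\<^esub> a) \<otimes>\<^bsub>A\<^esub> b) = q (x \<star>\<^bsub>N\<^esub> (a \<otimes>\<^bsub>A\<^esub> b))"
          using xa b by (simp add: key N.ract_closed N.ract_assoc)
        also have "\<dots> = lam (h x \<otimes>\<^bsub>A\<^esub> (a \<otimes>\<^bsub>A\<^esub> b))" using xa b by (simp add: key)
        finally show "lam (h (x \<star>\<^bsub>N\<^esub> a) \<otimes>\<^bsub>A\<^esub> b) = lam ((h x \<otimes>\<^bsub>A\<^esub> a) \<otimes>\<^bsub>A\<^esub> b)"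
          using xa b hc by (simp add: A.m_assoc)
      qed (use hc xa in auto)
    qed (rule hc)
    moreover have "h (g x) = f x" if x: "x \<in> carrier L" for x
    proof (rule nondeg [OF hc F(1) [OF x]])
      fix b assume b: "b \<in> carrier A"
      have gx: "g x \<in> carrier N" using rmod_homD(1) [OF *(3) x] .
      have "lam (h (g x) \<otimes>\<^bsub>A\<^esub> b) = q (g (x \<star>\<^bsub>L\<^esub> b))"
        using key [OF gx b] rmod_homD(3) [OF *(3) x b] by simp
      also have "\<dots> = lam (f (x \<star>\<^bsub>L\<^esub> b))" using q(1) L.ract_closed [OF x b] by simp
      finally show "lam (h (g x) \<otimes>\<^bsub>A\<^esub> b) = lam (f x \<otimes>\<^bsub>A\<^esub> b)" using F(3) [OF x b] by simp
    qed
    ultimately show "\<exists>h\<in>rmod_hom A N (regular_rmod A). \<forall>x\<in>carrier L. h (g x) = f x" by blast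
  qed
qed

text \<open>The three kernel constructions exhaust the quivers outside the hypotheses of
  \<open>selfinjectiveI\<close>; the missing condition on sources follows by counting.\<close>

lemma phi_kernel:
  assumes "\<not> selfinjective A"
  obtains M where "M \<in> fgmods A" "\<not> phi_stable (Omega_bar A) (add_subgroup A M) 0"
proof (cases "\<exists>v\<in>verts Q. \<exists>a\<in>out v. \<exists>b\<in>out v. a \<noteq> b")
  case True
  show ?thesis by (rule phi_kernel_branch [OF True]) (rule that; assumption)
next
  case False
  have tail_inj: "a = b" if "a \<in> arcs Q" "b \<in> arcs Q" "tail Q a = tail Q b" for a b
  proof -
    have "tail Q a \<in> verts Q" "a \<in> out (tail Q a)" "b \<in> out (tail Q a)" using that by auto
    then show ?thesis using False by blast
  qed
  have out1: "out (tail Q a) = {a}" if "a \<in> arcs Q" for a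
    using tail_inj [OF _ that] that by (intro equalityI subsetI) auto
  show ?thesis
  proof (cases "\<exists>a\<in>arcs Q. out (head Q a) = {}")
    case True
    then obtain a where a: "a \<in> arcs Q" "out (head Q a) = {}" by blast
    show ?thesis by (rule phi_kernel_sink [OF a(1) out1 [OF a(1)] a(2)]) (rule that; assumption)
  next
    case no_sink: False
    show ?thesis
    proof (cases "\<exists>a\<in>arcs Q. \<exists>b\<in>arcs Q. a \<noteq> b \<and> head Q a = head Q b")
      case True
      then obtain a b where ab: "a \<in> arcs Q" "b \<in> arcs Q" "a \<noteq> b" "head Q a = head Q b" by blast
      from ab(3) have t: "tail Q a \<noteq> tail Q b" using tail_inj [OF ab(1,2)] by (rule contrapos_nn)
      show ?thesis
        by (rule phi_kernel_join [OF ab(1,2) t ab(4) out1 [OF ab(1)] out1 [OF ab(2)]]) (rule that; assumption)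
    next
      case False
      have head_inj: "a = b" if "a \<in> arcs Q" "b \<in> arcs Q" "head Q a = head Q b" for a b
        using False that by blast
      \<comment> \<open>Every head is a tail because no arrow ends in a sink. Heads and tails are
        both as many as the arrows, so the two finite sets agree and no arrow starts at a
        source.\<close>
      have heads: "head Q ` arcs Q = tail Q ` arcs Q"
      proof (rule card_subset_eq)
        show "head Q ` arcs Q \<subseteq> tail Q ` arcs Q"
        proof
          fix w assume "w \<in> head Q ` arcs Q"
          then have "out w \<noteq> {}" using no_sink by blast
          then show "w \<in> tail Q ` arcs Q" by blast
        qed
        show "card (head Q ` arcs Q) = card (tail Q ` arcs Q)"
        proof -
          have "inj_on (head Q) (arcs Q)" by (rule inj_onI) (rule head_inj)
          moreover have "inj_on (tail Q) (arcs Q)" by (rule inj_onI) (rule tail_inj)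
          ultimately show ?thesis by (simp add: card_image)
        qed
      qed simp
      have "inn (tail Q a) \<noteq> {}" if "a \<in> arcs Q" for a
      proof -
        have "tail Q a \<in> head Q ` arcs Q" unfolding heads using that by (rule imageI)
        then obtain b where "b \<in> arcs Q" "tail Q a = head Q b" by (rule imageE)
        then have "b \<in> inn (tail Q a)" by simp
        then show ?thesis by (metis empty_iff)
      qed
      moreover have "out (head Q a) \<noteq> {}" if "a \<in> arcs Q" for a using no_sink that by blast
      ultimately have "selfinjective A" by (intro selfinjectiveI [OF tail_inj head_inj])
      then show ?thesis using assms by simp
    qed
  qed
qed

theorem phi_dim_eq:
  assumes "\<not> selfinjective A"
  shows "phi_dim A = enat (phi A (sum_S_D A) + 1)"
proof -
  let ?st = "phi_stable (Omega_bar A)"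
  let ?l = "phi A (sum_S_D A)"
  have l: "?l = (LEAST l. ?st simple_classes l)" by (simp add: phi_eq add_subgroup_sum_S_D)
  \<comment> \<open>The \<open>LEAST\<close> is attained only because some stable index
    exists.\<close>
  have st: "?st simple_classes ?l" unfolding l by (rule LeastI_ex [OF simple_classes_stable])
  have least: "?l \<le> m" if "?st simple_classes m" for m unfolding l using that by (rule Least_le)
  have fg: "fdmod M" if "M \<in> fgmods A" for M using that by (simp add: fgmods_iff)
  have st': "?st (add_subgroup A M) (Suc ?l)" if "M \<in> fgmods A" for M
    by (rule phi_le [OF fg [OF that] st])
  have phiM: "?st (add_subgroup A M) (phi A M)" if "M \<in> fgmods A" for M
    unfolding phi_eq using st' [OF that] by (rule LeastI)
  have upper: "phi A M \<le> Suc ?l" if "M \<in> fgmods A" for M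
    unfolding phi_eq [of A M] using st' [OF that] by (rule Least_le)
  have "\<exists>M\<in>fgmods A. \<not> ?st (add_subgroup A M) ?l"
  proof (cases ?l)
    case 0
    then show ?thesis using phi_kernel [OF assms] by metis
  next
    case (Suc m)
    obtain M where M: "M \<in> fgmods A" "simple_classes \<subseteq> Omega_bar A ` add_subgroup A M"
      using module_onto_simple_classes by blast
    \<comment> \<open>Stability of \<open>M\<close> at \<open>Suc m\<close> would pass to its image
      and then to \<open>simple_classes\<close> at \<open>m\<close>, below the least index.\<close>
    have "\<not> ?st (add_subgroup A M) (Suc m)"
      using phi_stable_mono [OF _ M(2), of "Omega_bar A" m] least [of m] Suc by (auto simp: phi_stable_image)
    then show ?thesis using M(1) Suc by auto
  qed
  then obtain M where M: "M \<in> fgmods A" "\<not> ?st (add_subgroup A M) ?l" by blast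
  then have "\<not> phi A M \<le> ?l" using phi_stable_le [OF phiM [OF M(1)]] by blast
  then have phi: "phi A M = Suc ?l" using upper [OF M(1)] by simp
  show ?thesis unfolding phi_dim_def
  proof (rule antisym)
    show "(SUP M\<in>fgmods A. enat (phi A M)) \<le> enat (?l + 1)"
      using upper by (intro SUP_least) simp
    show "enat (?l + 1) \<le> (SUP M\<in>fgmods A. enat (phi A M))"
      using phi by (intro SUP_upper2 [OF M(1)]) simp
  qed
qed

end

section \<open>The radical square zero algebra of a quiver\<close>

abbreviation psingle :: "'v \<Rightarrow> 'e list \<Rightarrow> 'k::field \<Rightarrow> ('v \<times> 'e list) \<Rightarrow>\<^sub>0 'k" where
  "psingle u p k \<equiv> Poly_Mapping.single (u, p) k"

lemma path_end_eq: "path_end Q (u, p) = (if p = [] then u else head Q (last p))"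
  by (simp add: path_end_def pre_digraph.awalk_verts_conv)

lemma sum_monomials:
  assumes "finite S" "Poly_Mapping.keys f \<subseteq> S"
  shows "(\<Sum>p\<in>S. Poly_Mapping.single p (Poly_Mapping.lookup f p)) = f"
proof (rule poly_mapping_eqI)
  fix q
  have "(\<Sum>p\<in>S. Poly_Mapping.lookup (Poly_Mapping.single p (Poly_Mapping.lookup f p)) q)
      = (\<Sum>p\<in>S. if p = q then Poly_Mapping.lookup f q else 0)"
    by (rule sum.cong) (auto simp: lookup_single when_def)
  then show "Poly_Mapping.lookup (\<Sum>p\<in>S. Poly_Mapping.single p (Poly_Mapping.lookup f p)) q = Poly_Mapping.lookup f q"
    using assms by (auto simp: lookup_sum in_keys_iff)
qed

text \<open>Identities between bilinear expressions are reduced to monomials. Zero needs no case of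
  its own, being a monomial with coefficient zero.\<close>

lemma monomial_induct [case_names single add]:
  assumes "\<And>p k. P (Poly_Mapping.single p (k::'k::field))" "\<And>f g. \<lbrakk>P f; P g\<rbrakk> \<Longrightarrow> P (f + g)"
  shows "P f"
proof -
  have "P (\<Sum>p\<in>S. Poly_Mapping.single p (Poly_Mapping.lookup f p))" if "finite S" for S
    using that
  proof (induction S rule: finite_induct)
    case empty
    show ?case using assms(1) [of undefined 0] by simp
  qed (simp add: assms)
  then show ?thesis using sum_monomials [of "Poly_Mapping.keys f" f] by (metis finite_keys order_refl)
qed

context
  fixes Q :: "('v, 'e) pre_digraph"
  assumes fin: "fin_digraph Q"
begin

interpretation Q: fin_digraph Q by (rule fin)

definition pbas :: "'v \<times> 'e list \<Rightarrow> 'v \<times> 'e list \<Rightarrow> 'k::field \<Rightarrow> ('v \<times> 'e list) \<Rightarrow>\<^sub>0 'k" where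
  "pbas p q k = (if path_end Q p = fst q then Poly_Mapping.single (fst p, snd p @ snd q) k else 0)"

text \<open>The product of \<open>path_algebra\<close> as an operation on the whole type. It is
  bilinear and associative there, so carrier conditions enter only for closure and the unit.\<close>

definition pmul :: "(('v \<times> 'e list) \<Rightarrow>\<^sub>0 'k::field) \<Rightarrow> (('v \<times> 'e list) \<Rightarrow>\<^sub>0 'k) \<Rightarrow> ('v \<times> 'e list) \<Rightarrow>\<^sub>0 'k" where
  "pmul f g = (\<Sum>p\<in>Poly_Mapping.keys f. \<Sum>q\<in>Poly_Mapping.keys g.
     pbas p q (Poly_Mapping.lookup f p * Poly_Mapping.lookup g q))"

abbreviation PA :: "(('v \<times> 'e list) \<Rightarrow>\<^sub>0 'k::field) ring" where "PA \<equiv> path_algebra Q"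

lemma PA_simps:
  "carrier PA = {f. Poly_Mapping.keys f \<subseteq> qpaths Q}" "\<zero>\<^bsub>PA\<^esub> = 0" "f \<oplus>\<^bsub>PA\<^esub> g = f + g"
  "f \<otimes>\<^bsub>PA\<^esub> g = pmul f g" "\<one>\<^bsub>PA\<^esub> = (\<Sum>v\<in>verts Q. psingle v [] 1)"
  by (simp_all add: path_algebra_def pmul_def pbas_def)

lemma pbas_zero [simp]: "pbas p q 0 = 0"
  by (simp add: pbas_def)

lemma pbas_add: "pbas p q (k + l) = pbas p q k + pbas p q l"
  by (simp add: pbas_def single_add)

text \<open>The supports of \<open>f\<close>, \<open>f'\<close> and \<open>f + f'\<close> differ by
  cancellation. Summing over a common larger set lets the sums be compared termwise.\<close>

lemma pmul_superset:
  assumes "finite S" "finite T" "Poly_Mapping.keys f \<subseteq> S" "Poly_Mapping.keys g \<subseteq> T"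
  shows "pmul f g = (\<Sum>p\<in>S. \<Sum>q\<in>T. pbas p q (Poly_Mapping.lookup f p * Poly_Mapping.lookup g q))"
proof -
  have "pmul f g = (\<Sum>p\<in>Poly_Mapping.keys f. \<Sum>q\<in>T. pbas p q (Poly_Mapping.lookup f p * Poly_Mapping.lookup g q))"
    unfolding pmul_def using assms
    by (intro sum.cong sum.mono_neutral_left) (auto simp: in_keys_iff)
  also have "\<dots> = (\<Sum>p\<in>S. \<Sum>q\<in>T. pbas p q (Poly_Mapping.lookup f p * Poly_Mapping.lookup g q))"
    using assms by (intro sum.mono_neutral_left) (auto simp: in_keys_iff)
  finally show ?thesis .
qed

lemma pmul_add_left: "pmul (f + f') g = pmul f g + pmul f' g"
proof -
  let ?S = "Poly_Mapping.keys f \<union> Poly_Mapping.keys f'" and ?T = "Poly_Mapping.keys g"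
  have k: "Poly_Mapping.keys (f + f') \<subseteq> ?S" by (rule keys_add)
  show ?thesis
    using pmul_superset [of ?S ?T f g] pmul_superset [of ?S ?T f' g] pmul_superset [of ?S ?T "f + f'" g] k
    by (simp add: lookup_add algebra_simps pbas_add sum.distrib)
qed

lemma pmul_add_right: "pmul g (f + f') = pmul g f + pmul g f'"
proof -
  let ?S = "Poly_Mapping.keys f \<union> Poly_Mapping.keys f'" and ?T = "Poly_Mapping.keys g"
  have k: "Poly_Mapping.keys (f + f') \<subseteq> ?S" by (rule keys_add)
  show ?thesis
    using pmul_superset [of ?T ?S g f] pmul_superset [of ?T ?S g f'] pmul_superset [of ?T ?S g "f + f'"] k
    by (simp add: lookup_add algebra_simps pbas_add sum.distrib)
qed

lemma pmul_zero [simp]: "pmul 0 g = 0" "pmul g 0 = 0"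
  by (simp_all add: pmul_def)

lemma pmul_single: "pmul (Poly_Mapping.single p k) (Poly_Mapping.single q l) = pbas p q (k * l)"
  using pmul_superset [of "{p}" "{q}" "Poly_Mapping.single p k" "Poly_Mapping.single q l"] by simp

lemma pmul_sum_left: "pmul (sum F I) g = (\<Sum>i\<in>I. pmul (F i) g)"
  by (induction I rule: infinite_finite_induct) (simp_all add: pmul_add_left)

lemma pmul_sum_right: "pmul g (sum F I) = (\<Sum>i\<in>I. pmul g (F i))"
  by (induction I rule: infinite_finite_induct) (simp_all add: pmul_add_right)

lemma pbas_mult_left: "pmul (pbas p q k) (Poly_Mapping.single r l)
    = (if path_end Q p = fst q \<and> path_end Q q = fst r then Poly_Mapping.single (fst p, snd p @ snd q @ snd r) (k * l) else 0)"
  by (cases p; cases q; cases r) (auto simp: pbas_def pmul_single path_end_eq)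

lemma pbas_mult_right: "pmul (Poly_Mapping.single p k) (pbas q r l)
    = (if path_end Q p = fst q \<and> path_end Q q = fst r then Poly_Mapping.single (fst p, snd p @ snd q @ snd r) (k * l) else 0)"
  by (cases p; cases q; cases r) (auto simp: pbas_def pmul_single path_end_eq)

lemma pmul_assoc: "pmul (pmul f g) h = pmul f (pmul g h)"
proof (induction f rule: monomial_induct)
  case (single p k)
  show ?case
  proof (induction g rule: monomial_induct)
    case (single q l)
    show ?case
    proof (induction h rule: monomial_induct)
      case (single r m)
      show ?case by (simp add: pmul_single pbas_mult_left pbas_mult_right mult.assoc)
    qed (simp add: pmul_add_left pmul_add_right)
  qed (simp add: pmul_add_left pmul_add_right)
qed (simp add: pmul_add_left pmul_add_right)

section \<open>Paths and the ring axioms\<close>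

lemma qpaths_Nil: "(u, []) \<in> qpaths Q \<longleftrightarrow> u \<in> verts Q"
  by (auto simp: qpaths_def Q.awalk_Nil_iff)

lemma qpaths_Cons: "(u, a # p) \<in> qpaths Q \<longleftrightarrow> a \<in> arcs Q \<and> u = tail Q a \<and> (head Q a, p) \<in> qpaths Q"
  by (auto simp: qpaths_def Q.awalk_Cons_iff)

lemma qpaths_append:
  assumes "(u, p) \<in> qpaths Q" "(w, q) \<in> qpaths Q" "path_end Q (u, p) = w"
  shows "(u, p @ q) \<in> qpaths Q"
  using assms(1,3)
proof (induction p arbitrary: u)
  case Nil
  then show ?case using assms(2) by (simp add: path_end_eq)
next
  case (Cons a p)
  have "path_end Q (head Q a, p) = w" using Cons.prems(2) by (simp add: path_end_eq split: if_splits)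
  then show ?case using Cons by (simp add: qpaths_Cons)
qed

lemma qpaths_end: "(u, p) \<in> qpaths Q \<Longrightarrow> path_end Q (u, p) \<in> verts Q"
proof (induction p arbitrary: u)
  case (Cons a p)
  then have "path_end Q (head Q a, p) \<in> verts Q" by (simp add: qpaths_Cons)
  then show ?case by (simp add: path_end_eq split: if_splits)
qed (simp add: path_end_eq qpaths_Nil)

lemma qpaths_start: "(u, p) \<in> qpaths Q \<Longrightarrow> u \<in> verts Q"
  by (cases p) (auto simp: qpaths_Cons qpaths_Nil)

lemma keys_sum_in: "(\<And>i. i \<in> I \<Longrightarrow> Poly_Mapping.keys (F i) \<subseteq> S) \<Longrightarrow> Poly_Mapping.keys (sum F I) \<subseteq> S"
proof (induction I rule: infinite_finite_induct)
  case (insert i I)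
  then show ?case using keys_add [of "F i" "sum F I"] by simp blast
qed auto

lemma pmul_closed:
  assumes "Poly_Mapping.keys f \<subseteq> qpaths Q" "Poly_Mapping.keys g \<subseteq> qpaths Q"
  shows "Poly_Mapping.keys (pmul f g) \<subseteq> qpaths Q"
  unfolding pmul_def
proof (intro keys_sum_in)
  fix p q assume "p \<in> Poly_Mapping.keys f" "q \<in> Poly_Mapping.keys g"
  then have "p \<in> qpaths Q" "q \<in> qpaths Q" using assms by auto
  then show "Poly_Mapping.keys (pbas p q (Poly_Mapping.lookup f p * Poly_Mapping.lookup g q)) \<subseteq> qpaths Q"
    using qpaths_append [of "fst p" "snd p" "fst q" "snd q"] by (auto simp: pbas_def)
qed

lemma pmul_one_left:
  assumes "Poly_Mapping.keys f \<subseteq> qpaths Q"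
  shows "pmul (\<Sum>v\<in>verts Q. psingle v [] 1) f = f"
proof -
  let ?T = "Poly_Mapping.keys f"
  have 1: "pmul (\<Sum>v\<in>verts Q. psingle v [] 1) (Poly_Mapping.single p k) = Poly_Mapping.single p k"
    if "p \<in> ?T" for p and k :: 'a
  proof -
    have "fst p \<in> verts Q" using assms that qpaths_start [of "fst p" "snd p"] by auto
    moreover have "pmul (\<Sum>v\<in>verts Q. psingle v [] 1) (Poly_Mapping.single p k)
        = (\<Sum>v\<in>verts Q. if v = fst p then Poly_Mapping.single p k else 0)"
      unfolding pmul_sum_left by (rule sum.cong) (auto simp: pmul_single pbas_def path_end_eq)
    ultimately show ?thesis by simp
  qed
  have f: "f = (\<Sum>p\<in>?T. Poly_Mapping.single p (Poly_Mapping.lookup f p))"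
    using sum_monomials [of ?T f] by simp
  have "pmul (\<Sum>v\<in>verts Q. psingle v [] 1) (\<Sum>p\<in>?T. Poly_Mapping.single p (Poly_Mapping.lookup f p))
      = (\<Sum>p\<in>?T. Poly_Mapping.single p (Poly_Mapping.lookup f p))"
    unfolding pmul_sum_right [of _ _ ?T] by (rule sum.cong) (simp_all add: 1)
  then show ?thesis using f by simp
qed

lemma pmul_one_right:
  assumes "Poly_Mapping.keys f \<subseteq> qpaths Q"
  shows "pmul f (\<Sum>v\<in>verts Q. psingle v [] 1) = f"
proof -
  let ?T = "Poly_Mapping.keys f"
  have 1: "pmul (Poly_Mapping.single p k) (\<Sum>v\<in>verts Q. psingle v [] 1) = Poly_Mapping.single p k"
    if "p \<in> ?T" for p and k :: 'a
  proof -
    have "path_end Q p \<in> verts Q" using assms that qpaths_end [of "fst p" "snd p"] by auto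
    moreover have "pmul (Poly_Mapping.single p k) (\<Sum>v\<in>verts Q. psingle v [] 1)
        = (\<Sum>v\<in>verts Q. if v = path_end Q p then Poly_Mapping.single p k else 0)"
      unfolding pmul_sum_right by (rule sum.cong) (auto simp: pmul_single pbas_def)
    ultimately show ?thesis by simp
  qed
  have f: "f = (\<Sum>p\<in>?T. Poly_Mapping.single p (Poly_Mapping.lookup f p))"
    using sum_monomials [of ?T f] by simp
  have "pmul (\<Sum>p\<in>?T. Poly_Mapping.single p (Poly_Mapping.lookup f p)) (\<Sum>v\<in>verts Q. psingle v [] 1)
      = (\<Sum>p\<in>?T. Poly_Mapping.single p (Poly_Mapping.lookup f p))"
    unfolding pmul_sum_left [of _ ?T] by (rule sum.cong) (simp_all add: 1)
  then show ?thesis using f by simp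
qed

lemma ring_PA: "ring (PA :: (('v \<times> 'e list) \<Rightarrow>\<^sub>0 'k::field) ring)"
proof (rule ringI)
  show "abelian_group (PA :: (('v \<times> 'e list) \<Rightarrow>\<^sub>0 'k) ring)"
  proof (rule abelian_groupI)
    fix f g :: "('v \<times> 'e list) \<Rightarrow>\<^sub>0 'k" assume fg: "f \<in> carrier PA" "g \<in> carrier PA"
    then show "f \<oplus>\<^bsub>PA\<^esub> g \<in> carrier PA" using keys_add [of f g] by (auto simp: PA_simps)
    show "\<exists>g\<in>carrier PA. g \<oplus>\<^bsub>PA\<^esub> f = \<zero>\<^bsub>PA\<^esub>"
      using fg by (intro bexI [of _ "- f"]) (auto simp: PA_simps)
  qed (auto simp: PA_simps algebra_simps)
  show "Group.monoid (PA :: (('v \<times> 'e list) \<Rightarrow>\<^sub>0 'k) ring)"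
  proof (rule Group.monoidI)
    show "\<one>\<^bsub>PA\<^esub> \<in> carrier (PA :: (('v \<times> 'e list) \<Rightarrow>\<^sub>0 'k) ring)"
      unfolding PA_simps mem_Collect_eq by (rule keys_sum_in) (simp add: qpaths_Nil)
  qed (simp_all add: PA_simps pmul_closed pmul_assoc pmul_one_left pmul_one_right)
qed (simp_all add: PA_simps pmul_add_left pmul_add_right)

lemma lookup_pmul_vert:
  "Poly_Mapping.lookup (pmul f g) (v, []) = Poly_Mapping.lookup f (v, []) * Poly_Mapping.lookup g (v, [])"
proof (induction f rule: monomial_induct)
  case (single p k)
  show ?case
  proof (induction g rule: monomial_induct)
    case (single q l)
    show ?case by (cases p; cases q) (auto simp: pmul_single pbas_def path_end_eq lookup_single when_def)
  qed (simp add: pmul_add_right lookup_add algebra_simps)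
qed (simp add: pmul_add_left lookup_add algebra_simps)

text \<open>A single arrow factors as a path in just two ways, with a trivial path on the left or on
  the right.\<close>

lemma lookup_pmul_arc:
  "Poly_Mapping.lookup (pmul f g) (tail Q a, [a])
    = Poly_Mapping.lookup f (tail Q a, []) * Poly_Mapping.lookup g (tail Q a, [a])
    + Poly_Mapping.lookup f (tail Q a, [a]) * Poly_Mapping.lookup g (head Q a, [])"
proof (induction f rule: monomial_induct)
  case (single p k)
  show ?case
  proof (induction g rule: monomial_induct)
    case (single q l)
    show ?case
      by (cases p; cases q)
        (auto simp: pmul_single pbas_def path_end_eq lookup_single when_def append_eq_Cons_conv Cons_eq_append_conv)
  qed (simp add: pmul_add_right lookup_add algebra_simps)
qed (simp add: pmul_add_left lookup_add algebra_simps)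

section \<open>The arrow ideal and its square\<close>

abbreviation AI :: "(('v \<times> 'e list) \<Rightarrow>\<^sub>0 'k::field) set" where "AI \<equiv> arrow_ideal Q"
abbreviation AI2 :: "(('v \<times> 'e list) \<Rightarrow>\<^sub>0 'k::field) set" where "AI2 \<equiv> ideal_prod PA AI AI"

lemma arrows_carrier: "(\<lambda>a. psingle (tail Q a) [a] 1) ` arcs Q \<subseteq> carrier PA"
  by (auto simp: PA_simps qpaths_Cons qpaths_Nil)

lemma ideal_AI: "ideal AI (PA :: (('v \<times> 'e list) \<Rightarrow>\<^sub>0 'k::field) ring)"
  unfolding arrow_ideal_def by (rule ring.genideal_ideal [OF ring_PA arrows_carrier])

lemma ideal_AI2: "ideal AI2 (PA :: (('v \<times> 'e list) \<Rightarrow>\<^sub>0 'k::field) ring)"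
  by (rule ring.ideal_prod_is_ideal [OF ring_PA ideal_AI ideal_AI])

lemma AI2_zero: "0 \<in> (AI2 :: (('v \<times> 'e list) \<Rightarrow>\<^sub>0 'k::field) set)"
  and AI2_add: "\<lbrakk>f \<in> (AI2 :: (('v \<times> 'e list) \<Rightarrow>\<^sub>0 'k) set); g \<in> AI2\<rbrakk> \<Longrightarrow> f + g \<in> AI2"
proof -
  have *: "additive_subgroup AI2 (PA :: (('v \<times> 'e list) \<Rightarrow>\<^sub>0 'k) ring)"
    by (rule ideal.axioms(1) [OF ideal_AI2])
  show "0 \<in> (AI2 :: (('v \<times> 'e list) \<Rightarrow>\<^sub>0 'k) set)" using additive_subgroup.zero_closed [OF *] by (simp only: PA_simps(2))
  show "\<lbrakk>f \<in> AI2; g \<in> AI2\<rbrakk> \<Longrightarrow> f + g \<in> AI2" for f g :: "('v \<times> 'e list) \<Rightarrow>\<^sub>0 'k"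
    using additive_subgroup.a_closed [OF *] by (simp only: PA_simps(3))
qed

text \<open>The elements without trivial paths form an ideal, because the coefficient of a trivial
  path is multiplicative; it contains the arrows and hence the ideal they generate.\<close>

lemma AI_vert: "f \<in> AI \<Longrightarrow> Poly_Mapping.lookup f (v, []) = (0 :: 'k::field)"
proof -
  let ?I = "{f \<in> carrier PA. \<forall>v. Poly_Mapping.lookup f (v, []) = (0 :: 'k)}"
  interpret R: ring "PA :: (('v \<times> 'e list) \<Rightarrow>\<^sub>0 'k) ring" by (rule ring_PA)
  have "ideal ?I PA"
  proof (rule idealI [OF ring_PA])
    show "subgroup ?I (add_monoid PA)"
    proof (rule R.add.subgroupI)
      fix f :: "('v \<times> 'e list) \<Rightarrow>\<^sub>0 'k" assume f: "f \<in> ?I"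
      then have "f \<oplus>\<^bsub>PA\<^esub> - f = \<zero>\<^bsub>PA\<^esub>" "- f \<in> carrier PA" by (auto simp: PA_simps)
      then have "\<ominus>\<^bsub>PA\<^esub> f = - f" using f by (intro R.minus_equality) (auto simp: R.a_comm)
      then show "\<ominus>\<^bsub>PA\<^esub> f \<in> ?I" using f \<open>- f \<in> carrier PA\<close> by simp
    next
      fix f g :: "('v \<times> 'e list) \<Rightarrow>\<^sub>0 'k" assume "f \<in> ?I" "g \<in> ?I"
      then show "f \<oplus>\<^bsub>PA\<^esub> g \<in> ?I" using R.add.m_closed [of f g] by (simp add: PA_simps(3) lookup_add)
    qed (use R.zero_closed in \<open>auto simp: PA_simps(2)\<close>)
    show "x \<otimes>\<^bsub>PA\<^esub> f \<in> ?I" "f \<otimes>\<^bsub>PA\<^esub> x \<in> ?I" if "f \<in> ?I" "x \<in> carrier PA" for f x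
      using that R.m_closed [of f x] R.m_closed [of x f] by (auto simp: PA_simps(4) lookup_pmul_vert)
  qed
  moreover have "(\<lambda>a. psingle (tail Q a) [a] 1) ` arcs Q \<subseteq> ?I"
    using arrows_carrier by (auto simp: lookup_single)
  ultimately have "AI \<subseteq> ?I" unfolding arrow_ideal_def by (rule R.genideal_minimal)
  then show "f \<in> AI \<Longrightarrow> Poly_Mapping.lookup f (v, []) = (0 :: 'k)" by blast
qed

text \<open>Each term in the formula for the coefficient of an arrow in a product has a coefficient
  at a trivial path as a factor, and these are zero in the arrow ideal.\<close>

lemma AI2_coords:
  assumes "f \<in> AI2"
  shows "Poly_Mapping.lookup f (v, []) = 0" "Poly_Mapping.lookup f (tail Q a, [a]) = 0"
  using assms
  by (induction rule: ideal_prod.induct)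
    (simp_all add: PA_simps lookup_pmul_vert lookup_pmul_arc lookup_add AI_vert)

lemma arrow_AI: "a \<in> arcs Q \<Longrightarrow> psingle (tail Q a) [a] 1 \<in> AI"
  unfolding arrow_ideal_def using ring.genideal_self [OF ring_PA arrows_carrier] by blast

lemma psingle_Cons:
  assumes "(u, a # p) \<in> qpaths Q"
  shows "pmul (psingle u [a] 1) (psingle (head Q a) p k) = psingle u (a # p) k"
  by (simp add: pmul_single pbas_def path_end_eq)

text \<open>The first arrow is split off; the remainder still begins with an arrow, so both factors
  lie in the arrow ideal.\<close>

lemma long_path_AI2:
  assumes "(u, p) \<in> qpaths Q" "2 \<le> length p"
  shows "psingle u p k \<in> AI2"
proof -
  interpret I: ideal AI PA by (rule ideal_AI)
  obtain a b p' where p: "p = a # b # p'" using assms(2) by (metis Suc_le_length_iff numeral_2_eq_2)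
  have q: "a \<in> arcs Q" "u = tail Q a" "b \<in> arcs Q" "head Q a = tail Q b" "(head Q b, p') \<in> qpaths Q"
    "(head Q a, b # p') \<in> qpaths Q"
    using assms(1) by (auto simp: p qpaths_Cons)
  have "psingle (head Q b) p' k \<in> carrier PA" using q(5) by (auto simp: PA_simps)
  then have "psingle (tail Q b) [b] 1 \<otimes>\<^bsub>PA\<^esub> psingle (head Q b) p' k \<in> AI"
    by (rule I.I_r_closed [OF arrow_AI [OF q(3)]])
  then have "psingle (head Q a) (b # p') k \<in> AI"
    using psingle_Cons [OF q(6), of k] q(4) by (simp add: PA_simps)
  then have "psingle (tail Q a) [a] 1 \<otimes>\<^bsub>PA\<^esub> psingle (head Q a) (b # p') k \<in> AI2"
    by (rule ideal_prod.prod [OF arrow_AI [OF q(1)]])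
  then show ?thesis using psingle_Cons [of u a "b # p'" k] assms(1) q(2) by (simp add: p PA_simps)
qed

text \<open>The square of the arrow ideal is spanned by the paths of length at least 2, so a coset
  is determined by the coefficients at trivial paths and arrows.\<close>

lemma AI2_iff:
  "f \<in> AI2 \<longleftrightarrow> f \<in> carrier PA \<and> (\<forall>v\<in>verts Q. Poly_Mapping.lookup f (v, []) = 0)
     \<and> (\<forall>a\<in>arcs Q. Poly_Mapping.lookup f (tail Q a, [a]) = 0)"
proof
  assume "f \<in> AI2"
  then show "f \<in> carrier PA \<and> (\<forall>v\<in>verts Q. Poly_Mapping.lookup f (v, []) = 0)
     \<and> (\<forall>a\<in>arcs Q. Poly_Mapping.lookup f (tail Q a, [a]) = 0)"
    using AI2_coords ring.ideal_prod_in_carrier [OF ring_PA ideal_AI ideal_AI] by blast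
next
  assume f: "f \<in> carrier PA \<and> (\<forall>v\<in>verts Q. Poly_Mapping.lookup f (v, []) = 0)
     \<and> (\<forall>a\<in>arcs Q. Poly_Mapping.lookup f (tail Q a, [a]) = 0)"
  have mono: "Poly_Mapping.single x (Poly_Mapping.lookup f x) \<in> AI2" if x: "x \<in> Poly_Mapping.keys f" for x
  proof -
    obtain u p where up: "x = (u, p)" by (cases x)
    have path: "(u, p) \<in> qpaths Q" using f x up by (auto simp: PA_simps)
    have nz: "Poly_Mapping.lookup f (u, p) \<noteq> 0" using x up by (simp add: in_keys_iff)
    have "2 \<le> length p"
    proof (rule ccontr)
      assume "\<not> 2 \<le> length p"
      then consider "p = []" | a where "p = [a]" by (cases p; cases "tl p") auto
      then show False
      proof cases
        case 1
        then show False using f nz path by (simp add: qpaths_Nil)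
      next
        case (2 a)
        then show False using f nz path by (simp add: qpaths_Cons)
      qed
    qed
    then show ?thesis using long_path_AI2 [OF path] up by simp
  qed
  have "(\<Sum>x\<in>S. Poly_Mapping.single x (Poly_Mapping.lookup f x)) \<in> AI2"
    if "finite S" "S \<subseteq> Poly_Mapping.keys f" for S
    using that
  proof (induction S rule: finite_induct)
    case empty
    show ?case by (simp add: AI2_zero)
  next
    case (insert x S)
    then show ?case using AI2_add [OF mono] by simp
  qed
  from this [of "Poly_Mapping.keys f"] show "f \<in> AI2" using sum_monomials [of "Poly_Mapping.keys f" f] by simp
qed

section \<open>The quotient ring and its coordinates\<close>

abbreviation RA :: "(('v \<times> 'e list) \<Rightarrow>\<^sub>0 'k::field) set ring" where "RA \<equiv> rad_sq_zero_algebra Q"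

definition coset :: "(('v \<times> 'e list) \<Rightarrow>\<^sub>0 'k::field) \<Rightarrow> (('v \<times> 'e list) \<Rightarrow>\<^sub>0 'k) set" where
  "coset f = AI2 +>\<^bsub>PA\<^esub> f"

lemma coset_eq: "coset f = (\<lambda>h. h + f) ` AI2"
  by (auto simp: coset_def a_r_coset_def r_coset_def PA_simps)

lemma RA_simps:
  "carrier RA = coset ` carrier PA" "\<one>\<^bsub>RA\<^esub> = coset \<one>\<^bsub>PA\<^esub>"
  "\<lbrakk>f \<in> carrier PA; g \<in> carrier PA\<rbrakk> \<Longrightarrow> coset f \<oplus>\<^bsub>RA\<^esub> coset g = coset (f + g)"
  "\<lbrakk>f \<in> carrier PA; g \<in> carrier PA\<rbrakk> \<Longrightarrow> coset f \<otimes>\<^bsub>RA\<^esub> coset g = coset (pmul f g)"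
proof -
  interpret I: ideal AI2 PA by (rule ideal_AI2)
  show "carrier RA = coset ` carrier PA"
    by (auto simp: rad_sq_zero_algebra_def FactRing_def A_RCOSETS_def' coset_def)
  show "\<one>\<^bsub>RA\<^esub> = coset \<one>\<^bsub>PA\<^esub>"
    by (simp add: rad_sq_zero_algebra_def FactRing_def coset_def)
  show "\<lbrakk>f \<in> carrier PA; g \<in> carrier PA\<rbrakk> \<Longrightarrow> coset f \<oplus>\<^bsub>RA\<^esub> coset g = coset (f + g)"
    using I.a_rcos_sum [of f g] by (simp add: rad_sq_zero_algebra_def FactRing_def coset_def PA_simps(3))
  show "\<lbrakk>f \<in> carrier PA; g \<in> carrier PA\<rbrakk> \<Longrightarrow> coset f \<otimes>\<^bsub>RA\<^esub> coset g = coset (pmul f g)"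
    using I.rcoset_mult_add [of f g] by (simp add: rad_sq_zero_algebra_def FactRing_def coset_def PA_simps(4))
qed

text \<open>Read off from an arbitrary representative; elements of the square of the arrow ideal
  have coefficient zero at trivial paths and arrows, so the value depends on the coset only.\<close>

definition vcoord :: "(('v \<times> 'e list) \<Rightarrow>\<^sub>0 'k::field) set \<Rightarrow> 'v \<Rightarrow> 'k" where
  "vcoord C v = Poly_Mapping.lookup (SOME f. f \<in> C) (v, [])"

definition acoord :: "(('v \<times> 'e list) \<Rightarrow>\<^sub>0 'k::field) set \<Rightarrow> 'e \<Rightarrow> 'k" where
  "acoord C a = Poly_Mapping.lookup (SOME f. f \<in> C) (tail Q a, [a])"

lemma coset_rep:
  obtains h where "h \<in> AI2" "(SOME g. g \<in> coset f) = h + f"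
proof -
  have "\<exists>g. g \<in> coset f" using AI2_zero by (auto simp: coset_eq)
  then have "(SOME g. g \<in> coset f) \<in> coset f" by (rule someI_ex)
  then show ?thesis using that by (auto simp: coset_eq)
qed

lemma vcoord_coset: "vcoord (coset f) v = Poly_Mapping.lookup f (v, [])"
  by (rule coset_rep [of f]) (simp add: vcoord_def lookup_add AI2_coords)

lemma acoord_coset: "acoord (coset f) a = Poly_Mapping.lookup f (tail Q a, [a])"
  by (rule coset_rep [of f]) (simp add: acoord_def lookup_add AI2_coords)

lemma radsq_RA:
  assumes "verts Q \<noteq> {}"
  shows "radsq (RA :: (('v \<times> 'e list) \<Rightarrow>\<^sub>0 'k::field) set ring) Q vcoord acoord"
proof -
  interpret R: ring "PA :: (('v \<times> 'e list) \<Rightarrow>\<^sub>0 'k) ring" by (rule ring_PA)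
  interpret I: ideal "AI2 :: (('v \<times> 'e list) \<Rightarrow>\<^sub>0 'k) set" PA by (rule ideal_AI2)
  have sumc: "f + g \<in> carrier PA" "pmul f g \<in> carrier PA" if "f \<in> carrier PA" "g \<in> carrier PA" for f g :: "('v \<times> 'e list) \<Rightarrow>\<^sub>0 'k"
    using R.a_closed [OF that] R.m_closed [OF that] by (simp_all only: PA_simps(3,4))
  show ?thesis
  proof (intro radsq.intro radsq_axioms.intro)
    show "ring (RA :: (('v \<times> 'e list) \<Rightarrow>\<^sub>0 'k) set ring)"
      unfolding rad_sq_zero_algebra_def by (rule I.quotient_is_ring)
    show "fin_digraph Q" by (rule fin)
    show "verts Q \<noteq> {}" by fact
  next
    fix x y :: "(('v \<times> 'e list) \<Rightarrow>\<^sub>0 'k) set" and v a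
    assume "x \<in> carrier RA" "y \<in> carrier RA"
    then obtain f g where fg: "x = coset f" "y = coset g" "f \<in> carrier PA" "g \<in> carrier PA"
      by (auto simp: RA_simps(1))
    show "vcoord (x \<oplus>\<^bsub>RA\<^esub> y) v = vcoord x v + vcoord y v" "acoord (x \<oplus>\<^bsub>RA\<^esub> y) a = acoord x a + acoord y a"
      "vcoord (x \<otimes>\<^bsub>RA\<^esub> y) v = vcoord x v * vcoord y v"
      "acoord (x \<otimes>\<^bsub>RA\<^esub> y) a = vcoord x (tail Q a) * acoord y a + acoord x a * vcoord y (head Q a)"
      using fg by (simp_all add: RA_simps vcoord_coset acoord_coset lookup_add lookup_pmul_vert lookup_pmul_arc)
    assume e: "\<And>v. v \<in> verts Q \<Longrightarrow> vcoord x v = vcoord y v" "\<And>a. a \<in> arcs Q \<Longrightarrow> acoord x a = acoord y a"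
    have m: "f - g \<in> carrier PA" using fg(3,4) keys_diff [of f g] by (auto simp: PA_simps)
    \<comment> \<open>Equal coordinates leave only paths of length at least 2 in the
      difference.\<close>
    then have d: "f - g \<in> AI2"
      using e fg by (simp add: AI2_iff lookup_minus vcoord_coset acoord_coset)
    have "g - f \<in> carrier PA" using fg(3,4) keys_diff [of g f] by (auto simp: PA_simps)
    then have d': "g - f \<in> AI2"
      using e fg by (simp add: AI2_iff lookup_minus vcoord_coset acoord_coset)
    have sub: "coset f \<subseteq> coset g" if "f - g \<in> AI2" for f g :: "('v \<times> 'e list) \<Rightarrow>\<^sub>0 'k"
    proof
      fix z assume "z \<in> coset f"
      then obtain h where h: "h \<in> AI2" "z = h + f" by (auto simp: coset_eq)
      then have "z = (h + (f - g)) + g" by simp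
      moreover have "h + (f - g) \<in> AI2" using AI2_add [OF h(1) that] .
      ultimately show "z \<in> coset g" unfolding coset_eq by (rule image_eqI)
    qed
    show "x = y" using sub [OF d] sub [OF d'] fg(1,2) by blast
  next
    fix v assume "v \<in> verts Q"
    then show "vcoord \<one>\<^bsub>RA\<^esub> v = (1 :: 'k)"
      by (simp add: RA_simps(2) vcoord_coset PA_simps(5) lookup_sum lookup_single when_def)
  next
    fix a
    show "acoord \<one>\<^bsub>RA\<^esub> a = (0 :: 'k)"
      by (simp add: RA_simps(2) acoord_coset PA_simps(5) lookup_sum lookup_single when_def)
  next
    fix c :: "'v \<Rightarrow> 'k" and d :: "'e \<Rightarrow> 'k"
    let ?f = "(\<Sum>v\<in>verts Q. psingle v [] (c v)) + (\<Sum>a\<in>arcs Q. psingle (tail Q a) [a] (d a))"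
    have "Poly_Mapping.keys (\<Sum>v\<in>verts Q. psingle v [] (c v)) \<subseteq> qpaths Q"
      by (intro keys_sum_in) (simp add: qpaths_Nil)
    moreover have "Poly_Mapping.keys (\<Sum>a\<in>arcs Q. psingle (tail Q a) [a] (d a)) \<subseteq> qpaths Q"
      by (intro keys_sum_in) (simp add: qpaths_Nil qpaths_Cons)
    ultimately have "?f \<in> carrier PA" by (intro sumc) (simp_all add: PA_simps(1))
    moreover have "Poly_Mapping.lookup ?f (v, []) = c v" if "v \<in> verts Q" for v
      using that by (simp add: lookup_add lookup_sum lookup_single when_def)
    moreover have "Poly_Mapping.lookup ?f (tail Q a, [a]) = d a" if "a \<in> arcs Q" for a
    proof -
      have "(\<Sum>b\<in>arcs Q. Poly_Mapping.lookup (psingle (tail Q b) [b] (d b)) (tail Q a, [a]))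
          = (\<Sum>b\<in>arcs Q. if b = a then d b else 0)"
        by (rule sum.cong) (auto simp: lookup_single when_def)
      then show ?thesis using that by (simp add: lookup_add lookup_sum lookup_single [of "(_, [])"] when_def)
    qed
    ultimately show "\<exists>x\<in>carrier RA. (\<forall>v\<in>verts Q. vcoord x v = c v) \<and> (\<forall>a\<in>arcs Q. acoord x a = d a)"
      by (intro bexI [of _ "coset ?f"]) (auto simp: RA_simps(1) vcoord_coset acoord_coset)
  qed
qed

end

theorem proposition4p14:
  fixes Q :: "('v, 'e) pre_digraph"
    and A :: "(('v \<times> 'e list) \<Rightarrow>\<^sub>0 'k::field) set ring"
  assumes "fin_digraph Q" and "Digraph_Component.connected Q"
    and "A = rad_sq_zero_algebra Q"
    and "\<not> selfinjective A"
  shows "phi_dim A = enat (phi A (sum_S_D A) + 1)"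
proof -
  \<comment> \<open>Connectedness includes the existence of a vertex, which the coordinate
    description asks for.\<close>
  have "verts Q \<noteq> {}"
    using assms(2) by (simp add: connected_def strongly_connected_def)
  then show ?thesis
    using radsq.phi_dim_eq [OF radsq_RA [OF assms(1)]] assms(3,4) by blast
qed

end
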